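(* Let $N,d\ge1$ be integers, $T>0$, $\gamma\in(\frac1{N+1},\frac1N]$, and let $\mathbf X$ be a $\gamma$-Hölder branched rough path on $[0,T]$ over $\mathbb R^d$. Let $\phi\in C^{N+1}(\mathbb R;\mathcal L(\mathbb R^d,\mathbb R))$. Suppose there exist a non-decreasing function $l:\mathbb R_+\to[1,\infty)$ and a constant $\alpha\in[(N-1)\gamma,N\gamma)$ such that: (i) the map $x\mapsto l(2x)/l(x)$ is monotone (either increasing or decreasing); (ii) there is a constant $c>0$ with $l(x)\le c(1+x)$ for all $x\ge0$; (iii) $\|D\phi(x)\|\le(\log l(|x|))^\gamma$ for all $x\in\mathbb R$; (iv) $\|D^n\phi(x)\|\le l(|x|)^{(1-n)\alpha}$ for all $n\in\{0,2,3,\dots,N\}$ and $x\in\mathbb R$. Then for every initial condition $Y_0\in\mathbb R$ the branched rough differential equation $\mathrm dY_t=\phi(Y_t)\,\mathrm d\mathbf X_t$ has a unique global solution, i.e. a unique solution defined on all of $[0,T]$.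
   Context: Trees and forests. $\mathcal T$ is the set of finite (non-planar) rooted trees with vertices labelled by $\{1,\dots,d\}$, together with the empty tree $\mathbf 1$. $\mathcal F$ is the set of forests, i.e. finite commutative products (repetitions allowed) of nonempty trees; the empty product is $\mathbf 1$. For $f\in\mathcal F$, $|f|$ is the number of vertices and $\#f$ the number of trees, counted with multiplicity. $\mathcal F_n=\{f\in\mathcal F:|f|\le n\}$. $[f]_a$ is the tree obtained by joining the roots of all trees in $f$ to a new root labelled $a$; every nonempty tree is uniquely of this form. Hopf algebra. $\mathcal H$ is the real vector space with basis $\mathcal F$, with the commutative product of forests and inner product $\langle f,g\rangle=\mathbf 1_{f=g}$. The coproduct $\Delta:\mathcal H\to\mathcal H\otimes\mathcal H$ is the algebra morphism with $\Delta\mathbf 1=\mathbf 1\otimes\mathbf 1$ and $\Delta[f]_a=[f]_a\otimes\mathbf 1+(\mathrm{id}\otimes[\cdot]_a)\Delta f$. For linear functionals $x,y$ on $\mathcal H$, the convolution product is $\langle x\star y,h\rangle=\langle x\otimes y,\Delta h\rangle$. $G_N$ is the group (under $\star$) of characters (unital real-valued algebra homomorphisms) of $\mathcal H$, modulo identification of characters agreeing on $\mathcal F_N$. Branched rough path. A $\gamma$-Hölder branched rough path is a map $\mathbf X:[0,T]\to G_N$ such that, with $\mathbf X_{st}:=\mathbf X_s^{-1}\star\mathbf X_t$, $\sup_{0\le s<t\le T}|\langle\mathbf X_{st},f\rangle|/|t-s|^{\gamma|f|}<\infty$ for all $f\in\mathcal F_N$. Controlled rough path. On an interval $J\subseteq[0,T]$,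 a real-valued $\mathbf X$-controlled rough path $\mathbf Y$ is a family $(\partial^f_XY)_{f\in\mathcal F_{N-1}}$ of paths $J\to\mathbb R$, with $Y_t:=\partial^{\mathbf 1}_XY_t$, such that for each $f\in\mathcal F_{N-1}$ the remainder $R^{\mathbf Y,f}_{st}:=\partial^f_XY_t-\sum_{g\in\mathcal F_{N-1}}\langle\mathbf X_{st}\otimes f,\Delta g\rangle\,\partial^g_XY_s$ satisfies $\sup|R^{\mathbf Y,f}_{st}|/|t-s|^{(N-|f|)\gamma}<\infty$ over $s<t$ in each compact subinterval of $J$. Composition and integral. Write $\phi=(\phi_a)_{a=1}^d$ with $\phi_a:\mathbb R\to\mathbb R$. For $f\in\mathcal F_{N-1}$, $\partial^f_X\phi_a(\mathbf Y)=\sum_{\tau_1\cdots\tau_{\#f}=f}\frac1{(\#f)!}D^{\#f}\phi_a(Y)[\partial_X^{\tau_1}Y,\dots,\partial_X^{\tau_{\#f}}Y]$, the sum being over ordered tuples of nonempty trees with product $f$ (for $f=\mathbf 1$ this is $\phi_a(Y)$). The rough integral is $\int_s^t\phi(\mathbf Y_r)\,\mathrm d\mathbf X_r=\lim_{|\mathcal P|\to0}\sum_{(u,v)\in\mathcal P}\sum_{a=1}^d\sum_{f\in\mathcal F_{N-1}}\partial^f_X\phi_a(\mathbf Y_u)\langle\mathbf X_{uv},[f]_a\rangle$ over partitions $\mathcal P$ of $[s,t]$. Solution. An $\mathbf X$-controlled rough path $\mathbf Y$ on an interval $J\ni0$ is a solution on $J$ if $Y_t=Y_0+\int_0^t\phi(\mathbf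 Y_s)\,\mathrm d\mathbf X_s$ for $t\in J$, $\partial_X^{[f]_a}Y=\partial^f_X\phi_a(\mathbf Y)$ for all $f\in\mathcal F_{N-2}$ and all $a$, and $\partial^f_XY=0$ for all $f\in\mathcal F_{N-1}$ with $\#f\ge2$. *)

theory Defs
  imports "HOL-Analysis.Analysis" "HOL-Analysis.Finite_Function_Topology"
    "HOL-Library.Multiset" "HOL-Library.Poly_Mapping" "HOL-Algebra.Group"
begin

section \<open>Labelled rooted trees and forests\<close>

text \<open>
  The label set \<open>{1,\<dots>,d}\<close> is a finite type \<open>'d\<close>, with \<open>d = CARD('d)\<close>. A forest is a multiset of
  nonempty trees, the product of forests is multiset union and the empty forest \<open>{#}\<close> plays the
  role of the empty tree. \<open>Node a f\<close> is the tree \<open>[f]\<^sub>a\<close>, \<open>size f\<close> is the number of trees in \<open>f\<close>.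
\<close>

datatype 'd rtree = Node 'd "'d rtree multiset"

type_synonym 'd forest = "'d rtree multiset"

primrec tree_verts :: "'d rtree \<Rightarrow> nat" where
  "tree_verts (Node a f) = Suc (\<Sum>\<^sub># (image_mset tree_verts f))"

definition verts :: "'d forest \<Rightarrow> nat" where
  "verts f = (\<Sum>\<^sub># (image_mset tree_verts f))"

text \<open>The bound is an integer so that the set for \<open>N - 2\<close> is empty when \<open>N = 1\<close>.\<close>

definition forests_upto :: "int \<Rightarrow> 'd forest set" where
  "forests_upto n = {f. int (verts f) \<le> n}"

lemma verts_single_Node: "verts {#Node a f#} = Suc (verts f)"
  by (simp add: verts_def)

lemma verts_ge_size: "size f \<le> verts f"
proof (induction f)
  case (add t f)
  then show ?case by (cases t) (simp add: verts_def)
qed (simp add: verts_def)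

lemma finite_forests_nat: "finite {f :: 'd::finite forest. verts f \<le> n}"
proof (induction n)
  case 0
  have "f = {#}" if "verts f \<le> 0" for f :: "'d forest"
    using verts_ge_size[of f] that by simp
  then have "{f :: 'd forest. verts f \<le> 0} \<subseteq> {{#}}" by blast
  then show ?case using finite_subset by blast
next
  case (Suc n)
  let ?T = "(\<lambda>(a, f). Node a f) ` (UNIV \<times> {f :: 'd forest. verts f \<le> n})"
  have fin: "finite ?T" using Suc by simp
  have "{f :: 'd forest. verts f \<le> Suc n} \<subseteq> mset ` {ts. set ts \<subseteq> ?T \<and> length ts \<le> Suc n}"
  proof
    fix f :: "'d forest" assume f: "f \<in> {f. verts f \<le> Suc n}"
    obtain ts where ts: "mset ts = f" using ex_mset by blast
    have "t \<in> ?T" if t: "t \<in># f" for t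
    proof -
      obtain a h where ah: "t = Node a h" by (cases t)
      have "tree_verts t \<le> verts f"
        unfolding verts_def using t by (metis (no_types, lifting) insert_DiffM image_mset_add_mset sum_mset.add_mset le_add1)
      then have "verts h \<le> n" using f ah by (simp add: verts_def)
      then show ?thesis using ah by force
    qed
    moreover have "length ts \<le> Suc n" using verts_ge_size[of f] f ts by (metis size_mset le_trans mem_Collect_eq)
    ultimately show "f \<in> mset ` {ts. set ts \<subseteq> ?T \<and> length ts \<le> Suc n}"
      using ts by (metis (mono_tags, lifting) image_eqI mem_Collect_eq set_mset_mset subsetI)
  qed
  then show ?case using finite_lists_length_le[OF fin] finite_subset by blast
qed

lemma finite_forests_upto: "finite (forests_upto n :: 'd::finite forest set)"
  by (rule finite_subset[OF _ finite_forests_nat[of "nat n"]]) (auto simp: forests_upto_def)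

section \<open>The Hopf algebra and its characters\<close>

text \<open>
  The real vector space with basis the forests consists of the finitely supported functions on
  forests. The ring multiplication of \<^type>\<open>poly_mapping\<close> is convolution along the addition of the
  index monoid, i.e. the bilinear extension of the product of forests. Likewise the tensor square
  has the pairs of forests as basis, with \<open>g \<otimes> h\<close> represented by the basis element of \<open>(g, h)\<close>, and
  its ring multiplication is that of the tensor product algebra.
\<close>

type_synonym 'd hopf = "'d forest \<Rightarrow>\<^sub>0 real"

type_synonym 'd hopf2 = "'d forest \<times> 'd forest \<Rightarrow>\<^sub>0 real"

abbreviation basis :: "'b \<Rightarrow> 'b \<Rightarrow>\<^sub>0 real" where
  "basis b \<equiv> Poly_Mapping.single b 1"

definition hinner :: "'d hopf \<Rightarrow> 'd hopf \<Rightarrow> real" where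
  "hinner p q = (\<Sum>f\<in>Poly_Mapping.keys p. Poly_Mapping.lookup p f * Poly_Mapping.lookup q f)"

definition id_tensor_graft :: "'d \<Rightarrow> 'd hopf2 \<Rightarrow> 'd hopf2" where
  "id_tensor_graft a p =
     (\<Sum>(g, h)\<in>Poly_Mapping.keys p. Poly_Mapping.lookup p (g, h) *\<^sub>R basis (g, {#Node a h#}))"

primrec tree_coproduct :: "'d rtree \<Rightarrow> 'd hopf2" where
  "tree_coproduct (Node a f) =
     basis ({#Node a f#}, {#}) + id_tensor_graft a (\<Prod>\<^sub># (image_mset tree_coproduct f))"

definition coproduct :: "'d hopf \<Rightarrow> 'd hopf2" where
  "coproduct p =
     (\<Sum>f\<in>Poly_Mapping.keys p. Poly_Mapping.lookup p f *\<^sub>R (\<Prod>\<^sub># (image_mset tree_coproduct f)))"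

lemma lincomb_superset:
  fixes p :: "'b \<Rightarrow>\<^sub>0 real" and F :: "'b \<Rightarrow> 'c::real_vector"
  assumes "finite S" "Poly_Mapping.keys p \<subseteq> S"
  shows "(\<Sum>f\<in>Poly_Mapping.keys p. Poly_Mapping.lookup p f *\<^sub>R F f) = (\<Sum>f\<in>S. Poly_Mapping.lookup p f *\<^sub>R F f)"
  by (rule sum.mono_neutral_left) (use assms in \<open>auto simp: in_keys_iff\<close>)

lemma lookup_scaleR': "Poly_Mapping.lookup (c *\<^sub>R (p :: 'b \<Rightarrow>\<^sub>0 real)) f = c * Poly_Mapping.lookup p f"
proof -
  have "{i. c *\<^sub>R Poly_Mapping.lookup p i \<noteq> 0} \<subseteq> Poly_Mapping.keys p"
    by (auto simp: in_keys_iff)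
  then have "finite {i. c *\<^sub>R Poly_Mapping.lookup p i \<noteq> 0}"
    using finite_keys finite_subset by blast
  then show ?thesis by (simp add: scaleR_poly_mapping_def)
qed

lemma linear_coproduct: "linear coproduct"
proof (rule linearI)
  fix p q :: "'d hopf" and c :: real
  let ?F = "\<lambda>f. \<Prod>\<^sub># (image_mset tree_coproduct f)"
  let ?S = "Poly_Mapping.keys p \<union> Poly_Mapping.keys q"
  have sub: "Poly_Mapping.keys (p + q) \<subseteq> ?S" by (rule Poly_Mapping.keys_add)
  have fin: "finite ?S" by simp
  show "coproduct (p + q) = coproduct p + coproduct q"
    unfolding coproduct_def lincomb_superset[OF fin sub, of ?F]
      lincomb_superset[OF fin Un_upper1, of ?F] lincomb_superset[OF fin Un_upper2, of ?F]
    by (simp add: lookup_add scaleR_add_left sum.distrib)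
  have "Poly_Mapping.keys (c *\<^sub>R p) \<subseteq> Poly_Mapping.keys p"
    by (auto simp: in_keys_iff lookup_scaleR')
  then show "coproduct (c *\<^sub>R p) = c *\<^sub>R coproduct p"
    unfolding coproduct_def
    by (subst lincomb_superset[of "Poly_Mapping.keys p"]) (auto simp: lookup_scaleR' scaleR_sum_right)
qed

text \<open>
  Together with linearity, the following say that the coproduct is the unital algebra morphism
  determined by its recursion on trees.
\<close>

lemma coproduct_basis: "coproduct (basis f) = \<Prod>\<^sub># (image_mset tree_coproduct f)"
  by (simp add: coproduct_def)

lemma basis_empty: "basis {#} = 1" "basis ({#}, {#}) = 1"
  by (simp_all flip: zero_prod_def)

lemma coproduct_one: "coproduct 1 = basis ({#}, {#})"
  by (metis basis_empty coproduct_basis image_mset_empty prod_mset_empty)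

lemma coproduct_basis_mult: "coproduct (basis f * basis g) = coproduct (basis f) * coproduct (basis g)"
  by (simp add: mult_single coproduct_basis)

lemma coproduct_Node:
  "coproduct (basis {#Node a f#}) = basis ({#Node a f#}, {#}) + id_tensor_graft a (coproduct (basis f))"
  by (simp add: coproduct_basis)

lemma basis_tensor_mult: "basis (f, g) * basis (f', g') = basis (f + f', g + g')"
  by (simp add: mult_single)

definition tensor_functional :: "('d hopf \<Rightarrow> real) \<Rightarrow> ('d hopf \<Rightarrow> real) \<Rightarrow> 'd hopf2 \<Rightarrow> real" where
  "tensor_functional x y p =
     (\<Sum>(g, h)\<in>Poly_Mapping.keys p. Poly_Mapping.lookup p (g, h) * (x (basis g) * y (basis h)))"

definition convolve :: "('d hopf \<Rightarrow> real) \<Rightarrow> ('d hopf \<Rightarrow> real) \<Rightarrow> 'd hopf \<Rightarrow> real" where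
  "convolve x y h = tensor_functional x y (coproduct h)"

text \<open>The neutral element for \<^const>\<open>convolve\<close>.\<close>

definition counit :: "'d hopf \<Rightarrow> real" where
  "counit h = Poly_Mapping.lookup h {#}"

definition characters :: "('d hopf \<Rightarrow> real) set" where
  "characters = {x. linear x \<and> x 1 = 1 \<and> (\<forall>p q. x (p * q) = x p * x q)}"

definition agree_upto :: "nat \<Rightarrow> (('d hopf \<Rightarrow> real) \<times> ('d hopf \<Rightarrow> real)) set" where
  "agree_upto N = {(x, y). x \<in> characters \<and> y \<in> characters \<and>
     (\<forall>f\<in>forests_upto (int N). x (basis f) = y (basis f))}"

definition trunc_group :: "nat \<Rightarrow> ('d hopf \<Rightarrow> real) set monoid" where
  "trunc_group N =
    \<lparr>carrier = characters // agree_upto N,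
     mult = (\<lambda>A B. \<Union>x\<in>A. \<Union>y\<in>B. agree_upto N `` {convolve x y}),
     one = agree_upto N `` {counit}\<rparr>"

text \<open>
  Evaluation of a class of characters. It is meaningful only where all members of the class have
  the same value, so on the span of \<^term>\<open>forests_upto (int N)\<close> for classes in \<^term>\<open>trunc_group N\<close>.
\<close>

definition class_eval :: "('d hopf \<Rightarrow> real) set \<Rightarrow> 'd hopf \<Rightarrow> real" where
  "class_eval A h = the_elem ((\<lambda>x. x h) ` A)"

section \<open>Branched rough paths and controlled rough paths\<close>

definition increment ::
    "nat \<Rightarrow> (real \<Rightarrow> ('d hopf \<Rightarrow> real) set) \<Rightarrow> real \<Rightarrow> real \<Rightarrow> 'd hopf \<Rightarrow> real" where
  "increment N X s t =
     class_eval (inv\<^bsub>trunc_group N\<^esub> (X s) \<otimes>\<^bsub>trunc_group N\<^esub> X t)"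

definition branched_rough_path ::
    "nat \<Rightarrow> real \<Rightarrow> real \<Rightarrow> (real \<Rightarrow> ('d hopf \<Rightarrow> real) set) \<Rightarrow> bool" where
  "branched_rough_path N \<gamma> T X \<longleftrightarrow>
     (\<forall>t\<in>{0..T}. X t \<in> carrier (trunc_group N)) \<and>
     (\<forall>f\<in>forests_upto (int N).
        bdd_above {\<bar>increment N X s t (basis f)\<bar> / \<bar>t - s\<bar> powr (\<gamma> * verts f) | s t.
                   0 \<le> s \<and> s < t \<and> t \<le> T})"

text \<open>
  A controlled rough path is a family \<open>Y\<close>, where \<open>Y f t\<close> is the Gubinelli derivative of index \<open>f\<close> at
  time \<open>t\<close>; only the values for \<open>f \<in> forests_upto (N - 1)\<close> and \<open>t \<in> J\<close> are relevant.
\<close>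

definition remainder ::
    "nat \<Rightarrow> (real \<Rightarrow> ('d hopf \<Rightarrow> real) set) \<Rightarrow> ('d forest \<Rightarrow> real \<Rightarrow> real) \<Rightarrow>
     'd forest \<Rightarrow> real \<Rightarrow> real \<Rightarrow> real" where
  "remainder N X Y f s t =
     Y f t - (\<Sum>g\<in>forests_upto (int N - 1).
       tensor_functional (increment N X s t) (hinner (basis f)) (coproduct (basis g)) * Y g s)"

definition controlled_rough_path ::
    "nat \<Rightarrow> real \<Rightarrow> (real \<Rightarrow> ('d hopf \<Rightarrow> real) set) \<Rightarrow> real set \<Rightarrow>
     ('d forest \<Rightarrow> real \<Rightarrow> real) \<Rightarrow> bool" where
  "controlled_rough_path N \<gamma> X J Y \<longleftrightarrow>
     (\<forall>f\<in>forests_upto (int N - 1). \<forall>a b. {a..b} \<subseteq> J \<longrightarrow>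
        bdd_above {\<bar>remainder N X Y f s t\<bar> / \<bar>t - s\<bar> powr ((real N - real (verts f)) * \<gamma>) | s t.
                   a \<le> s \<and> s < t \<and> t \<le> b})"

section \<open>Differential equations\<close>

text \<open>
  Derivatives of functions of one real variable: the \<open>n\<close>-linear map \<open>D\<^sup>n\<phi>(x)\<close> is identified with its
  value at \<open>(1,\<dots>,1)\<close>, which has the same norm.
\<close>

definition nderiv :: "nat \<Rightarrow> (real \<Rightarrow> 'b::real_normed_vector) \<Rightarrow> real \<Rightarrow> 'b" where
  "nderiv n \<phi> = ((\<lambda>\<psi> x. vector_derivative \<psi> (at x)) ^^ n) \<phi>"

definition cont_differentiable :: "nat \<Rightarrow> (real \<Rightarrow> 'b::real_normed_vector) \<Rightarrow> bool" where
  "cont_differentiable n \<phi> \<longleftrightarrow>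
     (\<forall>k<n. \<forall>x. nderiv k \<phi> differentiable at x) \<and> (\<forall>k\<le>n. continuous_on UNIV (nderiv k \<phi>))"

definition component :: "(real \<Rightarrow> (real ^ 'd) \<Rightarrow>\<^sub>L real) \<Rightarrow> 'd \<Rightarrow> real \<Rightarrow> real" where
  "component \<phi> a x = blinfun_apply (\<phi> x) (axis a 1)"

text \<open>
  The sum ranges over the lists of trees with product \<open>f\<close>, the ordered tuples of the definition;
  for scalar arguments the multilinear map \<open>D\<^sup>n\<psi>(y)\<close> acts by multiplication.
\<close>

definition compose_derivative ::
    "(real \<Rightarrow> real) \<Rightarrow> ('d forest \<Rightarrow> real \<Rightarrow> real) \<Rightarrow> 'd forest \<Rightarrow> real \<Rightarrow> real" where
  "compose_derivative \<psi> Y f t =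
     (\<Sum>ts\<in>{ts. mset ts = f}.
        1 / fact (size f) * (nderiv (size f) \<psi> (Y {#} t) * (\<Prod>\<tau>\<leftarrow>ts. Y {#\<tau>#} t)))"

definition has_rough_integral ::
    "nat \<Rightarrow> (real \<Rightarrow> ('d::finite hopf \<Rightarrow> real) set) \<Rightarrow> (real \<Rightarrow> (real ^ 'd) \<Rightarrow>\<^sub>L real) \<Rightarrow>
     ('d forest \<Rightarrow> real \<Rightarrow> real) \<Rightarrow> real \<Rightarrow> real \<Rightarrow> real \<Rightarrow> bool" where
  "has_rough_integral N X \<phi> Y s t I \<longleftrightarrow>
     (\<forall>\<epsilon>>0. \<exists>\<delta>>0. \<forall>(n::nat) (p::nat \<Rightarrow> real).
        p 0 = s \<and> p n = t \<and> (\<forall>i<n. p i < p (Suc i) \<and> p (Suc i) - p i < \<delta>) \<longrightarrow>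
        \<bar>(\<Sum>i<n. \<Sum>a\<in>UNIV. \<Sum>f\<in>forests_upto (int N - 1).
            compose_derivative (component \<phi> a) Y f (p i) *
            increment N X (p i) (p (Suc i)) (basis {#Node a f#})) - I\<bar> < \<epsilon>)"

definition rde_solution ::
    "nat \<Rightarrow> real \<Rightarrow> (real \<Rightarrow> ('d::finite hopf \<Rightarrow> real) set) \<Rightarrow> (real \<Rightarrow> (real ^ 'd) \<Rightarrow>\<^sub>L real) \<Rightarrow>
     real set \<Rightarrow> ('d forest \<Rightarrow> real \<Rightarrow> real) \<Rightarrow> bool" where
  "rde_solution N \<gamma> X \<phi> J Y \<longleftrightarrow>
     controlled_rough_path N \<gamma> X J Y \<and>
     (\<forall>t\<in>J. \<exists>I. has_rough_integral N X \<phi> Y 0 t I \<and> Y {#} t = Y {#} 0 + I) \<and>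
     (\<forall>f\<in>forests_upto (int N - 2). \<forall>a. \<forall>t\<in>J.
        Y {#Node a f#} t = compose_derivative (component \<phi> a) Y f t) \<and>
     (\<forall>f\<in>forests_upto (int N - 1). size f \<ge> 2 \<longrightarrow> (\<forall>t\<in>J. Y f t = 0))"

end

theory Submission
  imports Defs
begin

text \<open>
  Write \<open>D k a\<close> for the \<open>k\<close>-th derivative of \<open>\<phi>\<^sub>a\<close> and \<open>\<xi> s t\<close> for the increment of the rough path over
  \<open>[s, t]\<close>, a character and hence given by its values on trees. Each tree \<open>\<tau>\<close> has an elementary
  differential \<open>cT D y \<tau>\<close>, and the Euler step over \<open>[s, t]\<close> is \<open>y \<mapsto> y + (\<Sum>\<tau>. cT D y \<tau> * \<xi> s t \<tau>)\<close>, the sum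
  over trees with at most \<open>N\<close> vertices. The theorem is a statement about these one-step maps.

  Algebra. With \<open>P y = (\<Sum>\<tau>. cT D y \<tau> *\<^sub>R \<tau>)\<close> the step is \<open>y + \<langle>\<xi> s t, P y\<rangle>\<close>, and \<open>P y = (\<Sum>a. [\<Phi>\<^sub>a y]\<^sub>a)\<close> where
  \<open>\<Phi>\<^sub>a y\<close> is, up to forests with at least \<open>N\<close> vertices, the series \<open>(\<Sum>j. D j a y / j! *\<^sub>R P y ^ j)\<close>. The map
  \<open>Q = (\<xi> s u \<otimes> id) \<Delta>\<close> is a morphism of algebras with \<open>Q [U]\<^sub>a = \<langle>\<xi> s u, [U]\<^sub>a\<rangle> 1 + [Q U]\<^sub>a\<close>. Applied to the series, it
  replaces \<open>P y\<close> by a constant plus the grafted \<open>Q (\<Phi>\<^sub>a y)\<close>, and Taylor's formula at \<open>y' = y + \<langle>\<xi> s u, P y\<rangle>\<close>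
  moves the constant into the point of expansion. So if \<open>Q (\<Phi>\<^sub>a y)\<close> agrees with \<open>\<Phi>\<^sub>a y'\<close> up to some order,
  then it agrees to one order more, because grafting raises the order; by induction the error is of
  order \<open>N\<close> (\<open>consistency\<close>). Chen's relation then shows that the steps over \<open>[s, u]\<close> and \<open>[u, t]\<close>
  compose to the step over \<open>[s, t]\<close> up to an error of order \<open>N + 1\<close> (\<open>almost_flow\<close>), that is
  \<open>\<bar>t - s\<bar> powr \<theta>\<close> with \<open>\<theta> = (N + 1) * \<gamma> > 1\<close>. Sums of such errors along a partition are controlled by repeated
  halving (\<open>discrete_sewing\<close>).

  Global existence. The iterates of the Euler step on a grid stay bounded uniformly in the mesh
  (\<open>scheme_bounded\<close>). Hypotheses (i) and (ii) give \<open>l (2 * x) \<le> 2 * l x\<close>. Hence on the annulus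
  \<open>\<rho> \<le> \<bar>z\<bar> \<le> 8 * \<rho>\<close>, with \<open>L = l \<rho>\<close>, the derivatives satisfy \<open>\<bar>D k a z\<bar> \<le> A / M ^ k\<close> for \<open>A = 8 * L powr \<alpha>\<close> and
  \<open>M = L powr \<alpha> / (ln (8 * L) + 1) powr \<gamma>\<close>. The change of variable \<open>z \<mapsto> z / M\<close> turns this into bounds by \<open>1\<close>, so in
  the annulus the iterates move by at most \<open>M\<close> in any time \<open>w\<close> for which \<open>w powr \<gamma> * A / M\<close> is below a universal
  constant. About \<open>ln L\<close> such time intervals cover \<open>[0, T]\<close>, while \<open>M * ln L\<close> is small compared with \<open>\<rho>\<close> since \<open>l\<close>
  grows at most linearly and \<open>\<alpha> < 1\<close>. So iterates that leave \<open>\<bar>z\<bar> \<le> 2 * \<rho>\<close> do not reach the outer boundary. A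
  pointwise cluster point of the iterates, as the mesh tends to \<open>0\<close>, is a path \<open>Y\<close> with
  \<open>\<bar>Y t - step s t (Y s)\<bar> \<le> C * \<bar>t - s\<bar> powr \<theta>\<close> (\<open>davie_exists\<close>), a solution in the sense of Davie.

  Uniqueness. The error of composing two steps is also Lipschitz in the starting point, with a
  constant of the same order, because \<open>\<phi>\<close> has one derivative more than the size of that error
  requires. Together with
  a bound for second differences of the step this gives a contraction for the difference of two
  Davie solutions on short intervals (\<open>davie_unique\<close>).

  Equivalence. In a solution of the differential equation, the Gubinelli derivatives are the elementary
  differentials of the path, and the remainder of index \<open>{#}\<close> says that the path follows the
  Euler step up to order \<open>N\<close>. This is enough for consistency along the path; thus the
  summands of the rough integral are almost additive, the integral differs from one summand by
  order \<open>N + 1\<close>, and the path is a Davie solution (\<open>solution_davie\<close>). The same estimates, read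
  backwards, make a Davie solution a solution (\<open>davie_solution\<close>).
\<close>

section \<open>Linear extension from a basis\<close>

definition lext :: "('b \<Rightarrow> 'c::real_vector) \<Rightarrow> ('b \<Rightarrow>\<^sub>0 real) \<Rightarrow> 'c" where
  "lext F p = (\<Sum>k\<in>Poly_Mapping.keys p. Poly_Mapping.lookup p k *\<^sub>R F k)"

lemma linear_lext: "linear (lext F)"
proof (rule linearI)
  fix p q :: "'a \<Rightarrow>\<^sub>0 real" and c :: real
  let ?S = "Poly_Mapping.keys p \<union> Poly_Mapping.keys q"
  have sub: "Poly_Mapping.keys (p + q) \<subseteq> ?S" by (rule Poly_Mapping.keys_add)
  have fin: "finite ?S" by simp
  show "lext F (p + q) = lext F p + lext F q"
    unfolding lext_def lincomb_superset[OF fin sub, of F]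
      lincomb_superset[OF fin Un_upper1, of F] lincomb_superset[OF fin Un_upper2, of F]
    by (simp add: lookup_add scaleR_add_left sum.distrib)
  have "Poly_Mapping.keys (c *\<^sub>R p) \<subseteq> Poly_Mapping.keys p"
    by (auto simp: in_keys_iff lookup_scaleR')
  then show "lext F (c *\<^sub>R p) = c *\<^sub>R lext F p"
    unfolding lext_def
    by (subst lincomb_superset[of "Poly_Mapping.keys p"]) (auto simp: lookup_scaleR' scaleR_sum_right)
qed

lemma lext_basis [simp]: "lext F (basis k) = F k"
  by (simp add: lext_def)

lemma lext_add: "lext F (p + q) = lext F p + lext F q"
  by (rule linear_add[OF linear_lext])

lemma lext_scaleR: "lext F (c *\<^sub>R p) = c *\<^sub>R lext F p"
  by (rule linear_scale[OF linear_lext])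

lemma basis_expansion: "(\<Sum>k\<in>Poly_Mapping.keys p. Poly_Mapping.lookup p k *\<^sub>R basis k) = (p :: 'b \<Rightarrow>\<^sub>0 real)"
proof (rule poly_mapping_eqI)
  fix k
  have "Poly_Mapping.lookup (\<Sum>j\<in>Poly_Mapping.keys p. Poly_Mapping.lookup p j *\<^sub>R basis j) k
      = (\<Sum>j\<in>Poly_Mapping.keys p. if j = k then Poly_Mapping.lookup p j else 0)"
    unfolding lookup_sum by (rule sum.cong) (auto simp: lookup_scaleR' lookup_single when_def)
  then show "Poly_Mapping.lookup (\<Sum>j\<in>Poly_Mapping.keys p. Poly_Mapping.lookup p j *\<^sub>R basis j) k = Poly_Mapping.lookup p k"
    by (auto simp: in_keys_iff)
qed

lemma linear_eq_on_basis:
  fixes F G :: "('b \<Rightarrow>\<^sub>0 real) \<Rightarrow> 'c::real_vector"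
  assumes "linear F" "linear G" "\<And>k. k \<in> Poly_Mapping.keys p \<Longrightarrow> F (basis k) = G (basis k)"
  shows "F p = G p"
proof -
  have "F (\<Sum>k\<in>Poly_Mapping.keys p. Poly_Mapping.lookup p k *\<^sub>R basis k)
      = G (\<Sum>k\<in>Poly_Mapping.keys p. Poly_Mapping.lookup p k *\<^sub>R basis k)"
    using assms by (simp add: linear_sum linear_scale)
  then show ?thesis by (simp add: basis_expansion)
qed

lemma scaleR_eq_mult: "c *\<^sub>R (p :: 'b::comm_monoid_add \<Rightarrow>\<^sub>0 real) = Poly_Mapping.single 0 c * p"
proof (rule poly_mapping_eqI)
  fix k
  show "Poly_Mapping.lookup (c *\<^sub>R p) k = Poly_Mapping.lookup (Poly_Mapping.single 0 c * p) k"
    by (simp flip: mult_map_scale_conv_mult add: lookup_scaleR' Poly_Mapping.map.rep_eq when_def)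
qed

lemma pm_scaleR_left: "(c *\<^sub>R p) * q = c *\<^sub>R (p * (q :: 'b::comm_monoid_add \<Rightarrow>\<^sub>0 real))"
  by (simp add: scaleR_eq_mult mult.assoc)

lemma pm_scaleR_right: "p * (c *\<^sub>R q) = c *\<^sub>R (p * (q :: 'b::comm_monoid_add \<Rightarrow>\<^sub>0 real))"
  by (simp add: scaleR_eq_mult mult.left_commute)

lemma bilinear_eq_on_basis:
  fixes B C :: "('b \<Rightarrow>\<^sub>0 real) \<Rightarrow> ('c \<Rightarrow>\<^sub>0 real) \<Rightarrow> 'e::real_vector"
  assumes "\<And>p. linear (B p)" "\<And>p. linear (C p)" "\<And>q. linear (\<lambda>p. B p q)" "\<And>q. linear (\<lambda>p. C p q)"
    and "\<And>j k. B (basis j) (basis k) = C (basis j) (basis k)"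
  shows "B p q = C p q"
proof -
  have "B (basis j) q = C (basis j) q" for j
    by (rule linear_eq_on_basis[OF assms(1,2,5)])
  then show ?thesis
    by (rule linear_eq_on_basis[OF assms(3,4)])
qed

text \<open>
  Multiplicativity of a linear extension can be tested on basis elements; this covers all algebra
  morphisms below.
\<close>

lemma lext_mult_pm:
  fixes F :: "'b::comm_monoid_add \<Rightarrow> ('c::comm_monoid_add \<Rightarrow>\<^sub>0 real)"
  assumes "\<And>j k. F (j + k) = F j * F k"
  shows "lext F (p * q) = lext F p * lext F q"
proof (rule bilinear_eq_on_basis[of "\<lambda>p q. lext F (p * q)" "\<lambda>p q. lext F p * lext F q"])
  show "lext F (basis j * basis k) = lext F (basis j) * lext F (basis k)" for j k
    by (simp add: mult_single assms)
qed (rule linearI; simp add: lext_add lext_scaleR pm_scaleR_left pm_scaleR_right ring_distribs)+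

lemma lext_mult_real:
  fixes F :: "'b::comm_monoid_add \<Rightarrow> real"
  assumes "\<And>j k. F (j + k) = F j * F k"
  shows "lext F (p * q) = lext F p * lext F q"
proof (rule bilinear_eq_on_basis[of "\<lambda>p q. lext F (p * q)" "\<lambda>p q. lext F p * lext F q"])
  show "lext F (basis j * basis k) = lext F (basis j) * lext F (basis k)" for j k
    by (simp add: mult_single assms)
qed (rule linearI; simp add: lext_add lext_scaleR pm_scaleR_left pm_scaleR_right ring_distribs)+

section \<open>Characters as functions on trees\<close>

text \<open>
  The linear operator \<open>[\<cdot>]\<^sub>a\<close>.
\<close>

definition graft :: "'d \<Rightarrow> 'd hopf \<Rightarrow> 'd hopf" where
  "graft a = lext (\<lambda>h. basis {#Node a h#})"

lemma linear_graft: "linear (graft a)"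
  unfolding graft_def by (rule linear_lext)

lemma graft_basis [simp]: "graft a (basis h) = basis {#Node a h#}"
  by (simp add: graft_def)

text \<open>
  The character with the given values on trees. Trees generate the algebra freely, so every
  function on trees occurs, and the estimates only ever speak about such functions.
\<close>

definition evc :: "('d rtree \<Rightarrow> real) \<Rightarrow> 'd hopf \<Rightarrow> real" where
  "evc \<xi> = lext (\<lambda>f. \<Prod>\<^sub># (image_mset \<xi> f))"

lemma linear_evc: "linear (evc \<xi>)"
  unfolding evc_def by (rule linear_lext)

lemma evc_basis: "evc \<xi> (basis f) = \<Prod>\<^sub># (image_mset \<xi> f)"
  by (simp add: evc_def)

lemma evc_one [simp]: "evc \<xi> 1 = 1"
  using evc_basis[of \<xi> "{#}"] by simp

lemma evc_mult: "evc \<xi> (p * q) = evc \<xi> p * evc \<xi> q"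
  unfolding evc_def by (rule lext_mult_real) simp

lemma evc_character: "evc \<xi> \<in> characters"
  by (simp add: characters_def linear_evc evc_mult)

lemma character_evc:
  assumes "x \<in> characters"
  shows "x = evc (\<lambda>\<tau>. x (basis {#\<tau>#}))"
proof
  fix p
  have lin: "linear x" and one: "x 1 = 1" and mul: "\<And>p q. x (p * q) = x p * x q"
    using assms by (auto simp: characters_def)
  have *: "x (basis f) = \<Prod>\<^sub># (image_mset (\<lambda>\<tau>. x (basis {#\<tau>#})) f)" for f
  proof (induction f)
    case empty
    show ?case by (simp only: basis_empty one image_mset_empty prod_mset_empty)
  next
    case (add t f)
    have "basis (add_mset t f) = basis {#t#} * (basis f :: 'a hopf)"
      by (simp add: mult_single)
    then have "x (basis (add_mset t f)) = x (basis {#t#}) * x (basis f)"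
      by (simp only: mul)
    then show ?case by (simp only: add image_mset_add_mset prod_mset.add_mset)
  qed
  show "x p = evc (\<lambda>\<tau>. x (basis {#\<tau>#})) p"
    by (rule linear_eq_on_basis[OF lin linear_evc]) (unfold evc_basis, rule *)
qed

text \<open>
  \<open>(x \<otimes> id) \<Delta>\<close> on trees, on forests and by linearity on the whole algebra, for the character \<open>x\<close> with
  values \<open>\<xi>\<close> on trees. The recursion is the one of the coproduct; having it as a definition keeps the
  tensor square out of the estimates.
\<close>

primrec Qt :: "('d rtree \<Rightarrow> real) \<Rightarrow> 'd rtree \<Rightarrow> 'd hopf" where
  "Qt \<xi> (Node a f) = \<xi> (Node a f) *\<^sub>R 1 + graft a (\<Prod>\<^sub># (image_mset (Qt \<xi>) f))"

definition Qf :: "('d rtree \<Rightarrow> real) \<Rightarrow> 'd forest \<Rightarrow> 'd hopf" where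
  "Qf \<xi> f = \<Prod>\<^sub># (image_mset (Qt \<xi>) f)"

definition Qh :: "('d rtree \<Rightarrow> real) \<Rightarrow> 'd hopf \<Rightarrow> 'd hopf" where
  "Qh \<xi> = lext (Qf \<xi>)"

lemma Qt_Node: "Qt \<xi> (Node a f) = \<xi> (Node a f) *\<^sub>R 1 + graft a (Qf \<xi> f)"
  by (simp add: Qf_def)

declare Qt.simps [simp del]

lemma Qf_add: "Qf \<xi> (f + g) = Qf \<xi> f * Qf \<xi> g"
  by (simp add: Qf_def)

lemma Qf_empty [simp]: "Qf \<xi> {#} = 1"
  by (simp add: Qf_def)

lemma Qf_single [simp]: "Qf \<xi> {#\<tau>#} = Qt \<xi> \<tau>"
  by (simp add: Qf_def)

lemma linear_Qh: "linear (Qh \<xi>)"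
  unfolding Qh_def by (rule linear_lext)

lemma Qh_basis [simp]: "Qh \<xi> (basis f) = Qf \<xi> f"
  by (simp add: Qh_def)

lemma Qh_one [simp]: "Qh \<xi> 1 = 1"
  using Qh_basis[of \<xi> "{#}"] by (simp del: Qh_basis)

lemma Qh_mult: "Qh \<xi> (p * q) = Qh \<xi> p * Qh \<xi> q"
  unfolding Qh_def by (rule lext_mult_pm) (rule Qf_add)

text \<open>
  The identity that makes an induction on the order possible: after grafting, only a constant and a graft appear.
\<close>

lemma Qh_graft: "Qh \<xi> (graft a p) = evc \<xi> (graft a p) *\<^sub>R 1 + graft a (Qh \<xi> p)"
proof (rule linear_eq_on_basis[of "\<lambda>p. Qh \<xi> (graft a p)" "\<lambda>p. evc \<xi> (graft a p) *\<^sub>R 1 + graft a (Qh \<xi> p)"])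
  show "linear (\<lambda>p. Qh \<xi> (graft a p))"
    by (rule linearI) (simp_all add: linear_add[OF linear_Qh] linear_add[OF linear_graft]
        linear_scale[OF linear_Qh] linear_scale[OF linear_graft])
  show "linear (\<lambda>p. evc \<xi> (graft a p) *\<^sub>R 1 + graft a (Qh \<xi> p))"
    by (rule linearI) (simp_all add: linear_add[OF linear_Qh] linear_add[OF linear_graft]
        linear_add[OF linear_evc] linear_scale[OF linear_evc] scaleR_add_left scaleR_add_right
        linear_scale[OF linear_Qh] linear_scale[OF linear_graft])
qed (simp add: Qt_Node evc_basis)

lemma linear_lookup: "linear (\<lambda>p :: 'b \<Rightarrow>\<^sub>0 real. Poly_Mapping.lookup p k)"
  by (rule linearI) (simp_all add: lookup_add lookup_scaleR')

lemma linear_compose': "linear F \<Longrightarrow> linear G \<Longrightarrow> linear (\<lambda>p. G (F p))"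
  using linear_compose[of F G] by (simp add: o_def)

lemma lookup_graft_Node:
  "Poly_Mapping.lookup (graft a p) {#Node b h#} = (if a = b then Poly_Mapping.lookup p h else 0)"
proof -
  have l: "linear (\<lambda>p :: 'a hopf. if a = b then Poly_Mapping.lookup p h else 0)"
    by (rule linearI) (simp_all add: lookup_add lookup_scaleR')
  show ?thesis
    by (rule linear_eq_on_basis[OF linear_compose'[OF linear_graft linear_lookup] l])
      (auto simp: lookup_single when_def)
qed

lemma lookup_graft_size:
  assumes "size f \<noteq> 1"
  shows "Poly_Mapping.lookup (graft a p) f = 0"
proof -
  have l: "linear (\<lambda>p :: 'a hopf. 0 :: real)"
    by (rule linearI) simp_all
  show ?thesis
    by (rule linear_eq_on_basis[OF linear_compose'[OF linear_graft linear_lookup] l])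
      (use assms in \<open>auto simp: lookup_single when_def\<close>)
qed

lemma lookup_one: "Poly_Mapping.lookup (1 :: 'd hopf) f = (if f = {#} then 1 else 0)"
  by (auto simp: Poly_Mapping.lookup_one when_def)

lemma prod_mset_hom:
  assumes "F 1 = 1" "\<And>p q. F (p * q) = F p * F q"
  shows "F (\<Prod>\<^sub># (image_mset g f)) = \<Prod>\<^sub># (image_mset (\<lambda>t. F (g t)) f)"
  by (induction f) (simp_all add: assms)

section \<open>Convolution\<close>

abbreviation tr :: "('d hopf \<Rightarrow> real) \<Rightarrow> 'd rtree \<Rightarrow> real" where
  "tr x \<equiv> (\<lambda>\<tau>. x (basis {#\<tau>#}))"

lemma tr_evc: "tr (evc \<xi>) = \<xi>"
  by (simp add: evc_basis)

lemma character_multD: "x \<in> characters \<Longrightarrow> x (p * q) = x p * x q"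
  and character_oneD: "x \<in> characters \<Longrightarrow> x 1 = 1"
  and character_linear: "x \<in> characters \<Longrightarrow> linear x"
  by (auto simp: characters_def)

text \<open>
  The map \<open>(x \<otimes> id)\<close> on the tensor square.
\<close>

definition eval_left :: "('d hopf \<Rightarrow> real) \<Rightarrow> 'd hopf2 \<Rightarrow> 'd hopf" where
  "eval_left x = lext (\<lambda>(g, h). x (basis g) *\<^sub>R basis h)"

lemma linear_eval_left: "linear (eval_left x)"
  unfolding eval_left_def by (rule linear_lext)

lemma eval_left_basis: "eval_left x (basis (g, h)) = x (basis g) *\<^sub>R basis h"
  by (simp add: eval_left_def)

lemma eval_left_mult:
  assumes "x \<in> characters"
  shows "eval_left x (p * q) = eval_left x p * eval_left x q"
  unfolding eval_left_def
proof (rule lext_mult_pm)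
  fix j k :: "'a forest \<times> 'a forest"
  obtain g h g' h' where jk: "j = (g, h)" "k = (g', h')" by (metis surj_pair)
  have "x (basis (g + g')) = x (basis g) * x (basis g')"
    using character_multD[OF assms, of "basis g" "basis g'"] by (simp add: mult_single)
  moreover have "basis (h + h') = basis h * (basis h' :: 'a hopf)"
    by (simp add: mult_single)
  ultimately show "(case j + k of (g, h) \<Rightarrow> x (basis g) *\<^sub>R basis h)
      = (case j of (g, h) \<Rightarrow> x (basis g) *\<^sub>R basis h) * (case k of (g, h) \<Rightarrow> x (basis g) *\<^sub>R basis h)"
    unfolding jk plus_prod_def by (simp only: fst_conv snd_conv prod.case pm_scaleR_left pm_scaleR_right scaleR_scaleR mult.commute)
qed

lemma eval_left_one: "x \<in> characters \<Longrightarrow> eval_left x 1 = 1"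
  by (metis basis_empty(1,2) character_oneD eval_left_basis scaleR_one)

lemma id_tensor_graft_lext: "id_tensor_graft a p = lext (\<lambda>(g, h). basis (g, {#Node a h#})) p"
  unfolding id_tensor_graft_def lext_def by (rule sum.cong) auto

lemma linear_id_tensor_graft: "linear (id_tensor_graft a)"
  unfolding id_tensor_graft_lext by (rule linear_lext)

lemma eval_left_graft: "eval_left x (id_tensor_graft a p) = graft a (eval_left x p)"
proof (rule linear_eq_on_basis[OF linear_compose'[OF linear_id_tensor_graft linear_eval_left]
      linear_compose'[OF linear_eval_left linear_graft]])
  fix k :: "'a forest \<times> 'a forest"
  obtain g h where k: "k = (g, h)" by (metis surj_pair)
  show "eval_left x (id_tensor_graft a (basis k)) = graft a (eval_left x (basis k))"
    unfolding k by (simp add: id_tensor_graft_lext eval_left_basis linear_scale[OF linear_graft])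
qed

lemma eval_left_tree:
  assumes "x \<in> characters"
  shows "eval_left x (tree_coproduct \<tau>) = Qt (tr x) \<tau>"
proof (induction \<tau>)
  case (Node a f)
  have "eval_left x (tree_coproduct (Node a f))
      = x (basis {#Node a f#}) *\<^sub>R basis {#} + graft a (eval_left x (\<Prod>\<^sub># (image_mset tree_coproduct f)))"
    by (simp add: linear_add[OF linear_eval_left] eval_left_graft eval_left_basis)
  also have "eval_left x (\<Prod>\<^sub># (image_mset tree_coproduct f)) = Qf (tr x) f"
    unfolding prod_mset_hom[of "eval_left x", OF eval_left_one[OF assms] eval_left_mult[OF assms]] Qf_def
    by (rule arg_cong[where f = prod_mset], rule image_mset_cong) (rule Node)
  finally show ?case by (simp add: Qt_Node)
qed

text \<open>
  Both sides are algebra morphisms with the same recursion on trees.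
\<close>

lemma eval_left_coproduct:
  assumes "x \<in> characters"
  shows "eval_left x (coproduct p) = Qh (tr x) p"
proof (rule linear_eq_on_basis[OF linear_compose'[OF linear_coproduct linear_eval_left] linear_Qh])
  fix f
  show "eval_left x (coproduct (basis f)) = Qh (tr x) (basis f)"
    unfolding coproduct_basis Qh_basis Qf_def
      prod_mset_hom[of "eval_left x", OF eval_left_one[OF assms] eval_left_mult[OF assms]]
    by (simp add: eval_left_tree[OF assms])
qed

lemma tensor_functional_lext: "tensor_functional x y p = lext (\<lambda>(g, h). x (basis g) * y (basis h)) p"
  unfolding tensor_functional_def lext_def by (rule sum.cong) auto

lemma tensor_functional_eval_left:
  assumes "linear y"
  shows "tensor_functional x y p = y (eval_left x p)"
  unfolding tensor_functional_lext
proof (rule linear_eq_on_basis[OF linear_lext linear_compose'[OF linear_eval_left assms]])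
  fix k :: "'a forest \<times> 'a forest"
  obtain g h where k: "k = (g, h)" by (metis surj_pair)
  show "lext (\<lambda>(g, h). x (basis g) * y (basis h)) (basis k) = y (eval_left x (basis k))"
    unfolding k by (simp add: eval_left_basis linear_scale[OF assms])
qed

text \<open>
  Convolution with \<open>x\<close> on the left becomes composition with \<open>Qh\<close>, so associativity becomes a composition rule.
\<close>

lemma convolve_Qh:
  assumes "x \<in> characters" "linear y"
  shows "convolve x y h = y (Qh (tr x) h)"
  by (simp add: convolve_def tensor_functional_eval_left assms eval_left_coproduct)

lemma convolve_character:
  assumes "x \<in> characters" "y \<in> characters"
  shows "convolve x y \<in> characters"
proof -
  have "convolve x y = (\<lambda>h. y (Qh (tr x) h))"
    using convolve_Qh[OF assms(1) character_linear[OF assms(2)]] by blast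
  then show ?thesis
    unfolding characters_def
    by (simp add: linear_compose'[OF linear_Qh character_linear[OF assms(2)]] Qh_mult
        character_multD[OF assms(2)] character_oneD[OF assms(2)])
qed

text \<open>
  Coassociativity, in the form of a composition rule.
\<close>

lemma Qt_convolve:
  assumes "x \<in> characters" "y \<in> characters"
  shows "Qt (tr (convolve x y)) \<tau> = Qh (tr y) (Qt (tr x) \<tau>)"
proof (induction \<tau>)
  case (Node a f)
  have f: "Qf (tr (convolve x y)) f = Qh (tr y) (Qf (tr x) f)"
    unfolding Qf_def prod_mset_hom[of "Qh (tr y)", OF Qh_one Qh_mult]
    by (rule arg_cong[where f = prod_mset], rule image_mset_cong) (rule Node)
  have "tr (convolve x y) (Node a f) = x (basis {#Node a f#}) + y (graft a (Qf (tr x) f))"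
    using character_linear[OF assms(2)]
    by (simp add: convolve_Qh[OF assms(1) character_linear[OF assms(2)]] Qt_Node linear_add linear_scale
        character_oneD[OF assms(2)])
  then show ?case
    unfolding Qt_Node f linear_add[OF linear_Qh] linear_scale[OF linear_Qh] Qh_one Qh_graft
      character_evc[OF assms(2), symmetric] by (simp only: scaleR_add_left add.assoc)
qed

lemma Qh_convolve:
  assumes "x \<in> characters" "y \<in> characters"
  shows "Qh (tr (convolve x y)) p = Qh (tr y) (Qh (tr x) p)"
proof (rule linear_eq_on_basis[OF linear_Qh linear_compose'[OF linear_Qh linear_Qh]])
  fix f
  show "Qh (tr (convolve x y)) (basis f) = Qh (tr y) (Qh (tr x) (basis f))"
    unfolding Qh_basis Qf_def prod_mset_hom[of "Qh (tr y)", OF Qh_one Qh_mult]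
    by (rule arg_cong[where f = prod_mset], rule image_mset_cong, rule Qt_convolve[OF assms])
qed

lemma convolve_assoc:
  assumes "x \<in> characters" "y \<in> characters" "z \<in> characters"
  shows "convolve (convolve x y) z = convolve x (convolve y z)"
proof
  fix h
  note lin = character_linear[OF assms(2)] character_linear[OF assms(3)]
    character_linear[OF convolve_character[OF assms(2,3)]]
  have "convolve (convolve x y) z h = z (Qh (tr (convolve x y)) h)"
    by (rule convolve_Qh[OF convolve_character[OF assms(1,2)] lin(2)])
  also have "\<dots> = z (Qh (tr y) (Qh (tr x) h))"
    by (rule arg_cong[OF Qh_convolve[OF assms(1,2)]])
  also have "\<dots> = convolve x (convolve y z) h"
    unfolding convolve_Qh[OF assms(1) lin(3)] convolve_Qh[OF assms(2) lin(2)] ..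
  finally show "convolve (convolve x y) z h = convolve x (convolve y z) h" .
qed

lemma counit_evc: "counit = evc (\<lambda>_. 0)"
proof
  fix p :: "'a hopf"
  have l: "linear (counit :: 'a hopf \<Rightarrow> real)" unfolding counit_def[abs_def] by (rule linear_lookup)
  show "counit p = evc (\<lambda>_. 0) p"
  proof (rule linear_eq_on_basis[OF l linear_evc])
    fix f :: "'a forest"
    show "counit (basis f) = evc (\<lambda>_. 0) (basis f)"
      unfolding evc_basis counit_def by (cases f) (auto simp: lookup_single when_def)
  qed
qed

lemma Qt_zero: "Qt (\<lambda>_. 0) \<tau> = basis {#\<tau>#}"
proof (induction \<tau>)
  case (Node a f)
  have "Qf (\<lambda>_. 0) f = (\<Prod>\<^sub># (image_mset (\<lambda>\<tau>. basis {#\<tau>#}) f) :: 'a hopf)"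
    unfolding Qf_def by (rule arg_cong[where f = prod_mset], rule image_mset_cong) (rule Node)
  also have "\<dots> = basis f"
  proof (induction f)
    case (add t f)
    have "basis (add_mset t f) = basis {#t#} * (basis f :: 'a hopf)"
      by (simp add: mult_single)
    then show ?case by (simp only: add image_mset_add_mset prod_mset.add_mset)
  qed simp
  finally show ?case by (simp add: Qt_Node)
qed

lemma prod_mset_basis: "\<Prod>\<^sub># (image_mset (\<lambda>\<tau>. basis {#\<tau>#}) f) = (basis f :: 'd hopf)"
proof (induction f)
  case (add t f)
  have "basis (add_mset t f) = basis {#t#} * (basis f :: 'd hopf)"
    by (simp add: mult_single)
  then show ?case by (simp only: add image_mset_add_mset prod_mset.add_mset)
qed simp

lemma Qf_zero: "Qf (\<lambda>_. 0) f = basis f"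
  unfolding Qf_def Qt_zero by (rule prod_mset_basis)

lemma convolve_counit:
  fixes y :: "'d hopf \<Rightarrow> real"
  assumes "y \<in> characters"
  shows "convolve counit y = y"
proof
  fix h :: "'d hopf"
  have "Qh (\<lambda>_. 0) h = h"
    by (rule linear_eq_on_basis[OF linear_Qh linear_ident]) (simp add: Qf_zero)
  then show "convolve counit y h = y h"
    using convolve_Qh[OF evc_character character_linear[OF assms], of "\<lambda>_. 0" h]
    by (simp only: counit_evc tr_evc)
qed

text \<open>
  For the left convolution inverse \<open>\<eta>\<close> of a character, the recursion computes \<open>(\<eta> \<otimes> id) \<Delta> \<tau>\<close>, on which the
  character has to vanish. The value of \<open>\<eta>\<close> on \<open>\<tau>\<close> is the coefficient of the empty forest.
\<close>

primrec inverse_tree :: "('d rtree \<Rightarrow> real) \<Rightarrow> 'd rtree \<Rightarrow> 'd hopf" where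
  "inverse_tree \<xi> (Node a f) = graft a (\<Prod>\<^sub># (image_mset (inverse_tree \<xi>) f))
     - evc \<xi> (graft a (\<Prod>\<^sub># (image_mset (inverse_tree \<xi>) f))) *\<^sub>R 1"

lemma inverse_tree_Qt: "Qt (\<lambda>\<tau>. counit (inverse_tree \<xi> \<tau>)) \<tau> = inverse_tree \<xi> \<tau>"
proof (induction \<tau>)
  case (Node a f)
  let ?\<eta> = "\<lambda>\<tau>. counit (inverse_tree \<xi> \<tau>)"
  have f: "Qf ?\<eta> f = \<Prod>\<^sub># (image_mset (inverse_tree \<xi>) f)"
    unfolding Qf_def by (rule arg_cong[where f = prod_mset], rule image_mset_cong) (rule Node)
  have "?\<eta> (Node a f) = - evc \<xi> (graft a (\<Prod>\<^sub># (image_mset (inverse_tree \<xi>) f)))"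
    by (simp add: counit_def lookup_minus lookup_scaleR' lookup_graft_size)
  then show ?case unfolding Qt_Node f by simp
qed

lemma convolve_inverse:
  assumes "x \<in> characters"
  shows "\<exists>y\<in>characters. convolve y x = counit"
proof -
  let ?\<eta> = "\<lambda>\<tau>. counit (inverse_tree (tr x) \<tau>)"
  have "tr (convolve (evc ?\<eta>) x) \<tau> = 0" for \<tau>
  proof -
    have "tr (convolve (evc ?\<eta>) x) \<tau> = x (inverse_tree (tr x) \<tau>)"
      unfolding convolve_Qh[OF evc_character character_linear[OF assms]] tr_evc
      by (simp add: inverse_tree_Qt)
    also have "\<dots> = 0"
      using character_linear[OF assms] character_oneD[OF assms]
      by (cases \<tau>) (simp add: linear_diff linear_scale character_evc[OF assms, symmetric])
    finally show ?thesis .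
  qed
  then have "convolve (evc ?\<eta>) x = evc (\<lambda>_. 0)"
    by (subst character_evc[OF convolve_character[OF evc_character assms]]) simp
  then show ?thesis using evc_character counit_evc by metis
qed

lemma convolve_inverse_right:
  assumes "x \<in> characters" "y \<in> characters" "convolve y x = counit"
  shows "convolve x y = counit"
proof -
  obtain z where z: "z \<in> characters" "convolve z y = counit"
    using convolve_inverse[OF assms(2)] by blast
  have "convolve x y = convolve (convolve z y) (convolve x y)"
    by (simp only: z(2) convolve_counit convolve_character assms(1,2))
  also have "\<dots> = convolve z (convolve (convolve y x) y)"
    by (simp only: convolve_assoc convolve_character assms(1,2) z(1))
  also have "\<dots> = counit"
    unfolding assms(3) convolve_counit[OF assms(2)] z(2) ..
  finally show ?thesis .
qed

section \<open>The truncated group and the increments of a rough path\<close>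

lemma verts_add: "verts (f + g) = verts f + verts g"
  by (simp add: verts_def)

lemma verts_empty [simp]: "verts {#} = 0"
  by (simp add: verts_def)

lemma verts_single: "verts {#t#} = tree_verts t"
  by (simp add: verts_def)

lemma verts_add_mset: "verts (add_mset t f) = tree_verts t + verts f"
  by (simp add: verts_def)

lemma tree_verts_Node: "tree_verts (Node a f) = Suc (verts f)"
  by (simp add: verts_def)

declare tree_verts.simps [simp del]
declare tree_verts_Node [simp]

lemma tree_verts_le: "t \<in># f \<Longrightarrow> tree_verts t \<le> verts f"
  by (metis insert_DiffM le_add1 verts_add_mset)

lemma tree_verts_pos: "tree_verts t > 0"
  by (cases t) simp

lemma keys_prod_mset_verts:
  fixes G :: "'d rtree \<Rightarrow> 'd hopf"
  assumes "\<And>t h. t \<in># f \<Longrightarrow> h \<in> Poly_Mapping.keys (G t) \<Longrightarrow> verts h \<le> tree_verts t"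
    and "h \<in> Poly_Mapping.keys (\<Prod>\<^sub># (image_mset G f))"
  shows "verts h \<le> verts f"
  using assms
proof (induction f arbitrary: h)
  case empty
  then show ?case by (auto simp: in_keys_iff lookup_one split: if_splits)
next
  case (add t f)
  have "h \<in> Poly_Mapping.keys (G t * \<Prod>\<^sub># (image_mset G f))" using add.prems(2) by simp
  then obtain h1 h2 where h: "h = h1 + h2" "h1 \<in> Poly_Mapping.keys (G t)"
      "h2 \<in> Poly_Mapping.keys (\<Prod>\<^sub># (image_mset G f))"
    using keys_mult[of "G t" "\<Prod>\<^sub># (image_mset G f)"] by blast
  then show ?case using add.IH[of h2] add.prems(1) by (fastforce simp: verts_add verts_add_mset)
qed

text \<open>
  The coproduct does not increase the number of vertices, which is why truncation at \<open>N\<close> is compatible with the group operations.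
\<close>

lemma keys_Qt: "h \<in> Poly_Mapping.keys (Qt \<xi> \<tau>) \<Longrightarrow> verts h \<le> tree_verts \<tau>"
proof (induction \<tau> arbitrary: h)
  case (Node a f)
  show ?case
  proof (cases "h = {#}")
    case False
    then have "Poly_Mapping.lookup (graft a (Qf \<xi> f)) h \<noteq> 0"
      using Node.prems by (auto simp: in_keys_iff Qt_Node lookup_add lookup_scaleR' lookup_one)
    then obtain b g where h: "h = {#Node b g#}"
      by (metis lookup_graft_size rtree.exhaust size_1_singleton_mset)
    with \<open>Poly_Mapping.lookup (graft a (Qf \<xi> f)) h \<noteq> 0\<close> have "g \<in> Poly_Mapping.keys (Qf \<xi> f)"
      by (auto simp: lookup_graft_Node in_keys_iff split: if_splits)
    then have "verts g \<le> verts f"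
      unfolding Qf_def by (rule keys_prod_mset_verts[rotated]) (use Node.IH in auto)
    then show ?thesis using h by (simp add: verts_single)
  qed simp
qed

lemma keys_Qf: "h \<in> Poly_Mapping.keys (Qf \<xi> f) \<Longrightarrow> verts h \<le> verts f"
  unfolding Qf_def by (rule keys_prod_mset_verts[rotated]) (use keys_Qt in auto)

lemma Qt_cong:
  assumes "\<And>\<sigma>. tree_verts \<sigma> \<le> tree_verts \<tau> \<Longrightarrow> \<xi> \<sigma> = \<eta> \<sigma>"
  shows "Qt \<xi> \<tau> = Qt \<eta> \<tau>"
  using assms
proof (induction \<tau>)
  case (Node a f)
  have "Qf \<xi> f = Qf \<eta> f"
    unfolding Qf_def
  proof (rule arg_cong[where f = prod_mset], rule image_mset_cong)
    fix t assume t: "t \<in># f"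
    show "Qt \<xi> t = Qt \<eta> t"
      by (rule Node.IH[OF t]) (use tree_verts_le[OF t] Node.prems in auto)
  qed
  then show ?case using Node.prems by (simp add: Qt_Node)
qed

lemma Qf_cong:
  assumes "\<And>\<sigma>. tree_verts \<sigma> \<le> verts f \<Longrightarrow> \<xi> \<sigma> = \<eta> \<sigma>"
  shows "Qf \<xi> f = Qf \<eta> f"
  unfolding Qf_def
proof (rule arg_cong[where f = prod_mset], rule image_mset_cong)
  fix t assume t: "t \<in># f"
  show "Qt \<xi> t = Qt \<eta> t"
    by (rule Qt_cong) (use tree_verts_le[OF t] assms in auto)
qed

lemma forests_upto_iff [simp]: "f \<in> forests_upto (int N) \<longleftrightarrow> verts f \<le> N"
  by (simp add: forests_upto_def)

lemma convolve_agree: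
  assumes "(x, x') \<in> agree_upto N" "(y, y') \<in> agree_upto N"
  shows "(convolve x y, convolve x' y') \<in> agree_upto N"
proof -
  have c: "x \<in> characters" "x' \<in> characters" "y \<in> characters" "y' \<in> characters"
    and ag: "\<And>f. verts f \<le> N \<Longrightarrow> x (basis f) = x' (basis f)" "\<And>f. verts f \<le> N \<Longrightarrow> y (basis f) = y' (basis f)"
    using assms by (auto simp: agree_upto_def)
  have "convolve x y (basis f) = convolve x' y' (basis f)" if f: "verts f \<le> N" for f
  proof -
    have "Qf (tr x) f = Qf (tr x') f"
      by (rule Qf_cong) (use f ag(1) in \<open>auto simp: verts_single\<close>)
    moreover have "y (Qf (tr x') f) = y' (Qf (tr x') f)"
      by (rule linear_eq_on_basis[OF character_linear[OF c(3)] character_linear[OF c(4)]])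
        (use keys_Qf f ag(2) le_trans in blast)
    ultimately show ?thesis
      using convolve_Qh[OF c(1) character_linear[OF c(3)], of "basis f"]
        convolve_Qh[OF c(2) character_linear[OF c(4)], of "basis f"] by simp
  qed
  then show ?thesis using c by (auto simp: agree_upto_def convolve_character)
qed

lemma equiv_agree: "equiv characters (agree_upto N)"
  by (rule equivI) (auto simp: agree_upto_def refl_on_def sym_def trans_def)

lemma agree_refl: "x \<in> characters \<Longrightarrow> (x, x) \<in> agree_upto N"
  by (auto simp: agree_upto_def)

text \<open>
  The union that defines the product of classes ranges over equal classes.
\<close>

lemma mult_class:
  assumes "x \<in> characters" "y \<in> characters"
  shows "agree_upto N `` {x} \<otimes>\<^bsub>trunc_group N\<^esub> agree_upto N `` {y} = agree_upto N `` {convolve x y}"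
proof -
  let ?A = "agree_upto N `` {x}" and ?B = "agree_upto N `` {y}" and ?C = "agree_upto N `` {convolve x y}"
  have eq: "agree_upto N `` {convolve x' y'} = ?C" if "x' \<in> ?A" "y' \<in> ?B" for x' y'
    by (rule equiv_class_eq[OF equiv_agree convolve_agree, symmetric]) (use that in auto)
  have "x \<in> ?A" "y \<in> ?B"
    using assms agree_refl by auto
  then have "(\<Union>x'\<in>?A. \<Union>y'\<in>?B. agree_upto N `` {convolve x' y'}) = ?C"
    using eq by (metis (no_types, lifting) SUP_eq_const empty_iff)
  then show ?thesis by (simp add: trunc_group_def)
qed

lemma counit_character: "counit \<in> characters"
  unfolding counit_evc by (rule evc_character)

lemma group_trunc_group: "group (trunc_group N :: ('d hopf \<Rightarrow> real) set monoid)"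
proof -
  let ?c = "\<lambda>x :: 'd hopf \<Rightarrow> real. agree_upto N `` {x}"
  have car: "A \<in> carrier (trunc_group N) \<longleftrightarrow> (\<exists>x\<in>characters. A = ?c x)" for A :: "('d hopf \<Rightarrow> real) set"
    by (auto simp: trunc_group_def quotient_def)
  have one: "\<one>\<^bsub>trunc_group N :: ('d hopf \<Rightarrow> real) set monoid\<^esub> = ?c counit" by (simp add: trunc_group_def)
  show ?thesis
  proof (rule groupI)
    fix A B C :: "('d hopf \<Rightarrow> real) set"
    assume "A \<in> carrier (trunc_group N)" "B \<in> carrier (trunc_group N)"
    then obtain x y where xy: "x \<in> characters" "A = ?c x" "y \<in> characters" "B = ?c y"
      by (auto simp: car)
    show "A \<otimes>\<^bsub>trunc_group N\<^esub> B \<in> carrier (trunc_group N)"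
      unfolding xy mult_class[OF xy(1,3)] car using convolve_character[OF xy(1,3)] by blast
    assume "C \<in> carrier (trunc_group N)"
    then obtain z where z: "z \<in> characters" "C = ?c z" by (auto simp: car)
    show "A \<otimes>\<^bsub>trunc_group N\<^esub> B \<otimes>\<^bsub>trunc_group N\<^esub> C = A \<otimes>\<^bsub>trunc_group N\<^esub> (B \<otimes>\<^bsub>trunc_group N\<^esub> C)"
      by (simp only: xy(2,4) z(2) mult_class xy(1,3) z(1) convolve_character convolve_assoc)
  next
    show "\<one>\<^bsub>trunc_group N\<^esub> \<in> carrier (trunc_group N :: ('d hopf \<Rightarrow> real) set monoid)"
      unfolding one car using counit_character by blast
  next
    fix A :: "('d hopf \<Rightarrow> real) set" assume "A \<in> carrier (trunc_group N)"
    then obtain x where x: "x \<in> characters" "A = ?c x" by (auto simp: car)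
    show "\<one>\<^bsub>trunc_group N\<^esub> \<otimes>\<^bsub>trunc_group N\<^esub> A = A"
      by (simp only: one x mult_class counit_character convolve_counit)
    obtain y where y: "y \<in> characters" "convolve y x = counit" using convolve_inverse[OF x(1)] by blast
    have "?c y \<otimes>\<^bsub>trunc_group N\<^esub> A = \<one>\<^bsub>trunc_group N\<^esub>"
      by (simp only: one x(2) mult_class y x(1))
    then show "\<exists>B\<in>carrier (trunc_group N). B \<otimes>\<^bsub>trunc_group N\<^esub> A = \<one>\<^bsub>trunc_group N\<^esub>"
      using y(1) car by blast
  qed
qed

lemma class_eval_class:
  assumes "x \<in> characters" "verts f \<le> N"
  shows "class_eval (agree_upto N `` {x}) (basis f) = x (basis f)"
proof -
  have "(\<lambda>y. y (basis f)) ` (agree_upto N `` {x}) = {x (basis f)}"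
    using assms agree_refl[OF assms(1), of N] by (auto simp: agree_upto_def)
  then show ?thesis by (simp add: class_eval_def)
qed

text \<open>
  Representing characters \<open>x t\<close> of the classes \<open>X t\<close> can be chosen once for all times, together with
  inverses. The increments \<open>inv (x s) \<star> x t\<close> then satisfy Chen's relation exactly and on all trees, although \<open>X\<close> determines
  them only up to \<open>N\<close> vertices.
\<close>

theorem increment_characters:
  fixes X :: "real \<Rightarrow> ('d hopf \<Rightarrow> real) set"
  assumes "\<And>t. t \<in> J \<Longrightarrow> X t \<in> carrier (trunc_group N)"
  obtains \<xi> :: "real \<Rightarrow> real \<Rightarrow> 'd rtree \<Rightarrow> real" where
    "\<And>s t f. s \<in> J \<Longrightarrow> t \<in> J \<Longrightarrow> verts f \<le> N \<Longrightarrow> increment N X s t (basis f) = evc (\<xi> s t) (basis f)"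
    "\<And>s u t \<tau>. s \<in> J \<Longrightarrow> u \<in> J \<Longrightarrow> t \<in> J \<Longrightarrow> \<xi> s t \<tau> = evc (\<xi> u t) (Qt (\<xi> s u) \<tau>)"
    "\<And>s \<tau>. s \<in> J \<Longrightarrow> \<xi> s s \<tau> = 0"
proof -
  let ?c = "\<lambda>x. agree_upto N `` {x}"
  have "\<exists>x. x \<in> characters \<and> X t = ?c x" if "t \<in> J" for t
    using assms[OF that] by (auto simp: trunc_group_def quotient_def)
  then obtain x where x: "\<And>t. t \<in> J \<Longrightarrow> x t \<in> characters" "\<And>t. t \<in> J \<Longrightarrow> X t = ?c (x t)"
    by metis
  have "\<exists>w. w \<in> characters \<and> convolve w (x t) = counit" if "t \<in> J" for t
    using convolve_inverse[OF x(1)[OF that]] by blast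
  then obtain w where w: "\<And>t. t \<in> J \<Longrightarrow> w t \<in> characters" "\<And>t. t \<in> J \<Longrightarrow> convolve (w t) (x t) = counit"
    by metis
  let ?z = "\<lambda>s t. convolve (w s) (x t)"
  have z: "?z s t \<in> characters" if "s \<in> J" "t \<in> J" for s t
    using that x w convolve_character by blast
  have inv: "inv\<^bsub>trunc_group N\<^esub> (X s) = ?c (w s)" if "s \<in> J" for s
  proof (rule group.inv_equality[OF group_trunc_group])
    show "?c (w s) \<otimes>\<^bsub>trunc_group N\<^esub> X s = \<one>\<^bsub>trunc_group N\<^esub>"
      by (simp only: x(2) that mult_class w x(1)) (simp add: trunc_group_def)
  qed (use that assms w in \<open>auto simp: trunc_group_def quotient_def\<close>)
  have 1: "increment N X s t (basis f) = evc (tr (?z s t)) (basis f)" if "s \<in> J" "t \<in> J" "verts f \<le> N" for s t f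
  proof -
    have "increment N X s t (basis f) = ?z s t (basis f)"
      unfolding increment_def inv[OF that(1)] x(2)[OF that(2)] mult_class[OF w(1)[OF that(1)] x(1)[OF that(2)]]
      by (rule class_eval_class[OF z that(3)]) fact+
    then show ?thesis using character_evc[OF z[OF that(1,2)]] by metis
  qed
  have 2: "tr (?z s t) \<tau> = evc (tr (?z u t)) (Qt (tr (?z s u)) \<tau>)" if "s \<in> J" "u \<in> J" "t \<in> J" for s u t \<tau>
  proof -
    note c = x(1)[OF that(1)] x(1)[OF that(2)] x(1)[OF that(3)] w(1)[OF that(1)] w(1)[OF that(2)] w(1)[OF that(3)]
    have "convolve (?z s u) (?z u t) = convolve (w s) (convolve (convolve (x u) (w u)) (x t))"
      by (simp only: c convolve_assoc convolve_character)
    also have "\<dots> = ?z s t"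
      by (simp only: c convolve_inverse_right[OF c(2,5) w(2)[OF that(2)]] convolve_counit)
    finally have "tr (?z s t) \<tau> = convolve (?z s u) (?z u t) (basis {#\<tau>#})" by simp
    also have "\<dots> = ?z u t (Qt (tr (?z s u)) \<tau>)"
      using convolve_Qh[OF z[OF that(1,2)] character_linear[OF z[OF that(2,3)]]] by simp
    finally show ?thesis using character_evc[OF z[OF that(2,3)]] by metis
  qed
  have 3: "tr (?z s s) \<tau> = 0" if "s \<in> J" for s \<tau>
    using w(2)[OF that] by (simp add: counit_evc evc_basis)
  show ?thesis by (rule that[of "\<lambda>s t. tr (?z s t)", OF 1 2 3])
qed

text \<open>
  The coproduct is graded; both statements are needed because the recursion passes through forests.
\<close>

lemma keys_tree_coproduct:
  "(g, h) \<in> Poly_Mapping.keys (tree_coproduct \<tau>) \<Longrightarrow> verts g + verts h = tree_verts \<tau>"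
  and keys_coproduct:
  "(g, h) \<in> Poly_Mapping.keys (coproduct (basis f)) \<Longrightarrow> verts g + verts h = verts f"
proof -
  have prod: "verts g + verts h = verts f"
    if "(g, h) \<in> Poly_Mapping.keys (\<Prod>\<^sub># (image_mset tree_coproduct f))"
      "\<And>t g h. t \<in># f \<Longrightarrow> (g, h) \<in> Poly_Mapping.keys (tree_coproduct t) \<Longrightarrow> verts g + verts h = tree_verts t"
    for f :: "'d forest" and g h
    using that
  proof (induction f arbitrary: g h)
    case empty
    then show ?case
      by (auto simp: in_keys_iff Poly_Mapping.lookup_one when_def zero_prod_def split: if_splits)
  next
    case (add t f)
    let ?P = "\<Prod>\<^sub># (image_mset tree_coproduct f)"
    have "(g, h) \<in> Poly_Mapping.keys (tree_coproduct t * ?P)" using add.prems(1) by simp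
    then obtain k l where kl: "(g, h) = k + l" "k \<in> Poly_Mapping.keys (tree_coproduct t)" "l \<in> Poly_Mapping.keys ?P"
      using keys_mult[of "tree_coproduct t" ?P] by blast
    obtain k1 k2 l1 l2 where k: "k = (k1, k2)" "l = (l1, l2)" by (metis surj_pair)
    have "verts l1 + verts l2 = verts f"
      by (rule add.IH) (use kl(3) k add.prems(2) in auto)
    moreover have "verts k1 + verts k2 = tree_verts t"
      by (rule add.prems(2)) (use kl(2) k in auto)
    moreover have "g = k1 + l1" "h = k2 + l2" using kl(1) k by auto
    ultimately show ?case by (simp add: verts_add verts_add_mset)
  qed
  have tree: "\<And>g h. (g, h) \<in> Poly_Mapping.keys (tree_coproduct \<tau>) \<Longrightarrow> verts g + verts h = tree_verts \<tau>"
    for \<tau> :: "'d rtree"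
  proof (induction \<tau>)
    case (Node a f)
    let ?P = "\<Prod>\<^sub># (image_mset tree_coproduct f)"
    have P: "verts g' + verts h' = verts f" if "(g', h') \<in> Poly_Mapping.keys ?P" for g' h'
      by (rule prod[OF that]) (use Node.IH in auto)
    have "Poly_Mapping.keys (id_tensor_graft a ?P) \<subseteq> (\<Union>(g', h')\<in>Poly_Mapping.keys ?P. {(g', {#Node a h'#})})"
      unfolding id_tensor_graft_def
      by (rule subset_trans[OF keys_sum]) (auto simp: in_keys_iff lookup_scaleR' lookup_single when_def split: if_splits)
    then have "Poly_Mapping.keys (tree_coproduct (Node a f))
        \<subseteq> insert ({#Node a f#}, {#}) (\<Union>(g', h')\<in>Poly_Mapping.keys ?P. {(g', {#Node a h'#})})"
      using Poly_Mapping.keys_add[of "basis ({#Node a f#}, {#})" "id_tensor_graft a ?P"] by auto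
    then show ?case using Node.prems P by (fastforce simp: verts_single)
  qed
  show "(g, h) \<in> Poly_Mapping.keys (tree_coproduct \<tau>) \<Longrightarrow> verts g + verts h = tree_verts \<tau>"
    by (rule tree)
  show "(g, h) \<in> Poly_Mapping.keys (coproduct (basis f)) \<Longrightarrow> verts g + verts h = verts f"
    unfolding coproduct_basis by (rule prod) (use tree in auto)
qed

lemma hinner_basis: "hinner (basis f) q = Poly_Mapping.lookup q f"
  by (simp add: hinner_def)

text \<open>
  The coefficients in the remainder of a controlled rough path are the coefficients of \<open>(x \<otimes> id) \<Delta>\<close>.
\<close>

lemma tensor_functional_Qf:
  assumes "\<And>f. verts f \<le> N \<Longrightarrow> x (basis f) = evc \<xi> (basis f)" "verts g \<le> N"
  shows "tensor_functional x (hinner (basis f)) (coproduct (basis g)) = Poly_Mapping.lookup (Qf \<xi> g) f"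
proof -
  have lin: "linear (hinner (basis f))"
    unfolding hinner_basis[abs_def] by (rule linear_lookup)
  have "tensor_functional x (hinner (basis f)) (coproduct (basis g))
      = tensor_functional (evc \<xi>) (hinner (basis f)) (coproduct (basis g))"
    unfolding tensor_functional_def
  proof (rule sum.cong[OF refl], clarify)
    fix k l assume "(k, l) \<in> Poly_Mapping.keys (coproduct (basis g))"
    then have "verts k \<le> N" using keys_coproduct[of k l g] assms(2) by simp
    then show "Poly_Mapping.lookup (coproduct (basis g)) (k, l) * (x (basis k) * hinner (basis f) (basis l))
        = Poly_Mapping.lookup (coproduct (basis g)) (k, l) * (evc \<xi> (basis k) * hinner (basis f) (basis l))"
      by (simp only: assms(1))
  qed
  also have "\<dots> = hinner (basis f) (Qh \<xi> (basis g))"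
    unfolding tensor_functional_eval_left[OF lin] eval_left_coproduct[OF evc_character] tr_evc ..
  finally show ?thesis by (simp add: hinner_basis)
qed

section \<open>Elementary differentials\<close>

text \<open>
  The total weight of the ordered tuples with product \<open>f\<close> in the composition formula.
\<close>

definition symw :: "'d forest \<Rightarrow> real" where
  "symw f = real (card {ts. mset ts = f}) / fact (size f)"

text \<open>
  The elementary differential of a tree: the Gubinelli derivative along it that a solution is forced to
  have. \<open>D k a\<close> stands for the \<open>k\<close>-th derivative of the component \<open>a\<close>.
\<close>

primrec cT :: "(nat \<Rightarrow> 'd \<Rightarrow> real \<Rightarrow> real) \<Rightarrow> real \<Rightarrow> 'd rtree \<Rightarrow> real" where
  "cT D y (Node a f) = symw f * D (size f) a y * \<Prod>\<^sub># (image_mset (cT D y) f)"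

text \<open>
  The same with the root split off; as a function of the forest it is the Gubinelli derivative of \<open>\<phi>\<^sub>a(Y)\<close>.
\<close>

definition cF :: "(nat \<Rightarrow> 'd \<Rightarrow> real \<Rightarrow> real) \<Rightarrow> real \<Rightarrow> 'd \<Rightarrow> 'd forest \<Rightarrow> real" where
  "cF D y a f = symw f * D (size f) a y * \<Prod>\<^sub># (image_mset (cT D y) f)"

lemma cT_Node [simp]: "cT D y (Node a f) = cF D y a f"
  by (simp add: cF_def)

declare cT.simps [simp del]

text \<open>
  \<open>\<Phi>\<^sub>a y\<close>, the composition of \<open>\<phi>\<^sub>a\<close> with a solution, as an element of the algebra.
\<close>

definition PhiH :: "(nat \<Rightarrow> 'd::finite \<Rightarrow> real \<Rightarrow> real) \<Rightarrow> nat \<Rightarrow> real \<Rightarrow> 'd \<Rightarrow> 'd hopf" where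
  "PhiH D N y a = (\<Sum>f\<in>forests_upto (int N - 1). cF D y a f *\<^sub>R basis f)"

text \<open>
  \<open>P y\<close>; its pairing with an increment is the Euler increment from \<open>y\<close>.
\<close>

definition PP :: "(nat \<Rightarrow> 'd::finite \<Rightarrow> real \<Rightarrow> real) \<Rightarrow> nat \<Rightarrow> real \<Rightarrow> 'd hopf" where
  "PP D N y = (\<Sum>a\<in>UNIV. graft a (PhiH D N y a))"

lemma forests_upto_less [simp]: "f \<in> forests_upto (int N - 1) \<longleftrightarrow> verts f < N"
  by (auto simp: forests_upto_def)

lemma finite_FN [simp]: "finite (forests_upto n :: 'd::finite forest set)"
  by (rule finite_forests_upto)

lemma finite_trees: "finite {\<tau> :: 'd::finite rtree. tree_verts \<tau> \<le> N}"
proof -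
  have "(\<lambda>\<tau>. {#\<tau>#}) ` {\<tau> :: 'd rtree. tree_verts \<tau> \<le> N} \<subseteq> {f. verts f \<le> N}"
    by (auto simp: verts_single)
  then have "finite ((\<lambda>\<tau>. {#\<tau>#}) ` {\<tau> :: 'd rtree. tree_verts \<tau> \<le> N})"
    using finite_forests_nat finite_subset by blast
  then show ?thesis by (rule finite_imageD) (auto simp: inj_on_def)
qed

lemma sum_trees:
  fixes G :: "'d::finite rtree \<Rightarrow> 'c::comm_monoid_add"
  shows "(\<Sum>\<tau>\<in>{\<tau>. tree_verts \<tau> \<le> N}. G \<tau>) = (\<Sum>a\<in>UNIV. \<Sum>f\<in>forests_upto (int N - 1). G (Node a f))"
proof -
  have "(\<Sum>\<tau>\<in>{\<tau>. tree_verts \<tau> \<le> N}. G \<tau>)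
      = (\<Sum>(a, f)\<in>UNIV \<times> forests_upto (int N - 1). G (Node a f))"
  proof (rule sum.reindex_bij_witness[of _ "\<lambda>(a, f). Node a f" "\<lambda>\<tau>. case \<tau> of Node a f \<Rightarrow> (a, f)"])
  qed (auto split: rtree.splits)
  then show ?thesis by (simp add: sum.cartesian_product)
qed

lemma PP_trees: "PP D N y = (\<Sum>\<tau>\<in>{\<tau>. tree_verts \<tau> \<le> N}. cT D y \<tau> *\<^sub>R basis {#\<tau>#})"
  unfolding sum_trees PP_def PhiH_def
  by (simp add: linear_sum[OF linear_graft] linear_scale[OF linear_graft])

lemma evc_PP: "evc \<xi> (PP D N y) = (\<Sum>\<tau>\<in>{\<tau>. tree_verts \<tau> \<le> N}. cT D y \<tau> * \<xi> \<tau>)"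
  unfolding PP_trees by (simp add: linear_sum[OF linear_evc] linear_scale[OF linear_evc] evc_basis)

text \<open>
  Powers of \<open>P y\<close> are expanded over ordered tuples, which produces the weights \<open>symw\<close>.
\<close>

definition lists_of :: "'a set \<Rightarrow> nat \<Rightarrow> 'a list set" where
  "lists_of A j = {ts. set ts \<subseteq> A \<and> length ts = j}"

lemma finite_lists_of: "finite A \<Longrightarrow> finite (lists_of A j)"
  unfolding lists_of_def by (rule finite_lists_length_eq)

lemma PP_power:
  fixes D :: "nat \<Rightarrow> 'd::finite \<Rightarrow> real \<Rightarrow> real"
  shows "PP D N y ^ j = (\<Sum>ts\<in>lists_of {\<tau>. tree_verts \<tau> \<le> N} j. \<Prod>\<^sub># (image_mset (cT D y) (mset ts)) *\<^sub>R basis (mset ts))"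
proof (induction j)
  case 0
  have "lists_of {\<tau> :: 'd rtree. tree_verts \<tau> \<le> N} 0 = {[]}" by (auto simp: lists_of_def)
  then show ?case by simp
next
  case (Suc j)
  let ?T = "{\<tau> :: 'd rtree. tree_verts \<tau> \<le> N}"
  let ?G = "\<lambda>ts. \<Prod>\<^sub># (image_mset (cT D y) (mset ts)) *\<^sub>R (basis (mset ts) :: 'd hopf)"
  have "PP D N y ^ Suc j = (\<Sum>\<tau>\<in>?T. cT D y \<tau> *\<^sub>R basis {#\<tau>#}) * (\<Sum>ts\<in>lists_of ?T j. ?G ts)"
    unfolding power_Suc Suc.IH by (subst PP_trees) (rule refl)
  also have "\<dots> = (\<Sum>\<tau>\<in>?T. \<Sum>ts\<in>lists_of ?T j. ?G (\<tau> # ts))"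
    unfolding sum_product
  proof (intro sum.cong refl)
    fix \<tau> and ts :: "'d rtree list"
    have "basis (mset (\<tau> # ts)) = basis {#\<tau>#} * (basis (mset ts) :: 'd hopf)"
      by (simp add: mult_single)
    then show "cT D y \<tau> *\<^sub>R basis {#\<tau>#} * ?G ts = ?G (\<tau> # ts)"
      by (simp only: pm_scaleR_left pm_scaleR_right scaleR_scaleR mset.simps image_mset_add_mset prod_mset.add_mset mult.commute)
  qed
  also have "\<dots> = (\<Sum>(\<tau>, ts)\<in>?T \<times> lists_of ?T j. ?G (\<tau> # ts))"
    by (rule sum.cartesian_product)
  also have "\<dots> = (\<Sum>ts\<in>lists_of ?T (Suc j). ?G ts)"
    by (rule sum.reindex_bij_witness[of _ "\<lambda>ts. (hd ts, tl ts)" "\<lambda>(\<tau>, ts). \<tau> # ts"])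
      (auto simp: lists_of_def length_Suc_conv)
  finally show ?case .
qed

text \<open>
  The terms of the series \<open>(\<Sum>j<N. D j a y / j! *\<^sub>R P y ^ j)\<close> that have too many vertices for \<open>\<Phi>\<^sub>a y\<close>. They are all of order \<open>N\<close>.
\<close>

definition overflow :: "nat \<Rightarrow> 'd rtree list set" where
  "overflow N = {ts. set ts \<subseteq> {\<tau>. tree_verts \<tau> \<le> N} \<and> length ts < N \<and> N \<le> verts (mset ts)}"

lemma finite_overflow: "finite (overflow N :: 'd::finite rtree list set)"
proof -
  have "overflow N \<subseteq> (\<Union>j<N. lists_of {\<tau> :: 'd rtree. tree_verts \<tau> \<le> N} j)"
    by (auto simp: overflow_def lists_of_def)
  moreover have "finite (\<Union>j<N. lists_of {\<tau> :: 'd rtree. tree_verts \<tau> \<le> N} j)"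
    using finite_lists_of[OF finite_trees] by blast
  ultimately show ?thesis by (rule finite_subset)
qed

text \<open>
  The multinomial formula: summing the weights over ordered tuples gives the exponential series, up
  to terms with at least \<open>N\<close> vertices. Only this form of \<open>\<Phi>\<^sub>a\<close> interacts well with algebra morphisms.
\<close>

lemma Phi_as_series:
  fixes D :: "nat \<Rightarrow> 'd::finite \<Rightarrow> real \<Rightarrow> real"
  shows "PhiH D N y a = (\<Sum>j<N. (D j a y / fact j) *\<^sub>R PP D N y ^ j)
    - (\<Sum>ts\<in>overflow N. (D (length ts) a y / fact (length ts) * \<Prod>\<^sub># (image_mset (cT D y) (mset ts))) *\<^sub>R basis (mset ts))"
proof -
  let ?T = "{\<tau> :: 'd rtree. tree_verts \<tau> \<le> N}"
  let ?G = "\<lambda>ts. (D (length ts) a y / fact (length ts) * \<Prod>\<^sub># (image_mset (cT D y) (mset ts))) *\<^sub>R (basis (mset ts) :: 'd hopf)"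
  let ?F = "forests_upto (int N - 1) :: 'd forest set"
  have fp: "finite {ts. mset ts = f}" for f :: "'d forest"
  proof -
    obtain ts0 where "mset ts0 = f" using ex_mset by blast
    then show ?thesis using mset_eq_finite[of ts0] by (simp add: eq_commute)
  qed
  have small: "set ts \<subseteq> ?T \<and> length ts < N" if "verts (mset ts) < N" for ts
  proof
    show "set ts \<subseteq> ?T" using tree_verts_le[of _ "mset ts"] that by fastforce
    show "length ts < N" using verts_ge_size[of "mset ts"] that by simp
  qed
  have "PhiH D N y a = (\<Sum>f\<in>?F. \<Sum>ts\<in>{ts. mset ts = f}. ?G ts)"
    unfolding PhiH_def
  proof (rule sum.cong[OF refl])
    fix f :: "'d forest"
    have "(\<Sum>ts\<in>{ts. mset ts = f}. ?G ts)
        = (\<Sum>ts\<in>{ts. mset ts = f}. (D (size f) a y / fact (size f) * \<Prod>\<^sub># (image_mset (cT D y) f)) *\<^sub>R basis f)"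
      by (rule sum.cong) auto
    also have "\<dots> = cF D y a f *\<^sub>R basis f"
      unfolding sum_constant_scaleR cF_def symw_def scaleR_scaleR
      by (rule arg_cong[where f = "\<lambda>c. c *\<^sub>R basis f"]) simp
    finally show "cF D y a f *\<^sub>R basis f = (\<Sum>ts\<in>{ts. mset ts = f}. ?G ts)" ..
  qed
  also have "\<dots> = (\<Sum>ts\<in>(\<Union>f\<in>?F. {ts. mset ts = f}). ?G ts)"
    by (rule sum.UNION_disjoint[symmetric]) (auto simp: fp)
  also have "(\<Union>f\<in>?F. {ts. mset ts = f}) = {ts. verts (mset ts) < N}" by auto
  finally have 1: "PhiH D N y a = sum ?G {ts. verts (mset ts) < N}" .
  have "(\<Sum>j<N. (D j a y / fact j) *\<^sub>R PP D N y ^ j) = (\<Sum>j<N. \<Sum>ts\<in>lists_of ?T j. ?G ts)"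
  proof (rule sum.cong[OF refl])
    fix j
    show "(D j a y / fact j) *\<^sub>R PP D N y ^ j = (\<Sum>ts\<in>lists_of ?T j. ?G ts)"
      unfolding PP_power scaleR_sum_right by (rule sum.cong) (auto simp: lists_of_def)
  qed
  also have "\<dots> = sum ?G (\<Union>j<N. lists_of ?T j)"
    by (rule sum.UNION_disjoint[symmetric]) (use finite_lists_of[OF finite_trees] in \<open>auto simp: lists_of_def\<close>)
  also have "(\<Union>j<N. lists_of ?T j) = {ts. verts (mset ts) < N} \<union> overflow N"
    using small by (auto simp: lists_of_def overflow_def not_less)
  also have "sum ?G \<dots> = sum ?G {ts. verts (mset ts) < N} + sum ?G (overflow N)"
  proof (rule sum.union_disjoint)
    have "{ts. verts (mset ts) < N} \<subseteq> (\<Union>j<N. lists_of ?T j)"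
      using small by (auto simp: lists_of_def)
    moreover have "finite (\<Union>j<N. lists_of ?T j)" using finite_lists_of[OF finite_trees] by blast
    ultimately show "finite {ts :: 'd rtree list. verts (mset ts) < N}" by (rule finite_subset)
    show "finite (overflow N :: 'd rtree list set)" by (rule finite_overflow)
  qed (auto simp: overflow_def)
  finally show ?thesis using 1 by simp
qed

lemma finite_submultisets: "finite {g. g \<subseteq># (f :: 'a multiset)}"
proof (induction f)
  case (add t f)
  have "{g. g \<subseteq># add_mset t f} \<subseteq> {g. g \<subseteq># f} \<union> add_mset t ` {g. g \<subseteq># f}"
  proof
    fix g assume g: "g \<in> {g. g \<subseteq># add_mset t f}"
    show "g \<in> {g. g \<subseteq># f} \<union> add_mset t ` {g. g \<subseteq># f}"
    proof (cases "t \<in># g")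
      case True
      then obtain g' where "g = add_mset t g'" by (metis mset_add)
      then show ?thesis using g by auto
    next
      case False
      then have "count g x \<le> count f x" for x
        using g mset_subset_eq_count[of g "add_mset t f" x] by (cases "x = t") (auto simp: not_in_iff)
      then show ?thesis by (simp add: mset_subset_eqI)
    qed
  qed
  then show ?case using add by (meson finite_UnI finite_imageI finite_subset)
qed simp

lemma lookup_mult_hopf:
  "Poly_Mapping.lookup (p * q :: 'd hopf) h = (\<Sum>g | g \<subseteq># h. Poly_Mapping.lookup p g * Poly_Mapping.lookup q (h - g))"
proof (rule bilinear_eq_on_basis[of "\<lambda>p q. Poly_Mapping.lookup (p * q :: 'd hopf) h"
      "\<lambda>p q. \<Sum>g | g \<subseteq># h. Poly_Mapping.lookup p g * Poly_Mapping.lookup q (h - g)"])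
  show "Poly_Mapping.lookup (basis j * basis k :: 'd hopf) h
      = (\<Sum>g | g \<subseteq># h. Poly_Mapping.lookup (basis j) g * Poly_Mapping.lookup (basis k) (h - g))" for j k
  proof -
    have "(\<Sum>g | g \<subseteq># h. Poly_Mapping.lookup (basis j) g * Poly_Mapping.lookup (basis k) (h - g))
        = (\<Sum>g | g \<subseteq># h. if g = j then (if h = j + k then 1 else 0) else (0 :: real))"
      by (rule sum.cong) (auto simp: lookup_single when_def)
    also have "\<dots> = (if h = j + k then 1 else 0)"
      using finite_submultisets[of h] by (auto simp: sum.delta)
    finally show ?thesis by (auto simp: mult_single lookup_single when_def)
  qed
qed (rule linearI; simp add: lookup_add lookup_scaleR' pm_scaleR_left pm_scaleR_right ring_distribs sum.distrib sum_distrib_left mult.assoc mult.left_commute)+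

section \<open>Order calculus\<close>

text \<open>
  An element \<open>p\<close> of the index set \<open>P\<close> is a configuration (vector field, increments, base point) of
  size \<open>eps p\<close>, and \<open>S p\<close> is the set of admissible starting points. \<open>Ord n u\<close> says that \<open>u\<close> is
  \<open>O(eps ^ n)\<close> uniformly in the configuration, and that its Lipschitz constant in the starting point is of the
  same order. Both uses of the calculus come from one proof: for singletons \<open>S p\<close> the Lipschitz part is void
  and only sizes are estimated, and for an interval it yields the Lipschitz estimates needed for
  uniqueness.
\<close>

locale scale =
  fixes P :: "'p set" and S :: "'p \<Rightarrow> real set" and eps :: "'p \<Rightarrow> real" and E :: real
  assumes eps: "p \<in> P \<Longrightarrow> 0 \<le> eps p \<and> eps p \<le> E"
begin

definition Ord :: "nat \<Rightarrow> ('p \<Rightarrow> real \<Rightarrow> real) \<Rightarrow> bool" where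
  "Ord n u \<longleftrightarrow> (\<exists>C\<ge>0. \<forall>p\<in>P. (\<forall>y\<in>S p. \<bar>u p y\<bar> \<le> C * eps p ^ n) \<and>
     (\<forall>y\<in>S p. \<forall>z\<in>S p. \<bar>u p y - u p z\<bar> \<le> C * eps p ^ n * \<bar>y - z\<bar>))"

lemma OrdI:
  assumes "C \<ge> 0" "\<And>p y. p \<in> P \<Longrightarrow> y \<in> S p \<Longrightarrow> \<bar>u p y\<bar> \<le> C * eps p ^ n"
    "\<And>p y z. p \<in> P \<Longrightarrow> y \<in> S p \<Longrightarrow> z \<in> S p \<Longrightarrow> \<bar>u p y - u p z\<bar> \<le> C * eps p ^ n * \<bar>y - z\<bar>"
  shows "Ord n u"
  using assms unfolding Ord_def by blast

lemma OrdE: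
  assumes "Ord n u"
  obtains C where "C \<ge> 0" "\<And>p y. p \<in> P \<Longrightarrow> y \<in> S p \<Longrightarrow> \<bar>u p y\<bar> \<le> C * eps p ^ n"
    "\<And>p y z. p \<in> P \<Longrightarrow> y \<in> S p \<Longrightarrow> z \<in> S p \<Longrightarrow> \<bar>u p y - u p z\<bar> \<le> C * eps p ^ n * \<bar>y - z\<bar>"
  using assms unfolding Ord_def by blast

lemma Ord_cong:
  assumes "\<And>p y. p \<in> P \<Longrightarrow> y \<in> S p \<Longrightarrow> u p y = v p y" "Ord n v"
  shows "Ord n u"
proof -
  obtain C where C: "C \<ge> 0" "\<And>p y. p \<in> P \<Longrightarrow> y \<in> S p \<Longrightarrow> \<bar>v p y\<bar> \<le> C * eps p ^ n"
    "\<And>p y z. p \<in> P \<Longrightarrow> y \<in> S p \<Longrightarrow> z \<in> S p \<Longrightarrow> \<bar>v p y - v p z\<bar> \<le> C * eps p ^ n * \<bar>y - z\<bar>"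
    using OrdE[OF assms(2)] by blast
  show ?thesis by (rule OrdI[OF C(1)]) (use C assms(1) in auto)
qed

lemma Ord_mono:
  assumes "Ord n u" "m \<le> n"
  shows "Ord m u"
proof -
  obtain C where C: "C \<ge> 0" "\<And>p y. p \<in> P \<Longrightarrow> y \<in> S p \<Longrightarrow> \<bar>u p y\<bar> \<le> C * eps p ^ n"
    "\<And>p y z. p \<in> P \<Longrightarrow> y \<in> S p \<Longrightarrow> z \<in> S p \<Longrightarrow> \<bar>u p y - u p z\<bar> \<le> C * eps p ^ n * \<bar>y - z\<bar>"
    using OrdE[OF assms(1)] by blast
  let ?C = "C * \<bar>E\<bar> ^ (n - m)"
  have le: "C * eps p ^ n \<le> ?C * eps p ^ m" if "p \<in> P" for p
  proof -
    have "eps p ^ n = eps p ^ (n - m) * eps p ^ m" using assms(2) by (simp flip: power_add)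
    also have "\<dots> \<le> \<bar>E\<bar> ^ (n - m) * eps p ^ m"
      using eps[OF that] by (intro mult_right_mono power_mono) auto
    finally show ?thesis using C(1) mult_left_mono[of _ _ C] by (simp add: mult.assoc)
  qed
  show ?thesis
  proof (rule OrdI[of ?C])
    show "?C \<ge> 0" using C(1) by simp
    fix p y assume p: "p \<in> P" "y \<in> S p"
    show "\<bar>u p y\<bar> \<le> ?C * eps p ^ m" using C(2)[OF p] le[OF p(1)] by linarith
    fix z assume z: "z \<in> S p"
    show "\<bar>u p y - u p z\<bar> \<le> ?C * eps p ^ m * \<bar>y - z\<bar>"
      using C(3)[OF p z] mult_right_mono[OF le[OF p(1)], of "\<bar>y - z\<bar>"] by linarith
  qed
qed

lemma Ord_const: "Ord 0 (\<lambda>p y. c)"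
  by (rule OrdI[of "\<bar>c\<bar>"]) auto

lemma Ord_zero: "Ord n (\<lambda>p y. 0)"
  by (rule OrdI[of 0]) auto

lemma Ord_add:
  assumes "Ord n u" "Ord n v"
  shows "Ord n (\<lambda>p y. u p y + v p y)"
proof -
  obtain C where C: "C \<ge> 0" "\<And>p y. p \<in> P \<Longrightarrow> y \<in> S p \<Longrightarrow> \<bar>u p y\<bar> \<le> C * eps p ^ n"
    "\<And>p y z. p \<in> P \<Longrightarrow> y \<in> S p \<Longrightarrow> z \<in> S p \<Longrightarrow> \<bar>u p y - u p z\<bar> \<le> C * eps p ^ n * \<bar>y - z\<bar>"
    using OrdE[OF assms(1)] by blast
  obtain B where B: "B \<ge> 0" "\<And>p y. p \<in> P \<Longrightarrow> y \<in> S p \<Longrightarrow> \<bar>v p y\<bar> \<le> B * eps p ^ n"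
    "\<And>p y z. p \<in> P \<Longrightarrow> y \<in> S p \<Longrightarrow> z \<in> S p \<Longrightarrow> \<bar>v p y - v p z\<bar> \<le> B * eps p ^ n * \<bar>y - z\<bar>"
    using OrdE[OF assms(2)] by blast
  show ?thesis
  proof (rule OrdI[of "C + B"])
    fix p y assume p: "p \<in> P" "y \<in> S p"
    show "\<bar>u p y + v p y\<bar> \<le> (C + B) * eps p ^ n"
      using C(2)[OF p] B(2)[OF p] by (simp add: distrib_right)
    fix z assume z: "z \<in> S p"
    show "\<bar>u p y + v p y - (u p z + v p z)\<bar> \<le> (C + B) * eps p ^ n * \<bar>y - z\<bar>"
      using C(3)[OF p z] B(3)[OF p z] by (simp add: distrib_right)
  qed (use C B in auto)
qed

lemma Ord_mult:
  assumes "Ord n u" "Ord m v"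
  shows "Ord (n + m) (\<lambda>p y. u p y * v p y)"
proof -
  obtain C where C: "C \<ge> 0" "\<And>p y. p \<in> P \<Longrightarrow> y \<in> S p \<Longrightarrow> \<bar>u p y\<bar> \<le> C * eps p ^ n"
    "\<And>p y z. p \<in> P \<Longrightarrow> y \<in> S p \<Longrightarrow> z \<in> S p \<Longrightarrow> \<bar>u p y - u p z\<bar> \<le> C * eps p ^ n * \<bar>y - z\<bar>"
    using OrdE[OF assms(1)] by blast
  obtain B where B: "B \<ge> 0" "\<And>p y. p \<in> P \<Longrightarrow> y \<in> S p \<Longrightarrow> \<bar>v p y\<bar> \<le> B * eps p ^ m"
    "\<And>p y z. p \<in> P \<Longrightarrow> y \<in> S p \<Longrightarrow> z \<in> S p \<Longrightarrow> \<bar>v p y - v p z\<bar> \<le> B * eps p ^ m * \<bar>y - z\<bar>"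
    using OrdE[OF assms(2)] by blast
  show ?thesis
  proof (rule OrdI[of "2 * (C * B)"])
    fix p y assume p: "p \<in> P" "y \<in> S p"
    note e = eps[OF p(1)]
    have cn: "0 \<le> C * eps p ^ n" "0 \<le> B * eps p ^ m" using C B e by auto
    have prod: "\<bar>u p y * v p x\<bar> \<le> (C * B) * eps p ^ (n + m)" if "x \<in> S p" for x
      using mult_mono[OF C(2)[OF p] B(2)[OF p(1) that]] cn by (simp add: abs_mult power_add mult_ac)
    show "\<bar>u p y * v p y\<bar> \<le> 2 * (C * B) * eps p ^ (n + m)"
    proof -
      have "0 \<le> (C * B) * eps p ^ (n + m)" using C(1) B(1) e by simp
      then show ?thesis using prod[OF p(2)] unfolding mult.assoc[of 2] by linarith
    qed
    fix z assume z: "z \<in> S p"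
    have "u p y * v p y - u p z * v p z = u p y * (v p y - v p z) + (u p y - u p z) * v p z"
      by (simp add: algebra_simps)
    also have "\<bar>\<dots>\<bar> \<le> \<bar>u p y\<bar> * \<bar>v p y - v p z\<bar> + \<bar>u p y - u p z\<bar> * \<bar>v p z\<bar>"
      by (metis abs_mult abs_triangle_ineq)
    also have "\<dots> \<le> (C * eps p ^ n) * (B * eps p ^ m * \<bar>y - z\<bar>) + (C * eps p ^ n * \<bar>y - z\<bar>) * (B * eps p ^ m)"
      by (intro add_mono mult_mono C(2,3) B(2,3) p z) (use cn in auto)
    also have "\<dots> = 2 * (C * B) * eps p ^ (n + m) * \<bar>y - z\<bar>"
      by (simp add: power_add algebra_simps)
    finally show "\<bar>u p y * v p y - u p z * v p z\<bar> \<le> 2 * (C * B) * eps p ^ (n + m) * \<bar>y - z\<bar>" .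
  qed (use C B in auto)
qed

lemma Ord_mult_le:
  assumes "Ord n u" "Ord m v" "k \<le> n + m"
  shows "Ord k (\<lambda>p y. u p y * v p y)"
  using Ord_mono[OF Ord_mult[OF assms(1,2)] assms(3)] .

lemma Ord_cmult: "Ord n u \<Longrightarrow> Ord n (\<lambda>p y. c * u p y)"
  using Ord_mult[OF Ord_const[of c], of n u] by simp

lemma Ord_minus: "Ord n u \<Longrightarrow> Ord n (\<lambda>p y. - u p y)"
  using Ord_cmult[of n u "-1"] by simp

lemma Ord_diff: "Ord n u \<Longrightarrow> Ord n v \<Longrightarrow> Ord n (\<lambda>p y. u p y - v p y)"
  using Ord_add[OF _ Ord_minus, of n u v] by simp

lemma Ord_sum:
  assumes "\<And>i. i \<in> A \<Longrightarrow> Ord n (u i)"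
  shows "Ord n (\<lambda>p y. \<Sum>i\<in>A. u i p y)"
  using assms by (induction A rule: infinite_finite_induct) (auto intro: Ord_zero Ord_add)

lemma Ord_power: "Ord n u \<Longrightarrow> Ord (n * k) (\<lambda>p y. u p y ^ k)"
proof (induction k)
  case 0
  then show ?case using Ord_const[of 1] by simp
next
  case (Suc k)
  then show ?case using Ord_mult[of n u "n * k" "\<lambda>p y. u p y ^ k"] by simp
qed

text \<open>
  Products over forests, for elementary differentials.
\<close>

lemma Ord_prod_mset:
  assumes "\<And>t. t \<in># f \<Longrightarrow> Ord 0 (\<lambda>p y. g p y t)"
  shows "Ord 0 (\<lambda>p y. \<Prod>\<^sub># (image_mset (g p y) f))"
  using assms
proof (induction f)
  case empty
  then show ?case using Ord_const[of 1] by simp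
next
  case (add t f)
  then show ?case using Ord_mult[of 0 "\<lambda>p y. g p y t" 0 "\<lambda>p y. \<Prod>\<^sub># (image_mset (g p y) f)"] by simp
qed

text \<open>
  The order of an element of the algebra, where a vertex counts as one power of \<open>eps\<close>: the
  coefficient of \<open>h\<close> is of order \<open>n - verts h\<close>. With this grading multiplication adds orders and grafting
  raises the order by one. The subtraction is truncated, so forests with more than \<open>n\<close> vertices
  only need bounded coefficients.
\<close>

definition HOrd :: "nat \<Rightarrow> ('p \<Rightarrow> real \<Rightarrow> 'd hopf) \<Rightarrow> bool" where
  "HOrd n U \<longleftrightarrow> (\<forall>h. Ord (n - verts h) (\<lambda>p y. Poly_Mapping.lookup (U p y) h))"

lemma HOrdD: "HOrd n U \<Longrightarrow> Ord (n - verts h) (\<lambda>p y. Poly_Mapping.lookup (U p y) h)"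
  by (simp add: HOrd_def)

lemma HOrd_mono: "HOrd n U \<Longrightarrow> m \<le> n \<Longrightarrow> HOrd m U"
  unfolding HOrd_def by (meson Ord_mono diff_le_mono)

lemma HOrd_add: "HOrd n U \<Longrightarrow> HOrd n V \<Longrightarrow> HOrd n (\<lambda>p y. U p y + V p y)"
  unfolding HOrd_def lookup_add by (intro allI impI Ord_add) auto

lemma HOrd_diff: "HOrd n U \<Longrightarrow> HOrd n V \<Longrightarrow> HOrd n (\<lambda>p y. U p y - V p y)"
  unfolding HOrd_def lookup_minus by (intro allI impI Ord_diff) auto

lemma HOrd_sum: "(\<And>i. i \<in> A \<Longrightarrow> HOrd n (U i)) \<Longrightarrow> HOrd n (\<lambda>p y. \<Sum>i\<in>A. U i p y)"
  unfolding HOrd_def lookup_sum by (intro allI impI Ord_sum) auto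

lemma HOrd_scaleR:
  assumes "Ord n u" "HOrd m U" "k \<le> n + m"
  shows "HOrd k (\<lambda>p y. u p y *\<^sub>R U p y)"
  unfolding HOrd_def lookup_scaleR'
proof
  fix h
  show "Ord (k - verts h) (\<lambda>p y. u p y * Poly_Mapping.lookup (U p y) h)"
    by (rule Ord_mult_le[OF assms(1) HOrdD[OF assms(2)]]) (use assms(3) in arith)
qed

lemma HOrd_mult:
  assumes "HOrd n U" "HOrd m V"
  shows "HOrd (n + m) (\<lambda>p y. U p y * V p y)"
  unfolding HOrd_def lookup_mult_hopf
proof
  fix h
  show "Ord (n + m - verts h) (\<lambda>p y. \<Sum>g | g \<subseteq># h. Poly_Mapping.lookup (U p y) g * Poly_Mapping.lookup (V p y) (h - g))"
  proof (rule Ord_sum)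
    fix g assume "g \<in> {g. g \<subseteq># h}"
    then have "h = g + (h - g)" by simp
    then have "verts h = verts g + verts (h - g)" by (metis verts_add)
    then show "Ord (n + m - verts h) (\<lambda>p y. Poly_Mapping.lookup (U p y) g * Poly_Mapping.lookup (V p y) (h - g))"
      by (intro Ord_mult_le[OF HOrdD[OF assms(1)] HOrdD[OF assms(2)]]) arith
  qed
qed

lemma HOrd_mult_le: "HOrd n U \<Longrightarrow> HOrd m V \<Longrightarrow> k \<le> n + m \<Longrightarrow> HOrd k (\<lambda>p y. U p y * V p y)"
  using HOrd_mono[OF HOrd_mult] .

lemma HOrd_basis: "n \<le> verts f \<Longrightarrow> HOrd n (\<lambda>p y. basis f)"
  unfolding HOrd_def
proof
  fix h assume "n \<le> verts f"
  then show "Ord (n - verts h) (\<lambda>p y. Poly_Mapping.lookup (basis f) h)"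
    by (cases "h = f") (auto simp: lookup_single when_def intro: Ord_const Ord_zero)
qed

lemma HOrd_one: "HOrd 0 (\<lambda>p y. 1)"
  using HOrd_basis[of 0 "{#}"] by simp

lemma HOrd_power: "HOrd n U \<Longrightarrow> HOrd (n * k) (\<lambda>p y. U p y ^ k)"
proof (induction k)
  case 0
  then show ?case using HOrd_one by simp
next
  case (Suc k)
  then show ?case using HOrd_mult[of n U "n * k" "\<lambda>p y. U p y ^ k"] by simp
qed

lemma HOrd_prod_mset:
  assumes "\<And>t. t \<in># f \<Longrightarrow> HOrd (tree_verts t) (\<lambda>p y. g p y t)"
  shows "HOrd (verts f) (\<lambda>p y. \<Prod>\<^sub># (image_mset (g p y) f))"
  using assms
proof (induction f)
  case empty
  then show ?case using HOrd_one by simp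
next
  case (add t f)
  then show ?case
    using HOrd_mult[of "tree_verts t" "\<lambda>p y. g p y t" "verts f" "\<lambda>p y. \<Prod>\<^sub># (image_mset (g p y) f)"]
    by (simp add: verts_add_mset)
qed

text \<open>
  The gain of one order. The coefficient of the empty forest vanishes in a graft, so the new root can
  be charged.
\<close>

lemma HOrd_graft:
  assumes "HOrd n U"
  shows "HOrd (Suc n) (\<lambda>p y. graft a (U p y))"
  unfolding HOrd_def
proof
  fix h
  show "Ord (Suc n - verts h) (\<lambda>p y. Poly_Mapping.lookup (graft a (U p y)) h)"
  proof (cases "size h = 1")
    case True
    then obtain b g where "h = {#Node b g#}" by (metis rtree.exhaust size_1_singleton_mset)
    then show ?thesis
      using HOrdD[OF assms, of g] by (cases "a = b") (auto simp: lookup_graft_Node verts_single Ord_zero)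
  next
    case False
    then show ?thesis by (simp add: lookup_graft_size Ord_zero)
  qed
qed

text \<open>
  Telescoping \<open>u ^ (k + 1) - v ^ (k + 1) = u * (u ^ k - v ^ k) + (u - v) * v ^ k\<close>.
\<close>

lemma HOrd_power_diff:
  assumes "HOrd m (\<lambda>p y. U p y - V p y)" "HOrd 0 U" "HOrd 0 V"
  shows "HOrd m (\<lambda>p y. U p y ^ k - V p y ^ k)"
proof (induction k)
  case 0
  then show ?case by (simp add: HOrd_def Ord_zero)
next
  case (Suc k)
  have eq: "U p y ^ Suc k - V p y ^ Suc k = U p y * (U p y ^ k - V p y ^ k) + (U p y - V p y) * V p y ^ k" for p y
    by (simp add: algebra_simps)
  have "HOrd m (\<lambda>p y. U p y * (U p y ^ k - V p y ^ k))"
    by (rule HOrd_mult_le[OF assms(2) Suc]) simp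
  moreover have "HOrd m (\<lambda>p y. (U p y - V p y) * V p y ^ k)"
    using HOrd_mult_le[OF assms(1) HOrd_power[OF assms(3), of k], of m] by simp
  ultimately show ?case unfolding eq by (rule HOrd_add)
qed

lemma Ord_cT:
  assumes "\<And>k a. k < N \<Longrightarrow> Ord 0 (\<lambda>p y. D p k a (\<eta> p y))" "tree_verts \<tau> \<le> N"
  shows "Ord 0 (\<lambda>p y. cT (D p) (\<eta> p y) \<tau>)"
  using assms(2)
proof (induction \<tau>)
  case (Node a f)
  have 1: "Ord 0 (\<lambda>p y. \<Prod>\<^sub># (image_mset (cT (D p) (\<eta> p y)) f))"
  proof (rule Ord_prod_mset)
    fix t assume t: "t \<in># f"
    show "Ord 0 (\<lambda>p y. cT (D p) (\<eta> p y) t)"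
      by (rule Node.IH[OF t]) (use tree_verts_le[OF t] Node.prems in simp)
  qed
  have 2: "Ord 0 (\<lambda>p y. symw f * D p (size f) a (\<eta> p y))"
    by (rule Ord_cmult, rule assms(1)) (use verts_ge_size[of f] Node.prems in simp)
  show ?case
    unfolding cT_Node cF_def by (rule Ord_mult_le[OF 2 1]) simp
qed

lemma Ord_evc_PP_general:
  fixes D :: "'p \<Rightarrow> nat \<Rightarrow> 'd::finite \<Rightarrow> real \<Rightarrow> real"
  assumes "\<And>k a. k < N \<Longrightarrow> Ord 0 (\<lambda>p y. D p k a y)"
    and "\<And>\<tau>. tree_verts \<tau> \<le> N \<Longrightarrow> Ord (tree_verts \<tau>) (\<lambda>p y. \<xi> p \<tau>)"
  shows "Ord 1 (\<lambda>p y. evc (\<xi> p) (PP (D p) N y))"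
  unfolding evc_PP
proof (rule Ord_sum)
  fix \<tau> :: "'d rtree" assume "\<tau> \<in> {\<tau>. tree_verts \<tau> \<le> N}"
  then have t: "tree_verts \<tau> \<le> N" by simp
  have "Ord 0 (\<lambda>p y. cT (D p) y \<tau>)"
    by (rule Ord_cT[of N D "\<lambda>p y. y", OF assms(1) t])
  then show "Ord 1 (\<lambda>p y. cT (D p) y \<tau> * \<xi> p \<tau>)"
    by (rule Ord_mult_le[OF _ assms(2)[OF t]]) (use tree_verts_pos[of \<tau>] in simp)
qed

lemma HOrd_Qt_general:
  assumes "\<And>\<tau>. tree_verts \<tau> \<le> N \<Longrightarrow> Ord (tree_verts \<tau>) (\<lambda>p y. \<xi> p \<tau>)" "tree_verts \<tau> \<le> N"
  shows "HOrd (tree_verts \<tau>) (\<lambda>p y. Qt (\<xi> p) \<tau>)"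
  using assms(2)
proof (induction \<tau>)
  case (Node a f)
  have "HOrd (verts f) (\<lambda>p y. Qf (\<xi> p) f)"
    unfolding Qf_def
  proof (rule HOrd_prod_mset)
    fix t assume t: "t \<in># f"
    show "HOrd (tree_verts t) (\<lambda>p y. Qt (\<xi> p) t)"
      by (rule Node.IH[OF t]) (use tree_verts_le[OF t] Node.prems in simp)
  qed
  from HOrd_add[OF HOrd_scaleR[OF assms(1)[OF Node.prems] HOrd_one, of "tree_verts (Node a f)"], of "\<lambda>p y. graft a (Qf (\<xi> p) f)"] HOrd_graft[OF this, of a]
  show ?case unfolding Qt_Node by simp
qed

lemma HOrd_Qf_general:
  assumes "\<And>\<tau>. tree_verts \<tau> \<le> N \<Longrightarrow> Ord (tree_verts \<tau>) (\<lambda>p y. \<xi> p \<tau>)" "set_mset f \<subseteq> {\<tau>. tree_verts \<tau> \<le> N}"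
  shows "HOrd (verts f) (\<lambda>p y. Qf (\<xi> p) f)"
  unfolding Qf_def by (rule HOrd_prod_mset, rule HOrd_Qt_general[OF assms(1)]) (use assms(2) in auto)

lemma Ord_cF:
  assumes "\<And>k a. k < N \<Longrightarrow> Ord 0 (\<lambda>p y. D p k a (\<eta> p y))" "verts f < N"
  shows "Ord 0 (\<lambda>p y. cF (D p) (\<eta> p y) a f)"
  using Ord_cT[of N D \<eta> "Node a f", OF assms(1)] assms(2) by simp

lemma HOrd_Phi:
  assumes "\<And>k a. k < N \<Longrightarrow> Ord 0 (\<lambda>p y. D p k a (\<eta> p y))"
  shows "HOrd 0 (\<lambda>p y. PhiH (D p) N (\<eta> p y) a)"
  unfolding PhiH_def
  by (intro HOrd_sum HOrd_scaleR[OF Ord_cF[of N D \<eta>, OF assms] HOrd_basis[of 0]]) auto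

lemma HOrd_PP:
  assumes "\<And>k a. k < N \<Longrightarrow> Ord 0 (\<lambda>p y. D p k a (\<eta> p y))"
  shows "HOrd 1 (\<lambda>p y. PP (D p) N (\<eta> p y))"
  unfolding PP_def using HOrd_sum[OF HOrd_graft[OF HOrd_Phi[of N D \<eta>, OF assms]]] by simp

lemma HOrd_overflow:
  fixes D :: "'p \<Rightarrow> nat \<Rightarrow> 'd::finite \<Rightarrow> real \<Rightarrow> real" and G :: "'p \<Rightarrow> 'd rtree list \<Rightarrow> 'd hopf"
  assumes "\<And>k a. k < N \<Longrightarrow> Ord 0 (\<lambda>p y. D p k a (\<eta> p y))"
    and "\<And>ts. ts \<in> overflow N \<Longrightarrow> HOrd N (\<lambda>p y. G p ts)"
  shows "HOrd N (\<lambda>p y. \<Sum>ts\<in>overflow N. (D p (length ts) a (\<eta> p y) / fact (length ts)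
      * \<Prod>\<^sub># (image_mset (cT (D p) (\<eta> p y)) (mset ts))) *\<^sub>R G p ts)"
proof (rule HOrd_sum)
  fix ts :: "'d rtree list" assume ts: "ts \<in> overflow N"
  have "Ord 0 (\<lambda>p y. D p (length ts) a (\<eta> p y) / fact (length ts))"
    using Ord_cmult[OF assms(1), of "length ts" "1 / fact (length ts)" a] ts by (simp add: overflow_def)
  moreover have "Ord 0 (\<lambda>p y. \<Prod>\<^sub># (image_mset (cT (D p) (\<eta> p y)) (mset ts)))"
    by (rule Ord_prod_mset, rule Ord_cT[of N D \<eta>, OF assms(1)]) (use ts in \<open>auto simp: overflow_def\<close>)
  ultimately have "Ord 0 (\<lambda>p y. D p (length ts) a (\<eta> p y) / fact (length ts)
      * \<Prod>\<^sub># (image_mset (cT (D p) (\<eta> p y)) (mset ts)))"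
    by (rule Ord_mult_le) simp
  then show "HOrd N (\<lambda>p y. (D p (length ts) a (\<eta> p y) / fact (length ts)
      * \<Prod>\<^sub># (image_mset (cT (D p) (\<eta> p y)) (mset ts))) *\<^sub>R G p ts)"
    by (rule HOrd_scaleR[OF _ assms(2)[OF ts]]) simp
qed

end

lemma hopf_one_scaleR_power: "(c *\<^sub>R (1 :: 'd hopf)) ^ k = c ^ k *\<^sub>R 1"
  by (induction k) (simp_all add: pm_scaleR_left pm_scaleR_right)

lemma of_nat_hopf: "of_nat n * (p :: 'd hopf) = real n *\<^sub>R p"
  by (induction n) (simp_all add: distrib_right scaleR_add_left)

text \<open>
  Expanding the powers of \<open>c * 1 + W\<close> by the binomial theorem and collecting the powers of \<open>W\<close>: the
  coefficients become Taylor polynomials in \<open>c\<close>.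
\<close>

lemma shifted_series:
  fixes W :: "'d hopf" and d :: "nat \<Rightarrow> real"
  shows "(\<Sum>j<N. (d j / fact j) *\<^sub>R (c *\<^sub>R 1 + W) ^ j)
    = (\<Sum>k<N. ((\<Sum>i<N-k. d (k + i) * c ^ i / fact i) / fact k) *\<^sub>R W ^ k)"
proof -
  let ?g = "\<lambda>i k. (d (k + i) * c ^ i / fact i / fact k) *\<^sub>R W ^ k"
  have "(\<Sum>j<N. (d j / fact j) *\<^sub>R (c *\<^sub>R 1 + W) ^ j) = (\<Sum>j<N. \<Sum>i\<le>j. ?g i (j - i))"
  proof (rule sum.cong[OF refl])
    fix j
    have "(d j / fact j) *\<^sub>R (c *\<^sub>R 1 + W) ^ j
        = (\<Sum>i\<le>j. (d j / fact j) *\<^sub>R (of_nat (j choose i) * (c *\<^sub>R 1) ^ i * W ^ (j - i)))"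
      by (simp only: binomial_ring scaleR_sum_right)
    also have "\<dots> = (\<Sum>i\<le>j. ?g i (j - i))"
    proof (rule sum.cong[OF refl])
      fix i assume "i \<in> {..j}"
      then have i: "i \<le> j" by simp
      have "of_nat (j choose i) * (c *\<^sub>R 1) ^ i * W ^ (j - i) = (real (j choose i) * c ^ i) *\<^sub>R W ^ (j - i)"
        by (simp add: hopf_one_scaleR_power of_nat_hopf pm_scaleR_left)
      then show "(d j / fact j) *\<^sub>R (of_nat (j choose i) * (c *\<^sub>R 1) ^ i * W ^ (j - i)) = ?g i (j - i)"
        using i by (simp add: binomial_fact)
    qed
    finally show "(d j / fact j) *\<^sub>R (c *\<^sub>R 1 + W) ^ j = (\<Sum>i\<le>j. ?g i (j - i))" .
  qed
  also have "\<dots> = (\<Sum>(i, k)\<in>{(i, k). i + k < N}. ?g i k)"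
    by (rule sum.triangle_reindex[symmetric])
  also have "\<dots> = (\<Sum>(k, i)\<in>Sigma {..<N} (\<lambda>k. {..<N - k}). ?g i k)"
    by (rule sum.reindex_bij_witness[of _ "\<lambda>(k, i). (i, k)" "\<lambda>(i, k). (k, i)"]) auto
  also have "\<dots> = (\<Sum>k<N. \<Sum>i<N-k. ?g i k)"
    by (rule sum.Sigma[symmetric]) auto
  also have "\<dots> = (\<Sum>k<N. ((\<Sum>i<N-k. d (k + i) * c ^ i / fact i) / fact k) *\<^sub>R W ^ k)"
    by (simp add: scaleR_sum_left sum_divide_distrib)
  finally show ?thesis .
qed

lemma Qh_PP: "Qh \<zeta> (PP D' N y) = evc \<zeta> (PP D' N y) *\<^sub>R 1 + (\<Sum>a\<in>UNIV. graft a (Qh \<zeta> (PhiH D' N y a)))"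
  unfolding PP_def
  by (simp add: linear_sum[OF linear_Qh] linear_sum[OF linear_evc] Qh_graft sum.distrib scaleR_sum_left)

lemma Qh_Phi_series:
  "Qh \<zeta> (PhiH D' N y a) = (\<Sum>j<N. (D' j a y / fact j) *\<^sub>R Qh \<zeta> (PP D' N y) ^ j)
    - (\<Sum>ts\<in>overflow N. (D' (length ts) a y / fact (length ts) * \<Prod>\<^sub># (image_mset (cT D' y) (mset ts))) *\<^sub>R Qf \<zeta> (mset ts))"
proof -
  have pow: "Qh \<zeta> (p ^ j) = Qh \<zeta> p ^ j" for p j
    by (induction j) (simp_all add: Qh_mult)
  show ?thesis
    unfolding Phi_as_series[of D' N y a]
    by (simp add: linear_diff[OF linear_Qh] linear_sum[OF linear_Qh] linear_scale[OF linear_Qh] pow)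
qed

lemma lookup_Phi: "Poly_Mapping.lookup (PhiH D' N y a) h = (if verts h < N then cF D' y a h else 0)"
proof -
  have "Poly_Mapping.lookup (PhiH D' N y a) h = (\<Sum>f\<in>forests_upto (int N - 1). if f = h then cF D' y a f else 0)"
    unfolding PhiH_def lookup_sum by (rule sum.cong) (auto simp: lookup_scaleR' lookup_single when_def)
  then show ?thesis by simp
qed

lemma Qh_Phi: "Qh \<zeta> (PhiH D' N y a) = (\<Sum>f\<in>forests_upto (int N - 1). cF D' y a f *\<^sub>R Qf \<zeta> f)"
  unfolding PhiH_def by (simp add: linear_sum[OF linear_Qh] linear_scale[OF linear_Qh])

lemma lookup_Qh_Phi:
  "Poly_Mapping.lookup (Qh \<zeta> (PhiH D' N y a)) h
    = (\<Sum>f\<in>forests_upto (int N - 1). cF D' y a f * Poly_Mapping.lookup (Qf \<zeta> f) h)"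
  unfolding Qh_Phi lookup_sum lookup_scaleR' ..

lemma evc_graft_expand:
  fixes U :: "'d::finite hopf"
  assumes "\<And>h. N \<le> verts h \<Longrightarrow> Poly_Mapping.lookup U h = 0"
  shows "evc \<zeta> (graft a U) = (\<Sum>h\<in>forests_upto (int N - 1). Poly_Mapping.lookup U h * \<zeta> (Node a h))"
proof -
  have sub: "Poly_Mapping.keys U \<subseteq> forests_upto (int N - 1)"
    using assms by (auto simp: in_keys_iff) (meson not_less)
  have "evc \<zeta> (graft a U) = lext (\<lambda>h. \<zeta> (Node a h)) U"
    by (rule linear_eq_on_basis[OF linear_compose'[OF linear_graft linear_evc] linear_lext]) (simp add: evc_basis)
  also have "\<dots> = (\<Sum>h\<in>forests_upto (int N - 1). Poly_Mapping.lookup U h * \<zeta> (Node a h))"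
    unfolding lext_def lincomb_superset[OF finite_FN sub] by simp
  finally show ?thesis .
qed

text \<open>
  Chen's relation for the Euler increment: what is paired with the second increment is \<open>Q (\<Phi>\<^sub>a y)\<close>.
\<close>

lemma evc_PP_convolve:
  assumes "\<And>\<tau>. tree_verts \<tau> \<le> N \<Longrightarrow> \<xi>12 \<tau> = evc \<xi>2 (Qt \<xi>1 \<tau>)"
  shows "evc \<xi>12 (PP D' N y) = evc \<xi>1 (PP D' N y) + (\<Sum>a\<in>UNIV. evc \<xi>2 (graft a (Qh \<xi>1 (PhiH D' N y a))))"
proof -
  have "evc \<xi>12 (PP D' N y) = (\<Sum>\<tau>\<in>{\<tau>. tree_verts \<tau> \<le> N}. cT D' y \<tau> * evc \<xi>2 (Qt \<xi>1 \<tau>))"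
    unfolding evc_PP by (rule sum.cong) (auto simp: assms)
  also have "\<dots> = evc \<xi>2 (Qh \<xi>1 (PP D' N y))"
    unfolding PP_trees by (simp add: linear_sum[OF linear_Qh] linear_scale[OF linear_Qh]
        linear_sum[OF linear_evc] linear_scale[OF linear_evc])
  finally show ?thesis
    unfolding Qh_PP by (simp add: linear_add[OF linear_evc] linear_sum[OF linear_evc] linear_scale[OF linear_evc])
qed

lemma lookup_Qh_Phi_0:
  assumes "N \<le> verts h"
  shows "Poly_Mapping.lookup (Qh \<zeta> (PhiH D' N y a)) h = 0"
proof -
  have "Poly_Mapping.lookup (Qf \<zeta> f) h = 0" if "verts f < N" for f
    using keys_Qf[of h \<zeta> f] that assms by (auto simp: in_keys_iff)
  then show ?thesis by (simp add: lookup_Qh_Phi)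
qed

section \<open>Consistency and the almost flow property\<close>

text \<open>
  The analytic input of the algebra: the increments have the order of their trees, Taylor's formula
  holds for the derivatives at \<open>y + \<delta>\<close>, and \<open>\<delta>\<close> is the Euler increment up to order \<open>N\<close>. Stating the
  last condition as an approximation makes the result applicable along paths that follow the Euler scheme only
  approximately.
\<close>

locale expansion = scale P S eps E
  for P :: "'p set" and S :: "'p \<Rightarrow> real set" and eps :: "'p \<Rightarrow> real" and E :: real +
  fixes N :: nat and D :: "'p \<Rightarrow> nat \<Rightarrow> 'd::finite \<Rightarrow> real \<Rightarrow> real"
    and \<xi> :: "'p \<Rightarrow> 'd rtree \<Rightarrow> real" and \<delta> :: "'p \<Rightarrow> real \<Rightarrow> real"
  assumes N1: "N \<ge> 1"
    and DO: "\<And>k a. k < N \<Longrightarrow> Ord 0 (\<lambda>p y. D p k a y)"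
    and xiO: "\<And>\<tau>. tree_verts \<tau> \<le> N \<Longrightarrow> Ord (tree_verts \<tau>) (\<lambda>p y. \<xi> p \<tau>)"
    and TO: "\<And>k a. k < N \<Longrightarrow> Ord (N - k)
        (\<lambda>p y. D p k a (y + \<delta> p y) - (\<Sum>i<N-k. D p (k + i) a y * \<delta> p y ^ i / fact i))"
    and deltaO: "Ord N (\<lambda>p y. \<delta> p y - evc (\<xi> p) (PP (D p) N y))"
begin

lemma Ord_evc_PP: "Ord 1 (\<lambda>p y. evc (\<xi> p) (PP (D p) N y))"
  by (rule Ord_evc_PP_general[of N D \<xi>, OF DO xiO])

lemma Ord_delta: "Ord 1 \<delta>"
  using Ord_add[OF Ord_mono[OF deltaO, of 1] Ord_evc_PP] N1 by simp

lemma DO': "k < N \<Longrightarrow> Ord 0 (\<lambda>p y. D p k a (y + \<delta> p y))"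
proof -
  assume k: "k < N"
  have "Ord 0 (\<lambda>p y. \<Sum>i<N-k. D p (k + i) a y * \<delta> p y ^ i / fact i)"
  proof (rule Ord_sum)
    fix i assume "i \<in> {..<N - k}"
    then have "Ord 0 (\<lambda>p y. D p (k + i) a y)" by (intro DO) auto
    from Ord_mult_le[OF Ord_cmult[OF this, of "1 / fact i"] Ord_power[OF Ord_delta, of i], of 0]
    show "Ord 0 (\<lambda>p y. D p (k + i) a y * \<delta> p y ^ i / fact i)" by simp
  qed
  from Ord_add[OF Ord_mono[OF TO[OF k, of a], of 0] this] show ?thesis by simp
qed

lemma HOrd_Qf: "set_mset f \<subseteq> {\<tau>. tree_verts \<tau> \<le> N} \<Longrightarrow> HOrd (verts f) (\<lambda>p y. Qf (\<xi> p) f)"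
  by (rule HOrd_Qf_general[OF xiO])

lemma HOrd_Qh_Phi: "HOrd 0 (\<lambda>p y. Qh (\<xi> p) (PhiH (D p) N y a))"
proof -
  have "HOrd 0 (\<lambda>p y. \<Sum>f\<in>forests_upto (int N - 1). cF (D p) y a f *\<^sub>R Qf (\<xi> p) f)"
  proof (rule HOrd_sum)
    fix f :: "'d forest" assume f: "f \<in> forests_upto (int N - 1)"
    have 1: "HOrd (verts f) (\<lambda>p y. Qf (\<xi> p) f)"
      by (rule HOrd_Qf) (use tree_verts_le f in fastforce)
    have 2: "Ord 0 (\<lambda>p y. cF (D p) y a f)"
      by (rule Ord_cF[of N D "\<lambda>p y. y", OF DO]) (use f in auto)
    show "HOrd 0 (\<lambda>p y. cF (D p) y a f *\<^sub>R Qf (\<xi> p) f)"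
      by (rule HOrd_scaleR[OF 2 1]) simp
  qed
  then show ?thesis
    unfolding PhiH_def by (simp add: linear_sum[OF linear_Qh] linear_scale[OF linear_Qh])
qed

text \<open>
  With \<open>W = P (y + \<delta>)\<close>, the series for \<open>Q (\<Phi>\<^sub>a y)\<close> has powers of \<open>A = Q (P y)\<close> and the series for
  \<open>\<Phi>\<^sub>a (y + \<delta>)\<close> is, by Taylor's formula, the same series with \<open>A\<close> replaced by \<open>B = \<delta> * 1 + W\<close>. The
  difference \<open>A - B\<close> is a graft of the consistency error plus \<open>(\<langle>\<xi>, P y\<rangle> - \<delta>) * 1\<close>, hence of order \<open>m + 1\<close>; the
  Taylor remainders and the overflow terms are of order \<open>N\<close>.
\<close>

theorem consistency_step:
  assumes "\<And>a. HOrd m (\<lambda>p y. Qh (\<xi> p) (PhiH (D p) N y a) - PhiH (D p) N (y + \<delta> p y) a)" "m < N"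
  shows "HOrd (Suc m) (\<lambda>p y. Qh (\<xi> p) (PhiH (D p) N y a) - PhiH (D p) N (y + \<delta> p y) a)"
proof -
  let ?A = "\<lambda>p y. Qh (\<xi> p) (PP (D p) N y)"
  let ?W = "\<lambda>p y. PP (D p) N (y + \<delta> p y)"
  let ?B = "\<lambda>p y. \<delta> p y *\<^sub>R 1 + ?W p y"
  let ?T = "\<lambda>k p y. D p k a (y + \<delta> p y) - (\<Sum>i<N-k. D p (k + i) a y * \<delta> p y ^ i / fact i)"
  have W: "HOrd 1 ?W" by (rule HOrd_PP[of N D "\<lambda>p y. y + \<delta> p y", OF DO'])
  have B: "HOrd 1 ?B"
    by (rule HOrd_add[OF HOrd_scaleR[OF Ord_delta HOrd_one] W]) simp
  \<comment> \<open>Both \<open>A\<close> and \<open>B\<close> are a constant plus grafts.\<close>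
  have A_B: "?A p y - ?B p y = (\<Sum>b\<in>UNIV. graft b (Qh (\<xi> p) (PhiH (D p) N y b) - PhiH (D p) N (y + \<delta> p y) b))
      - (\<delta> p y - evc (\<xi> p) (PP (D p) N y)) *\<^sub>R 1" for p y
    unfolding Qh_PP PP_def[of "D p" N "y + \<delta> p y"]
    by (simp add: linear_diff[OF linear_graft] sum_subtractf scaleR_diff_left)
  have AB: "HOrd (Suc m) (\<lambda>p y. ?A p y - ?B p y)"
    unfolding A_B
    by (intro HOrd_diff HOrd_sum HOrd_graft assms(1) HOrd_scaleR[OF deltaO HOrd_one]) (use assms(2) in auto)
  have A: "HOrd 0 ?A"
    using HOrd_add[OF HOrd_mono[OF AB] HOrd_mono[OF B], of 0] by simp
  have "HOrd (Suc m) (\<lambda>p y. \<Sum>j<N. (D p j a y / fact j) *\<^sub>R (?A p y ^ j - ?B p y ^ j))"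
  proof (rule HOrd_sum)
    fix j assume "j \<in> {..<N}"
    then have "Ord 0 (\<lambda>p y. D p j a y / fact j)"
      using Ord_cmult[OF DO, of j "1 / fact j" a] by simp
    then show "HOrd (Suc m) (\<lambda>p y. (D p j a y / fact j) *\<^sub>R (?A p y ^ j - ?B p y ^ j))"
      by (rule HOrd_scaleR[OF _ HOrd_power_diff[OF AB A HOrd_mono[OF B]]]) simp_all
  qed
  moreover have "HOrd (Suc m) (\<lambda>p y. \<Sum>k<N. (?T k p y / fact k) *\<^sub>R ?W p y ^ k)"
  proof (rule HOrd_sum)
    fix k assume k: "k \<in> {..<N}"
    then have "Ord (N - k) (\<lambda>p y. ?T k p y / fact k)"
      using Ord_cmult[OF TO, of k "1 / fact k" a] by simp
    then show "HOrd (Suc m) (\<lambda>p y. (?T k p y / fact k) *\<^sub>R ?W p y ^ k)"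
      by (rule HOrd_scaleR[OF _ HOrd_power[OF W]]) (use k assms(2) in simp)
  qed
  moreover have "HOrd (Suc m) (\<lambda>p y. \<Sum>ts\<in>overflow N. (D p (length ts) a y / fact (length ts)
      * \<Prod>\<^sub># (image_mset (cT (D p) y) (mset ts))) *\<^sub>R Qf (\<xi> p) (mset ts))"
  proof (rule HOrd_mono[OF HOrd_overflow])
    fix ts :: "'d rtree list" assume ts: "ts \<in> overflow N"
    show "HOrd N (\<lambda>p y. Qf (\<xi> p) (mset ts))"
      by (rule HOrd_mono[OF HOrd_Qf]) (use ts in \<open>auto simp: overflow_def\<close>)
  qed (use assms(2) DO in auto)
  moreover have "HOrd (Suc m) (\<lambda>p y. \<Sum>ts\<in>overflow N. (D p (length ts) a (y + \<delta> p y) / fact (length ts)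
      * \<Prod>\<^sub># (image_mset (cT (D p) (y + \<delta> p y)) (mset ts))) *\<^sub>R basis (mset ts))"
  proof (rule HOrd_mono[OF HOrd_overflow])
    fix ts :: "'d rtree list" assume ts: "ts \<in> overflow N"
    show "HOrd N (\<lambda>p y. basis (mset ts))"
      by (rule HOrd_basis) (use ts in \<open>auto simp: overflow_def\<close>)
  qed (use assms(2) DO' in auto)
  ultimately have "HOrd (Suc m) (\<lambda>p y.
      (\<Sum>j<N. (D p j a y / fact j) *\<^sub>R (?A p y ^ j - ?B p y ^ j))
      - (\<Sum>k<N. (?T k p y / fact k) *\<^sub>R ?W p y ^ k)
      - (\<Sum>ts\<in>overflow N. (D p (length ts) a y / fact (length ts)
         * \<Prod>\<^sub># (image_mset (cT (D p) y) (mset ts))) *\<^sub>R Qf (\<xi> p) (mset ts))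
      + (\<Sum>ts\<in>overflow N. (D p (length ts) a (y + \<delta> p y) / fact (length ts)
         * \<Prod>\<^sub># (image_mset (cT (D p) (y + \<delta> p y)) (mset ts))) *\<^sub>R basis (mset ts)))"
    by (intro HOrd_add HOrd_diff)
  moreover have "Qh (\<xi> p) (PhiH (D p) N y a) - PhiH (D p) N (y + \<delta> p y) a =
      (\<Sum>j<N. (D p j a y / fact j) *\<^sub>R (?A p y ^ j - ?B p y ^ j))
      - (\<Sum>k<N. (?T k p y / fact k) *\<^sub>R ?W p y ^ k)
      - (\<Sum>ts\<in>overflow N. (D p (length ts) a y / fact (length ts)
         * \<Prod>\<^sub># (image_mset (cT (D p) y) (mset ts))) *\<^sub>R Qf (\<xi> p) (mset ts))
      + (\<Sum>ts\<in>overflow N. (D p (length ts) a (y + \<delta> p y) / fact (length ts)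
         * \<Prod>\<^sub># (image_mset (cT (D p) (y + \<delta> p y)) (mset ts))) *\<^sub>R basis (mset ts))" for p y
  proof -
    \<comment> \<open>Adding and subtracting the series in \<open>B\<close>, which equals the series in \<open>W\<close> up to the Taylor remainders \<open>T\<close>.\<close>
    have "(\<Sum>j<N. (D p j a y / fact j) *\<^sub>R (?A p y ^ j - ?B p y ^ j)) - (\<Sum>k<N. (?T k p y / fact k) *\<^sub>R ?W p y ^ k)
        = (\<Sum>j<N. (D p j a y / fact j) *\<^sub>R ?A p y ^ j) - (\<Sum>k<N. (D p k a (y + \<delta> p y) / fact k) *\<^sub>R ?W p y ^ k)"
      by (simp only: scaleR_diff_right sum_subtractf shifted_series[of "\<lambda>j. D p j a y"] diff_divide_distrib scaleR_diff_left)
         simp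
    then show ?thesis
      unfolding Qh_Phi_series[of "\<xi> p" "D p" N y a] Phi_as_series[of "D p" N "y + \<delta> p y" a] by simp
  qed
  ultimately show ?thesis by simp
qed

theorem consistency:
  "HOrd N (\<lambda>p y. Qh (\<xi> p) (PhiH (D p) N y a) - PhiH (D p) N (y + \<delta> p y) a)"
proof -
  have "\<forall>a. HOrd m (\<lambda>p y. Qh (\<xi> p) (PhiH (D p) N y a) - PhiH (D p) N (y + \<delta> p y) a)" if "m \<le> N" for m
    using that
  proof (induction m)
    case 0
    have "HOrd 0 (\<lambda>p y. PhiH (D p) N (y + \<delta> p y) b)" for b
      by (rule HOrd_Phi[of N D "\<lambda>p y. y + \<delta> p y", OF DO'])
    then show ?case by (intro allI HOrd_diff HOrd_Qh_Phi)
  next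
    case (Suc m)
    then show ?case using consistency_step[of m] by auto
  qed
  then show ?thesis by blast
qed

lemma consistency_coeff:
  assumes "verts h < N"
  shows "Ord (N - verts h) (\<lambda>p y. (\<Sum>f\<in>forests_upto (int N - 1). cF (D p) y a f * Poly_Mapping.lookup (Qf (\<xi> p) f) h)
    - cF (D p) (y + \<delta> p y) a h)"
  using HOrdD[OF consistency[of a], of h] assms by (simp add: lookup_minus lookup_Phi lookup_Qh_Phi)

text \<open>
  By Chen's relation the defect is the pairing of the second increment with the grafted consistency
  errors. A coefficient of order \<open>N - verts h\<close> meets an increment on a tree with \<open>verts h + 1\<close> vertices.
\<close>

theorem almost_flow:
  assumes xi2: "\<And>\<tau>. tree_verts \<tau> \<le> N \<Longrightarrow> Ord (tree_verts \<tau>) (\<lambda>p y. \<xi>2 p \<tau>)"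
    and conv: "\<And>p \<tau>. p \<in> P \<Longrightarrow> tree_verts \<tau> \<le> N \<Longrightarrow> \<xi>12 p \<tau> = evc (\<xi>2 p) (Qt (\<xi> p) \<tau>)"
    and \<delta>: "\<And>p y. p \<in> P \<Longrightarrow> y \<in> S p \<Longrightarrow> \<delta> p y = evc (\<xi> p) (PP (D p) N y)"
  shows "Ord (Suc N) (\<lambda>p y. \<delta> p y + evc (\<xi>2 p) (PP (D p) N (y + \<delta> p y)) - evc (\<xi>12 p) (PP (D p) N y))"
proof (rule Ord_cong)
  let ?U = "\<lambda>p y a. PhiH (D p) N (y + \<delta> p y) a - Qh (\<xi> p) (PhiH (D p) N y a)"
  show "\<delta> p y + evc (\<xi>2 p) (PP (D p) N (y + \<delta> p y)) - evc (\<xi>12 p) (PP (D p) N y)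
      = (\<Sum>a\<in>UNIV. \<Sum>h\<in>forests_upto (int N - 1). Poly_Mapping.lookup (?U p y a) h * \<xi>2 p (Node a h))"
    if p: "p \<in> P" "y \<in> S p" for p y
  proof -
    have 0: "Poly_Mapping.lookup (?U p y a) h = 0" if h: "N \<le> verts h" for a h
      using h by (simp add: lookup_minus lookup_Phi lookup_Qh_Phi_0)
    have "evc (\<xi>12 p) (PP (D p) N y) = \<delta> p y + (\<Sum>a\<in>UNIV. evc (\<xi>2 p) (graft a (Qh (\<xi> p) (PhiH (D p) N y a))))"
      using evc_PP_convolve[of N "\<xi>12 p" "\<xi>2 p" "\<xi> p"] conv[OF p(1)] \<delta>[OF p] by simp
    then have "\<delta> p y + evc (\<xi>2 p) (PP (D p) N (y + \<delta> p y)) - evc (\<xi>12 p) (PP (D p) N y)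
      = (\<Sum>a\<in>UNIV. evc (\<xi>2 p) (graft a (?U p y a)))"
      by (simp add: PP_def linear_sum[OF linear_evc] linear_diff[OF linear_evc] linear_diff[OF linear_graft] sum_subtractf)
    also have "\<dots> = (\<Sum>a\<in>UNIV. \<Sum>h\<in>forests_upto (int N - 1). Poly_Mapping.lookup (?U p y a) h * \<xi>2 p (Node a h))"
      by (rule sum.cong[OF refl], rule evc_graft_expand, rule 0)
    finally show ?thesis .
  qed
  show "Ord (Suc N) (\<lambda>p y. \<Sum>a\<in>UNIV. \<Sum>h\<in>forests_upto (int N - 1). Poly_Mapping.lookup (?U p y a) h * \<xi>2 p (Node a h))"
  proof (intro Ord_sum)
    fix a and h :: "'d forest" assume h: "h \<in> forests_upto (int N - 1)"
    then have v: "verts h < N" by simp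
    have "HOrd N (\<lambda>p y. ?U p y a)"
    proof -
      have "HOrd N (\<lambda>p y. 0 *\<^sub>R 1 - (Qh (\<xi> p) (PhiH (D p) N y a) - PhiH (D p) N (y + \<delta> p y) a))"
        by (rule HOrd_diff[OF HOrd_scaleR[OF Ord_zero[of N] HOrd_one] consistency]) simp
      then show ?thesis by simp
    qed
    from Ord_mult_le[OF HOrdD[OF this, of h] xi2[of "Node a h"], of "Suc N"]
    show "Ord (Suc N) (\<lambda>p y. Poly_Mapping.lookup (?U p y a) h * \<xi>2 p (Node a h))"
      using v by simp
  qed
qed

end

section \<open>Estimates from Taylor's formula\<close>

text \<open>
  A family of functions, each the derivative of the one before, rather than the derivatives of a single function: the
  rescaled families of derivatives are then covered as they are.
\<close>

definition jets :: "nat \<Rightarrow> (nat \<Rightarrow> 'd \<Rightarrow> real \<Rightarrow> real) \<Rightarrow> bool" where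
  "jets M D \<longleftrightarrow> (\<forall>k<M. \<forall>a z. (D k a has_real_derivative D (Suc k) a z) (at z))"

lemma jetsD: "jets M D \<Longrightarrow> k < M \<Longrightarrow> (D k a has_real_derivative D (Suc k) a z) (at z)"
  by (simp add: jets_def)

lemma taylor_bound:
  fixes g :: "nat \<Rightarrow> real \<Rightarrow> real"
  assumes "\<And>i z. i < m \<Longrightarrow> (g i has_real_derivative g (Suc i) z) (at z)"
    and "\<And>z. \<bar>z - y\<bar> \<le> \<bar>d\<bar> \<Longrightarrow> \<bar>g m z\<bar> \<le> B"
  shows "\<bar>g 0 (y + d) - (\<Sum>i<m. g i y * d ^ i / fact i)\<bar> \<le> B * \<bar>d\<bar> ^ m"
proof -
  have "\<forall>i t. i < m \<and> \<bar>t\<bar> \<le> \<bar>d\<bar> \<longrightarrow> ((\<lambda>t. g i (y + t)) has_real_derivative g (Suc i) (y + t)) (at t)"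
  proof (intro allI impI)
    fix i t assume "i < m \<and> \<bar>t\<bar> \<le> \<bar>d\<bar>"
    then have "(g i has_real_derivative g (Suc i) (y + t)) (at (y + t))" using assms(1) by blast
    moreover have "((\<lambda>t. y + t) has_real_derivative 1) (at t)" by (auto intro!: derivative_eq_intros)
    ultimately show "((\<lambda>t. g i (y + t)) has_real_derivative g (Suc i) (y + t)) (at t)"
      using DERIV_chain2[of "g i" _ "\<lambda>t. y + t" t 1] by simp
  qed
  from Maclaurin_bi_le[of "\<lambda>i t. g i (y + t)" "\<lambda>t. g 0 (y + t)" m d, OF refl this]
  obtain t where t: "\<bar>t\<bar> \<le> \<bar>d\<bar>"
    "g 0 (y + d) = (\<Sum>i<m. g i (y + 0) / fact i * d ^ i) + g m (y + t) / fact m * d ^ m" by blast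
  have "\<bar>g 0 (y + d) - (\<Sum>i<m. g i y * d ^ i / fact i)\<bar> = \<bar>g m (y + t)\<bar> / fact m * \<bar>d\<bar> ^ m"
    unfolding t(2) by (simp add: abs_mult power_abs)
  also have "\<dots> \<le> \<bar>g m (y + t)\<bar> * \<bar>d\<bar> ^ m"
    by (rule mult_right_mono) (auto simp: divide_le_eq mult_left_le_one_le fact_ge_1 mult_le_cancel_left1)
  also have "\<dots> \<le> B * \<bar>d\<bar> ^ m"
    by (rule mult_right_mono) (use assms(2) t(1) in auto)
  finally show ?thesis .
qed

lemma mvt_bound:
  fixes f :: "real \<Rightarrow> real"
  assumes "convex I" "\<And>x. x \<in> I \<Longrightarrow> (f has_real_derivative f' x) (at x)" "\<And>x. x \<in> I \<Longrightarrow> \<bar>f' x\<bar> \<le> B"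
    "x \<in> I" "y \<in> I"
  shows "\<bar>f x - f y\<bar> \<le> B * \<bar>x - y\<bar>"
proof -
  have "norm (f x - f y) \<le> B * norm (x - y)"
    by (rule field_differentiable_bound[OF assms(1), of f f' B])
      (use assms in \<open>auto intro: has_field_derivative_at_within\<close>)
  then show ?thesis by simp
qed

context scale
begin

lemma Ord_point:
  assumes "\<And>p. p \<in> P \<Longrightarrow> S p = {y p}" "\<And>p. p \<in> P \<Longrightarrow> \<bar>u p (y p)\<bar> \<le> C * eps p ^ n"
  shows "Ord n u"
proof (rule OrdI[of "\<bar>C\<bar>"])
  fix p x assume p: "p \<in> P" "x \<in> S p"
  have "C * eps p ^ n \<le> \<bar>C\<bar> * eps p ^ n" using eps[OF p(1)] by (intro mult_right_mono) auto
  then show "\<bar>u p x\<bar> \<le> \<bar>C\<bar> * eps p ^ n" using assms p by fastforce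
qed (use assms in auto)

lemma Ord_boundE:
  assumes "Ord n u"
  obtains C where "C \<ge> 0" "\<And>p y. p \<in> P \<Longrightarrow> y \<in> S p \<Longrightarrow> \<bar>u p y\<bar> \<le> C * eps p ^ n"
  using assms unfolding Ord_def by blast

lemma Ord_param:
  assumes "\<And>p. p \<in> P \<Longrightarrow> \<bar>u p\<bar> \<le> C * eps p ^ n"
  shows "Ord n (\<lambda>p y. u p)"
proof (rule OrdI[of "\<bar>C\<bar>"])
  fix p x assume p: "p \<in> P"
  have "C * eps p ^ n \<le> \<bar>C\<bar> * eps p ^ n" using eps[OF p(1)] by (intro mult_right_mono) auto
  then show "\<bar>u p\<bar> \<le> \<bar>C\<bar> * eps p ^ n" using assms p by fastforce
qed (use eps in auto)

lemma Ord_jets: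
  assumes "\<And>p. p \<in> P \<Longrightarrow> jets N (D p)" "\<And>p. p \<in> P \<Longrightarrow> convex (S p)"
    "\<And>p k a y. p \<in> P \<Longrightarrow> k \<le> N \<Longrightarrow> y \<in> S p \<Longrightarrow> \<bar>D p k a y\<bar> \<le> B" "k < N"
  shows "Ord 0 (\<lambda>p y. D p k a y)"
proof (rule OrdI[of "\<bar>B\<bar>"])
  fix p y assume p: "p \<in> P" "y \<in> S p"
  show "\<bar>D p k a y\<bar> \<le> \<bar>B\<bar> * eps p ^ 0" using assms(3)[OF p(1) _ p(2), of k a] assms(4) by simp
  fix z assume z: "z \<in> S p"
  have "\<bar>D p k a y - D p k a z\<bar> \<le> \<bar>B\<bar> * \<bar>y - z\<bar>"
    by (rule mvt_bound[OF assms(2)[OF p(1)] jetsD[OF assms(1)[OF p(1)] assms(4)] _ p(2) z])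
      (use assms(3)[OF p(1), of "Suc k" _ a] assms(4) in fastforce)
  then show "\<bar>D p k a y - D p k a z\<bar> \<le> \<bar>B\<bar> * eps p ^ 0 * \<bar>y - z\<bar>" by simp
qed simp

end

text \<open>
  Size and Lipschitz constant of the Euler increment, with a constant that depends only on the bounds for the data.
\<close>

lemma step_bounds:
  fixes N :: nat
  obtains C where "C \<ge> 0"
    "\<And>(D :: nat \<Rightarrow> 'd::finite \<Rightarrow> real \<Rightarrow> real) \<xi> I \<epsilon> z z'. \<lbrakk>jets N D; convex I;
      \<And>k a z. k \<le> N \<Longrightarrow> z \<in> I \<Longrightarrow> \<bar>D k a z\<bar> \<le> B; 0 \<le> \<epsilon>; \<epsilon> \<le> E;
      \<And>\<tau>. tree_verts \<tau> \<le> N \<Longrightarrow> \<bar>\<xi> \<tau>\<bar> \<le> \<epsilon> ^ tree_verts \<tau>; z \<in> I; z' \<in> I\<rbrakk>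
      \<Longrightarrow> \<bar>evc \<xi> (PP D N z)\<bar> \<le> C * \<epsilon> \<and> \<bar>evc \<xi> (PP D N z) - evc \<xi> (PP D N z')\<bar> \<le> C * \<epsilon> * \<bar>z - z'\<bar>"
proof -
  let ?P = "{(D :: nat \<Rightarrow> 'd \<Rightarrow> real \<Rightarrow> real, \<xi>, I, \<epsilon>). jets N D \<and> convex I \<and>
      (\<forall>k a z. k \<le> N \<longrightarrow> z \<in> I \<longrightarrow> \<bar>D k a z\<bar> \<le> B) \<and> 0 \<le> \<epsilon> \<and> \<epsilon> \<le> E \<and>
      (\<forall>\<tau>. tree_verts \<tau> \<le> N \<longrightarrow> \<bar>\<xi> \<tau>\<bar> \<le> \<epsilon> ^ tree_verts \<tau>)}"
  let ?D = "\<lambda>(D, \<xi>, I, \<epsilon>). D" and ?\<xi> = "\<lambda>(D, \<xi>, I, \<epsilon>). \<xi>" and ?S = "\<lambda>(D, \<xi>, I, \<epsilon>). I"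
    and ?\<epsilon> = "\<lambda>(D, \<xi>, I, \<epsilon>). \<epsilon>"
  interpret scale ?P ?S ?\<epsilon> E
    by unfold_locales auto
  have "Ord 1 (\<lambda>p y. evc (?\<xi> p) (PP (?D p) N y))"
  proof (rule Ord_evc_PP_general)
    fix k a assume "k < N"
    then show "Ord 0 (\<lambda>p y. ?D p k a y)"
      by (rule Ord_jets[of N ?D B, rotated -1]) auto
  next
    fix \<tau> assume "tree_verts \<tau> \<le> N"
    then show "Ord (tree_verts \<tau>) (\<lambda>p y. ?\<xi> p \<tau>)"
      by (intro Ord_param[of _ 1]) auto
  qed
  then obtain C where C: "C \<ge> 0" "\<And>p y. p \<in> ?P \<Longrightarrow> y \<in> ?S p \<Longrightarrow> \<bar>evc (?\<xi> p) (PP (?D p) N y)\<bar> \<le> C * ?\<epsilon> p ^ 1"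
    "\<And>p y z. p \<in> ?P \<Longrightarrow> y \<in> ?S p \<Longrightarrow> z \<in> ?S p \<Longrightarrow>
      \<bar>evc (?\<xi> p) (PP (?D p) N y) - evc (?\<xi> p) (PP (?D p) N z)\<bar> \<le> C * ?\<epsilon> p ^ 1 * \<bar>y - z\<bar>"
    using OrdE by blast
  show ?thesis
  proof (rule that[OF C(1)])
    fix D :: "nat \<Rightarrow> 'd \<Rightarrow> real \<Rightarrow> real" and \<xi> :: "'d rtree \<Rightarrow> real" and I \<epsilon> z z'
    assume "jets N D" "convex I" "\<And>k a z. k \<le> N \<Longrightarrow> z \<in> I \<Longrightarrow> \<bar>D k a z\<bar> \<le> B" "0 \<le> \<epsilon>" "\<epsilon> \<le> E"
      "\<And>\<tau>. tree_verts \<tau> \<le> N \<Longrightarrow> \<bar>\<xi> \<tau>\<bar> \<le> \<epsilon> ^ tree_verts \<tau>" "z \<in> I" "z' \<in> I"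
    then show "\<bar>evc \<xi> (PP D N z)\<bar> \<le> C * \<epsilon> \<and> \<bar>evc \<xi> (PP D N z) - evc \<xi> (PP D N z')\<bar> \<le> C * \<epsilon> * \<bar>z - z'\<bar>"
      using C(2)[of "(D, \<xi>, I, \<epsilon>)" z] C(3)[of "(D, \<xi>, I, \<epsilon>)" z z'] by auto
  qed
qed

text \<open>
  The hypotheses of the order calculus for single starting points. The derivatives are bounded only between \<open>y\<close> and
  \<open>y + \<delta>\<close>, which makes local estimates for unbounded vector fields possible.
\<close>

lemma expansion_point:
  fixes D :: "'p \<Rightarrow> nat \<Rightarrow> 'd::finite \<Rightarrow> real \<Rightarrow> real"
  assumes "N \<ge> 1" and eps: "\<And>p. p \<in> P \<Longrightarrow> 0 \<le> \<epsilon> p \<and> \<epsilon> p \<le> E"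
    and jets: "\<And>p. p \<in> P \<Longrightarrow> jets N (D p)"
    and bound: "\<And>p k a z. p \<in> P \<Longrightarrow> k \<le> N \<Longrightarrow> \<bar>z - y p\<bar> \<le> \<bar>\<delta> p\<bar> \<Longrightarrow> \<bar>D p k a z\<bar> \<le> B"
    and xi: "\<And>p \<tau>. p \<in> P \<Longrightarrow> tree_verts \<tau> \<le> N \<Longrightarrow> \<bar>\<xi> p \<tau>\<bar> \<le> \<epsilon> p ^ tree_verts \<tau>"
    and delta: "\<And>p. p \<in> P \<Longrightarrow> \<bar>\<delta> p - evc (\<xi> p) (PP (D p) N (y p))\<bar> \<le> C0 * \<epsilon> p ^ N"
  shows "expansion P (\<lambda>p. {y p}) \<epsilon> E N D \<xi> (\<lambda>p _. \<delta> p)"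
proof -
  interpret scale P "\<lambda>p. {y p}" \<epsilon> E
    by unfold_locales (rule eps)
  have DO: "Ord 0 (\<lambda>p y. D p k a y)" if "k < N" for k a
    by (rule Ord_jets[where N = N and B = B, OF jets _ _ that]) (use bound in auto)
  have xiO: "Ord (tree_verts \<tau>) (\<lambda>p y. \<xi> p \<tau>)" if "tree_verts \<tau> \<le> N" for \<tau>
    by (rule Ord_param[of _ 1]) (use xi that in auto)
  have deltaO: "Ord N (\<lambda>p y. \<delta> p - evc (\<xi> p) (PP (D p) N y))"
    by (rule Ord_point[of y]) (use delta in auto)
  have "Ord 1 (\<lambda>p y. \<delta> p)"
    using Ord_add[OF Ord_mono[OF deltaO \<open>N \<ge> 1\<close>] Ord_evc_PP_general[of N D \<xi>, OF DO xiO]] by simp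
  then obtain C where C: "C \<ge> 0" "\<And>p. p \<in> P \<Longrightarrow> \<bar>\<delta> p\<bar> \<le> C * \<epsilon> p"
    by (auto elim!: OrdE)
  have TO: "Ord (N - k) (\<lambda>p y. D p k a (y + \<delta> p) - (\<Sum>i<N-k. D p (k + i) a y * \<delta> p ^ i / fact i))" if k: "k < N" for k a
  proof (rule Ord_point[of y])
    fix p assume p: "p \<in> P"
    have "\<bar>D p (k + 0) a (y p + \<delta> p) - (\<Sum>i<N-k. D p (k + i) a (y p) * \<delta> p ^ i / fact i)\<bar> \<le> \<bar>B\<bar> * \<bar>\<delta> p\<bar> ^ (N - k)"
    proof (rule taylor_bound)
      fix i z assume "i < N - k"
      then show "(D p (k + i) a has_real_derivative D p (k + Suc i) a z) (at z)"
        using jetsD[OF jets[OF p], of "k + i" a z] by simp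
    next
      fix z assume "\<bar>z - y p\<bar> \<le> \<bar>\<delta> p\<bar>"
      then show "\<bar>D p (k + (N - k)) a z\<bar> \<le> \<bar>B\<bar>" using bound[OF p _ , of "k + (N - k)" z a] k by simp
    qed
    also have "\<dots> \<le> \<bar>B\<bar> * (C * \<epsilon> p) ^ (N - k)"
      using C(2)[OF p] by (intro mult_left_mono power_mono) auto
    finally show "\<bar>D p k a (y p + \<delta> p) - (\<Sum>i<N-k. D p (k + i) a (y p) * \<delta> p ^ i / fact i)\<bar> \<le> \<bar>B\<bar> * C ^ (N - k) * \<epsilon> p ^ (N - k)"
      by (simp add: power_mult_distrib mult.assoc)
  qed simp
  show ?thesis
    by unfold_locales (fact \<open>N \<ge> 1\<close> DO xiO TO deltaO)+
qed

text \<open>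
  The uniformity in the order calculus is over an index set; taking all configurations with the stated bounds as
  the index set gives one constant for all of them.
\<close>

lemma consistency_point:
  fixes N :: nat and h :: "'d::finite forest"
  assumes "N \<ge> 1" "verts h < N"
  obtains C where "C \<ge> 0"
    "\<And>(D :: nat \<Rightarrow> 'd \<Rightarrow> real \<Rightarrow> real) \<xi> y \<delta> \<epsilon>. \<lbrakk>jets N D;
      \<And>k a z. k \<le> N \<Longrightarrow> \<bar>z - y\<bar> \<le> \<bar>\<delta>\<bar> \<Longrightarrow> \<bar>D k a z\<bar> \<le> B; 0 \<le> \<epsilon>; \<epsilon> \<le> E;
      \<And>\<tau>. tree_verts \<tau> \<le> N \<Longrightarrow> \<bar>\<xi> \<tau>\<bar> \<le> \<epsilon> ^ tree_verts \<tau>;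
      \<bar>\<delta> - evc \<xi> (PP D N y)\<bar> \<le> C0 * \<epsilon> ^ N\<rbrakk>
      \<Longrightarrow> \<bar>(\<Sum>f\<in>forests_upto (int N - 1). cF D y a f * Poly_Mapping.lookup (Qf \<xi> f) h) - cF D (y + \<delta>) a h\<bar>
         \<le> C * \<epsilon> ^ (N - verts h)"
proof -
  let ?P = "{(D :: nat \<Rightarrow> 'd \<Rightarrow> real \<Rightarrow> real, \<xi>, y :: real, \<delta>, \<epsilon>). jets N D \<and>
      (\<forall>k a z. k \<le> N \<longrightarrow> \<bar>z - y\<bar> \<le> \<bar>\<delta>\<bar> \<longrightarrow> \<bar>D k a z\<bar> \<le> B) \<and> 0 \<le> \<epsilon> \<and> \<epsilon> \<le> E \<and>
      (\<forall>\<tau>. tree_verts \<tau> \<le> N \<longrightarrow> \<bar>\<xi> \<tau>\<bar> \<le> \<epsilon> ^ tree_verts \<tau>) \<and>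
      \<bar>\<delta> - evc \<xi> (PP D N y)\<bar> \<le> C0 * \<epsilon> ^ N}"
  let ?D = "\<lambda>(D, \<xi>, y, \<delta>, \<epsilon>). D" and ?\<xi> = "\<lambda>(D, \<xi>, y, \<delta>, \<epsilon>). \<xi>" and ?y = "\<lambda>(D, \<xi>, y, \<delta>, \<epsilon>). y"
    and ?\<delta> = "\<lambda>(D, \<xi>, y, \<delta>, \<epsilon>). \<delta>" and ?\<epsilon> = "\<lambda>(D, \<xi>, y, \<delta>, \<epsilon>). \<epsilon>"
  interpret expansion ?P "\<lambda>p. {?y p}" ?\<epsilon> E N ?D ?\<xi> "\<lambda>p _. ?\<delta> p"
    by (rule expansion_point[of N ?P ?\<epsilon> E ?D ?y ?\<delta> B ?\<xi> C0]) (use assms(1) in auto)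
  obtain C where C: "C \<ge> 0" "\<And>p y. p \<in> ?P \<Longrightarrow> y \<in> {?y p} \<Longrightarrow>
      \<bar>(\<Sum>f\<in>forests_upto (int N - 1). cF (?D p) y a f * Poly_Mapping.lookup (Qf (?\<xi> p) f) h) - cF (?D p) (y + ?\<delta> p) a h\<bar>
        \<le> C * ?\<epsilon> p ^ (N - verts h)"
    using consistency_coeff[OF assms(2), of a] by (rule Ord_boundE) (rule that)
  show ?thesis
  proof (rule that[OF C(1)])
    fix D :: "nat \<Rightarrow> 'd \<Rightarrow> real \<Rightarrow> real" and \<xi> :: "'d rtree \<Rightarrow> real" and y \<delta> \<epsilon>
    assume "jets N D" "\<And>k a z. k \<le> N \<Longrightarrow> \<bar>z - y\<bar> \<le> \<bar>\<delta>\<bar> \<Longrightarrow> \<bar>D k a z\<bar> \<le> B" "0 \<le> \<epsilon>" "\<epsilon> \<le> E"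
      "\<And>\<tau>. tree_verts \<tau> \<le> N \<Longrightarrow> \<bar>\<xi> \<tau>\<bar> \<le> \<epsilon> ^ tree_verts \<tau>" "\<bar>\<delta> - evc \<xi> (PP D N y)\<bar> \<le> C0 * \<epsilon> ^ N"
    then show "\<bar>(\<Sum>f\<in>forests_upto (int N - 1). cF D y a f * Poly_Mapping.lookup (Qf \<xi> f) h) - cF D (y + \<delta>) a h\<bar>
         \<le> C * \<epsilon> ^ (N - verts h)"
      using C(2)[of "(D, \<xi>, y, \<delta>, \<epsilon>)" y] by auto
  qed
qed

lemma almost_flow_point:
  fixes N :: nat
  assumes "N \<ge> 1"
  obtains C where "C \<ge> 0"
    "\<And>(D :: nat \<Rightarrow> 'd::finite \<Rightarrow> real \<Rightarrow> real) \<xi> \<xi>2 \<xi>12 y \<epsilon>. \<lbrakk>jets N D;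
      \<And>k a z. k \<le> N \<Longrightarrow> \<bar>z - y\<bar> \<le> \<bar>evc \<xi> (PP D N y)\<bar> \<Longrightarrow> \<bar>D k a z\<bar> \<le> B; 0 \<le> \<epsilon>; \<epsilon> \<le> E;
      \<And>\<tau>. tree_verts \<tau> \<le> N \<Longrightarrow> \<bar>\<xi> \<tau>\<bar> \<le> \<epsilon> ^ tree_verts \<tau>;
      \<And>\<tau>. tree_verts \<tau> \<le> N \<Longrightarrow> \<bar>\<xi>2 \<tau>\<bar> \<le> \<epsilon> ^ tree_verts \<tau>;
      \<And>\<tau>. tree_verts \<tau> \<le> N \<Longrightarrow> \<xi>12 \<tau> = evc \<xi>2 (Qt \<xi> \<tau>)\<rbrakk>
      \<Longrightarrow> \<bar>evc \<xi> (PP D N y) + evc \<xi>2 (PP D N (y + evc \<xi> (PP D N y))) - evc \<xi>12 (PP D N y)\<bar> \<le> C * \<epsilon> ^ Suc N"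
proof -
  let ?P = "{(D :: nat \<Rightarrow> 'd \<Rightarrow> real \<Rightarrow> real, \<xi>, \<xi>2, \<xi>12, y :: real, \<epsilon>). jets N D \<and>
      (\<forall>k a z. k \<le> N \<longrightarrow> \<bar>z - y\<bar> \<le> \<bar>evc \<xi> (PP D N y)\<bar> \<longrightarrow> \<bar>D k a z\<bar> \<le> B) \<and> 0 \<le> \<epsilon> \<and> \<epsilon> \<le> E \<and>
      (\<forall>\<tau>. tree_verts \<tau> \<le> N \<longrightarrow> \<bar>\<xi> \<tau>\<bar> \<le> \<epsilon> ^ tree_verts \<tau>) \<and>
      (\<forall>\<tau>. tree_verts \<tau> \<le> N \<longrightarrow> \<bar>\<xi>2 \<tau>\<bar> \<le> \<epsilon> ^ tree_verts \<tau>) \<and>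
      (\<forall>\<tau>. tree_verts \<tau> \<le> N \<longrightarrow> \<xi>12 \<tau> = evc \<xi>2 (Qt \<xi> \<tau>))}"
  let ?D = "\<lambda>(D, \<xi>, \<xi>2, \<xi>12, y, \<epsilon>). D" and ?\<xi> = "\<lambda>(D, \<xi>, \<xi>2, \<xi>12, y, \<epsilon>). \<xi>"
    and ?\<xi>2 = "\<lambda>(D, \<xi>, \<xi>2, \<xi>12, y, \<epsilon>). \<xi>2" and ?\<xi>12 = "\<lambda>(D, \<xi>, \<xi>2, \<xi>12, y, \<epsilon>). \<xi>12"
    and ?y = "\<lambda>(D, \<xi>, \<xi>2, \<xi>12, y, \<epsilon>). y" and ?\<epsilon> = "\<lambda>(D, \<xi>, \<xi>2, \<xi>12, y, \<epsilon>). \<epsilon>"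
  let ?\<delta> = "\<lambda>p. evc (?\<xi> p) (PP (?D p) N (?y p))"
  interpret expansion ?P "\<lambda>p. {?y p}" ?\<epsilon> E N ?D ?\<xi> "\<lambda>p _. ?\<delta> p"
    by (rule expansion_point[of N ?P ?\<epsilon> E ?D ?y ?\<delta> B ?\<xi> 0]) (use assms(1) in auto)
  have "Ord (Suc N) (\<lambda>p y. ?\<delta> p + evc (?\<xi>2 p) (PP (?D p) N (y + ?\<delta> p)) - evc (?\<xi>12 p) (PP (?D p) N y))"
  proof (rule almost_flow)
    fix \<tau> :: "'d rtree" assume "tree_verts \<tau> \<le> N"
    then show "Ord (tree_verts \<tau>) (\<lambda>p y. ?\<xi>2 p \<tau>)"
      by (intro Ord_param[of _ 1]) auto
  qed auto
  then obtain C where C: "C \<ge> 0" "\<And>p y. p \<in> ?P \<Longrightarrow> y \<in> {?y p} \<Longrightarrow>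
      \<bar>?\<delta> p + evc (?\<xi>2 p) (PP (?D p) N (y + ?\<delta> p)) - evc (?\<xi>12 p) (PP (?D p) N y)\<bar> \<le> C * ?\<epsilon> p ^ Suc N"
    by (rule Ord_boundE) (rule that)
  show ?thesis
  proof (rule that[OF C(1)])
    fix D :: "nat \<Rightarrow> 'd \<Rightarrow> real \<Rightarrow> real" and \<xi> \<xi>2 \<xi>12 :: "'d rtree \<Rightarrow> real" and y \<epsilon>
    assume "jets N D" "\<And>k a z. k \<le> N \<Longrightarrow> \<bar>z - y\<bar> \<le> \<bar>evc \<xi> (PP D N y)\<bar> \<Longrightarrow> \<bar>D k a z\<bar> \<le> B" "0 \<le> \<epsilon>" "\<epsilon> \<le> E"
      "\<And>\<tau>. tree_verts \<tau> \<le> N \<Longrightarrow> \<bar>\<xi> \<tau>\<bar> \<le> \<epsilon> ^ tree_verts \<tau>" "\<And>\<tau>. tree_verts \<tau> \<le> N \<Longrightarrow> \<bar>\<xi>2 \<tau>\<bar> \<le> \<epsilon> ^ tree_verts \<tau>"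
      "\<And>\<tau>. tree_verts \<tau> \<le> N \<Longrightarrow> \<xi>12 \<tau> = evc \<xi>2 (Qt \<xi> \<tau>)"
    then show "\<bar>evc \<xi> (PP D N y) + evc \<xi>2 (PP D N (y + evc \<xi> (PP D N y))) - evc \<xi>12 (PP D N y)\<bar> \<le> C * \<epsilon> ^ Suc N"
      using C(2)[of "(D, \<xi>, \<xi>2, \<xi>12, y, \<epsilon>)" y] by auto
  qed
qed

text \<open>
  Lipschitz dependence of a Taylor remainder of order \<open>m\<close> on the base point and on the displacement. The
  first part costs one derivative more, the second gains only \<open>r ^ (m - 1)\<close>, which is compensated since
  displacements differ by a multiple of \<open>r\<close> times the distance of the base points.
\<close>

lemma taylor_lip:
  fixes g :: "nat \<Rightarrow> real \<Rightarrow> real"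
  assumes g: "\<And>i z. i \<le> m \<Longrightarrow> (g i has_real_derivative g (Suc i) z) (at z)" and m: "m \<ge> 1"
    and B: "\<And>z. \<bar>z\<bar> \<le> K + 1 \<Longrightarrow> \<bar>g m z\<bar> \<le> B" "\<And>z. \<bar>z\<bar> \<le> K + 1 \<Longrightarrow> \<bar>g (Suc m) z\<bar> \<le> B"
    and yz: "\<bar>y\<bar> \<le> K" "\<bar>z\<bar> \<le> K" and de: "\<bar>d\<bar> \<le> r" "\<bar>e\<bar> \<le> r" "\<bar>d\<bar> \<le> 1" "\<bar>e\<bar> \<le> 1"
  shows "\<bar>(g 0 (y + d) - (\<Sum>i<m. g i y * d ^ i / fact i)) - (g 0 (z + e) - (\<Sum>i<m. g i z * e ^ i / fact i))\<bar>
    \<le> B * r ^ m * \<bar>y - z\<bar> + B * r ^ (m - 1) * \<bar>d - e\<bar>"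
proof -
  let ?T = "\<lambda>x d. g 0 (x + d) - (\<Sum>i<m. g i x * d ^ i / fact i)"
  have B0: "B \<ge> 0" using B(1)[of 0] yz(1) by simp
  have r0: "r \<ge> 0" using de(1) by simp
  have shift: "(f has_real_derivative f' (x + c)) (at (x + c)) \<Longrightarrow> ((\<lambda>x. f (x + c)) has_real_derivative f' (x + c)) (at x)" for f f' :: "real \<Rightarrow> real" and x c
    using DERIV_shift[of f "f' (x + c)" x c] by simp
  have 1: "\<bar>?T y d - ?T z d\<bar> \<le> B * r ^ m * \<bar>y - z\<bar>"
  proof (rule mvt_bound[of "{-K..K}"])
    fix x assume x: "x \<in> {-K..K}"
    let ?T' = "g (Suc 0) (x + d) - (\<Sum>i<m. g (Suc i) x * d ^ i / fact i)"
    show "((\<lambda>x. ?T x d) has_real_derivative ?T') (at x)"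
      by (intro DERIV_diff DERIV_sum DERIV_cdivide DERIV_cmult_right shift g) (use m in auto)
    have "\<bar>?T'\<bar> \<le> B * \<bar>d\<bar> ^ m"
      by (rule taylor_bound[of m "\<lambda>i. g (Suc i)"]) (use g B(2) x de(3) in auto)
    also have "\<dots> \<le> B * r ^ m"
      using de(1) B0 by (intro mult_left_mono power_mono) auto
    finally show "\<bar>?T'\<bar> \<le> B * r ^ m" .
  qed (use yz in auto)
  obtain k where k: "m = Suc k" using m by (cases m) auto
  have 2: "\<bar>?T z d - ?T z e\<bar> \<le> B * r ^ (m - 1) * \<bar>d - e\<bar>"
  proof (rule mvt_bound[of "{-r..r} \<inter> {-1..1}"])
    fix x assume x: "x \<in> {-r..r} \<inter> {-1..1}"
    have eq: "?T z = (\<lambda>x. g 0 (z + x) - (g 0 z + (\<Sum>i<k. g (Suc i) z * x ^ Suc i / fact (Suc i))))"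
      unfolding k sum.lessThan_Suc_shift by simp
    let ?T' = "g (Suc 0) (z + x) - (\<Sum>i<k. g (Suc i) z * x ^ i / fact i)"
    have pow: "((\<lambda>x. c * x ^ Suc i / fact (Suc i)) has_real_derivative c * x ^ i / fact i) (at x)" for c :: real and i
      by (rule derivative_eq_intros refl | simp)+
    have s2: "((\<lambda>x. g 0 (z + x)) has_real_derivative g (Suc 0) (z + x)) (at x)"
      using shift[of "g 0" "g (Suc 0)" x z] g[of 0 "x + z"] by (simp add: add.commute)
    show "(?T z has_real_derivative ?T') (at x)"
      unfolding eq by (rule DERIV_diff[OF s2]) (rule derivative_eq_intros pow refl | simp)+
    have "\<bar>?T'\<bar> \<le> B * \<bar>x\<bar> ^ k"
      by (rule taylor_bound[of k "\<lambda>i. g (Suc i)"]) (use g B(1) x yz k in auto)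
    also have "\<dots> \<le> B * r ^ k"
      using x B0 by (intro mult_left_mono power_mono) auto
    finally show "\<bar>?T'\<bar> \<le> B * r ^ (m - 1)" using k by simp
  qed (use de in \<open>auto intro: convex_Int\<close>)
  show ?thesis using 1 2 by linarith
qed

text \<open>
  The order calculus with the interval \<open>{-K..K}\<close> as set of starting points.
\<close>

lemma almost_flow_lip:
  fixes N :: nat and D :: "nat \<Rightarrow> 'd::finite \<Rightarrow> real \<Rightarrow> real"
  assumes N1: "N \<ge> 1" and jets: "jets (Suc N) D"
    and B: "\<And>k a z. k \<le> Suc N \<Longrightarrow> \<bar>z\<bar> \<le> K + 1 \<Longrightarrow> \<bar>D k a z\<bar> \<le> B"
  obtains C where "C \<ge> 0"
    "\<And>\<xi> \<xi>2 \<xi>12 \<epsilon> y z. \<lbrakk>0 \<le> \<epsilon>; \<epsilon> \<le> E; \<And>y. \<bar>y\<bar> \<le> K \<Longrightarrow> \<bar>evc \<xi> (PP D N y)\<bar> \<le> 1;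
      \<And>\<tau>. tree_verts \<tau> \<le> N \<Longrightarrow> \<bar>\<xi> \<tau>\<bar> \<le> \<epsilon> ^ tree_verts \<tau>;
      \<And>\<tau>. tree_verts \<tau> \<le> N \<Longrightarrow> \<bar>\<xi>2 \<tau>\<bar> \<le> \<epsilon> ^ tree_verts \<tau>;
      \<And>\<tau>. tree_verts \<tau> \<le> N \<Longrightarrow> \<xi>12 \<tau> = evc \<xi>2 (Qt \<xi> \<tau>); \<bar>y\<bar> \<le> K; \<bar>z\<bar> \<le> K\<rbrakk>
      \<Longrightarrow> \<bar>(evc \<xi> (PP D N y) + evc \<xi>2 (PP D N (y + evc \<xi> (PP D N y))) - evc \<xi>12 (PP D N y))
          - (evc \<xi> (PP D N z) + evc \<xi>2 (PP D N (z + evc \<xi> (PP D N z))) - evc \<xi>12 (PP D N z))\<bar> \<le> C * \<epsilon> ^ Suc N * \<bar>y - z\<bar>"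
proof -
  let ?P = "{(\<xi>, \<xi>2, \<xi>12, \<epsilon>). 0 \<le> \<epsilon> \<and> \<epsilon> \<le> E \<and> (\<forall>y. \<bar>y\<bar> \<le> K \<longrightarrow> \<bar>evc \<xi> (PP D N y)\<bar> \<le> 1) \<and>
      (\<forall>\<tau>. tree_verts \<tau> \<le> N \<longrightarrow> \<bar>\<xi> \<tau>\<bar> \<le> \<epsilon> ^ tree_verts \<tau>) \<and>
      (\<forall>\<tau> :: 'd rtree. tree_verts \<tau> \<le> N \<longrightarrow> \<bar>\<xi>2 \<tau>\<bar> \<le> \<epsilon> ^ tree_verts \<tau>) \<and>
      (\<forall>\<tau>. tree_verts \<tau> \<le> N \<longrightarrow> \<xi>12 \<tau> = evc \<xi>2 (Qt \<xi> \<tau>))}"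
  let ?\<xi> = "\<lambda>(\<xi>, \<xi>2, \<xi>12, \<epsilon>). \<xi>" and ?\<xi>2 = "\<lambda>(\<xi>, \<xi>2, \<xi>12, \<epsilon>). \<xi>2"
    and ?\<xi>12 = "\<lambda>(\<xi>, \<xi>2, \<xi>12, \<epsilon>). \<xi>12" and ?\<epsilon> = "\<lambda>(\<xi>, \<xi>2, \<xi>12, \<epsilon>). \<epsilon>"
  let ?\<delta> = "\<lambda>p y. evc (?\<xi> p) (PP D N y)"
  interpret sc: scale ?P "\<lambda>_. {-K..K}" ?\<epsilon> E
    by unfold_locales auto
  have DO: "sc.Ord 0 (\<lambda>p y. D k a y)" if "k < N" for k a
  proof (rule sc.Ord_jets[where N = N and B = B])
    show "jets N D" using jets by (simp add: jets_def)
  qed (use B that in auto)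
  have xiO: "sc.Ord (tree_verts \<tau>) (\<lambda>p y. ?\<xi> p \<tau>)" if "tree_verts \<tau> \<le> N" for \<tau>
    by (rule sc.Ord_param[of _ 1]) (use that in auto)
  have xi2O: "sc.Ord (tree_verts \<tau>) (\<lambda>p y. ?\<xi>2 p \<tau>)" if "tree_verts \<tau> \<le> N" for \<tau> :: "'d rtree"
    by (rule sc.Ord_param[of _ 1]) (use that in auto)
  have "sc.Ord 1 ?\<delta>"
    by (rule sc.Ord_evc_PP_general[of N "\<lambda>_. D" ?\<xi>, OF DO xiO])
  then obtain C where C: "C \<ge> 0" "\<And>p y. p \<in> ?P \<Longrightarrow> y \<in> {-K..K} \<Longrightarrow> \<bar>?\<delta> p y\<bar> \<le> C * ?\<epsilon> p ^ 1"
    "\<And>p y z. p \<in> ?P \<Longrightarrow> y \<in> {-K..K} \<Longrightarrow> z \<in> {-K..K} \<Longrightarrow> \<bar>?\<delta> p y - ?\<delta> p z\<bar> \<le> C * ?\<epsilon> p ^ 1 * \<bar>y - z\<bar>"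
    by (rule sc.OrdE) (rule that)
  have d1: "\<bar>?\<delta> p y\<bar> \<le> 1" if "p \<in> ?P" "y \<in> {-K..K}" for p y
    using that by auto
  have TO: "sc.Ord (N - k) (\<lambda>p y. D k a (y + ?\<delta> p y) - (\<Sum>i<N-k. D (k + i) a y * ?\<delta> p y ^ i / fact i))" if k: "k < N" for k a
  proof (rule sc.OrdI[of "2 * (\<bar>B\<bar> * C ^ (N - k))"])
    show "2 * (\<bar>B\<bar> * C ^ (N - k)) \<ge> 0" using C(1) by simp
    fix p y assume p: "p \<in> ?P" and y: "y \<in> {-K..K}"
    have e0: "?\<epsilon> p \<ge> 0" using p by auto
    have "\<bar>D (k + 0) a (y + ?\<delta> p y) - (\<Sum>i<N-k. D (k + i) a y * ?\<delta> p y ^ i / fact i)\<bar> \<le> \<bar>B\<bar> * \<bar>?\<delta> p y\<bar> ^ (N - k)"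
    proof (rule taylor_bound)
      fix i z assume "i < N - k"
      then show "(D (k + i) a has_real_derivative D (k + Suc i) a z) (at z)"
        using jetsD[OF jets, of "k + i" a z] by simp
    next
      fix z assume "\<bar>z - y\<bar> \<le> \<bar>?\<delta> p y\<bar>"
      then have "\<bar>z\<bar> \<le> K + 1" using d1[OF p y] y by auto
      then show "\<bar>D (k + (N - k)) a z\<bar> \<le> \<bar>B\<bar>" using B[of N z a] k by simp
    qed
    also have "\<dots> \<le> \<bar>B\<bar> * (C * ?\<epsilon> p) ^ (N - k)"
      using C(2)[OF p y] by (intro mult_left_mono power_mono) auto
    also have "\<dots> = \<bar>B\<bar> * C ^ (N - k) * ?\<epsilon> p ^ (N - k)"
      by (simp add: power_mult_distrib mult.assoc)
    also have "\<dots> \<le> 2 * (\<bar>B\<bar> * C ^ (N - k)) * ?\<epsilon> p ^ (N - k)"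
      using e0 C(1) by (intro mult_right_mono) auto
    finally show "\<bar>D k a (y + ?\<delta> p y) - (\<Sum>i<N-k. D (k + i) a y * ?\<delta> p y ^ i / fact i)\<bar>
      \<le> 2 * (\<bar>B\<bar> * C ^ (N - k)) * ?\<epsilon> p ^ (N - k)" by simp
    fix z assume z: "z \<in> {-K..K}"
    let ?r = "C * ?\<epsilon> p"
    have r0: "?r \<ge> 0" using C(1) e0 by simp
    have "\<bar>(D (k + 0) a (y + ?\<delta> p y) - (\<Sum>i<N-k. D (k + i) a y * ?\<delta> p y ^ i / fact i))
        - (D (k + 0) a (z + ?\<delta> p z) - (\<Sum>i<N-k. D (k + i) a z * ?\<delta> p z ^ i / fact i))\<bar>
        \<le> \<bar>B\<bar> * ?r ^ (N - k) * \<bar>y - z\<bar> + \<bar>B\<bar> * ?r ^ (N - k - 1) * \<bar>?\<delta> p y - ?\<delta> p z\<bar>"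
    proof (rule taylor_lip[where K = K])
      fix i z assume "i \<le> N - k"
      then show "(D (k + i) a has_real_derivative D (k + Suc i) a z) (at z)"
        using jetsD[OF jets, of "k + i" a z] k by simp
    next
      fix x assume x: "\<bar>x\<bar> \<le> K + 1"
      show "\<bar>D (k + (N - k)) a x\<bar> \<le> \<bar>B\<bar>" "\<bar>D (k + Suc (N - k)) a x\<bar> \<le> \<bar>B\<bar>"
        using B[of N x a] B[of "Suc N" x a] x k by auto
    qed (use k y z C(2)[OF p y] C(2)[OF p z] d1[OF p y] d1[OF p z] in auto)
    also have "\<dots> \<le> \<bar>B\<bar> * ?r ^ (N - k) * \<bar>y - z\<bar> + \<bar>B\<bar> * ?r ^ (N - k - 1) * (?r * \<bar>y - z\<bar>)"
      using C(3)[OF p y z] r0 by (intro add_left_mono mult_left_mono) auto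
    also have "\<dots> = 2 * (\<bar>B\<bar> * (?r ^ (N - k - 1) * ?r)) * \<bar>y - z\<bar>"
      using k by (cases "N - k") (auto simp: algebra_simps)
    also have "?r ^ (N - k - 1) * ?r = ?r ^ (N - k)"
      using k by (cases "N - k") auto
    finally show "\<bar>D k a (y + ?\<delta> p y) - (\<Sum>i<N-k. D (k + i) a y * ?\<delta> p y ^ i / fact i)
        - (D k a (z + ?\<delta> p z) - (\<Sum>i<N-k. D (k + i) a z * ?\<delta> p z ^ i / fact i))\<bar>
        \<le> 2 * (\<bar>B\<bar> * C ^ (N - k)) * ?\<epsilon> p ^ (N - k) * \<bar>y - z\<bar>"
      by (simp only: add_0_right power_mult_distrib mult.assoc)
  qed
  interpret ex: expansion ?P "\<lambda>_. {-K..K}" ?\<epsilon> E N "\<lambda>_. D" ?\<xi> ?\<delta>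
    by unfold_locales (use N1 DO xiO TO sc.Ord_zero in simp_all)
  have "sc.Ord (Suc N) (\<lambda>p y. ?\<delta> p y + evc (?\<xi>2 p) (PP D N (y + ?\<delta> p y)) - evc (?\<xi>12 p) (PP D N y))"
    by (rule ex.almost_flow[of ?\<xi>2 ?\<xi>12, OF xi2O]) auto
  then obtain C' where C': "C' \<ge> 0" "\<And>p y. p \<in> ?P \<Longrightarrow> y \<in> {-K..K} \<Longrightarrow>
      \<bar>?\<delta> p y + evc (?\<xi>2 p) (PP D N (y + ?\<delta> p y)) - evc (?\<xi>12 p) (PP D N y)\<bar> \<le> C' * ?\<epsilon> p ^ Suc N"
      "\<And>p y z. p \<in> ?P \<Longrightarrow> y \<in> {-K..K} \<Longrightarrow> z \<in> {-K..K} \<Longrightarrow>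
      \<bar>(?\<delta> p y + evc (?\<xi>2 p) (PP D N (y + ?\<delta> p y)) - evc (?\<xi>12 p) (PP D N y))
      - (?\<delta> p z + evc (?\<xi>2 p) (PP D N (z + ?\<delta> p z)) - evc (?\<xi>12 p) (PP D N z))\<bar> \<le> C' * ?\<epsilon> p ^ Suc N * \<bar>y - z\<bar>"
    by (rule sc.OrdE) (rule that)
  show ?thesis
  proof (rule that[OF C'(1)])
    fix \<xi> \<xi>2 \<xi>12 :: "'d rtree \<Rightarrow> real" and \<epsilon> y z :: real
    assume "0 \<le> \<epsilon>" "\<epsilon> \<le> E" "\<And>y. \<bar>y\<bar> \<le> K \<Longrightarrow> \<bar>evc \<xi> (PP D N y)\<bar> \<le> 1"
      "\<And>\<tau>. tree_verts \<tau> \<le> N \<Longrightarrow> \<bar>\<xi> \<tau>\<bar> \<le> \<epsilon> ^ tree_verts \<tau>" "\<And>\<tau>. tree_verts \<tau> \<le> N \<Longrightarrow> \<bar>\<xi>2 \<tau>\<bar> \<le> \<epsilon> ^ tree_verts \<tau>"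
      "\<And>\<tau>. tree_verts \<tau> \<le> N \<Longrightarrow> \<xi>12 \<tau> = evc \<xi>2 (Qt \<xi> \<tau>)" "\<bar>y\<bar> \<le> K" "\<bar>z\<bar> \<le> K"
    then show "\<bar>(evc \<xi> (PP D N y) + evc \<xi>2 (PP D N (y + evc \<xi> (PP D N y))) - evc \<xi>12 (PP D N y))
          - (evc \<xi> (PP D N z) + evc \<xi>2 (PP D N (z + evc \<xi> (PP D N z))) - evc \<xi>12 (PP D N z))\<bar> \<le> C' * \<epsilon> ^ Suc N * \<bar>y - z\<bar>"
      using C'(3)[of "(\<xi>, \<xi>2, \<xi>12, \<epsilon>)" y z] by (auto simp: abs_le_iff)
  qed
qed

section \<open>Scaling of the vector field\<close>

text \<open>
  The automorphism given by the grading; rescaling a character amounts to composing it with this map.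
\<close>

definition dil :: "real \<Rightarrow> 'd hopf \<Rightarrow> 'd hopf" where
  "dil c = lext (\<lambda>f. c ^ verts f *\<^sub>R basis f)"

lemma linear_dil: "linear (dil c)"
  unfolding dil_def by (rule linear_lext)

lemma dil_basis: "dil c (basis f) = c ^ verts f *\<^sub>R basis f"
  by (simp add: dil_def)

lemma dil_one: "dil c 1 = 1"
  using dil_basis[of c "{#}"] by simp

lemma dil_mult: "dil c (p * q) = dil c p * dil c q"
  unfolding dil_def
proof (rule lext_mult_pm)
  fix j k :: "'a forest"
  have "basis (j + k) = basis j * (basis k :: 'a hopf)" by (simp add: mult_single)
  then show "c ^ verts (j + k) *\<^sub>R basis (j + k) = (c ^ verts j *\<^sub>R basis j) * (c ^ verts k *\<^sub>R (basis k :: 'a hopf))"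
    by (simp only: verts_add power_add pm_scaleR_left pm_scaleR_right scaleR_scaleR mult.commute)
qed

lemma dil_graft: "dil c (graft a p) = c *\<^sub>R graft a (dil c p)"
proof (rule linear_eq_on_basis[OF linear_compose'[OF linear_graft linear_dil]])
  show "linear (\<lambda>p. c *\<^sub>R graft a (dil c p))"
    by (rule linear_compose_scale_right[OF linear_compose'[OF linear_dil linear_graft]])
qed (simp add: dil_basis linear_scale[OF linear_graft] verts_single)

lemma evc_dil: "evc (\<lambda>\<tau>. c ^ tree_verts \<tau> * \<xi> \<tau>) p = evc \<xi> (dil c p)"
proof (rule linear_eq_on_basis[OF linear_evc linear_compose'[OF linear_dil linear_evc]])
  fix f
  have "\<Prod>\<^sub># (image_mset (\<lambda>\<tau>. c ^ tree_verts \<tau> * \<xi> \<tau>) f) = c ^ verts f * \<Prod>\<^sub># (image_mset \<xi> f)"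
    by (induction f) (simp_all add: verts_add_mset power_add)
  then show "evc (\<lambda>\<tau>. c ^ tree_verts \<tau> * \<xi> \<tau>) (basis f) = evc \<xi> (dil c (basis f))"
    by (simp add: dil_basis evc_basis linear_scale[OF linear_evc])
qed

lemma Qt_dil: "dil c (Qt (\<lambda>\<tau>. c ^ tree_verts \<tau> * \<xi> \<tau>) \<tau>) = c ^ tree_verts \<tau> *\<^sub>R Qt \<xi> \<tau>"
proof (induction \<tau>)
  case (Node a f)
  have "dil c (Qf (\<lambda>\<tau>. c ^ tree_verts \<tau> * \<xi> \<tau>) f) = (\<Prod>t\<in>#f. c ^ tree_verts t *\<^sub>R Qt \<xi> t)"
    unfolding Qf_def prod_mset_hom[of "dil c", OF dil_one dil_mult]
    by (rule arg_cong[where f = prod_mset], rule image_mset_cong) (rule Node)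
  also have "\<dots> = c ^ verts f *\<^sub>R Qf \<xi> f"
    unfolding Qf_def by (induction f) (simp_all add: verts_add_mset power_add pm_scaleR_left pm_scaleR_right)
  finally show ?case
    by (simp add: Qt_Node linear_add[OF linear_dil] linear_scale[OF linear_dil] dil_one dil_graft
        linear_scale[OF linear_graft] scaleR_add_right)
qed

text \<open>
  With time and space units chosen so that the bounds \<open>A / M ^ k\<close> become \<open>1\<close>, an elementary differential with
  \<open>n\<close> vertices changes by \<open>(A / M) ^ n\<close> and one space unit.
\<close>

lemma cT_scaled:
  assumes "A \<noteq> 0" "M \<noteq> 0" and D': "\<And>k a z. D' k a z = M ^ k / A * D k a (M * z)"
  shows "cT D (M * z) \<tau> = (A / M) ^ tree_verts \<tau> * M * cT D' z \<tau>"
proof (induction \<tau>)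
  case (Node a f)
  have "image_mset (cT D (M * z)) f = image_mset (\<lambda>t. (A / M) ^ tree_verts t * M * cT D' z t) f"
    by (rule image_mset_cong) (rule Node)
  then have "\<Prod>\<^sub># (image_mset (cT D (M * z)) f) = (\<Prod>t\<in>#f. (A / M) ^ tree_verts t * M * cT D' z t)" by simp
  also have "\<dots> = (A / M) ^ verts f * M ^ size f * \<Prod>\<^sub># (image_mset (cT D' z) f)"
    by (induction f) (simp_all add: verts_add_mset power_add)
  finally show ?case
    using assms(1,2) by (simp add: cF_def D'[of "size f" a z] field_simps)
qed

lemma PP_scaled:
  assumes "A \<noteq> 0" "M \<noteq> 0" and D': "\<And>k a z. D' k a z = M ^ k / A * D k a (M * z)"
  shows "evc \<xi> (PP D N (M * z)) = M * evc (\<lambda>\<tau>. (A / M) ^ tree_verts \<tau> * \<xi> \<tau>) (PP D' N z)"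
  unfolding evc_PP sum_distrib_left
  by (rule sum.cong) (simp_all add: cT_scaled[OF assms(1,2), of D' D, OF D'])

lemma jets_scaled:
  assumes "jets N D" and D': "\<And>k a z. D' k a z = M ^ k / A * D k a (M * z)"
  shows "jets N D'"
  unfolding jets_def
proof (intro allI impI)
  fix k a z assume k: "k < N"
  have "((\<lambda>z. D k a (M * z)) has_real_derivative D (Suc k) a (M * z) * M) (at z)"
    by (rule DERIV_chain2[OF jetsD[OF assms(1) k]]) (auto intro!: derivative_eq_intros)
  from DERIV_cmult[OF this, of "M ^ k / A"]
  show "(D' k a has_real_derivative D' (Suc k) a z) (at z)"
    unfolding D'[abs_def] by (simp add: mult_ac)
qed

text \<open>
  The constant does not depend on \<open>A\<close> and \<open>M\<close>: everything is reduced to bounds by \<open>1\<close> through the change of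
  variable \<open>z \<mapsto> z / M\<close>, and only the ratio \<open>A / M\<close> enters, through \<open>\<epsilon>\<close>.
\<close>

theorem almost_flow_scaled:
  fixes N :: nat
  assumes "N \<ge> 1"
  obtains C where "C \<ge> 1"
    "\<And>(D :: nat \<Rightarrow> 'd::finite \<Rightarrow> real \<Rightarrow> real) \<xi> y y' x A M \<epsilon>. \<lbrakk>jets N D; A > 0; M > 0;
      \<And>k a z. k \<le> N \<Longrightarrow> \<bar>z - x\<bar> \<le> R * M \<Longrightarrow> \<bar>D k a z\<bar> \<le> A / M ^ k; 0 \<le> \<epsilon>; \<epsilon> \<le> 1;
      \<And>\<tau>. tree_verts \<tau> \<le> N \<Longrightarrow> \<bar>\<xi> \<tau>\<bar> \<le> (\<epsilon> * M / A) ^ tree_verts \<tau>; \<bar>y - x\<bar> \<le> R * M; \<bar>y' - x\<bar> \<le> R * M\<rbrakk>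
      \<Longrightarrow> \<bar>evc \<xi> (PP D N y)\<bar> \<le> C * M * \<epsilon> \<and> \<bar>evc \<xi> (PP D N y) - evc \<xi> (PP D N y')\<bar> \<le> C * \<epsilon> * \<bar>y - y'\<bar>"
    "\<And>(D :: nat \<Rightarrow> 'd::finite \<Rightarrow> real \<Rightarrow> real) \<xi> \<xi>2 \<xi>12 y A M \<epsilon>. \<lbrakk>jets N D; A > 0; M > 0;
      \<And>k a z. k \<le> N \<Longrightarrow> \<bar>z - y\<bar> \<le> M \<Longrightarrow> \<bar>D k a z\<bar> \<le> A / M ^ k; 0 \<le> \<epsilon>; \<epsilon> \<le> 1;
      \<bar>evc \<xi> (PP D N y)\<bar> \<le> M;
      \<And>\<tau>. tree_verts \<tau> \<le> N \<Longrightarrow> \<bar>\<xi> \<tau>\<bar> \<le> (\<epsilon> * M / A) ^ tree_verts \<tau>;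
      \<And>\<tau>. tree_verts \<tau> \<le> N \<Longrightarrow> \<bar>\<xi>2 \<tau>\<bar> \<le> (\<epsilon> * M / A) ^ tree_verts \<tau>;
      \<And>\<tau>. tree_verts \<tau> \<le> N \<Longrightarrow> \<xi>12 \<tau> = evc \<xi>2 (Qt \<xi> \<tau>)\<rbrakk>
      \<Longrightarrow> \<bar>evc \<xi> (PP D N y) + evc \<xi>2 (PP D N (y + evc \<xi> (PP D N y))) - evc \<xi>12 (PP D N y)\<bar> \<le> C * M * \<epsilon> ^ Suc N"
proof -
  show ?thesis
  proof (rule step_bounds[where ?'d = 'd, of N 1 1])
  fix C1 assume C1: "C1 \<ge> 0" "\<And>(D :: nat \<Rightarrow> 'd \<Rightarrow> real \<Rightarrow> real) \<xi> I \<epsilon> z z'. \<lbrakk>jets N D; convex I;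
      \<And>k a z. k \<le> N \<Longrightarrow> z \<in> I \<Longrightarrow> \<bar>D k a z\<bar> \<le> 1; 0 \<le> \<epsilon>; \<epsilon> \<le> 1;
      \<And>\<tau>. tree_verts \<tau> \<le> N \<Longrightarrow> \<bar>\<xi> \<tau>\<bar> \<le> \<epsilon> ^ tree_verts \<tau>; z \<in> I; z' \<in> I\<rbrakk>
      \<Longrightarrow> \<bar>evc \<xi> (PP D N z)\<bar> \<le> C1 * \<epsilon> \<and> \<bar>evc \<xi> (PP D N z) - evc \<xi> (PP D N z')\<bar> \<le> C1 * \<epsilon> * \<bar>z - z'\<bar>"
  show ?thesis
  proof (rule almost_flow_point[where ?'d = 'd, OF assms, of 1 1])
  fix C2 assume C2: "C2 \<ge> 0" "\<And>(D :: nat \<Rightarrow> 'd \<Rightarrow> real \<Rightarrow> real) \<xi> \<xi>2 \<xi>12 y \<epsilon>. \<lbrakk>jets N D;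
      \<And>k a z. k \<le> N \<Longrightarrow> \<bar>z - y\<bar> \<le> \<bar>evc \<xi> (PP D N y)\<bar> \<Longrightarrow> \<bar>D k a z\<bar> \<le> 1; 0 \<le> \<epsilon>; \<epsilon> \<le> 1;
      \<And>\<tau>. tree_verts \<tau> \<le> N \<Longrightarrow> \<bar>\<xi> \<tau>\<bar> \<le> \<epsilon> ^ tree_verts \<tau>;
      \<And>\<tau>. tree_verts \<tau> \<le> N \<Longrightarrow> \<bar>\<xi>2 \<tau>\<bar> \<le> \<epsilon> ^ tree_verts \<tau>;
      \<And>\<tau>. tree_verts \<tau> \<le> N \<Longrightarrow> \<xi>12 \<tau> = evc \<xi>2 (Qt \<xi> \<tau>)\<rbrakk>
      \<Longrightarrow> \<bar>evc \<xi> (PP D N y) + evc \<xi>2 (PP D N (y + evc \<xi> (PP D N y))) - evc \<xi>12 (PP D N y)\<bar> \<le> C2 * \<epsilon> ^ Suc N"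
  let ?C = "max 1 (max C1 C2)"
  have xi': "\<bar>(A / M) ^ tree_verts \<tau> * \<xi> \<tau>\<bar> \<le> \<epsilon> ^ tree_verts \<tau>"
    if "A > 0" "M > 0" "\<bar>\<xi> \<tau>\<bar> \<le> (\<epsilon> * M / A) ^ tree_verts \<tau>" for A M \<epsilon> :: real and \<xi> and \<tau> :: "'d rtree"
  proof -
    have "\<bar>(A / M) ^ tree_verts \<tau> * \<xi> \<tau>\<bar> = (A / M) ^ tree_verts \<tau> * \<bar>\<xi> \<tau>\<bar>"
      using that by (simp add: abs_mult)
    also have "\<dots> \<le> (A / M) ^ tree_verts \<tau> * (\<epsilon> * M / A) ^ tree_verts \<tau>"
      using that by (intro mult_left_mono) auto
    also have "\<dots> = \<epsilon> ^ tree_verts \<tau>"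
      using that by (simp flip: power_mult_distrib)
    finally show ?thesis .
  qed
  show ?thesis
  proof (rule that[of ?C])
    fix D :: "nat \<Rightarrow> 'd \<Rightarrow> real \<Rightarrow> real" and \<xi> :: "'d rtree \<Rightarrow> real" and y y' x A M \<epsilon> :: real
    assume j: "jets N D" and A: "A > 0" and M: "M > 0"
      and bd: "\<And>k a z. k \<le> N \<Longrightarrow> \<bar>z - x\<bar> \<le> R * M \<Longrightarrow> \<bar>D k a z\<bar> \<le> A / M ^ k" and e: "0 \<le> \<epsilon>" "\<epsilon> \<le> 1"
      and xi: "\<And>\<tau>. tree_verts \<tau> \<le> N \<Longrightarrow> \<bar>\<xi> \<tau>\<bar> \<le> (\<epsilon> * M / A) ^ tree_verts \<tau>"
      and y: "\<bar>y - x\<bar> \<le> R * M" "\<bar>y' - x\<bar> \<le> R * M"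
    define D' where "D' = (\<lambda>k a z. M ^ k / A * D k a (M * z))"
    have D': "D' k a z = M ^ k / A * D k a (M * z)" for k a z by (simp add: D'_def)
    have b': "\<bar>D' k a z\<bar> \<le> 1" if "k \<le> N" "z \<in> cball (x / M) R" for k a z
    proof -
      have "\<bar>M * z - x\<bar> = M * \<bar>z - x / M\<bar>" using M by (simp add: abs_if field_simps)
      also have "\<dots> \<le> R * M" using that(2) M by (simp add: dist_real_def abs_minus_commute mult.commute)
      finally have "\<bar>D k a (M * z)\<bar> \<le> A / M ^ k" by (rule bd[OF that(1)])
      then have "M ^ k / A * \<bar>D k a (M * z)\<bar> \<le> M ^ k / A * (A / M ^ k)"
        using A M by (intro mult_left_mono) auto
      then show ?thesis using A M by (simp add: D' abs_mult)
    qed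
    have in': "z / M \<in> cball (x / M) R" if "\<bar>z - x\<bar> \<le> R * M" for z
    proof -
      have "dist (x / M) (z / M) = \<bar>z - x\<bar> / M" using M by (simp add: dist_real_def diff_divide_distrib[symmetric] abs_minus_commute)
      then show ?thesis using that M by (simp add: divide_le_eq)
    qed
    note sc = PP_scaled[of A M D' D, OF _ _ D']
    have eq: "evc \<xi> (PP D N z) = M * evc (\<lambda>\<tau>. (A / M) ^ tree_verts \<tau> * \<xi> \<tau>) (PP D' N (z / M))" for z
      using sc[of \<xi> N "z / M"] A M by simp
    have *: "\<bar>evc (\<lambda>\<tau>. (A / M) ^ tree_verts \<tau> * \<xi> \<tau>) (PP D' N (y / M))\<bar> \<le> C1 * \<epsilon> \<and>
        \<bar>evc (\<lambda>\<tau>. (A / M) ^ tree_verts \<tau> * \<xi> \<tau>) (PP D' N (y / M)) - evc (\<lambda>\<tau>. (A / M) ^ tree_verts \<tau> * \<xi> \<tau>) (PP D' N (y' / M))\<bar>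
        \<le> C1 * \<epsilon> * \<bar>y / M - y' / M\<bar>"
      by (rule C1(2)[OF jets_scaled[OF j D'] convex_cball b' e]) (use xi' A M xi in' y in auto)
    have c: "C1 * \<epsilon> \<le> ?C * \<epsilon>" using e by (intro mult_right_mono) auto
    have "\<bar>evc \<xi> (PP D N y)\<bar> \<le> M * (C1 * \<epsilon>)"
      unfolding eq using * M by (simp add: abs_mult)
    also have "\<dots> \<le> M * (?C * \<epsilon>)" using c M by simp
    finally have 1: "\<bar>evc \<xi> (PP D N y)\<bar> \<le> ?C * M * \<epsilon>" by (simp add: mult_ac)
    have "\<bar>evc \<xi> (PP D N y) - evc \<xi> (PP D N y')\<bar> \<le> M * (C1 * \<epsilon> * \<bar>y / M - y' / M\<bar>)"
      unfolding eq right_diff_distrib[symmetric] abs_mult using * M by simp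
    also have "\<dots> = C1 * \<epsilon> * \<bar>y - y'\<bar>"
      using M by (simp add: diff_divide_distrib[symmetric])
    also have "\<dots> \<le> ?C * \<epsilon> * \<bar>y - y'\<bar>" by (rule mult_right_mono[OF c]) simp
    finally show "\<bar>evc \<xi> (PP D N y)\<bar> \<le> ?C * M * \<epsilon> \<and> \<bar>evc \<xi> (PP D N y) - evc \<xi> (PP D N y')\<bar> \<le> ?C * \<epsilon> * \<bar>y - y'\<bar>"
      using 1 by blast
  next
    fix D :: "nat \<Rightarrow> 'd \<Rightarrow> real \<Rightarrow> real" and \<xi> \<xi>2 \<xi>12 :: "'d rtree \<Rightarrow> real" and y A M \<epsilon> :: real
    assume j: "jets N D" and A: "A > 0" and M: "M > 0"
      and bd: "\<And>k a z. k \<le> N \<Longrightarrow> \<bar>z - y\<bar> \<le> M \<Longrightarrow> \<bar>D k a z\<bar> \<le> A / M ^ k" and e: "0 \<le> \<epsilon>" "\<epsilon> \<le> 1"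
      and le: "\<bar>evc \<xi> (PP D N y)\<bar> \<le> M"
      and xi: "\<And>\<tau>. tree_verts \<tau> \<le> N \<Longrightarrow> \<bar>\<xi> \<tau>\<bar> \<le> (\<epsilon> * M / A) ^ tree_verts \<tau>"
      and xi2: "\<And>\<tau>. tree_verts \<tau> \<le> N \<Longrightarrow> \<bar>\<xi>2 \<tau>\<bar> \<le> (\<epsilon> * M / A) ^ tree_verts \<tau>"
      and conv: "\<And>\<tau>. tree_verts \<tau> \<le> N \<Longrightarrow> \<xi>12 \<tau> = evc \<xi>2 (Qt \<xi> \<tau>)"
    define D' where "D' = (\<lambda>k a z. M ^ k / A * D k a (M * z))"
    have D': "D' k a z = M ^ k / A * D k a (M * z)" for k a z by (simp add: D'_def)
    note sc = PP_scaled[of A M D' D, OF _ _ D']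
    have eq: "evc \<zeta> (PP D N z) = M * evc (\<lambda>\<tau>. (A / M) ^ tree_verts \<tau> * \<zeta> \<tau>) (PP D' N (z / M))" for z \<zeta>
      using sc[of \<zeta> N "z / M"] A M by simp
    let ?s = "\<lambda>(\<zeta> :: 'd rtree \<Rightarrow> real) \<tau>. (A / M) ^ tree_verts \<tau> * \<zeta> \<tau>"
    let ?d = "evc (?s \<xi>) (PP D' N (y / M))"
    have le': "\<bar>?d\<bar> \<le> 1" using le M unfolding eq[of \<xi>] abs_mult by simp
    have b': "\<bar>D' k a z\<bar> \<le> 1" if "k \<le> N" "\<bar>z - y / M\<bar> \<le> \<bar>?d\<bar>" for k a z
    proof -
      have "\<bar>M * z - y\<bar> = M * \<bar>z - y / M\<bar>" using M by (simp add: abs_if field_simps)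
      also have "\<dots> \<le> M * 1" using that(2) le' M by (intro mult_left_mono) auto
      finally have "\<bar>D k a (M * z)\<bar> \<le> A / M ^ k" using bd[OF that(1)] by simp
      then have "M ^ k / A * \<bar>D k a (M * z)\<bar> \<le> M ^ k / A * (A / M ^ k)"
        using A M by (intro mult_left_mono) auto
      then show ?thesis using A M by (simp add: D' abs_mult)
    qed
    have conv': "?s \<xi>12 \<tau> = evc (?s \<xi>2) (Qt (?s \<xi>) \<tau>)" if "tree_verts \<tau> \<le> N" for \<tau>
      unfolding evc_dil Qt_dil linear_scale[OF linear_evc] using conv[OF that] by simp
    have *: "\<bar>?d + evc (?s \<xi>2) (PP D' N (y / M + ?d)) - evc (?s \<xi>12) (PP D' N (y / M))\<bar> \<le> C2 * \<epsilon> ^ Suc N"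
      by (rule C2(2)[OF jets_scaled[OF j D'] b' e]) (use xi' A M xi xi2 conv' in auto)
    have "(y + M * ?d) / M = y / M + ?d" using M by (simp add: add_divide_distrib)
    then have "evc \<xi> (PP D N y) + evc \<xi>2 (PP D N (y + evc \<xi> (PP D N y))) - evc \<xi>12 (PP D N y)
        = M * (?d + evc (?s \<xi>2) (PP D' N (y / M + ?d)) - evc (?s \<xi>12) (PP D' N (y / M)))"
      by (simp add: eq algebra_simps)
    then have "\<bar>evc \<xi> (PP D N y) + evc \<xi>2 (PP D N (y + evc \<xi> (PP D N y))) - evc \<xi>12 (PP D N y)\<bar> \<le> M * (C2 * \<epsilon> ^ Suc N)"
      using * M by (simp only: abs_mult) simp
    also have "\<dots> \<le> M * (?C * \<epsilon> ^ Suc N)"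
      using M e by (intro mult_left_mono mult_right_mono) auto
    finally show "\<bar>evc \<xi> (PP D N y) + evc \<xi>2 (PP D N (y + evc \<xi> (PP D N y))) - evc \<xi>12 (PP D N y)\<bar> \<le> ?C * M * \<epsilon> ^ Suc N"
      by (simp add: mult_ac)
  qed simp
  qed
  qed
qed

section \<open>Second differences\<close>

definition C2 :: "(real \<Rightarrow> real) \<Rightarrow> bool" where
  "C2 u \<longleftrightarrow> (\<exists>u1 u2. (\<forall>x. (u has_real_derivative u1 x) (at x)) \<and>
     (\<forall>x. (u1 has_real_derivative u2 x) (at x)) \<and> continuous_on UNIV u2)"

lemma DERIV_continuous_on_UNIV: "(\<And>x. (f has_real_derivative f' x) (at x)) \<Longrightarrow> continuous_on UNIV f"
  by (meson DERIV_continuous continuous_at_imp_continuous_on)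

lemma C2_const: "C2 (\<lambda>x. c)"
  unfolding C2_def by (rule exI[of _ "\<lambda>_. 0"], rule exI[of _ "\<lambda>_. 0"]) auto

lemma C2_mult:
  assumes "C2 u" "C2 v"
  shows "C2 (\<lambda>x. u x * v x)"
proof -
  obtain u1 u2 where u: "\<And>x. (u has_real_derivative u1 x) (at x)" "\<And>x. (u1 has_real_derivative u2 x) (at x)"
    "continuous_on UNIV u2" using assms(1) unfolding C2_def by blast
  obtain v1 v2 where v: "\<And>x. (v has_real_derivative v1 x) (at x)" "\<And>x. (v1 has_real_derivative v2 x) (at x)"
    "continuous_on UNIV v2" using assms(2) unfolding C2_def by blast
  note cont = DERIV_continuous_on_UNIV[OF u(1)] DERIV_continuous_on_UNIV[OF u(2)]
    DERIV_continuous_on_UNIV[OF v(1)] DERIV_continuous_on_UNIV[OF v(2)] u(3) v(3)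
  show ?thesis
    unfolding C2_def
  proof (intro exI conjI allI)
    fix x
    show "((\<lambda>x. u x * v x) has_real_derivative u1 x * v x + v1 x * u x) (at x)"
      by (rule DERIV_mult[OF u(1) v(1)])
    show "((\<lambda>x. u1 x * v x + v1 x * u x) has_real_derivative (u2 x * v x + v1 x * u1 x) + (v2 x * u x + u1 x * v1 x)) (at x)"
      by (intro DERIV_add DERIV_mult u v)
    show "continuous_on UNIV (\<lambda>x. (u2 x * v x + v1 x * u1 x) + (v2 x * u x + u1 x * v1 x))"
      by (intro continuous_intros cont)
  qed
qed

lemma C2_prod_mset: "(\<And>t. t \<in># f \<Longrightarrow> C2 (\<lambda>x. g x t)) \<Longrightarrow> C2 (\<lambda>x. \<Prod>\<^sub># (image_mset (g x) f))"
  by (induction f) (auto intro: C2_mult C2_const)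

lemma jets_continuous:
  assumes "jets M D" "\<And>a. continuous_on UNIV (D M a)" "k \<le> M"
  shows "continuous_on UNIV (D k a)"
proof (cases "k = M")
  case False
  show ?thesis by (rule DERIV_continuous_on_UNIV[OF jetsD[OF assms(1)]]) (use assms(3) False in auto)
qed (use assms in auto)

lemma C2_cT:
  assumes "jets (Suc N) D" "\<And>a. continuous_on UNIV (D (Suc N) a)" "tree_verts \<tau> \<le> N"
  shows "C2 (\<lambda>y. cT D y \<tau>)"
  using assms(3)
proof (induction \<tau>)
  case (Node a f)
  have s: "size f < N" using verts_ge_size[of f] Node.prems by simp
  have "C2 (D (size f) a)"
    unfolding C2_def
  proof (intro exI conjI allI)
    show "(D (size f) a has_real_derivative D (Suc (size f)) a x) (at x)" for x
      by (rule jetsD[OF assms(1)]) (use s in simp)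
    show "(D (Suc (size f)) a has_real_derivative D (Suc (Suc (size f))) a x) (at x)" for x
      by (rule jetsD[OF assms(1)]) (use s in simp)
    show "continuous_on UNIV (D (Suc (Suc (size f))) a)"
      by (rule jets_continuous[OF assms(1,2)]) (use s in auto)
  qed
  moreover have "C2 (\<lambda>y. \<Prod>\<^sub># (image_mset (cT D y) f))"
  proof (rule C2_prod_mset)
    fix t assume t: "t \<in># f"
    show "C2 (\<lambda>y. cT D y t)" by (rule Node.IH[OF t]) (use tree_verts_le[OF t] Node.prems in simp)
  qed
  ultimately show ?case
    unfolding cT_Node cF_def by (intro C2_mult C2_const)
qed

lemma continuous_bounded_interval:
  fixes f :: "real \<Rightarrow> real"
  assumes "continuous_on UNIV f"
  obtains B where "B \<ge> 0" "\<And>x. \<bar>x\<bar> \<le> R \<Longrightarrow> \<bar>f x\<bar> \<le> B"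
proof -
  have "bounded (f ` {-R..R})"
    by (rule compact_imp_bounded[OF compact_continuous_image]) (use assms continuous_on_subset in auto)
  then obtain B where B: "\<And>x. x \<in> {-R..R} \<Longrightarrow> norm (f x) \<le> B" unfolding bounded_iff by blast
  show ?thesis
  proof (rule that[of "\<bar>B\<bar>"])
    fix x assume "\<bar>x\<bar> \<le> R"
    then show "\<bar>f x\<bar> \<le> \<bar>B\<bar>" using B[of x] by (simp add: abs_le_iff)
  qed simp
qed

lemma jets_bounded:
  fixes D :: "nat \<Rightarrow> 'd::finite \<Rightarrow> real \<Rightarrow> real"
  assumes "jets M D" "\<And>a. continuous_on UNIV (D M a)"
  obtains B where "B \<ge> 0" "\<And>k a x. k \<le> M \<Longrightarrow> \<bar>x\<bar> \<le> R \<Longrightarrow> \<bar>D k a x\<bar> \<le> B"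
proof -
  have "\<exists>B\<ge>0. \<forall>x. \<bar>x\<bar> \<le> R \<longrightarrow> \<bar>D k a x\<bar> \<le> B" if "k \<le> M" for k a
    using continuous_bounded_interval[OF jets_continuous[OF assms that]] by metis
  then obtain b where b: "\<And>k a. k \<le> M \<Longrightarrow> b k a \<ge> 0" "\<And>k a x. k \<le> M \<Longrightarrow> \<bar>x\<bar> \<le> R \<Longrightarrow> \<bar>D k a x\<bar> \<le> b k a"
    by metis
  let ?B = "\<Sum>k\<le>M. \<Sum>a\<in>UNIV. b k a"
  have le: "b k a \<le> ?B" if "k \<le> M" for k a
  proof -
    have "b k a \<le> (\<Sum>a\<in>UNIV. b k a)" by (rule member_le_sum) (use b that in auto)
    also have "\<dots> \<le> ?B"
      by (rule member_le_sum[of k "{..M}" "\<lambda>k. \<Sum>a\<in>UNIV. b k a"]) (use b that in \<open>auto intro!: sum_nonneg\<close>)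
    finally show ?thesis .
  qed
  show ?thesis
  proof (rule that[of ?B])
    show "?B \<ge> 0" using b by (auto intro!: sum_nonneg)
    fix k a x assume "k \<le> M" "\<bar>x\<bar> \<le> R"
    then show "\<bar>D k a x\<bar> \<le> ?B" using b(2)[of k x a] le[of k a] by linarith
  qed
qed

lemma continuous_cT:
  assumes "jets N D" "\<And>a. continuous_on UNIV (D N a)" "tree_verts \<tau> \<le> N"
  shows "continuous_on UNIV (\<lambda>y. cT D y \<tau>)"
  using assms(3)
proof (induction \<tau>)
  case (Node a f)
  have "continuous_on UNIV (\<lambda>y. \<Prod>\<^sub># (image_mset (cT D y) f))"
  proof -
    have c: "continuous_on UNIV (\<lambda>y. cT D y t)" if "t \<in># f" for t
      by (rule Node.IH[OF that]) (use tree_verts_le[OF that] Node.prems in simp)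
    show ?thesis using c by (induction f) (auto intro!: continuous_intros)
  qed
  moreover have "continuous_on UNIV (D (size f) a)"
    by (rule jets_continuous[OF assms(1,2)]) (use verts_ge_size[of f] Node.prems in simp)
  ultimately show ?case
    unfolding cT_Node cF_def by (intro continuous_intros)
qed

lemma cT_bounded:
  fixes D :: "nat \<Rightarrow> 'd::finite \<Rightarrow> real \<Rightarrow> real"
  assumes "jets N D" "\<And>a. continuous_on UNIV (D N a)"
  obtains b where "\<And>\<tau>. tree_verts \<tau> \<le> N \<Longrightarrow> b \<tau> \<ge> 0"
    "\<And>\<tau> y. tree_verts \<tau> \<le> N \<Longrightarrow> \<bar>y\<bar> \<le> K \<Longrightarrow> \<bar>cT D y \<tau>\<bar> \<le> b \<tau>"
proof -
  have "\<exists>b\<ge>0. \<forall>y. \<bar>y\<bar> \<le> K \<longrightarrow> \<bar>cT D y \<tau>\<bar> \<le> b" if "tree_verts \<tau> \<le> N" for \<tau>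
    using continuous_bounded_interval[OF continuous_cT[OF assms that]] by metis
  then show ?thesis using that by metis
qed

text \<open>
  The mean value theorem twice: \<open>u (a + r) - u (a + q)\<close> is controlled by the first derivative, and what remains is
  a second difference in the directions \<open>q\<close> and \<open>a - b\<close>.
\<close>

lemma four_point:
  assumes "C2 u"
  obtains B where "B \<ge> 0" "\<And>a b q r. \<lbrakk>\<bar>a\<bar> \<le> R; \<bar>b\<bar> \<le> R; \<bar>a + r\<bar> \<le> R; \<bar>a + q\<bar> \<le> R; \<bar>b + q\<bar> \<le> R\<rbrakk>
    \<Longrightarrow> \<bar>u (a + r) - u a - u (b + q) + u b\<bar> \<le> B * (\<bar>r - q\<bar> + \<bar>q\<bar> * \<bar>a - b\<bar>)"
proof -
  obtain u1 u2 where u: "\<And>x. (u has_real_derivative u1 x) (at x)" "\<And>x. (u1 has_real_derivative u2 x) (at x)"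
    "continuous_on UNIV u2" using assms(1) unfolding C2_def by blast
  obtain B1 where B1: "B1 \<ge> 0" "\<And>x. \<bar>x\<bar> \<le> R \<Longrightarrow> \<bar>u1 x\<bar> \<le> B1"
    using continuous_bounded_interval[OF DERIV_continuous_on_UNIV[OF u(2)]] by metis
  obtain B2 where B2: "B2 \<ge> 0" "\<And>x. \<bar>x\<bar> \<le> R \<Longrightarrow> \<bar>u2 x\<bar> \<le> B2"
    using continuous_bounded_interval[OF u(3)] by metis
  show ?thesis
  proof (rule that[of "B1 + B2"])
    fix a b q r assume h: "\<bar>a\<bar> \<le> R" "\<bar>b\<bar> \<le> R" "\<bar>a + r\<bar> \<le> R" "\<bar>a + q\<bar> \<le> R" "\<bar>b + q\<bar> \<le> R"
    have 1: "\<bar>u (a + r) - u (a + q)\<bar> \<le> B1 * \<bar>(a + r) - (a + q)\<bar>"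
      by (rule mvt_bound[of "{-R..R}" u u1]) (use u B1 h in auto)
    have 2: "\<bar>(u (a + q) - u a) - (u (b + q) - u b)\<bar> \<le> (B2 * \<bar>q\<bar>) * \<bar>a - b\<bar>"
    proof (rule mvt_bound[of "{min a b..max a b}" "\<lambda>v. u (v + q) - u v" "\<lambda>v. u1 (v + q) - u1 v"])
      fix v assume v: "v \<in> {min a b..max a b}"
      have "((\<lambda>v. u (v + q)) has_real_derivative u1 (v + q)) (at v)"
        using DERIV_shift[of u "u1 (v + q)" v q] u(1) by blast
      then show "((\<lambda>v. u (v + q) - u v) has_real_derivative u1 (v + q) - u1 v) (at v)"
        by (rule DERIV_diff[OF _ u(1)])
      have "\<bar>u1 (v + q) - u1 v\<bar> \<le> B2 * \<bar>(v + q) - v\<bar>"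
        by (rule mvt_bound[of "{-R..R}" u1 u2]) (use u B2 v h in \<open>auto simp: min_def max_def split: if_splits\<close>)
      then show "\<bar>u1 (v + q) - u1 v\<bar> \<le> B2 * \<bar>q\<bar>" by simp
    qed auto
    have "\<bar>u (a + r) - u a - u (b + q) + u b\<bar> \<le> B1 * \<bar>r - q\<bar> + B2 * (\<bar>q\<bar> * \<bar>a - b\<bar>)"
      using 1 2 by (simp add: mult.assoc)
    also have "\<dots> \<le> (B1 + B2) * (\<bar>r - q\<bar> + \<bar>q\<bar> * \<bar>a - b\<bar>)"
      using B1(1) B2(1) by (simp add: algebra_simps)
    finally show "\<bar>u (a + r) - u a - u (b + q) + u b\<bar> \<le> (B1 + B2) * (\<bar>r - q\<bar> + \<bar>q\<bar> * \<bar>a - b\<bar>)" .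
  qed (use B1 B2 in auto)
qed

lemma four_point_PP:
  fixes D :: "nat \<Rightarrow> 'd::finite \<Rightarrow> real \<Rightarrow> real"
  assumes "jets (Suc N) D" "\<And>a. continuous_on UNIV (D (Suc N) a)"
  obtains B where "B \<ge> 0" "\<And>\<xi> \<epsilon> a b q r. \<lbrakk>0 \<le> \<epsilon>; \<epsilon> \<le> 1;
      \<And>\<tau>. tree_verts \<tau> \<le> N \<Longrightarrow> \<bar>\<xi> \<tau>\<bar> \<le> \<epsilon> ^ tree_verts \<tau>;
      \<bar>a\<bar> \<le> R; \<bar>b\<bar> \<le> R; \<bar>a + r\<bar> \<le> R; \<bar>a + q\<bar> \<le> R; \<bar>b + q\<bar> \<le> R\<rbrakk>
    \<Longrightarrow> \<bar>evc \<xi> (PP D N (a + r)) - evc \<xi> (PP D N a) - evc \<xi> (PP D N (b + q)) + evc \<xi> (PP D N b)\<bar>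
      \<le> B * \<epsilon> * (\<bar>r - q\<bar> + \<bar>q\<bar> * \<bar>a - b\<bar>)"
proof -
  let ?T = "{\<tau> :: 'd rtree. tree_verts \<tau> \<le> N}"
  let ?u = "\<lambda>\<tau> y. cT D y \<tau>"
  have "\<exists>B\<ge>0. \<forall>a b q r. \<bar>a\<bar> \<le> R \<longrightarrow> \<bar>b\<bar> \<le> R \<longrightarrow> \<bar>a + r\<bar> \<le> R \<longrightarrow> \<bar>a + q\<bar> \<le> R \<longrightarrow> \<bar>b + q\<bar> \<le> R \<longrightarrow>
      \<bar>?u \<tau> (a + r) - ?u \<tau> a - ?u \<tau> (b + q) + ?u \<tau> b\<bar> \<le> B * (\<bar>r - q\<bar> + \<bar>q\<bar> * \<bar>a - b\<bar>)"
    if "tree_verts \<tau> \<le> N" for \<tau>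
    using four_point[OF C2_cT[OF assms that], of R] by metis
  then obtain c where c: "\<And>\<tau>. tree_verts \<tau> \<le> N \<Longrightarrow> c \<tau> \<ge> 0"
    "\<And>\<tau> a b q r. \<lbrakk>tree_verts \<tau> \<le> N; \<bar>a\<bar> \<le> R; \<bar>b\<bar> \<le> R; \<bar>a + r\<bar> \<le> R; \<bar>a + q\<bar> \<le> R; \<bar>b + q\<bar> \<le> R\<rbrakk> \<Longrightarrow>
      \<bar>?u \<tau> (a + r) - ?u \<tau> a - ?u \<tau> (b + q) + ?u \<tau> b\<bar> \<le> c \<tau> * (\<bar>r - q\<bar> + \<bar>q\<bar> * \<bar>a - b\<bar>)"
    by metis
  show ?thesis
  proof (rule that[of "\<Sum>\<tau>\<in>?T. c \<tau>"])
    show "(\<Sum>\<tau>\<in>?T. c \<tau>) \<ge> 0" using c(1) by (auto intro!: sum_nonneg)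
    fix \<xi> :: "'d rtree \<Rightarrow> real" and \<epsilon> a b q r :: real
    assume e: "0 \<le> \<epsilon>" "\<epsilon> \<le> 1" and xi: "\<And>\<tau>. tree_verts \<tau> \<le> N \<Longrightarrow> \<bar>\<xi> \<tau>\<bar> \<le> \<epsilon> ^ tree_verts \<tau>"
      and R: "\<bar>a\<bar> \<le> R" "\<bar>b\<bar> \<le> R" "\<bar>a + r\<bar> \<le> R" "\<bar>a + q\<bar> \<le> R" "\<bar>b + q\<bar> \<le> R"
    let ?z = "\<bar>r - q\<bar> + \<bar>q\<bar> * \<bar>a - b\<bar>"
    have eq: "evc \<xi> (PP D N (a + r)) - evc \<xi> (PP D N a) - evc \<xi> (PP D N (b + q)) + evc \<xi> (PP D N b)
        = (\<Sum>\<tau>\<in>?T. (?u \<tau> (a + r) - ?u \<tau> a - ?u \<tau> (b + q) + ?u \<tau> b) * \<xi> \<tau>)"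
      unfolding evc_PP by (simp add: sum_subtractf sum.distrib algebra_simps)
    have "\<bar>\<Sum>\<tau>\<in>?T. (?u \<tau> (a + r) - ?u \<tau> a - ?u \<tau> (b + q) + ?u \<tau> b) * \<xi> \<tau>\<bar> \<le> (\<Sum>\<tau>\<in>?T. (c \<tau> * ?z) * \<epsilon>)"
    proof (rule order.trans[OF sum_abs], rule sum_mono)
      fix \<tau> assume "\<tau> \<in> ?T"
      then have t: "tree_verts \<tau> \<le> N" by simp
      have "\<epsilon> ^ tree_verts \<tau> \<le> \<epsilon> ^ 1"
        using e tree_verts_pos[of \<tau>] by (intro power_decreasing) auto
      then have "\<bar>\<xi> \<tau>\<bar> \<le> \<epsilon>" using xi[OF t] by simp
      then show "\<bar>(?u \<tau> (a + r) - ?u \<tau> a - ?u \<tau> (b + q) + ?u \<tau> b) * \<xi> \<tau>\<bar> \<le> (c \<tau> * ?z) * \<epsilon>"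
        unfolding abs_mult by (rule mult_mono[OF c(2)[OF t R]]) (auto intro: mult_nonneg_nonneg c(1)[OF t])
    qed
    also have "\<dots> = (\<Sum>\<tau>\<in>?T. c \<tau> * (\<epsilon> * ?z))"
      by (rule sum.cong[OF refl]) (simp only: mult_ac)
    also have "\<dots> = (\<Sum>\<tau>\<in>?T. c \<tau>) * \<epsilon> * ?z"
      by (simp only: sum_distrib_right mult.assoc)
    finally show "\<bar>evc \<xi> (PP D N (a + r)) - evc \<xi> (PP D N a) - evc \<xi> (PP D N (b + q)) + evc \<xi> (PP D N b)\<bar>
      \<le> (\<Sum>\<tau>\<in>?T. c \<tau>) * \<epsilon> * ?z" unfolding eq .
  qed
qed

section \<open>Discrete sewing\<close>

text \<open>
  The factor by which \<open>x powr \<theta> + (1 - x) powr \<theta>\<close> is bounded for \<open>x\<close> between \<open>1 / 3\<close> and \<open>2 / 3\<close>; splitting an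
  interval of grid points into two nearly equal halves always lands in that range.
\<close>

definition sew_ratio :: "real \<Rightarrow> real" where
  "sew_ratio \<theta> = (1 / 3) powr \<theta> + (2 / 3) powr \<theta>"

lemma sew_ratio_less: "\<theta> > 1 \<Longrightarrow> sew_ratio \<theta> < 1"
proof -
  assume t: "\<theta> > 1"
  have "(1 / 3 :: real) powr \<theta> < (1 / 3) powr 1" "(2 / 3 :: real) powr \<theta> < (2 / 3) powr 1"
    using t by (intro powr_less_mono'; simp)+
  then show ?thesis by (simp add: sew_ratio_def)
qed

lemma sew_ratio_pos: "sew_ratio \<theta> > 0"
  by (simp add: sew_ratio_def add_pos_pos)

lemma sew_ratio_split:
  assumes "\<theta> > 1" "1 / 3 \<le> x" "x \<le> 2 / 3"
  shows "x powr \<theta> + (1 - x) powr \<theta> \<le> sew_ratio \<theta>"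
proof -
  note cv = powr_convex[of \<theta>]
  let ?l = "3 * x - 1"
  have l: "0 \<le> ?l" "?l \<le> 1" using assms by auto
  have 1: "((1 - ?l) *\<^sub>R (1 / 3) + ?l *\<^sub>R (2 / 3)) powr \<theta> \<le> (1 - ?l) * (1 / 3) powr \<theta> + ?l * (2 / 3) powr \<theta>"
    by (rule convex_onD[OF cv]) (use assms l in auto)
  have 2: "((1 - ?l) *\<^sub>R (2 / 3) + ?l *\<^sub>R (1 / 3)) powr \<theta> \<le> (1 - ?l) * (2 / 3) powr \<theta> + ?l * (1 / 3) powr \<theta>"
    by (rule convex_onD[OF cv]) (use assms l in auto)
  have "(1 - ?l) *\<^sub>R (1 / 3) + ?l *\<^sub>R (2 / 3) = x" "(1 - ?l) *\<^sub>R (2 / 3) + ?l *\<^sub>R (1 / 3) = 1 - x"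
    by (simp_all add: field_simps)
  then show ?thesis using 1 2 unfolding sew_ratio_def by (simp add: algebra_simps)
qed

lemma sew_ratio_nat:
  assumes "\<theta> > 1" "m \<ge> 2" "h \<ge> 0"
  shows "(real (m div 2) * h) powr \<theta> + (real (m - m div 2) * h) powr \<theta> \<le> sew_ratio \<theta> * (real m * h) powr \<theta>"
proof -
  let ?x = "real (m div 2) / real m"
  have m: "real m > 0" using assms by simp
  have n: "m \<le> 3 * (m div 2)" "3 * (m div 2) \<le> 2 * m" using assms(2) by presburger+
  have "real m \<le> 3 * real (m div 2)" "3 * real (m div 2) \<le> 2 * real m"
    using n[THEN of_nat_mono[where 'a = real]] by simp_all
  then have "1 / 3 \<le> ?x" "?x \<le> 2 / 3" using m by (simp_all add: field_simps)
  then have *: "?x powr \<theta> + (1 - ?x) powr \<theta> \<le> sew_ratio \<theta>" by (rule sew_ratio_split[OF assms(1)])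
  have e: "real (m div 2) * h = ?x * (real m * h)" "real (m - m div 2) * h = (1 - ?x) * (real m * h)"
    using m by (simp_all add: field_simps of_nat_diff)
  have "(real (m div 2) * h) powr \<theta> + (real (m - m div 2) * h) powr \<theta>
      = ?x powr \<theta> * (real m * h) powr \<theta> + (1 - ?x) powr \<theta> * (real m * h) powr \<theta>"
    unfolding e powr_mult[of ?x "real m * h"] powr_mult[of "1 - ?x" "real m * h"] ..
  also have "\<dots> = (?x powr \<theta> + (1 - ?x) powr \<theta>) * (real m * h) powr \<theta>"
    by (simp only: distrib_right)
  also have "\<dots> \<le> sew_ratio \<theta> * (real m * h) powr \<theta>"
    by (rule mult_right_mono[OF *]) simp
  finally show ?thesis .
qed

text \<open>
  Induction on the number of grid intervals, splitting in the middle: the geometric factor \<open>q * sew_ratio \<theta> < 1\<close>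
  absorbs the error of each split. Allowing \<open>q > 1\<close> covers schemes whose steps are only nearly
  isometric.
\<close>

lemma discrete_sewing:
  fixes r :: "nat \<Rightarrow> nat \<Rightarrow> real"
  assumes th: "\<theta> > 1" and q: "q \<ge> 0" "q * sew_ratio \<theta> < 1" and h: "h \<ge> 0" and C: "C \<ge> 0"
    and one: "\<And>i. a \<le> i \<Longrightarrow> i < b \<Longrightarrow> r i (Suc i) \<le> 0"
    and split: "\<And>i j k. a \<le> i \<Longrightarrow> i < j \<Longrightarrow> j < k \<Longrightarrow> k \<le> b \<Longrightarrow>
      r i k \<le> q * (r i j + r j k) + C * (real (k - i) * h) powr \<theta>"
  shows "a \<le> i \<Longrightarrow> i < k \<Longrightarrow> k \<le> b \<Longrightarrow> r i k \<le> C / (1 - q * sew_ratio \<theta>) * (real (k - i) * h) powr \<theta>"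
proof (induction "k - i" arbitrary: i k rule: less_induct)
  case less
  let ?K = "C / (1 - q * sew_ratio \<theta>)"
  have K: "?K \<ge> 0" using C q by simp
  show ?case
  proof (cases "k = Suc i")
    case True
    then show ?thesis using one[of i] less.prems K by (smt (verit) Suc_le_eq mult_nonneg_nonneg powr_ge_zero)
  next
    case False
    let ?m = "k - i"
    let ?j = "i + ?m div 2"
    have m: "?m \<ge> 2" using False less.prems by simp
    have j: "i < ?j" "?j < k" using m by linarith+
    have 1: "r i ?j \<le> ?K * (real (?j - i) * h) powr \<theta>"
      by (rule less.hyps) (use j less.prems in auto)
    have 2: "r ?j k \<le> ?K * (real (k - ?j) * h) powr \<theta>"
      by (rule less.hyps) (use j less.prems in auto)
    have "r i ?j + r ?j k \<le> ?K * ((real (?m div 2) * h) powr \<theta> + (real (?m - ?m div 2) * h) powr \<theta>)"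
      using 1 2 by (simp add: distrib_left)
    also have "\<dots> \<le> ?K * (sew_ratio \<theta> * (real ?m * h) powr \<theta>)"
      by (rule mult_left_mono[OF sew_ratio_nat[OF th m h] K])
    finally have "q * (r i ?j + r ?j k) \<le> q * (?K * (sew_ratio \<theta> * (real ?m * h) powr \<theta>))"
      by (rule mult_left_mono[OF _ q(1)])
    then have "r i k \<le> q * (?K * (sew_ratio \<theta> * (real ?m * h) powr \<theta>)) + C * (real ?m * h) powr \<theta>"
      using split[of i ?j k] j less.prems by linarith
    also have "\<dots> = (?K * (q * sew_ratio \<theta>) + C) * (real ?m * h) powr \<theta>"
      by (simp add: algebra_simps)
    also have "?K * (q * sew_ratio \<theta>) + C = ?K"
      using q(2) by (simp add: field_simps)
    finally show ?thesis .
  qed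
qed

text \<open>
  Tychonoff's theorem for functions into \<open>{-K..K}\<close>. A cluster point rather than a subsequence is obtained, and two times at once suffice in the application.
\<close>

lemma pointwise_cluster:
  fixes F :: "nat \<Rightarrow> real \<Rightarrow> real"
  assumes "\<And>n t. \<bar>F n t\<bar> \<le> K"
  obtains Y where "\<And>t. \<bar>Y t\<bar> \<le> K"
    "\<And>s t e n0. e > 0 \<Longrightarrow> \<exists>n\<ge>n0. \<bar>F n s - Y s\<bar> < e \<and> \<bar>F n t - Y t\<bar> < e"
proof -
  let ?U = "PiE UNIV (\<lambda>_ :: real. {-K..K})"
  have "compactin (product_topology (\<lambda>_ :: real. euclideanreal) UNIV) ?U"
    unfolding compactin_PiE by auto
  then have comp: "compact ?U"
    unfolding euclidean_product_topology compactin_euclidean_iff .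
  have in_U: "F n \<in> ?U" for n using assms[of n] by (auto simp: abs_le_iff minus_le_iff)
  let ?G = "filtermap F sequentially"
  have "?G \<noteq> bot" "eventually (\<lambda>x. x \<in> ?U) ?G"
    using in_U by (simp_all add: filtermap_bot_iff eventually_filtermap)
  then obtain Y where Y: "Y \<in> ?U" "inf (nhds Y) ?G \<noteq> bot"
    using comp unfolding compact_filter by blast
  show ?thesis
  proof (rule that[of Y])
    show "\<bar>Y t\<bar> \<le> K" for t using Y(1) by (auto simp: abs_le_iff minus_le_iff PiE_def Pi_def)
    fix s t e :: real and n0 :: nat assume e: "e > 0"
    have coord: "eventually (\<lambda>g. \<bar>g x - Y x\<bar> < e) (nhds Y)" for x
    proof -
      have "open ((\<lambda>g :: real \<Rightarrow> real. g x) -` ball (Y x) e)"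
        by (rule open_vimage[OF open_ball continuous_on_product_coordinates])
      then have "eventually (\<lambda>g. g \<in> (\<lambda>g. g x) -` ball (Y x) e) (nhds Y)"
        by (rule eventually_nhds_in_open) (use e in simp)
      then show ?thesis
        by (rule eventually_mono) (simp add: dist_real_def abs_minus_commute)
    qed
    have "eventually (\<lambda>g. \<bar>g s - Y s\<bar> < e \<and> \<bar>g t - Y t\<bar> < e) (inf (nhds Y) ?G)"
      using eventually_conj[OF coord[of s] coord[of t]] by (rule filter_leD[OF inf_le1])
    moreover have "eventually (\<lambda>g. \<exists>n\<ge>n0. g = F n) (inf (nhds Y) ?G)"
      by (rule filter_leD[OF inf_le2]) (auto simp: eventually_filtermap eventually_sequentially)
    ultimately have "eventually (\<lambda>g. (\<bar>g s - Y s\<bar> < e \<and> \<bar>g t - Y t\<bar> < e) \<and> (\<exists>n\<ge>n0. g = F n)) (inf (nhds Y) ?G)"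
      by (rule eventually_conj)
    then have "\<exists>g. (\<bar>g s - Y s\<bar> < e \<and> \<bar>g t - Y t\<bar> < e) \<and> (\<exists>n\<ge>n0. g = F n)"
      using eventually_happens Y(2) by fastforce
    then show "\<exists>n\<ge>n0. \<bar>F n s - Y s\<bar> < e \<and> \<bar>F n t - Y t\<bar> < e" by blast
  qed
qed

section \<open>The Euler scheme\<close>

text \<open>
  A rough path in terms of its increments on trees. The constant is put inside the power, so that
  \<open>Cx * (t - s) powr \<gamma>\<close> serves as the size of a time interval.
\<close>

locale rough =
  fixes N :: nat and \<gamma> T Cx :: real and \<xi> :: "real \<Rightarrow> real \<Rightarrow> 'd::finite rtree \<Rightarrow> real"
  assumes N1: "N \<ge> 1" and gam: "\<gamma> > 0" and theta1: "real (Suc N) * \<gamma> > 1" and T0: "T > 0" and Cx0: "Cx > 0"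
    and chen: "\<And>s u t \<tau>. 0 \<le> s \<Longrightarrow> s \<le> u \<Longrightarrow> u \<le> t \<Longrightarrow> t \<le> T \<Longrightarrow> \<xi> s t \<tau> = evc (\<xi> u t) (Qt (\<xi> s u) \<tau>)"
    and diag: "\<And>s \<tau>. 0 \<le> s \<Longrightarrow> s \<le> T \<Longrightarrow> \<xi> s s \<tau> = 0"
    and bnd: "\<And>s t \<tau>. 0 \<le> s \<Longrightarrow> s \<le> t \<Longrightarrow> t \<le> T \<Longrightarrow> tree_verts \<tau> \<le> N \<Longrightarrow>
      \<bar>\<xi> s t \<tau>\<bar> \<le> (Cx * (t - s) powr \<gamma>) ^ tree_verts \<tau>"
begin

definition \<theta> :: real where "\<theta> = real (Suc N) * \<gamma>"

lemma theta: "\<theta> > 1"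
  using theta1 by (simp add: \<theta>_def)

definition step :: "(nat \<Rightarrow> 'd \<Rightarrow> real \<Rightarrow> real) \<Rightarrow> real \<Rightarrow> real \<Rightarrow> real \<Rightarrow> real" where
  "step D s t y = y + evc (\<xi> s t) (PP D N y)"

definition euler :: "(nat \<Rightarrow> 'd \<Rightarrow> real \<Rightarrow> real) \<Rightarrow> real \<Rightarrow> (nat \<Rightarrow> real) \<Rightarrow> nat \<Rightarrow> nat \<Rightarrow> bool" where
  "euler D h Y i0 j \<longleftrightarrow> (\<forall>i. i0 \<le> i \<and> i < j \<longrightarrow> Y (Suc i) = step D (real i * h) (real (Suc i) * h) (Y i))"

lemma eps_power: "(Cx * x powr \<gamma> * c) ^ Suc N = Cx ^ Suc N * c ^ Suc N * x powr \<theta>"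
proof -
  have "(x powr \<gamma>) ^ Suc N = x powr \<theta>"
    by (cases "x = 0") (simp_all add: powr_power \<theta>_def del: power_Suc)
  then show ?thesis by (simp only: power_mult_distrib mult_ac)
qed

lemma bnd_mono:
  assumes "0 \<le> s" "s \<le> t" "t \<le> T" "tree_verts \<tau> \<le> N" "t - s \<le> x"
  shows "\<bar>\<xi> s t \<tau>\<bar> \<le> (Cx * x powr \<gamma>) ^ tree_verts \<tau>"
proof -
  have "Cx * (t - s) powr \<gamma> \<le> Cx * x powr \<gamma>"
    using assms Cx0 gam by (intro mult_left_mono powr_mono2) auto
  then have "(Cx * (t - s) powr \<gamma>) ^ tree_verts \<tau> \<le> (Cx * x powr \<gamma>) ^ tree_verts \<tau>"
    using Cx0 by (intro power_mono) auto
  then show ?thesis using bnd[OF assms(1-4)] by linarith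
qed

text \<open>
  One bootstrap gives both claims. As long as the orbit stays within \<open>M\<close> of its start, sewing applies to the
  deviation from a single large step: a deviation at an intermediate point is propagated with factor at most
  \<open>1 + C * \<kappa>\<close>, close to \<open>1\<close>, and the defect of the almost flow is added. The resulting bound keeps the
  orbit within \<open>M\<close> for one more step, since it is at most \<open>(C + C3) * \<kappa> * M\<close>. Radius \<open>4 * M\<close> leaves room for all
  intermediate points; \<open>\<kappa>\<close> and \<open>C3\<close> do not depend on the vector field.
\<close>

theorem orbit_bounds:
  obtains \<kappa> C3 where "\<kappa> > 0" "C3 \<ge> 0"
    "\<And>D A M h Y i0 j. \<lbrakk>jets N D; A > 0; M > 0; \<And>k a z. k \<le> N \<Longrightarrow> \<bar>z - Y i0\<bar> \<le> 4 * M \<Longrightarrow> \<bar>D k a z\<bar> \<le> A / M ^ k;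
      h \<ge> 0; real j * h \<le> T; i0 \<le> j; euler D h Y i0 j; Cx * (real (j - i0) * h) powr \<gamma> * (A / M) \<le> \<kappa>\<rbrakk> \<Longrightarrow>
      (\<forall>i. i0 \<le> i \<and> i \<le> j \<longrightarrow> \<bar>Y i - Y i0\<bar> \<le> M) \<and>
      (\<forall>i k. i0 \<le> i \<and> i < k \<and> k \<le> j \<longrightarrow> \<bar>Y k - step D (real i * h) (real k * h) (Y i)\<bar>
         \<le> C3 * M * (Cx ^ Suc N * (A / M) ^ Suc N) * (real (k - i) * h) powr \<theta>)"
proof (rule almost_flow_scaled[where ?'d = 'd, OF N1, of 4])
  fix C :: real
  assume C1: "C \<ge> 1" and
    C2: "\<And>(D :: nat \<Rightarrow> 'd \<Rightarrow> real \<Rightarrow> real) \<xi> y y' x A M \<epsilon>. \<lbrakk>jets N D; A > 0; M > 0;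
      \<And>k a z. k \<le> N \<Longrightarrow> \<bar>z - x\<bar> \<le> 4 * M \<Longrightarrow> \<bar>D k a z\<bar> \<le> A / M ^ k; 0 \<le> \<epsilon>; \<epsilon> \<le> 1;
      \<And>\<tau>. tree_verts \<tau> \<le> N \<Longrightarrow> \<bar>\<xi> \<tau>\<bar> \<le> (\<epsilon> * M / A) ^ tree_verts \<tau>; \<bar>y - x\<bar> \<le> 4 * M; \<bar>y' - x\<bar> \<le> 4 * M\<rbrakk>
      \<Longrightarrow> \<bar>evc \<xi> (PP D N y)\<bar> \<le> C * M * \<epsilon> \<and> \<bar>evc \<xi> (PP D N y) - evc \<xi> (PP D N y')\<bar> \<le> C * \<epsilon> * \<bar>y - y'\<bar>" and
    C3: "\<And>(D :: nat \<Rightarrow> 'd::finite \<Rightarrow> real \<Rightarrow> real) \<xi> \<xi>2 \<xi>12 y A M \<epsilon>. \<lbrakk>jets N D; A > 0; M > 0;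
      \<And>k a z. k \<le> N \<Longrightarrow> \<bar>z - y\<bar> \<le> M \<Longrightarrow> \<bar>D k a z\<bar> \<le> A / M ^ k; 0 \<le> \<epsilon>; \<epsilon> \<le> 1;
      \<bar>evc \<xi> (PP D N y)\<bar> \<le> M;
      \<And>\<tau>. tree_verts \<tau> \<le> N \<Longrightarrow> \<bar>\<xi> \<tau>\<bar> \<le> (\<epsilon> * M / A) ^ tree_verts \<tau>;
      \<And>\<tau>. tree_verts \<tau> \<le> N \<Longrightarrow> \<bar>\<xi>2 \<tau>\<bar> \<le> (\<epsilon> * M / A) ^ tree_verts \<tau>;
      \<And>\<tau>. tree_verts \<tau> \<le> N \<Longrightarrow> \<xi>12 \<tau> = evc \<xi>2 (Qt \<xi> \<tau>)\<rbrakk>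
      \<Longrightarrow> \<bar>evc \<xi> (PP D N y) + evc \<xi>2 (PP D N (y + evc \<xi> (PP D N y))) - evc \<xi>12 (PP D N y)\<bar> \<le> C * M * \<epsilon> ^ Suc N"
  let ?\<rho> = "sew_ratio \<theta>"
  \<comment> \<open>\<open>1 + C * \<kappa>1\<close> times the sewing ratio is the midpoint between the ratio and \<open>1\<close>, and the last bound on \<open>\<kappa>\<close> keeps
    the orbit within \<open>M\<close>.\<close>
  let ?\<kappa>1 = "(1 - ?\<rho>) / (2 * ?\<rho> * C)"
  let ?C3 = "C / ((1 - ?\<rho>) / 2)"
  let ?\<kappa> = "min (min 1 ?\<kappa>1) (1 / (C + ?C3))"
  have r: "0 < ?\<rho>" "?\<rho> < 1" using sew_ratio_pos sew_ratio_less[OF theta] by auto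
  have C3_0: "?C3 \<ge> 0" using r C1 by simp
  have "C + ?C3 > 0" using C1 C3_0 by linarith
  then have k0: "?\<kappa> > 0" using r C1 by simp
  show ?thesis
  proof (rule that[OF k0 C3_0])
    fix D :: "nat \<Rightarrow> 'd \<Rightarrow> real \<Rightarrow> real" and A M h :: real and Y :: "nat \<Rightarrow> real" and i0 j :: nat
    assume jt: "jets N D" and A: "A > 0" and M: "M > 0"
      and bd: "\<And>k a z. k \<le> N \<Longrightarrow> \<bar>z - Y i0\<bar> \<le> 4 * M \<Longrightarrow> \<bar>D k a z\<bar> \<le> A / M ^ k"
      and h: "h \<ge> 0" and jT: "real j * h \<le> T" and ij: "i0 \<le> j" and eu: "euler D h Y i0 j"
      and small: "Cx * (real (j - i0) * h) powr \<gamma> * (A / M) \<le> ?\<kappa>"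
    let ?x = "Y i0"
    let ?e = "\<lambda>i k. Cx * (real (k - i) * h) powr \<gamma> * (A / M)"
    have e0: "?e i k \<ge> 0" for i k using Cx0 A M by simp
    have e_mono: "?e i k \<le> ?e i' k'" if "k - i \<le> k' - i'" for i k i' k'
    proof -
      have "(real (k - i) * h) powr \<gamma> \<le> (real (k' - i') * h) powr \<gamma>"
        using that h gam by (intro powr_mono2 mult_right_mono) auto
      then show ?thesis using Cx0 A M by (intro mult_right_mono mult_left_mono) auto
    qed
    have e_small: "?e i k \<le> ?\<kappa>" if "i0 \<le> i" "k \<le> j" for i k
      using e_mono[of k i j i0] that small by linarith
    have e1: "?e i k \<le> 1" if "i0 \<le> i" "k \<le> j" for i k
      using e_small[OF that] by simp
    have xi: "\<bar>\<xi> (real i * h) (real k * h) \<tau>\<bar> \<le> (?e i' k' * M / A) ^ tree_verts \<tau>"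
      if "i \<le> k" "k \<le> j" "k - i \<le> k' - i'" "tree_verts \<tau> \<le> N" for i k i' k' \<tau>
    proof -
      have "real k * h \<le> real j * h" using that h by (intro mult_right_mono) auto
      moreover have "real k * h - real i * h = real (k - i) * h" using that by (simp add: of_nat_diff algebra_simps)
      moreover have "real (k - i) * h \<le> real (k' - i') * h" using that h by (intro mult_right_mono) auto
      moreover have "real i * h \<le> real k * h" using that h by (intro mult_right_mono) auto
      ultimately have "\<bar>\<xi> (real i * h) (real k * h) \<tau>\<bar> \<le> (Cx * (real (k' - i') * h) powr \<gamma>) ^ tree_verts \<tau>"
        by (intro bnd_mono) (use h jT that in auto)
      then show ?thesis using A M by simp
    qed
    have inc: "\<bar>evc (\<xi> (real i * h) (real k * h)) (PP D N y)\<bar> \<le> C * M * ?e i' k' \<and>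
        \<bar>evc (\<xi> (real i * h) (real k * h)) (PP D N y) - evc (\<xi> (real i * h) (real k * h)) (PP D N y')\<bar> \<le> C * ?e i' k' * \<bar>y - y'\<bar>"
      if "i \<le> k" "k \<le> j" "k - i \<le> k' - i'" "i0 \<le> i'" "k' \<le> j" "\<bar>y - ?x\<bar> \<le> 4 * M" "\<bar>y' - ?x\<bar> \<le> 4 * M" for i k i' k' y y'
      by (rule C2[OF jt A M bd e0 e1 xi]) (use that in auto)
    let ?C' = "C * M * (Cx ^ Suc N * (A / M) ^ Suc N)"
    have sew: "\<bar>Y k - step D (real i * h) (real k * h) (Y i)\<bar> \<le> ?C' / ((1 - ?\<rho>) / 2) * (real (k - i) * h) powr \<theta>"
      if stay: "\<And>i. i0 \<le> i \<Longrightarrow> i < n \<Longrightarrow> \<bar>Y i - ?x\<bar> \<le> M" and nj: "n \<le> j" and ik: "i0 \<le> i" "i < k" "k \<le> n" for n i k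
    proof -
      let ?q = "1 + C * ?\<kappa>1"
      have q0: "?q \<ge> 0" using C1 r by simp
      have q: "?q * ?\<rho> = (1 + ?\<rho>) / 2" using C1 r by (simp add: field_simps)
      have "\<bar>Y k - step D (real i * h) (real k * h) (Y i)\<bar> \<le> ?C' / (1 - ?q * ?\<rho>) * (real (k - i) * h) powr \<theta>"
      proof (rule discrete_sewing[OF theta q0 _ h _ _ _ ik])
        show "?q * ?\<rho> < 1" unfolding q using r by simp
        show "?C' \<ge> 0" using C1 M A Cx0 by simp
        show "\<bar>Y (Suc i) - step D (real i * h) (real (Suc i) * h) (Y i)\<bar> \<le> 0" if "i0 \<le> i" "i < n" for i
          using eu that nj by (simp add: euler_def)
        fix i m k assume im: "i0 \<le> i" "i < m" "m < k" "k \<le> n"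
        have kj: "k \<le> j" using im nj by simp
        let ?x1 = "\<xi> (real i * h) (real m * h)" and ?x2 = "\<xi> (real m * h) (real k * h)" and ?x12 = "\<xi> (real i * h) (real k * h)"
        let ?ep = "?e i k"
        define d where "d = evc ?x1 (PP D N (Y i))"
        have Yi: "\<bar>Y i - ?x\<bar> \<le> M" "\<bar>Y m - ?x\<bar> \<le> M" using stay im by auto
        have cM: "C * M * ?ep \<le> M"
        proof -
          have "?ep \<le> 1 / (C + ?C3)" using e_small[OF im(1) kj] by simp
          then have "C * ?ep \<le> C * (1 / (C + ?C3))" using C1 by (intro mult_left_mono) auto
          also have "\<dots> \<le> 1" using C1 C3_0 by (simp add: divide_le_eq)
          finally show ?thesis using M mult_left_mono[of "C * ?ep" 1 M] by (simp add: mult_ac)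
        qed
        have d: "\<bar>d\<bar> \<le> M"
        proof -
          have "\<bar>d\<bar> \<le> C * M * ?ep"
            unfolding d_def by (rule conjunct1[OF inc[of i m k i "Y i" "Y i"]]) (use Yi im kj M in auto)
          then show ?thesis using cM by linarith
        qed
        have E: "\<bar>d + evc ?x2 (PP D N (Y i + d)) - evc ?x12 (PP D N (Y i))\<bar> \<le> C * M * ?ep ^ Suc N"
          unfolding d_def
        proof (rule C3[OF jt A M _ e0 e1[OF im(1) kj]])
          show "\<bar>evc ?x1 (PP D N (Y i))\<bar> \<le> M" using d unfolding d_def .
          show "\<bar>D k a z\<bar> \<le> A / M ^ k" if "k \<le> N" "\<bar>z - Y i\<bar> \<le> M" for k a z
            by (rule bd[OF that(1)]) (use that(2) Yi(1) M in linarith)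
          show "\<bar>?x1 \<tau>\<bar> \<le> (?ep * M / A) ^ tree_verts \<tau>" "\<bar>?x2 \<tau>\<bar> \<le> (?ep * M / A) ^ tree_verts \<tau>"
            if "tree_verts \<tau> \<le> N" for \<tau>
            using xi[of i m k i \<tau>] xi[of m k k i \<tau>] that im kj by auto
          have "real k * h \<le> real j * h" using kj h by (intro mult_right_mono) auto
          then show "?x12 \<tau> = evc ?x2 (Qt ?x1 \<tau>)" for \<tau>
            by (intro chen) (use im h jT in \<open>auto intro!: mult_right_mono\<close>)
        qed
        have L: "\<bar>evc ?x2 (PP D N (Y m)) - evc ?x2 (PP D N (Y i + d))\<bar> \<le> C * ?ep * \<bar>Y m - (Y i + d)\<bar>"
          using inc[of m k k i "Y m" "Y i + d"] Yi d M im kj by auto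
        have "C * ?ep \<le> C * ?\<kappa>1" using e_small[OF im(1) kj] C1 by (intro mult_left_mono) auto
        then have L': "C * ?ep * \<bar>Y m - (Y i + d)\<bar> \<le> C * ?\<kappa>1 * \<bar>Y m - (Y i + d)\<bar>" by (rule mult_right_mono) simp
        have q1: "\<bar>Y k - step D (real m * h) (real k * h) (Y m)\<bar> \<le> ?q * \<bar>Y k - step D (real m * h) (real k * h) (Y m)\<bar>"
          using C1 r by (simp add: mult_le_cancel_right1)
        have "\<bar>Y k - step D (real i * h) (real k * h) (Y i)\<bar>
            \<le> \<bar>Y k - step D (real m * h) (real k * h) (Y m)\<bar> + \<bar>Y m - (Y i + d)\<bar>
              + \<bar>evc ?x2 (PP D N (Y m)) - evc ?x2 (PP D N (Y i + d))\<bar>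
              + \<bar>d + evc ?x2 (PP D N (Y i + d)) - evc ?x12 (PP D N (Y i))\<bar>"
          unfolding step_def by linarith
        also have "\<dots> \<le> ?q * (\<bar>Y m - step D (real i * h) (real m * h) (Y i)\<bar> + \<bar>Y k - step D (real m * h) (real k * h) (Y m)\<bar>)
              + C * M * ?ep ^ Suc N"
          using L L' E q1 unfolding distrib_left distrib_right step_def[of D "real i * h" "real m * h"] d_def[symmetric] by linarith
        also have "C * M * ?ep ^ Suc N = ?C' * (real (k - i) * h) powr \<theta>"
          unfolding eps_power by (simp only: mult_ac)
        finally show "\<bar>Y k - step D (real i * h) (real k * h) (Y i)\<bar>
          \<le> ?q * (\<bar>Y m - step D (real i * h) (real m * h) (Y i)\<bar> + \<bar>Y k - step D (real m * h) (real k * h) (Y m)\<bar>)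
            + ?C' * (real (k - i) * h) powr \<theta>" .
      qed
      moreover have "1 - ?q * ?\<rho> = (1 - ?\<rho>) / 2" unfolding q by (simp add: field_simps)
      ultimately show ?thesis by (simp only:)
    qed
    have stay: "\<forall>i. i0 \<le> i \<and> i \<le> n \<longrightarrow> \<bar>Y i - ?x\<bar> \<le> M" if "n \<le> j" for n
      using that
    proof (induction n)
      case 0
      then show ?case using M by auto
    next
      case (Suc n)
      have IH: "\<bar>Y i - ?x\<bar> \<le> M" if "i0 \<le> i" "i < Suc n" for i
        using Suc.IH Suc.prems that by auto
      show ?case
      proof (intro allI impI)
        fix i assume i: "i0 \<le> i \<and> i \<le> Suc n"
        show "\<bar>Y i - ?x\<bar> \<le> M"
        proof (cases "i = Suc n \<and> i0 < i")
          case True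
          let ?ep = "?e i0 i"
          have ep: "?ep \<le> ?\<kappa>" by (rule e_small) (use True Suc.prems in auto)
          have "\<bar>Y i - step D (real i0 * h) (real i * h) ?x\<bar> \<le> ?C' / ((1 - ?\<rho>) / 2) * (real (i - i0) * h) powr \<theta>"
            by (rule sew[OF IH Suc.prems]) (use True in auto)
          also have "\<dots> = ?C3 * M * ?ep ^ Suc N"
            unfolding eps_power by simp
          also have "\<dots> \<le> ?C3 * M * ?ep"
          proof -
            have "?ep ^ Suc N \<le> ?ep" using power_decreasing[of 1 "Suc N" ?ep] e0 ep by simp
            then show ?thesis using M by (intro mult_left_mono mult_nonneg_nonneg[OF C3_0]) auto
          qed
          finally have 1: "\<bar>Y i - step D (real i0 * h) (real i * h) ?x\<bar> \<le> ?C3 * M * ?ep" .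
          have 2: "\<bar>evc (\<xi> (real i0 * h) (real i * h)) (PP D N ?x)\<bar> \<le> C * M * ?ep"
            using inc[of i0 i i i0 ?x ?x] True Suc.prems M by auto
          have "\<bar>Y i - ?x\<bar> \<le> ?C3 * M * ?ep + C * M * ?ep"
            using 1 2 unfolding step_def by linarith
          also have "\<dots> = M * ((C + ?C3) * ?ep)" by (simp only: distrib_left distrib_right mult_ac add.commute)
          also have "\<dots> \<le> M * 1"
          proof (rule mult_left_mono)
            have "?ep \<le> 1 / (C + ?C3)" using ep by simp
            then have "(C + ?C3) * ?ep \<le> (C + ?C3) * (1 / (C + ?C3))" using C1 C3_0 by (intro mult_left_mono) auto
            then show "(C + ?C3) * ?ep \<le> 1" using C1 C3_0 by simp
          qed (use M in simp)
          finally show ?thesis by simp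
        next
          case False
          then show ?thesis using i IH M by (cases "i = i0") auto
        qed
      qed
    qed
    have "\<bar>Y k - step D (real i * h) (real k * h) (Y i)\<bar>
         \<le> ?C3 * M * (Cx ^ Suc N * (A / M) ^ Suc N) * (real (k - i) * h) powr \<theta>"
      if "i0 \<le> i \<and> i < k \<and> k \<le> j" for i k
    proof -
      have "\<bar>Y k - step D (real i * h) (real k * h) (Y i)\<bar> \<le> ?C' / ((1 - ?\<rho>) / 2) * (real (k - i) * h) powr \<theta>"
        by (rule sew[of j]) (use stay[of j] that in auto)
      then show ?thesis by (simp only: times_divide_eq_left)
    qed
    then show "(\<forall>i. i0 \<le> i \<and> i \<le> j \<longrightarrow> \<bar>Y i - Y i0\<bar> \<le> M) \<and>
      (\<forall>i k. i0 \<le> i \<and> i < k \<and> k \<le> j \<longrightarrow> \<bar>Y k - step D (real i * h) (real k * h) (Y i)\<bar>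
         \<le> ?C3 * M * (Cx ^ Suc N * (A / M) ^ Suc N) * (real (k - i) * h) powr \<theta>)"
      using stay[of j] by blast
  qed
qed

end

lemma nat_diff_mult: "j \<le> k \<Longrightarrow> real (k - j) * h = real k * h - real j * h"
  by (simp add: of_nat_diff algebra_simps)

context rough begin

lemma step_size:
  assumes "jets N D" "\<And>a. continuous_on UNIV (D N a)"
  obtains C where "C \<ge> 0"
    "\<And>s t y. \<lbrakk>0 \<le> s; s \<le> t; t \<le> T; \<bar>y\<bar> \<le> K\<rbrakk> \<Longrightarrow> \<bar>evc (\<xi> s t) (PP D N y)\<bar> \<le> C * (t - s) powr \<gamma>"
    "\<And>s t y z. \<lbrakk>0 \<le> s; s \<le> t; t \<le> T; \<bar>y\<bar> \<le> K; \<bar>z\<bar> \<le> K\<rbrakk>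
      \<Longrightarrow> \<bar>evc (\<xi> s t) (PP D N y) - evc (\<xi> s t) (PP D N z)\<bar> \<le> C * (t - s) powr \<gamma> * \<bar>y - z\<bar>"
proof -
  obtain B where B: "B \<ge> 0" "\<And>k a x. k \<le> N \<Longrightarrow> \<bar>x\<bar> \<le> K \<Longrightarrow> \<bar>D k a x\<bar> \<le> B"
    using jets_bounded[OF assms, of K] by metis
  show ?thesis
  proof (rule step_bounds[where ?'d = 'd, of N B "Cx * T powr \<gamma>"])
    fix C assume C: "C \<ge> 0" and
    C': "\<And>(D :: nat \<Rightarrow> 'd \<Rightarrow> real \<Rightarrow> real) \<xi> I \<epsilon> z z'. \<lbrakk>jets N D; convex I;
      \<And>k a z. k \<le> N \<Longrightarrow> z \<in> I \<Longrightarrow> \<bar>D k a z\<bar> \<le> B; 0 \<le> \<epsilon>; \<epsilon> \<le> Cx * T powr \<gamma>;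
      \<And>\<tau>. tree_verts \<tau> \<le> N \<Longrightarrow> \<bar>\<xi> \<tau>\<bar> \<le> \<epsilon> ^ tree_verts \<tau>; z \<in> I; z' \<in> I\<rbrakk>
      \<Longrightarrow> \<bar>evc \<xi> (PP D N z)\<bar> \<le> C * \<epsilon> \<and> \<bar>evc \<xi> (PP D N z) - evc \<xi> (PP D N z')\<bar> \<le> C * \<epsilon> * \<bar>z - z'\<bar>"
    have *: "\<bar>evc (\<xi> s t) (PP D N y)\<bar> \<le> C * (Cx * (t - s) powr \<gamma>) \<and>
        \<bar>evc (\<xi> s t) (PP D N y) - evc (\<xi> s t) (PP D N z)\<bar> \<le> C * (Cx * (t - s) powr \<gamma>) * \<bar>y - z\<bar>"
      if h: "0 \<le> s" "s \<le> t" "t \<le> T" "\<bar>y\<bar> \<le> K" "\<bar>z\<bar> \<le> K" for s t y z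
    proof (rule C'[OF assms(1), of "{-K..K}"])
      show "Cx * (t - s) powr \<gamma> \<le> Cx * T powr \<gamma>"
        using h Cx0 gam by (intro mult_left_mono powr_mono2) auto
      show "\<bar>\<xi> s t \<tau>\<bar> \<le> (Cx * (t - s) powr \<gamma>) ^ tree_verts \<tau>" if "tree_verts \<tau> \<le> N" for \<tau>
        by (rule bnd[OF h(1-3) that])
    qed (use h B Cx0 in auto)
    show ?thesis
    proof (rule that[of "C * Cx"])
      show "C * Cx \<ge> 0" using C Cx0 by simp
      show "\<bar>evc (\<xi> s t) (PP D N y)\<bar> \<le> C * Cx * (t - s) powr \<gamma>"
        if "0 \<le> s" "s \<le> t" "t \<le> T" "\<bar>y\<bar> \<le> K" for s t y
        using *[OF that(1,2,3,4,4)] by (simp only: mult.assoc)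
      show "\<bar>evc (\<xi> s t) (PP D N y) - evc (\<xi> s t) (PP D N z)\<bar> \<le> C * Cx * (t - s) powr \<gamma> * \<bar>y - z\<bar>"
        if "0 \<le> s" "s \<le> t" "t \<le> T" "\<bar>y\<bar> \<le> K" "\<bar>z\<bar> \<le> K" for s t y z
        using *[OF that] by (simp only: mult.assoc)
    qed
  qed
qed

primrec scheme :: "(nat \<Rightarrow> 'd \<Rightarrow> real \<Rightarrow> real) \<Rightarrow> real \<Rightarrow> real \<Rightarrow> nat \<Rightarrow> real" where
  "scheme D h y0 0 = y0"
| "scheme D h y0 (Suc i) = step D (real i * h) (real (Suc i) * h) (scheme D h y0 i)"

declare scheme.simps(2) [simp del]

lemma euler_scheme: "euler D h (scheme D h y0) i j"
  by (simp add: euler_def scheme.simps(2))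

section \<open>A priori bounds for the Euler scheme\<close>

text \<open>
  Let \<open>p\<close> be the last grid point at which the scheme is within \<open>2 * \<rho>\<close> of the origin. From then on it
  stays outside that ball, so as long as it is within \<open>4 * \<rho>\<close> the bounds of the annulus hold in
  a ball of radius \<open>4 * M \<le> \<rho>\<close> around it. Each of the \<open>Q\<close> time windows of length \<open>T / Q\<close> moves it by at most \<open>M\<close>, in total
  by at most \<open>Q * M \<le> \<rho>\<close>. Starting within \<open>3 * \<rho>\<close> (one step is short if the mesh is small), it remains within
  \<open>4 * \<rho>\<close>.
\<close>

theorem scheme_bounded:
  assumes D: "jets N D" "\<And>a. continuous_on UNIV (D N a)"
    and growth: "\<And>\<kappa> \<rho>0. \<kappa> > 0 \<Longrightarrow> \<exists>\<rho> A M Q. \<rho> \<ge> \<rho>0 \<and> A > 0 \<and> M > 0 \<and> Q \<ge> (1 :: nat) \<and> 4 * M \<le> \<rho> \<and> real Q * M \<le> \<rho> \<and>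
      Cx * (2 * T / real Q) powr \<gamma> * (A / M) \<le> \<kappa> \<and>
      (\<forall>k a z. k \<le> N \<longrightarrow> \<rho> \<le> \<bar>z\<bar> \<longrightarrow> \<bar>z\<bar> \<le> 8 * \<rho> \<longrightarrow> \<bar>D k a z\<bar> \<le> A / M ^ k)"
  obtains K n0 where "\<And>n i. n \<ge> n0 \<Longrightarrow> i \<le> n \<Longrightarrow> \<bar>scheme D (T / real n) y0 i\<bar> \<le> K"
proof (rule orbit_bounds)
  fix \<kappa> C3 :: real assume \<kappa>: "\<kappa> > 0" and
    ob: "\<And>D A M h Y i0 j. \<lbrakk>jets N D; A > 0; M > 0; \<And>k a z. k \<le> N \<Longrightarrow> \<bar>z - Y i0\<bar> \<le> 4 * M \<Longrightarrow> \<bar>D k a z\<bar> \<le> A / M ^ k;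
      h \<ge> 0; real j * h \<le> T; i0 \<le> j; euler D h Y i0 j; Cx * (real (j - i0) * h) powr \<gamma> * (A / M) \<le> \<kappa>\<rbrakk> \<Longrightarrow>
      (\<forall>i. i0 \<le> i \<and> i \<le> j \<longrightarrow> \<bar>Y i - Y i0\<bar> \<le> M) \<and>
      (\<forall>i k. i0 \<le> i \<and> i < k \<and> k \<le> j \<longrightarrow> \<bar>Y k - step D (real i * h) (real k * h) (Y i)\<bar>
         \<le> C3 * M * (Cx ^ Suc N * (A / M) ^ Suc N) * (real (k - i) * h) powr \<theta>)"
  obtain \<rho> A M Q where g: "\<rho> \<ge> max 1 \<bar>y0\<bar>" "A > 0" "M > 0" "Q \<ge> (1 :: nat)" "4 * M \<le> \<rho>" "real Q * M \<le> \<rho>"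
      "Cx * (2 * T / real Q) powr \<gamma> * (A / M) \<le> \<kappa>"
      "\<And>k a z. k \<le> N \<Longrightarrow> \<rho> \<le> \<bar>z\<bar> \<Longrightarrow> \<bar>z\<bar> \<le> 8 * \<rho> \<Longrightarrow> \<bar>D k a z\<bar> \<le> A / M ^ k"
    using growth[OF \<kappa>, of "max 1 \<bar>y0\<bar>"] by blast
  have \<rho>1: "\<rho> \<ge> 1" using g(1) by simp
  obtain C where C: "C \<ge> 0"
    "\<And>s t y. \<lbrakk>0 \<le> s; s \<le> t; t \<le> T; \<bar>y\<bar> \<le> 2 * \<rho>\<rbrakk> \<Longrightarrow> \<bar>evc (\<xi> s t) (PP D N y)\<bar> \<le> C * (t - s) powr \<gamma>"
    using step_size[OF D, of "2 * \<rho>"] by metis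
  \<comment> \<open>The mesh is so small that one step moves by at most \<open>\<rho>\<close> inside the ball of radius \<open>2 * \<rho>\<close>.\<close>
  define h0 where "h0 = min (T / real Q) ((\<rho> / (C + 1)) powr (1 / \<gamma>))"
  have h0: "h0 > 0" using T0 g(4) \<rho>1 C(1) by (simp add: h0_def)
  define n0 where "n0 = Suc (nat \<lceil>T / h0\<rceil>)"
  show ?thesis
  proof (rule that[of n0 "4 * \<rho>"])
    fix n i assume n: "n \<ge> n0" and i: "i \<le> n"
    let ?h = "T / real n"
    let ?Y = "scheme D ?h y0"
    have n_pos: "n > 0" using n by (simp add: n0_def)
    have h_pos: "?h > 0" using n_pos T0 by simp
    have "T / h0 \<le> real n" using n unfolding n0_def by linarith
    then have hh0: "?h \<le> h0" using n_pos h0 by (simp add: field_simps)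
    then have hQ: "?h \<le> T / real Q" by (simp add: h0_def)
    have hmul: "real j * ?h \<le> T" if "j \<le> n" for j
    proof -
      have "real j * ?h \<le> real n * ?h" using that h_pos by (intro mult_right_mono) auto
      then show ?thesis using n_pos by simp
    qed
    have one: "\<bar>?Y (Suc j) - ?Y j\<bar> \<le> \<rho>" if "\<bar>?Y j\<bar> \<le> 2 * \<rho>" "Suc j \<le> n" for j
    proof -
      have "real (Suc j) * x - real j * x = x" for x by (simp add: algebra_simps)
      then have "real (Suc j) * ?h - real j * ?h = ?h" .
      moreover have "0 \<le> real j * ?h" by (rule mult_nonneg_nonneg) (use h_pos in auto)
      ultimately have "\<bar>?Y (Suc j) - ?Y j\<bar> \<le> C * ?h powr \<gamma>"
        using C(2)[of "real j * ?h" "real (Suc j) * ?h" "?Y j"] that hmul[OF that(2)] h_pos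
        by (simp add: scheme.simps(2) step_def)
      also have "\<dots> \<le> (C + 1) * ((\<rho> / (C + 1)) powr (1 / \<gamma>)) powr \<gamma>"
        using hh0 h_pos C(1) gam by (intro mult_mono powr_mono2) (auto simp: h0_def)
      also have "\<dots> = \<rho>" using gam C(1) \<rho>1 by (simp add: powr_powr)
      finally show ?thesis .
    qed
    show "\<bar>?Y i\<bar> \<le> 4 * \<rho>"
    proof (cases "\<bar>?Y i\<bar> \<le> 2 * \<rho>")
      case False
      define p where "p = (GREATEST j. j < i \<and> \<bar>?Y j\<bar> \<le> 2 * \<rho>)"
      have "i \<noteq> 0" using False g(1) by (intro notI) auto
      then have ex: "\<exists>j. j < i \<and> \<bar>?Y j\<bar> \<le> 2 * \<rho>" using g(1) by (intro exI[of _ 0]) auto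
      then have p: "p < i" "\<bar>?Y p\<bar> \<le> 2 * \<rho>"
        using GreatestI_ex_nat[of "\<lambda>j. j < i \<and> \<bar>?Y j\<bar> \<le> 2 * \<rho>" i] unfolding p_def by auto
      have big: "\<bar>?Y k\<bar> > 2 * \<rho>" if "p < k" "k \<le> i" for k
      proof (rule ccontr)
        assume "\<not> \<bar>?Y k\<bar> > 2 * \<rho>"
        then have "k < i \<and> \<bar>?Y k\<bar> \<le> 2 * \<rho>" using that False by (cases "k = i") auto
        then have "k \<le> p" unfolding p_def by (rule Greatest_le_nat[of _ _ i]) auto
        then show False using that by simp
      qed
      let ?p = "Suc p"
      have Yp: "\<bar>?Y ?p\<bar> \<le> 3 * \<rho>" using one[OF p(2)] p i by auto
      have walk: "\<bar>?Y k - ?Y ?p\<bar> \<le> real q * M"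
        if "q \<le> Q" "?p \<le> k" "k \<le> i" "real (k - ?p) * ?h \<le> real q * (T / real Q)" for q k
        using that
      proof (induction q arbitrary: k)
        case 0
        have "real (k - ?p) * ?h \<le> 0" using 0(4) by (simp only: of_nat_0 mult_zero_left)
        then have "real (k - ?p) \<le> 0" using h_pos by (meson mult_pos_pos not_le)
        then have "k = ?p" using 0(2) by simp
        then show ?case by simp
      next
        case (Suc q)
        let ?w = "T / real Q"
        show ?case
        proof (cases "real (k - ?p) * ?h \<le> real q * ?w")
          case True
          then have "\<bar>?Y k - ?Y ?p\<bar> \<le> real q * M" using Suc by auto
          then show ?thesis using g(3) by (simp add: distrib_right)
        next
          case False
          \<comment> \<open>The last grid point in the first \<open>q\<close> windows. It may lie up to one mesh width before their end, which is why the smallness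
            condition is stated for windows of double length.\<close>
          define m where "m = nat \<lfloor>real q * ?w / ?h\<rfloor>"
          have nn: "0 \<le> real q * ?w / ?h" using T0 h_pos by simp
          have m1: "real m \<le> real q * ?w / ?h" "real q * ?w / ?h < real m + 1"
            unfolding m_def using nn by linarith+
          have m2: "real m * ?h \<le> real q * ?w" "real q * ?w < (real m + 1) * ?h"
            using m1 h_pos by (simp_all only: pos_le_divide_eq pos_divide_less_eq)
          let ?k = "?p + m"
          have "real m * ?h < real (k - ?p) * ?h" using m2(1) False by linarith
          then have "real m < real (k - ?p)" by (rule mult_right_less_imp_less) (use h_pos in simp)
          then have mk: "m < k - ?p" by (simp only: of_nat_less_iff)
          have kk: "?p \<le> ?k" "?k \<le> i" "?k < k" using mk Suc.prems by auto
          have IH: "\<bar>?Y ?k - ?Y ?p\<bar> \<le> real q * M"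
            by (rule Suc.IH) (use Suc.prems kk m2 in auto)
          have qM: "real q * M \<le> \<rho>"
          proof -
            have "real q * M \<le> real Q * M" using Suc.prems(1) g(3) by (intro mult_right_mono) auto
            then show ?thesis using g(6) by linarith
          qed
          have Yk: "2 * \<rho> < \<bar>?Y ?k\<bar>" "\<bar>?Y ?k\<bar> \<le> 4 * \<rho>"
            using big[of ?k] kk IH qM Yp by auto
          have "real (k - ?p - m) * ?h = real (k - ?p) * ?h - real m * ?h"
            by (rule nat_diff_mult) (use mk in simp)
          then have "real (k - ?k) * ?h = real (k - ?p) * ?h - real m * ?h"
            by (simp only: diff_diff_left)
          also have "\<dots> \<le> real (Suc q) * ?w - (real q * ?w - ?h)"
          proof -
            have "real q * ?w < real m * ?h + ?h" using m2(2) by (simp only: distrib_right mult_1_left)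
            then show ?thesis using Suc.prems(4) by linarith
          qed
          also have "\<dots> \<le> 2 * ?w"
          proof -
            have "real (Suc q) * ?w = ?w + real q * ?w" by (simp only: of_nat_Suc distrib_right mult_1_left)
            then show ?thesis using hQ by linarith
          qed
          finally have w: "real (k - ?k) * ?h \<le> 2 * T / real Q" by simp
          have "0 \<le> real (k - ?k) * ?h" by (rule mult_nonneg_nonneg) (use h_pos in auto)
          then have "Cx * (real (k - ?k) * ?h) powr \<gamma> * (A / M) \<le> Cx * (2 * T / real Q) powr \<gamma> * (A / M)"
            using w h_pos gam Cx0 g(2,3) by (intro mult_right_mono mult_left_mono powr_mono2) auto
          then have small: "Cx * (real (k - ?k) * ?h) powr \<gamma> * (A / M) \<le> \<kappa>" using g(7) by linarith
          have "\<bar>?Y k - ?Y ?k\<bar> \<le> M"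
          proof -
            have "\<forall>l. ?k \<le> l \<and> l \<le> k \<longrightarrow> \<bar>?Y l - ?Y ?k\<bar> \<le> M"
            proof (rule conjunct1[OF ob[OF D(1) g(2,3)]])
              show "\<bar>D l a z\<bar> \<le> A / M ^ l" if "l \<le> N" "\<bar>z - ?Y ?k\<bar> \<le> 4 * M" for l a z
                by (rule g(8)[OF that(1)]) (use that(2) Yk g(5) \<rho>1 in linarith)+
              show "euler D ?h ?Y ?k k" by (rule euler_scheme)
              show "real k * ?h \<le> T" by (rule hmul) (use Suc.prems i in simp)
            qed (use h_pos kk small in auto)
            then show ?thesis using kk by simp
          qed
          then show ?thesis using IH by (simp add: distrib_right)
        qed
      qed
      have "real (i - ?p) * ?h \<le> real Q * (T / real Q)"
        using hmul[of "i - ?p"] i g(4) by simp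
      then have "\<bar>?Y i - ?Y ?p\<bar> \<le> real Q * M" by (intro walk) (use p in auto)
      then show ?thesis using Yp g(6) by linarith
    qed (use \<rho>1 in simp)
  qed
qed

text \<open>
  On short time intervals this is the estimate for orbits; on long ones boundedness suffices, as \<open>(t - s) powr \<theta>\<close> is bounded below.
\<close>

lemma scheme_davie:
  assumes D: "jets N D" "\<And>a. continuous_on UNIV (D N a)"
    and K: "\<And>n i. n \<ge> n0 \<Longrightarrow> i \<le> n \<Longrightarrow> \<bar>scheme D (T / real n) y0 i\<bar> \<le> K"
  obtains C where "C \<ge> 0" "\<And>n i k. \<lbrakk>n \<ge> n0; n \<ge> 1; i < k; k \<le> n\<rbrakk> \<Longrightarrow>
    \<bar>scheme D (T / real n) y0 k - step D (real i * (T / real n)) (real k * (T / real n)) (scheme D (T / real n) y0 i)\<bar>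
      \<le> C * (real (k - i) * (T / real n)) powr \<theta>"
proof (rule orbit_bounds)
  fix \<kappa> C3 :: real assume \<kappa>: "\<kappa> > 0" and C3: "C3 \<ge> 0" and
    ob: "\<And>D A M h Y i0 j. \<lbrakk>jets N D; A > 0; M > 0; \<And>k a z. k \<le> N \<Longrightarrow> \<bar>z - Y i0\<bar> \<le> 4 * M \<Longrightarrow> \<bar>D k a z\<bar> \<le> A / M ^ k;
      h \<ge> 0; real j * h \<le> T; i0 \<le> j; euler D h Y i0 j; Cx * (real (j - i0) * h) powr \<gamma> * (A / M) \<le> \<kappa>\<rbrakk> \<Longrightarrow>
      (\<forall>i. i0 \<le> i \<and> i \<le> j \<longrightarrow> \<bar>Y i - Y i0\<bar> \<le> M) \<and>
      (\<forall>i k. i0 \<le> i \<and> i < k \<and> k \<le> j \<longrightarrow> \<bar>Y k - step D (real i * h) (real k * h) (Y i)\<bar>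
         \<le> C3 * M * (Cx ^ Suc N * (A / M) ^ Suc N) * (real (k - i) * h) powr \<theta>)"
  obtain B where B: "B \<ge> 0" "\<And>k a x. k \<le> N \<Longrightarrow> \<bar>x\<bar> \<le> K + 4 \<Longrightarrow> \<bar>D k a x\<bar> \<le> B"
    using jets_bounded[OF D, of "K + 4"] by metis
  obtain C where C: "C \<ge> 0"
    "\<And>s t y. \<lbrakk>0 \<le> s; s \<le> t; t \<le> T; \<bar>y\<bar> \<le> K\<rbrakk> \<Longrightarrow> \<bar>evc (\<xi> s t) (PP D N y)\<bar> \<le> C * (t - s) powr \<gamma>"
    using step_size[OF D, of K] by metis
  define A where "A = B + 1"
  have A: "A > 0" using B by (simp add: A_def)
  define w where "w = (\<kappa> / (Cx * A)) powr (1 / \<gamma>)"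
  have w: "w > 0" "Cx * w powr \<gamma> * A = \<kappa>" using \<kappa> A Cx0 gam by (simp_all add: w_def powr_powr)
  let ?C1 = "C3 * (Cx ^ Suc N * A ^ Suc N)" and ?C2 = "(2 * \<bar>K\<bar> + C * T powr \<gamma>) / w powr \<theta>"
  have C12: "?C1 \<ge> 0" "?C2 \<ge> 0" using C3 Cx0 A C(1) by auto
  show ?thesis
  proof (rule that[of "?C1 + ?C2"])
    show "?C1 + ?C2 \<ge> 0" using C12 by simp
    fix n i k assume n: "n \<ge> n0" "n \<ge> 1" and ik: "i < k" "k \<le> n"
    let ?h = "T / real n"
    let ?Y = "scheme D ?h y0"
    have h_pos: "?h > 0" using n T0 by simp
    have kT: "real k * ?h \<le> T"
    proof -
      have "real k * ?h \<le> real n * ?h" using ik h_pos by (intro mult_right_mono) auto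
      then show ?thesis using n by simp
    qed
    have ihkh: "real i * ?h \<le> real k * ?h" using ik h_pos by (intro mult_right_mono) auto
    have nn: "0 \<le> real i * ?h" by (rule mult_nonneg_nonneg) (use h_pos in auto)
    have Ki: "\<bar>?Y i\<bar> \<le> K" "\<bar>?Y k\<bar> \<le> K" using K n(1) ik by auto
    let ?r = "\<bar>?Y k - step D (real i * ?h) (real k * ?h) (?Y i)\<bar>"
    let ?x = "real (k - i) * ?h"
    show "?r \<le> (?C1 + ?C2) * ?x powr \<theta>"
    proof (cases "?x \<le> w")
      case True
      have "0 \<le> ?x" by (rule mult_nonneg_nonneg) (use h_pos in auto)
      then have "Cx * ?x powr \<gamma> * A \<le> Cx * w powr \<gamma> * A"
        using True h_pos gam Cx0 A by (intro mult_right_mono mult_left_mono powr_mono2) auto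
      then have small: "Cx * ?x powr \<gamma> * (A / 1) \<le> \<kappa>" using w(2) by simp
      have "?r \<le> C3 * 1 * (Cx ^ Suc N * (A / 1) ^ Suc N) * ?x powr \<theta>"
      proof -
        have "\<forall>i' k'. i \<le> i' \<and> i' < k' \<and> k' \<le> k \<longrightarrow> \<bar>?Y k' - step D (real i' * ?h) (real k' * ?h) (?Y i')\<bar>
         \<le> C3 * 1 * (Cx ^ Suc N * (A / 1) ^ Suc N) * (real (k' - i') * ?h) powr \<theta>"
        proof (rule conjunct2[OF ob[OF D(1) A _ _ _ kT _ _ small]])
          show "\<bar>D l a z\<bar> \<le> A / 1 ^ l" if "l \<le> N" "\<bar>z - ?Y i\<bar> \<le> 4 * 1" for l a z
            using B(2)[of l z a] that Ki unfolding A_def by (simp add: abs_le_iff)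
          show "euler D ?h ?Y i k" by (rule euler_scheme)
        qed (use h_pos ik in auto)
        then show ?thesis using ik by blast
      qed
      also have "\<dots> \<le> (?C1 + ?C2) * ?x powr \<theta>"
        using C12 by (intro mult_right_mono) auto
      finally show ?thesis .
    next
      case False
      have "?r \<le> 2 * \<bar>K\<bar> + \<bar>evc (\<xi> (real i * ?h) (real k * ?h)) (PP D N (?Y i))\<bar>"
        using Ki unfolding step_def by linarith
      also have "\<dots> \<le> 2 * \<bar>K\<bar> + C * (real k * ?h - real i * ?h) powr \<gamma>"
        using C(2)[of "real i * ?h" "real k * ?h" "?Y i"] kT ihkh h_pos Ki nn by auto
      also have "\<dots> \<le> 2 * \<bar>K\<bar> + C * T powr \<gamma>"
        using kT ihkh h_pos C(1) gam nn by (intro add_left_mono mult_left_mono powr_mono2) auto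
      also have "\<dots> = ?C2 * w powr \<theta>" using w(1) by simp
      also have "\<dots> \<le> ?C2 * ?x powr \<theta>"
      proof -
        have wx: "w \<le> ?x" using False by linarith
        have "w powr \<theta> \<le> ?x powr \<theta>" by (rule powr_mono2[OF _ _ wx]) (use w(1) theta in simp_all)
        then show ?thesis using C12(2) by (rule mult_left_mono)
      qed
      also have "\<dots> \<le> (?C1 + ?C2) * ?x powr \<theta>"
        using C12 by (intro mult_right_mono) auto
      finally show ?thesis .
    qed
  qed
qed

end

section \<open>Existence by passage to the limit\<close>

lemma tendsto_lookup_prod_mset:
  fixes G :: "'n \<Rightarrow> 'd rtree \<Rightarrow> 'd hopf"
  assumes "\<And>t h. t \<in># f \<Longrightarrow> ((\<lambda>n. Poly_Mapping.lookup (G n t) h) \<longlongrightarrow> Poly_Mapping.lookup (G' t) h) F"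
  shows "((\<lambda>n. Poly_Mapping.lookup (\<Prod>\<^sub># (image_mset (G n) f)) h) \<longlongrightarrow> Poly_Mapping.lookup (\<Prod>\<^sub># (image_mset G' f)) h) F"
  using assms
proof (induction f arbitrary: h)
  case (add t f)
  show ?case
    unfolding image_mset_add_mset prod_mset.add_mset lookup_mult_hopf
    by (intro tendsto_sum tendsto_mult add.prems add.IH) auto
qed simp

lemma tendsto_lookup_Qt:
  assumes "\<And>\<sigma>. tree_verts \<sigma> \<le> N \<Longrightarrow> ((\<lambda>n. x n \<sigma>) \<longlongrightarrow> x' \<sigma>) F" "tree_verts \<tau> \<le> N"
  shows "((\<lambda>n. Poly_Mapping.lookup (Qt (x n) \<tau>) h) \<longlongrightarrow> Poly_Mapping.lookup (Qt x' \<tau>) h) F"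
  using assms(2)
proof (induction \<tau> arbitrary: h)
  case (Node a f)
  have f: "((\<lambda>n. Poly_Mapping.lookup (Qf (x n) f) h) \<longlongrightarrow> Poly_Mapping.lookup (Qf x' f) h) F" for h
    unfolding Qf_def
  proof (rule tendsto_lookup_prod_mset)
    fix t h assume t: "t \<in># f"
    show "((\<lambda>n. Poly_Mapping.lookup (Qt (x n) t) h) \<longlongrightarrow> Poly_Mapping.lookup (Qt x' t) h) F"
      by (rule Node.IH[OF t]) (use tree_verts_le[OF t] Node.prems in simp)
  qed
  have g: "((\<lambda>n. Poly_Mapping.lookup (graft a (Qf (x n) f)) h) \<longlongrightarrow> Poly_Mapping.lookup (graft a (Qf x' f)) h) F"
  proof (cases "size h = 1")
    case True
    then obtain b g where "h = {#Node b g#}" by (metis rtree.exhaust size_1_singleton_mset)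
    then show ?thesis using f by (simp add: lookup_graft_Node)
  qed (simp add: lookup_graft_size)
  show ?case
    unfolding Qt_Node lookup_add lookup_scaleR'
    by (intro tendsto_add tendsto_mult tendsto_const assms(1) Node.prems g)
qed

lemma tendsto_evc_Qt:
  fixes x z :: "'n \<Rightarrow> 'd::finite rtree \<Rightarrow> real"
  assumes x: "\<And>\<sigma>. tree_verts \<sigma> \<le> N \<Longrightarrow> ((\<lambda>n. x n \<sigma>) \<longlongrightarrow> x' \<sigma>) F"
    and z: "\<And>\<sigma>. tree_verts \<sigma> \<le> N \<Longrightarrow> ((\<lambda>n. z n \<sigma>) \<longlongrightarrow> z' \<sigma>) F" and \<tau>: "tree_verts \<tau> \<le> N"
  shows "((\<lambda>n. evc (z n) (Qt (x n) \<tau>)) \<longlongrightarrow> evc z' (Qt x' \<tau>)) F"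
proof -
  have expand: "evc \<zeta> (Qt \<xi> \<tau>) = (\<Sum>h | verts h \<le> N. Poly_Mapping.lookup (Qt \<xi> \<tau>) h * \<Prod>\<^sub># (image_mset \<zeta> h))" for \<zeta> \<xi> :: "'d rtree \<Rightarrow> real"
  proof -
    have sub: "Poly_Mapping.keys (Qt \<xi> \<tau>) \<subseteq> {h. verts h \<le> N}"
      using keys_Qt[of _ \<xi> \<tau>] \<tau> by fastforce
    show ?thesis
      unfolding evc_def lext_def lincomb_superset[OF finite_forests_nat sub] by simp
  qed
  have prod: "((\<lambda>n. \<Prod>\<^sub># (image_mset (z n) h)) \<longlongrightarrow> \<Prod>\<^sub># (image_mset z' h)) F" if "verts h \<le> N" for h
    using that
  proof (induction h)
    case (add t h)
    then show ?case by (auto simp: verts_add_mset intro!: tendsto_mult z)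
  qed simp
  show ?thesis
    unfolding expand by (intro tendsto_sum tendsto_mult tendsto_lookup_Qt[OF x \<tau>] prod) auto
qed

lemma lookup_Qt_empty: "Poly_Mapping.lookup (Qt \<xi> \<tau>) {#} = \<xi> \<tau>"
  by (cases \<tau>) (simp add: Qt_Node lookup_add lookup_scaleR' lookup_graft_size lookup_one)

lemma evc_zero_Qt: "evc (\<lambda>_. 0) (Qt x \<tau>) = x \<tau>"
  unfolding counit_evc[symmetric] counit_def by (rule lookup_Qt_empty)

context rough begin

lemma xi_shrink:
  assumes "\<And>n. 0 \<le> s n \<and> s n \<le> t n \<and> t n \<le> T" "(\<lambda>n. t n - s n) \<longlonglongrightarrow> 0" "tree_verts \<tau> \<le> N"
  shows "(\<lambda>n. \<xi> (s n) (t n) \<tau>) \<longlonglongrightarrow> 0"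
proof (rule tendsto_rabs_zero_cancel, rule tendsto_sandwich[OF _ _ tendsto_const])
  have "(\<lambda>n. (t n - s n) powr \<gamma>) \<longlonglongrightarrow> 0"
    by (rule tendsto_zero_powrI[OF assms(2) tendsto_const _ gam]) (use assms(1) in simp)
  then have "(\<lambda>n. (Cx * (t n - s n) powr \<gamma>) ^ tree_verts \<tau>) \<longlonglongrightarrow> (Cx * 0) ^ tree_verts \<tau>"
    by (intro tendsto_intros)
  moreover have "(Cx * 0) ^ tree_verts \<tau> = 0" using tree_verts_pos[of \<tau>] by (simp add: zero_power)
  ultimately show "(\<lambda>n. (Cx * (t n - s n) powr \<gamma>) ^ tree_verts \<tau>) \<longlonglongrightarrow> 0"
    by (simp only:)
  show "\<forall>\<^sub>F n in sequentially. 0 \<le> \<bar>\<xi> (s n) (t n) \<tau>\<bar>" by simp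
  show "\<forall>\<^sub>F n in sequentially. \<bar>\<xi> (s n) (t n) \<tau>\<bar> \<le> (Cx * (t n - s n) powr \<gamma>) ^ tree_verts \<tau>"
    using bnd assms(1,3) by simp
qed

text \<open>
  Increments are continuous in both times by Chen's relation, because increments over shrinking intervals tend to zero.
\<close>

lemma xi_tendsto:
  assumes st: "0 \<le> s" "s \<le> t" "t \<le> T" and s: "\<And>n. 0 \<le> s' n \<and> s' n \<le> s" "s' \<longlonglongrightarrow> s"
    and t: "\<And>n. t \<le> t' n \<and> t' n \<le> T" "t' \<longlonglongrightarrow> t" and \<tau>: "tree_verts \<tau> \<le> N"
  shows "(\<lambda>n. \<xi> (s' n) (t' n) \<tau>) \<longlonglongrightarrow> \<xi> s t \<tau>"
proof -
  have 1: "(\<lambda>n. \<xi> (s' n) s \<sigma>) \<longlonglongrightarrow> 0" if "tree_verts \<sigma> \<le> N" for \<sigma>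
    by (rule xi_shrink[OF _ _ that]) (use s st tendsto_diff[OF tendsto_const s(2), of s] in auto)
  have 2: "(\<lambda>n. \<xi> t (t' n) \<sigma>) \<longlonglongrightarrow> 0" if "tree_verts \<sigma> \<le> N" for \<sigma>
    by (rule xi_shrink[OF _ _ that]) (use t st tendsto_diff[OF t(2) tendsto_const, of t] in auto)
  have 3: "(\<lambda>n. \<xi> (s' n) t \<sigma>) \<longlonglongrightarrow> \<xi> s t \<sigma>" if "tree_verts \<sigma> \<le> N" for \<sigma>
  proof -
    have "(\<lambda>n. evc (\<xi> s t) (Qt (\<xi> (s' n) s) \<sigma>)) \<longlonglongrightarrow> evc (\<xi> s t) (Qt (\<lambda>_. 0) \<sigma>)"
      by (rule tendsto_evc_Qt[OF 1 tendsto_const that])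
    moreover have "evc (\<xi> s t) (Qt (\<xi> (s' n) s) \<sigma>) = \<xi> (s' n) t \<sigma>" for n
      using chen[of "s' n" s t \<sigma>] s(1)[of n] st by simp
    ultimately show ?thesis by (simp add: Qt_zero evc_basis)
  qed
  have "(\<lambda>n. evc (\<xi> t (t' n)) (Qt (\<xi> (s' n) t) \<tau>)) \<longlonglongrightarrow> evc (\<lambda>_. 0) (Qt (\<xi> s t) \<tau>)"
    by (rule tendsto_evc_Qt[OF 3 2 \<tau>])
  moreover have "evc (\<xi> t (t' n)) (Qt (\<xi> (s' n) t) \<tau>) = \<xi> (s' n) (t' n) \<tau>" for n
    using chen[of "s' n" t "t' n" \<tau>] s(1)[of n] t(1)[of n] st by auto
  ultimately show ?thesis by (simp add: evc_zero_Qt)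
qed

text \<open>
  The path follows the one-step maps up to the error of an almost flow. This determines it by its initial value, and
  no integral or Gubinelli derivative appears.
\<close>

definition davie :: "(nat \<Rightarrow> 'd \<Rightarrow> real \<Rightarrow> real) \<Rightarrow> (real \<Rightarrow> real) \<Rightarrow> bool" where
  "davie D Y \<longleftrightarrow> (\<exists>C. \<forall>s t. 0 \<le> s \<and> s < t \<and> t \<le> T \<longrightarrow> \<bar>Y t - step D s t (Y s)\<bar> \<le> C * (t - s) powr \<theta>)"

text \<open>
  The estimate for the schemes is a closed condition on the values at two times, except that grid points have
  to be compared with arbitrary times: \<open>s\<close> is rounded down and \<open>t\<close> is rounded up to the grid, and the
  errors tend to zero with the mesh.
\<close>

theorem davie_exists:
  assumes D: "jets N D" "\<And>a. continuous_on UNIV (D N a)"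
    and K: "\<And>n i. n \<ge> n0 \<Longrightarrow> i \<le> n \<Longrightarrow> \<bar>scheme D (T / real n) y0 i\<bar> \<le> K"
  obtains Y where "davie D Y" "Y 0 = y0" "\<And>t. \<bar>Y t\<bar> \<le> K"
proof -
  obtain C where C: "C \<ge> 0" "\<And>n i k. \<lbrakk>n \<ge> n0; n \<ge> 1; i < k; k \<le> n\<rbrakk> \<Longrightarrow>
    \<bar>scheme D (T / real n) y0 k - step D (real i * (T / real n)) (real k * (T / real n)) (scheme D (T / real n) y0 i)\<bar>
      \<le> C * (real (k - i) * (T / real n)) powr \<theta>"
    using scheme_davie[OF D K] by metis
  have K0: "K \<ge> 0" using K[of n0 0] by simp
  obtain C1 where C1: "C1 \<ge> 0"
    "\<And>s t y. \<lbrakk>0 \<le> s; s \<le> t; t \<le> T; \<bar>y\<bar> \<le> K\<rbrakk> \<Longrightarrow> \<bar>evc (\<xi> s t) (PP D N y)\<bar> \<le> C1 * (t - s) powr \<gamma>"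
    "\<And>s t y z. \<lbrakk>0 \<le> s; s \<le> t; t \<le> T; \<bar>y\<bar> \<le> K; \<bar>z\<bar> \<le> K\<rbrakk>
      \<Longrightarrow> \<bar>evc (\<xi> s t) (PP D N y) - evc (\<xi> s t) (PP D N z)\<bar> \<le> C1 * (t - s) powr \<gamma> * \<bar>y - z\<bar>"
    using step_size[OF D, of K] by metis
  define m where "m n = Suc (n + n0)" for n :: nat
  define h where "h n = T / real (m n)" for n
  define lo where "lo n t = nat \<lfloor>t / h n\<rfloor>" for n t
  define hi where "hi n t = nat \<lceil>t / h n\<rceil>" for n t
  define Z where "Z n = scheme D (h n) y0" for n
  have h_pos: "h n > 0" for n using T0 by (simp add: h_def m_def)
  have mh: "real (m n) * h n = T" for n by (simp add: h_def m_def)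
  have Zb: "\<bar>Z n i\<bar> \<le> K" if "i \<le> m n" for n i
    unfolding Z_def h_def by (rule K) (use that in \<open>auto simp: m_def\<close>)
  have lo: "real (lo n t) * h n \<le> t" "t < (real (lo n t) + 1) * h n" "lo n t \<le> m n" if "0 \<le> t" "t \<le> T" for n t
  proof -
    have "0 \<le> t / h n" using that h_pos[of n] by simp
    then have "real (lo n t) \<le> t / h n" "t / h n < real (lo n t) + 1" unfolding lo_def by linarith+
    then show "real (lo n t) * h n \<le> t" "t < (real (lo n t) + 1) * h n"
      using h_pos[of n] by (simp_all only: pos_le_divide_eq pos_divide_less_eq)
    have "t / h n \<le> real (m n)" using that h_pos[of n] mh[of n] by (simp add: pos_divide_le_eq)
    then show "lo n t \<le> m n" using \<open>real (lo n t) \<le> t / h n\<close> by linarith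
  qed
  have hi: "t \<le> real (hi n t) * h n" "real (hi n t) * h n < t + h n" "hi n t \<le> m n" if "0 \<le> t" "t \<le> T" for n t
  proof -
    have "0 \<le> t / h n" using that h_pos[of n] by simp
    then have 1: "t / h n \<le> real (hi n t)" "real (hi n t) < t / h n + 1" unfolding hi_def by linarith+
    then show "t \<le> real (hi n t) * h n" using h_pos[of n] by (simp only: pos_divide_le_eq)
    have "real (hi n t) * h n < (t / h n + 1) * h n" using 1(2) h_pos[of n] by (rule mult_strict_right_mono)
    also have "\<dots> = t + h n" using h_pos[of n] by (simp add: field_simps)
    finally show "real (hi n t) * h n < t + h n" .
    have le: "t / h n \<le> real (m n)" using that h_pos[of n] mh[of n] by (simp add: pos_divide_le_eq)
    then have "\<lceil>t / h n\<rceil> \<le> int (m n)" by (simp add: ceiling_le_iff)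
    then show "hi n t \<le> m n" unfolding hi_def by linarith
  qed
  have hiT: "real (hi n t) * h n \<le> T" if "0 \<le> t" "t \<le> T" for n t
  proof -
    have "real (hi n t) * h n \<le> real (m n) * h n" using hi(3)[OF that, of n] h_pos[of n] by (intro mult_right_mono) auto
    also have "\<dots> = T" by (rule mh)
    finally show ?thesis .
  qed
  have h_lim: "h \<longlonglongrightarrow> 0"
    unfolding h_def m_def by real_asymp
  define F where "F n t = (if 0 \<le> t \<and> t \<le> T then Z n (lo n t) else 0)" for n t
  have "\<bar>F n t\<bar> \<le> K" for n t
    using Zb lo(3) K0 by (simp add: F_def)
  then obtain Y where Y: "\<And>t. \<bar>Y t\<bar> \<le> K"
    "\<And>s t e n0. e > 0 \<Longrightarrow> \<exists>n\<ge>n0. \<bar>F n s - Y s\<bar> < e \<and> \<bar>F n t - Y t\<bar> < e"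
    using pointwise_cluster[of F K] by metis
  have Y0: "Y 0 = y0"
  proof (rule ccontr)
    assume "Y 0 \<noteq> y0"
    then obtain n where "\<bar>F n 0 - Y 0\<bar> < \<bar>y0 - Y 0\<bar>" using Y(2)[of "\<bar>y0 - Y 0\<bar>" 0 0 0] by auto
    moreover have "F n 0 = y0" using T0 by (simp add: F_def lo_def Z_def)
    ultimately show False by simp
  qed
  have main: "\<bar>Y t - step D s t (Y s)\<bar> \<le> C * (t - s) powr \<theta>" if st: "0 \<le> s" "s < t" "t \<le> T" for s t
  proof (rule field_le_epsilon)
    fix e :: real assume e: "e > 0"
    have sT: "s \<le> T" "0 \<le> t" using st by auto
    let ?s = "\<lambda>n. real (lo n s) * h n" and ?t = "\<lambda>n. real (hi n t) * h n"
    have s_lim: "?s \<longlonglongrightarrow> s"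
    proof (rule tendsto_sandwich[of "\<lambda>n. s - h n" _ _ "\<lambda>_. s"])
      show "(\<lambda>n. s - h n) \<longlonglongrightarrow> s" using tendsto_diff[OF tendsto_const h_lim, of s] by simp
      show "\<forall>\<^sub>F n in sequentially. s - h n \<le> ?s n"
      proof (rule always_eventually, rule allI)
        fix n
        show "s - h n \<le> ?s n" using lo(2)[OF st(1) sT(1), of n] by (simp add: distrib_right)
      qed
    qed (use lo(1)[OF st(1) sT(1)] in auto)
    have t_lim: "?t \<longlonglongrightarrow> t"
    proof (rule tendsto_sandwich[of "\<lambda>n. t" _ _ "\<lambda>n. t + h n"])
      show "(\<lambda>n. t + h n) \<longlonglongrightarrow> t" using tendsto_add[OF tendsto_const h_lim, of t] by simp
      show "\<forall>\<^sub>F n in sequentially. ?t n \<le> t + h n"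
      proof (rule always_eventually, rule allI)
        fix n
        show "?t n \<le> t + h n" using hi(2)[OF sT(2) st(3), of n] by simp
      qed
    qed (use hi(1)[OF sT(2) st(3)] in auto)
    have s_prop: "0 \<le> ?s n \<and> ?s n \<le> s" for n
      using lo(1)[OF st(1) sT(1), of n] mult_nonneg_nonneg[OF of_nat_0_le_iff less_imp_le[OF h_pos]] by blast
    have t_prop: "t \<le> ?t n \<and> ?t n \<le> T" for n
      using hi(1)[OF sT(2) st(3), of n] hiT[OF sT(2) st(3), of n] by blast
    have xi_lim: "(\<lambda>n. \<xi> (?s n) (?t n) \<tau>) \<longlonglongrightarrow> \<xi> s t \<tau>" if "tree_verts \<tau> \<le> N" for \<tau>
      by (rule xi_tendsto[OF st(1) less_imp_le[OF st(2)] st(3) s_prop s_lim t_prop t_lim that])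
    obtain b where b: "\<And>\<tau> y. tree_verts \<tau> \<le> N \<Longrightarrow> \<bar>y\<bar> \<le> K \<Longrightarrow> \<bar>cT D y \<tau>\<bar> \<le> b \<tau>"
      using cT_bounded[OF D, of K] by metis
    let ?E = "\<lambda>n. \<Sum>\<tau> | tree_verts \<tau> \<le> N. b \<tau> * \<bar>\<xi> (?s n) (?t n) \<tau> - \<xi> s t \<tau>\<bar>"
    have E_lim: "?E \<longlonglongrightarrow> 0"
    proof -
      have "?E \<longlonglongrightarrow> (\<Sum>\<tau> | tree_verts \<tau> \<le> N. b \<tau> * \<bar>\<xi> s t \<tau> - \<xi> s t \<tau>\<bar>)"
        by (intro tendsto_intros xi_lim) auto
      then show ?thesis by simp
    qed
    have h_powr: "(\<lambda>n. C1 * (2 * h n) powr \<gamma>) \<longlonglongrightarrow> 0"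
    proof -
      have "(\<lambda>n. (2 * h n) powr \<gamma>) \<longlonglongrightarrow> 0"
      proof (rule tendsto_zero_powrI[OF _ tendsto_const _ gam])
        show "(\<lambda>n. 2 * h n) \<longlonglongrightarrow> 0" by (rule tendsto_mult_right_zero[OF h_lim])
      qed (use less_imp_le[OF h_pos] in simp)
      then show ?thesis by (rule tendsto_mult_right_zero)
    qed
    have C_lim: "(\<lambda>n. C * (?t n - ?s n) powr \<theta>) \<longlonglongrightarrow> C * (t - s) powr \<theta>"
      using st by (intro tendsto_intros t_lim s_lim) auto
    define L where "L = 1 + C1 * (t - s) powr \<gamma>"
    have L: "L \<ge> 1" using C1(1) by (simp add: L_def)
    let ?R = "\<lambda>n. C * (?t n - ?s n) powr \<theta> + ?E n + C1 * (2 * h n) powr \<gamma>"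
    have "?R \<longlonglongrightarrow> C * (t - s) powr \<theta> + 0 + 0"
      by (intro tendsto_add C_lim E_lim h_powr)
    then have "\<forall>\<^sub>F n in sequentially. ?R n < C * (t - s) powr \<theta> + e / 2"
      using e by (intro order_tendstoD(2)) auto
    then obtain n1 where n1: "\<And>n. n \<ge> n1 \<Longrightarrow> ?R n < C * (t - s) powr \<theta> + e / 2"
      by (auto simp: eventually_sequentially)
    obtain n where n: "n \<ge> n1" "\<bar>F n s - Y s\<bar> < e / (4 * L)" "\<bar>F n t - Y t\<bar> < e / (4 * L)"
      using Y(2)[of "e / (4 * L)" n1 s t] e L by auto
    have Fs: "F n s = Z n (lo n s)" "F n t = Z n (lo n t)" using st sT by (auto simp: F_def)
    have Fb: "\<bar>F n s\<bar> \<le> K" unfolding Fs using Zb lo(3)[OF st(1) sT(1)] by simp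
    have lohi: "lo n s < hi n t"
    proof -
      have "real (lo n s) * h n < real (hi n t) * h n"
        using lo(1)[OF st(1) sT(1), of n] hi(1)[OF sT(2) st(3), of n] st(2) by linarith
      then show ?thesis using h_pos[of n] by (simp add: mult_less_cancel_right)
    qed
    have "real (hi n t - lo n s) * h n = ?t n - ?s n" using lohi by (simp add: of_nat_diff algebra_simps)
    then have d1: "\<bar>Z n (hi n t) - step D (?s n) (?t n) (F n s)\<bar> \<le> C * (?t n - ?s n) powr \<theta>"
      using C(2)[of "m n" "lo n s" "hi n t"] lohi hi(3)[OF sT(2) st(3), of n]
      unfolding Fs Z_def h_def[symmetric] by (simp add: m_def)
    have d2: "\<bar>step D (?s n) (?t n) (F n s) - step D s t (F n s)\<bar> \<le> ?E n"
    proof -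
      have "step D (?s n) (?t n) (F n s) - step D s t (F n s)
          = (\<Sum>\<tau> | tree_verts \<tau> \<le> N. cT D (F n s) \<tau> * (\<xi> (?s n) (?t n) \<tau> - \<xi> s t \<tau>))"
        unfolding step_def evc_PP by (simp add: sum_subtractf right_diff_distrib)
      also have "\<bar>\<Sum>\<tau> | tree_verts \<tau> \<le> N. cT D (F n s) \<tau> * (\<xi> (?s n) (?t n) \<tau> - \<xi> s t \<tau>)\<bar> \<le> ?E n"
        by (rule order.trans[OF sum_abs], rule sum_mono) (auto simp: abs_mult intro!: mult_right_mono b Fb)
      finally show ?thesis .
    qed
    have d3: "\<bar>step D s t (F n s) - step D s t (Y s)\<bar> \<le> e / 4"
    proof -
      have "\<bar>step D s t (F n s) - step D s t (Y s)\<bar>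
          \<le> \<bar>F n s - Y s\<bar> + \<bar>evc (\<xi> s t) (PP D N (F n s)) - evc (\<xi> s t) (PP D N (Y s))\<bar>"
        unfolding step_def by linarith
      also have "\<dots> \<le> L * \<bar>F n s - Y s\<bar>"
        using C1(3)[OF st(1) _ st(3) Fb Y(1)[of s]] st(2) by (simp add: L_def distrib_right)
      also have "\<dots> \<le> L * (e / (4 * L))" using n(2) L by (intro mult_left_mono) auto
      finally show ?thesis using L by simp
    qed
    have d4: "\<bar>F n t - Y t\<bar> \<le> e / 4"
    proof -
      have "e / (4 * L) \<le> e / 4" using L e by (intro divide_left_mono) auto
      then show ?thesis using n(3) by linarith
    qed
    have d5: "\<bar>Z n (hi n t) - F n t\<bar> \<le> C1 * (2 * h n) powr \<gamma>"
    proof -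
      have l: "lo n t \<le> hi n t"
      proof -
        have "real (lo n t) * h n \<le> real (hi n t) * h n"
          using lo(1)[OF sT(2) st(3), of n] hi(1)[OF sT(2) st(3), of n] by linarith
        then show ?thesis using h_pos[of n] by (simp add: mult_le_cancel_right)
      qed
      have u: "hi n t \<le> Suc (lo n t)"
      proof -
        have "real (hi n t) * h n < (real (lo n t) + 2) * h n"
          using lo(2)[OF sT(2) st(3), of n] hi(2)[OF sT(2) st(3), of n] by (simp add: distrib_right)
        then have "real (hi n t) < real (lo n t) + 2" using h_pos[of n] by (simp add: mult_less_cancel_right)
        then show ?thesis by linarith
      qed
      show ?thesis
      proof (cases "hi n t = lo n t")
        case True
        then show ?thesis using C1(1) by (simp add: Fs)
      next
        case False
        then have s: "hi n t = Suc (lo n t)" using l u by simp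
        have "\<bar>Z n (hi n t) - F n t\<bar> = \<bar>evc (\<xi> (real (lo n t) * h n) (real (hi n t) * h n)) (PP D N (Z n (lo n t)))\<bar>"
          unfolding Fs s Z_def scheme.simps(2) step_def by simp
        also have "\<dots> \<le> C1 * (real (hi n t) * h n - real (lo n t) * h n) powr \<gamma>"
          by (rule C1(2)) (use h_pos[of n] l hiT[OF sT(2) st(3), of n] Zb lo(3)[OF sT(2) st(3)] in \<open>auto intro!: mult_right_mono\<close>)
        also have "real (hi n t) * h n - real (lo n t) * h n = h n" unfolding s by (simp add: distrib_right)
        also have "C1 * h n powr \<gamma> \<le> C1 * (2 * h n) powr \<gamma>"
          using C1(1) h_pos[of n] gam by (intro mult_left_mono powr_mono2) auto
        finally show ?thesis .
      qed
    qed
    show "\<bar>Y t - step D s t (Y s)\<bar> \<le> C * (t - s) powr \<theta> + e"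
      using d1 d2 d3 d4 d5 n1[OF n(1)] by linarith
  qed
  show ?thesis
    by (rule that[of Y]) (use main Y0 Y(1) in \<open>auto simp: davie_def\<close>)
qed

section \<open>Uniqueness\<close>

text \<open>
  Let \<open>Rs s t\<close> be the difference of the two deviations from the one-step maps. Splitting \<open>[s, t]\<close> in the middle,
  a bound \<open>M * (t - s) powr \<theta>\<close> for \<open>Rs\<close> improves to \<open>(q * M + C * S) * (t - s) powr \<theta>\<close> with \<open>q < 1\<close>, where \<open>S\<close> bounds
  \<open>\<bar>Y - Z\<bar>\<close>: the defect of the almost flow contributes its Lipschitz constant times \<open>S\<close>, and the propagation
  of the deviations a second difference. Iterating gives \<open>\<bar>Y - Z\<bar> \<le> S / 2\<close> on intervals of a fixed length on which the
  paths start at the same point, hence \<open>Y = Z\<close> there.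
\<close>

theorem davie_unique:
  assumes D: "jets (Suc N) D" "\<And>a. continuous_on UNIV (D (Suc N) a)"
    and YZ: "davie D Y" "davie D Z" "Y 0 = Z 0"
    and K: "\<And>t. 0 \<le> t \<Longrightarrow> t \<le> T \<Longrightarrow> \<bar>Y t\<bar> \<le> K" "\<And>t. 0 \<le> t \<Longrightarrow> t \<le> T \<Longrightarrow> \<bar>Z t\<bar> \<le> K"
    and t: "0 \<le> t" "t \<le> T"
  shows "Y t = Z t"
proof -
  have D': "jets N D" "\<And>a. continuous_on UNIV (D N a)"
    using D(1) jets_continuous[OF D, of N] by (auto simp: jets_def)
  have K0: "K \<ge> 0" using K(1)[of 0] T0 by simp
  obtain CY where CY: "\<And>s t. 0 \<le> s \<Longrightarrow> s < t \<Longrightarrow> t \<le> T \<Longrightarrow> \<bar>Y t - step D s t (Y s)\<bar> \<le> CY * (t - s) powr \<theta>"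
    using YZ(1) unfolding davie_def by blast
  obtain CZ where CZ: "\<And>s t. 0 \<le> s \<Longrightarrow> s < t \<Longrightarrow> t \<le> T \<Longrightarrow> \<bar>Z t - step D s t (Z s)\<bar> \<le> CZ * (t - s) powr \<theta>"
    using YZ(2) unfolding davie_def by blast
  define c where "c = max 0 (max CY CZ)"
  have c0: "c \<ge> 0" "CY \<le> c" "CZ \<le> c" by (simp_all add: c_def)
  have cY: "\<bar>Y t - step D s t (Y s)\<bar> \<le> c * (t - s) powr \<theta>" "\<bar>Z t - step D s t (Z s)\<bar> \<le> c * (t - s) powr \<theta>"
    if "0 \<le> s" "s < t" "t \<le> T" for s t
    using CY[OF that] CZ[OF that] mult_right_mono[OF c0(2), of "(t - s) powr \<theta>"]
      mult_right_mono[OF c0(3), of "(t - s) powr \<theta>"] by auto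
  obtain B where B: "B \<ge> 0" "\<And>k a x. k \<le> Suc N \<Longrightarrow> \<bar>x\<bar> \<le> K + 1 \<Longrightarrow> \<bar>D k a x\<bar> \<le> B"
    using jets_bounded[OF D, of "K + 1"] by metis
  obtain C1 where C1: "C1 \<ge> 0"
    "\<And>s t y. \<lbrakk>0 \<le> s; s \<le> t; t \<le> T; \<bar>y\<bar> \<le> K\<rbrakk> \<Longrightarrow> \<bar>evc (\<xi> s t) (PP D N y)\<bar> \<le> C1 * (t - s) powr \<gamma>"
    "\<And>s t y z. \<lbrakk>0 \<le> s; s \<le> t; t \<le> T; \<bar>y\<bar> \<le> K; \<bar>z\<bar> \<le> K\<rbrakk>
      \<Longrightarrow> \<bar>evc (\<xi> s t) (PP D N y) - evc (\<xi> s t) (PP D N z)\<bar> \<le> C1 * (t - s) powr \<gamma> * \<bar>y - z\<bar>"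
    using step_size[OF D', of K] by metis
  show ?thesis
  proof (rule almost_flow_lip[OF N1 D(1), of K B 1])
    show "\<bar>D k a z\<bar> \<le> B" if "k \<le> Suc N" "\<bar>z\<bar> \<le> K + 1" for k a z by (rule B(2)[OF that])
    fix C2 assume C2: "C2 \<ge> 0" and
    fl: "\<And>\<xi> \<xi>2 \<xi>12 \<epsilon> y z. \<lbrakk>0 \<le> \<epsilon>; \<epsilon> \<le> 1; \<And>y. \<bar>y\<bar> \<le> K \<Longrightarrow> \<bar>evc \<xi> (PP D N y)\<bar> \<le> 1;
      \<And>\<tau>. tree_verts \<tau> \<le> N \<Longrightarrow> \<bar>\<xi> \<tau>\<bar> \<le> \<epsilon> ^ tree_verts \<tau>;
      \<And>\<tau>. tree_verts \<tau> \<le> N \<Longrightarrow> \<bar>\<xi>2 \<tau>\<bar> \<le> \<epsilon> ^ tree_verts \<tau>;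
      \<And>\<tau>. tree_verts \<tau> \<le> N \<Longrightarrow> \<xi>12 \<tau> = evc \<xi>2 (Qt \<xi> \<tau>); \<bar>y\<bar> \<le> K; \<bar>z\<bar> \<le> K\<rbrakk>
      \<Longrightarrow> \<bar>(evc \<xi> (PP D N y) + evc \<xi>2 (PP D N (y + evc \<xi> (PP D N y))) - evc \<xi>12 (PP D N y))
          - (evc \<xi> (PP D N z) + evc \<xi>2 (PP D N (z + evc \<xi> (PP D N z))) - evc \<xi>12 (PP D N z))\<bar> \<le> C2 * \<epsilon> ^ Suc N * \<bar>y - z\<bar>"
    show ?thesis
    proof (rule four_point_PP[OF D, of "K + 2"])
      fix C3 assume C3: "C3 \<ge> 0" and
      fp: "\<And>\<xi> \<epsilon> a b q r. \<lbrakk>0 \<le> \<epsilon>; \<epsilon> \<le> 1; \<And>\<tau>. tree_verts \<tau> \<le> N \<Longrightarrow> \<bar>\<xi> \<tau>\<bar> \<le> \<epsilon> ^ tree_verts \<tau>;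
        \<bar>a\<bar> \<le> K + 2; \<bar>b\<bar> \<le> K + 2; \<bar>a + r\<bar> \<le> K + 2; \<bar>a + q\<bar> \<le> K + 2; \<bar>b + q\<bar> \<le> K + 2\<rbrakk>
        \<Longrightarrow> \<bar>evc \<xi> (PP D N (a + r)) - evc \<xi> (PP D N a) - evc \<xi> (PP D N (b + q)) + evc \<xi> (PP D N b)\<bar>
          \<le> C3 * \<epsilon> * (\<bar>r - q\<bar> + \<bar>q\<bar> * \<bar>a - b\<bar>)"
      define Rs where "Rs s t = (Y t - step D s t (Y s)) - (Z t - step D s t (Z s))" for s t
      \<comment> \<open>Halving alone contracts by \<open>2 powr (1 - \<theta>)\<close>; any \<open>q\<close> between this and \<open>1\<close> tolerates the perturbation
        on short intervals.\<close>
      define q where "q = (1 + 2 powr (1 - \<theta>)) / 2"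
      have p2: "2 powr (1 - \<theta>) < 1" using theta by (simp add: powr_less_one)
      have q: "q < 1" "q > 2 powr (1 - \<theta>)" using p2 by (simp_all add: q_def)
      have q0: "q > 0" using q(2) by (smt (verit) powr_ge_zero)
      have "\<exists>h>0. Cx * h powr \<gamma> \<le> 1 \<and> C1 * h powr \<gamma> \<le> 1 \<and> c * h powr \<theta> \<le> 1 \<and>
          (2 + C3 * (Cx * h powr \<gamma>)) * (1 / 2) powr \<theta> \<le> q \<and> (C2 * Cx ^ Suc N + C3 * 2 * c) / (1 - q) * h powr \<theta> \<le> 1 / 2"
      proof -
        have g: "((\<lambda>h. a * h powr \<gamma>) \<longlongrightarrow> 0) (at_right 0)" "((\<lambda>h. a * h powr \<theta>) \<longlongrightarrow> 0) (at_right 0)" for a :: real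
        proof -
          have "((\<lambda>h::real. h powr x) \<longlongrightarrow> 0) (at_right 0)" if "x > 0" for x
            by (rule tendsto_zero_powrI[OF tendsto_ident_at tendsto_const _ that])
              (rule eventually_mono[OF eventually_at_right_less], simp)
          then show "((\<lambda>h. a * h powr \<gamma>) \<longlongrightarrow> 0) (at_right 0)" "((\<lambda>h. a * h powr \<theta>) \<longlongrightarrow> 0) (at_right 0)"
            using gam theta by (auto intro!: tendsto_mult_right_zero)
        qed
        have half: "2 * (1 / 2) powr \<theta> = (2 :: real) powr (1 - \<theta>)"
          by (simp add: powr_diff powr_divide)
        have "((\<lambda>h. (2 + C3 * (Cx * h powr \<gamma>)) * (1 / 2) powr \<theta>) \<longlongrightarrow> (2 + C3 * 0) * (1 / 2) powr \<theta>) (at_right 0)"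
          by (intro tendsto_mult tendsto_add tendsto_const g)
        then have 4: "\<forall>\<^sub>F h in at_right 0. (2 + C3 * (Cx * h powr \<gamma>)) * (1 / 2) powr \<theta> < q"
          by (rule order_tendstoD(2)) (use half q in simp)
        have "\<forall>\<^sub>F h in at_right 0. h > 0 \<and> Cx * h powr \<gamma> < 1 \<and> C1 * h powr \<gamma> < 1 \<and> c * h powr \<theta> < 1 \<and>
          (2 + C3 * (Cx * h powr \<gamma>)) * (1 / 2) powr \<theta> < q \<and> (C2 * Cx ^ Suc N + C3 * 2 * c) / (1 - q) * h powr \<theta> < 1 / 2"
          by (intro eventually_conj 4 eventually_at_right_less order_tendstoD(2)[OF g(1)] order_tendstoD(2)[OF g(2)]) auto
        then obtain h where "h > 0 \<and> Cx * h powr \<gamma> < 1 \<and> C1 * h powr \<gamma> < 1 \<and> c * h powr \<theta> < 1 \<and>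
          (2 + C3 * (Cx * h powr \<gamma>)) * (1 / 2) powr \<theta> < q \<and> (C2 * Cx ^ Suc N + C3 * 2 * c) / (1 - q) * h powr \<theta> < 1 / 2"
          using eventually_happens'[OF trivial_limit_at_right_real] by blast
        then show ?thesis by (intro exI[of _ h]) auto
      qed
      then obtain h where h: "h > 0" "Cx * h powr \<gamma> \<le> 1" "C1 * h powr \<gamma> \<le> 1" "c * h powr \<theta> \<le> 1"
        "(2 + C3 * (Cx * h powr \<gamma>)) * (1 / 2) powr \<theta> \<le> q" "(C2 * Cx ^ Suc N + C3 * 2 * c) / (1 - q) * h powr \<theta> \<le> 1 / 2"
        by blast
      let ?C = "C2 * Cx ^ Suc N + C3 * 2 * c"
      have C_0: "?C \<ge> 0" using C2 C3 c0 Cx0 by simp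
      have improve: "\<bar>Rs s t\<bar> \<le> (q * M + ?C * S) * (t - s) powr \<theta>"
        if S: "\<And>r. a \<le> r \<Longrightarrow> r \<le> b \<Longrightarrow> \<bar>Y r - Z r\<bar> \<le> S" and ab: "0 \<le> a" "b \<le> T" "b - a \<le> h"
          and M: "M \<ge> 0" "\<And>s t. a \<le> s \<Longrightarrow> s < t \<Longrightarrow> t \<le> b \<Longrightarrow> \<bar>Rs s t\<bar> \<le> M * (t - s) powr \<theta>"
          and st: "a \<le> s" "s < t" "t \<le> b" for a b S M s t
      proof -
        define u where "u = (s + t) / 2"
        have u: "s < u" "u < t" "u - s = (t - s) / 2" "t - u = (t - s) / 2" using st by (auto simp: u_def field_simps)
        have ord: "0 \<le> s" "s \<le> T" "0 \<le> u" "u \<le> T" "t \<le> T" "0 \<le> t" using u st ab by auto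
        have len: "t - s \<le> h" using st ab by linarith
        let ?x1 = "\<xi> s u" and ?x2 = "\<xi> u t" and ?x12 = "\<xi> s t"
        let ?ep = "Cx * (t - s) powr \<gamma>"
        have pw: "(t - s) powr \<gamma> \<le> h powr \<gamma>" "(t - s) powr \<theta> \<le> h powr \<theta>"
          using len st gam theta by (intro powr_mono2; simp)+
        have ep: "0 \<le> ?ep" "?ep \<le> Cx * h powr \<gamma>" using Cx0 pw by auto
        have ep1: "?ep \<le> 1" using ep h(2) by linarith
        have x1: "\<bar>?x1 \<tau>\<bar> \<le> ?ep ^ tree_verts \<tau>" "\<bar>?x2 \<tau>\<bar> \<le> ?ep ^ tree_verts \<tau>" if "tree_verts \<tau> \<le> N" for \<tau>
          using bnd_mono[of s u \<tau> "t - s"] bnd_mono[of u t \<tau> "t - s"] u ord that by auto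
        have inc1: "\<bar>evc ?x1 (PP D N y)\<bar> \<le> 1" if "\<bar>y\<bar> \<le> K" for y
        proof -
          have "\<bar>evc ?x1 (PP D N y)\<bar> \<le> C1 * (u - s) powr \<gamma>" by (rule C1(2)) (use u ord that in auto)
          also have "\<dots> \<le> C1 * h powr \<gamma>" using u len gam C1(1) st by (intro mult_left_mono powr_mono2) auto
          finally show ?thesis using h(3) by linarith
        qed
        have Ks: "\<bar>Y s\<bar> \<le> K" "\<bar>Z s\<bar> \<le> K" "\<bar>Y u\<bar> \<le> K" "\<bar>Z u\<bar> \<le> K" using K ord by auto
        let ?E = "\<lambda>y. evc ?x1 (PP D N y) + evc ?x2 (PP D N (y + evc ?x1 (PP D N y))) - evc ?x12 (PP D N y)"
        have E: "\<bar>?E (Y s) - ?E (Z s)\<bar> \<le> C2 * ?ep ^ Suc N * \<bar>Y s - Z s\<bar>"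
          by (rule fl[OF ep(1) ep1 inc1 x1 _ Ks(1,2)]) (use chen[of s u t] u ord in auto)
        define A where "A = step D s u (Y s)"
        define A' where "A' = step D s u (Z s)"
        define r where "r = Y u - A"
        define r' where "r' = Z u - A'"
        have small: "\<bar>r\<bar> \<le> c * (t - s) powr \<theta>" "\<bar>r'\<bar> \<le> c * (t - s) powr \<theta>"
        proof -
          have "c * (u - s) powr \<theta> \<le> c * (t - s) powr \<theta>"
            using u st theta c0 by (intro mult_left_mono powr_mono2) auto
          then show "\<bar>r\<bar> \<le> c * (t - s) powr \<theta>" "\<bar>r'\<bar> \<le> c * (t - s) powr \<theta>"
            using cY[of s u] u ord unfolding r_def r'_def A_def A'_def by auto
        qed
        have r1: "\<bar>r'\<bar> \<le> 1"
          using small(2) mult_left_mono[OF pw(2) c0(1)] h(4) by linarith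
        have AK: "\<bar>A\<bar> \<le> K + 1" "\<bar>A'\<bar> \<le> K + 1"
          using inc1[OF Ks(1)] inc1[OF Ks(2)] Ks unfolding A_def A'_def step_def by auto
        have F: "\<bar>evc ?x2 (PP D N (A + r)) - evc ?x2 (PP D N A) - evc ?x2 (PP D N (A' + r')) + evc ?x2 (PP D N A')\<bar>
          \<le> C3 * ?ep * (\<bar>r - r'\<bar> + \<bar>r'\<bar> * \<bar>A - A'\<bar>)"
          by (rule fp[OF ep(1) ep1 x1(2)]) (use AK r1 Ks r_def r'_def in auto)
        have AA: "\<bar>A - A'\<bar> \<le> 2 * S"
        proof -
          have "\<bar>evc ?x1 (PP D N (Y s)) - evc ?x1 (PP D N (Z s))\<bar> \<le> C1 * (u - s) powr \<gamma> * \<bar>Y s - Z s\<bar>"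
            by (rule C1(3)) (use u ord Ks in auto)
          also have "\<dots> \<le> 1 * \<bar>Y s - Z s\<bar>"
          proof (rule mult_right_mono)
            have "C1 * (u - s) powr \<gamma> \<le> C1 * h powr \<gamma>" using u len gam C1(1) st by (intro mult_left_mono powr_mono2) auto
            then show "C1 * (u - s) powr \<gamma> \<le> 1" using h(3) by linarith
          qed simp
          finally show ?thesis using S[of s] st unfolding A_def A'_def step_def by auto
        qed
        have S0: "S \<ge> 0" using S[of s] st by auto
        \<comment> \<open>Deviation over \<open>[u, t]\<close>, deviation over \<open>[s, u]\<close>, its propagation by the step over \<open>[u, t]\<close>, and the defect of the almost flow.\<close>
        have dec: "Rs s t = Rs u t + (r - r')
            + (evc ?x2 (PP D N (A + r)) - evc ?x2 (PP D N A) - evc ?x2 (PP D N (A' + r')) + evc ?x2 (PP D N A'))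
            + (?E (Y s) - ?E (Z s))"
          unfolding Rs_def r_def r'_def A_def A'_def step_def by simp
        have rr: "r - r' = Rs s u" unfolding Rs_def r_def r'_def A_def A'_def by simp
        have M1: "\<bar>Rs s u\<bar> \<le> M * ((1 / 2) powr \<theta> * (t - s) powr \<theta>)" "\<bar>Rs u t\<bar> \<le> M * ((1 / 2) powr \<theta> * (t - s) powr \<theta>)"
        proof -
          have e: "((t - s) / 2) powr \<theta> = (1 / 2) powr \<theta> * (t - s) powr \<theta>"
            using powr_mult[of "1 / 2" "t - s" \<theta>] by simp
          show "\<bar>Rs s u\<bar> \<le> M * ((1 / 2) powr \<theta> * (t - s) powr \<theta>)" "\<bar>Rs u t\<bar> \<le> M * ((1 / 2) powr \<theta> * (t - s) powr \<theta>)"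
            using M(2)[of s u] M(2)[of u t] u st unfolding u(3,4) e by auto
        qed
        let ?P = "(1 / 2) powr \<theta> * (t - s) powr \<theta>"
        have F': "C3 * ?ep * (\<bar>r - r'\<bar> + \<bar>r'\<bar> * \<bar>A - A'\<bar>)
            \<le> C3 * (Cx * h powr \<gamma>) * (M * ?P) + C3 * 1 * ((c * (t - s) powr \<theta>) * (2 * S))"
        proof -
          have "C3 * ?ep * \<bar>r - r'\<bar> \<le> C3 * (Cx * h powr \<gamma>) * (M * ?P)"
            unfolding rr using ep C3 M1(1) Cx0 by (intro mult_mono mult_left_mono) auto
          moreover have "C3 * ?ep * (\<bar>r'\<bar> * \<bar>A - A'\<bar>) \<le> C3 * 1 * ((c * (t - s) powr \<theta>) * (2 * S))"
            using ep ep1 C3 small(2) AA c0 S0 by (intro mult_mono mult_left_mono) auto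
          ultimately show ?thesis by (simp only: distrib_left)
        qed
        have E': "C2 * ?ep ^ Suc N * \<bar>Y s - Z s\<bar> \<le> C2 * (Cx ^ Suc N * (t - s) powr \<theta>) * S"
        proof -
          have eq: "?ep ^ Suc N = Cx ^ Suc N * (t - s) powr \<theta>"
            using eps_power[of "t - s" 1] by (simp only: mult_1_right power_one)
          show ?thesis unfolding eq by (rule mult_left_mono) (use C2 Cx0 S[of s] st in auto)
        qed
        have tri: "\<bar>w1 + w2 + w3 + w4\<bar> \<le> b1 + b2 + b3 + b4"
          if "\<bar>w1\<bar> \<le> b1" "\<bar>w2\<bar> \<le> b2" "\<bar>w3\<bar> \<le> b3" "\<bar>w4\<bar> \<le> b4" for w1 w2 w3 w4 b1 b2 b3 b4 :: real
          using that by linarith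
        have "\<bar>Rs s t\<bar> \<le> M * ?P + M * ?P + (C3 * (Cx * h powr \<gamma>) * (M * ?P) + C3 * 1 * ((c * (t - s) powr \<theta>) * (2 * S)))
            + C2 * (Cx ^ Suc N * (t - s) powr \<theta>) * S"
          unfolding dec
          by (rule tri[OF M1(2) _ order.trans[OF F F'] order.trans[OF E E']]) (unfold rr, rule M1(1))
        also have "\<dots> = ((2 + C3 * (Cx * h powr \<gamma>)) * (1 / 2) powr \<theta> * M + ?C * S) * (t - s) powr \<theta>"
          by (simp add: algebra_simps)
        also have "\<dots> \<le> (q * M + ?C * S) * (t - s) powr \<theta>"
          using mult_right_mono[OF h(5) M(1)] by (intro mult_right_mono) auto
        finally show ?thesis .
      qed
      have contract: "\<bar>Y r - Z r\<bar> \<le> S / 2"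
        if S: "\<And>r. a \<le> r \<Longrightarrow> r \<le> b \<Longrightarrow> \<bar>Y r - Z r\<bar> \<le> S" and ab: "0 \<le> a" "b \<le> T" "b - a \<le> h" and eq: "Y a = Z a"
          and r: "a \<le> r" "r \<le> b" for a b S r
      proof (cases "r = a")
        case True
        then show ?thesis using eq S[OF r] by simp
      next
        case False
        have S0: "S \<ge> 0" using S[OF r] by auto
        have iter: "\<bar>Rs s t\<bar> \<le> (q ^ n * (2 * c) + ?C * S / (1 - q)) * (t - s) powr \<theta>"
          if "a \<le> s" "s < t" "t \<le> b" for n s t
          using that
        proof (induction n arbitrary: s t)
          case 0
          have "\<bar>Rs s t\<bar> \<le> (2 * c) * (t - s) powr \<theta>"
            using cY[of s t] 0 ab unfolding Rs_def by auto
          also have "\<dots> \<le> (q ^ 0 * (2 * c) + ?C * S / (1 - q)) * (t - s) powr \<theta>"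
            using C_0 S0 q by (intro mult_right_mono) auto
          finally show ?case .
        next
          case (Suc n)
          let ?M = "q ^ n * (2 * c) + ?C * S / (1 - q)"
          have "\<bar>Rs s t\<bar> \<le> (q * ?M + ?C * S) * (t - s) powr \<theta>"
            by (rule improve[OF S ab _ Suc.IH Suc.prems]) (use q q0 c0 C_0 S0 in auto)
          also have "q * ?M + ?C * S = q ^ Suc n * (2 * c) + ?C * S / (1 - q)"
            using q(1) by (simp add: field_simps)
          finally show ?case .
        qed
        have "(\<lambda>n. (q ^ n * (2 * c) + ?C * S / (1 - q)) * (r - a) powr \<theta>) \<longlonglongrightarrow> (0 * (2 * c) + ?C * S / (1 - q)) * (r - a) powr \<theta>"
          using q q0 by (intro tendsto_mult tendsto_add tendsto_const LIMSEQ_realpow_zero) auto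
        then have lim: "\<bar>Rs a r\<bar> \<le> (0 * (2 * c) + ?C * S / (1 - q)) * (r - a) powr \<theta>"
          by (rule LIMSEQ_le_const) (use iter[of a r] r False in auto)
        have "Y r - Z r = Rs a r" unfolding Rs_def step_def eq by simp
        then have "\<bar>Y r - Z r\<bar> \<le> ?C * S / (1 - q) * (r - a) powr \<theta>" using lim by simp
        also have "\<dots> \<le> ?C * S / (1 - q) * h powr \<theta>"
          using r ab theta C_0 S0 q by (intro mult_left_mono powr_mono2) auto
        also have "\<dots> = (?C / (1 - q) * h powr \<theta>) * S" by simp
        also have "\<dots> \<le> 1 / 2 * S" by (rule mult_right_mono[OF h(6) S0])
        finally show ?thesis by simp
      qed
      have local: "Y r = Z r" if ab: "0 \<le> a" "b \<le> T" "b - a \<le> h" and eq: "Y a = Z a" and r: "a \<le> r" "r \<le> b" for a b r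
      proof -
        have "\<bar>Y r - Z r\<bar> \<le> 2 * K * (1 / 2) ^ n" if "a \<le> r" "r \<le> b" for n r
          using that
        proof (induction n arbitrary: r)
          case 0
          then show ?case using K(1)[of r] K(2)[of r] ab by auto
        next
          case (Suc n)
          show ?case using contract[OF Suc.IH ab eq Suc.prems] by simp
        qed
        moreover have "(\<lambda>n. 2 * K * (1 / 2) ^ n) \<longlonglongrightarrow> 2 * K * 0"
          by (intro tendsto_mult tendsto_const LIMSEQ_realpow_zero) auto
        ultimately have "\<bar>Y r - Z r\<bar> \<le> 2 * K * 0"
          using LIMSEQ_le_const[of "\<lambda>n. 2 * K * (1 / 2) ^ n" "2 * K * 0" "\<bar>Y r - Z r\<bar>"] r by blast
        then show ?thesis by simp
      qed
      have "\<forall>r. 0 \<le> r \<and> r \<le> T \<and> r \<le> real n * h \<longrightarrow> Y r = Z r" for n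
      proof (induction n)
        case 0
        then show ?case using YZ(3) by auto
      next
        case (Suc n)
        show ?case
        proof (intro allI impI)
          fix r assume r: "0 \<le> r \<and> r \<le> T \<and> r \<le> real (Suc n) * h"
          show "Y r = Z r"
          proof (cases "r \<le> real n * h")
            case False
            have n0: "0 \<le> real n * h" using h(1) by simp
            have "real n * h \<le> T" using False r by linarith
            then have "Y (real n * h) = Z (real n * h)" using Suc.IH n0 by simp
            from local[OF n0 _ _ this, of r r] show ?thesis using r False by (simp add: distrib_right)
          qed (use Suc.IH r in auto)
        qed
      qed
      moreover obtain n :: nat where "t / h \<le> real n" using real_arch_simple by blast
      ultimately show "Y t = Z t" using t h(1) by (simp add: pos_divide_le_eq)
    qed
  qed
qed

end

section \<open>Local expansions and the germ of the rough integral\<close>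

lemma lookup_Qf_bound:
  fixes g h :: "'d::finite forest"
  assumes "verts g \<le> N"
  shows "\<exists>C\<ge>0. \<forall>\<xi> \<epsilon>. 0 \<le> \<epsilon> \<longrightarrow> \<epsilon> \<le> E \<longrightarrow> (\<forall>\<tau>. tree_verts \<tau> \<le> N \<longrightarrow> \<bar>\<xi> \<tau>\<bar> \<le> \<epsilon> ^ tree_verts \<tau>)
    \<longrightarrow> \<bar>Poly_Mapping.lookup (Qf \<xi> g) h\<bar> \<le> C * \<epsilon> ^ (verts g - verts h)"
proof -
  let ?P = "{(\<xi> :: 'd rtree \<Rightarrow> real, \<epsilon>). 0 \<le> \<epsilon> \<and> \<epsilon> \<le> E \<and> (\<forall>\<tau>. tree_verts \<tau> \<le> N \<longrightarrow> \<bar>\<xi> \<tau>\<bar> \<le> \<epsilon> ^ tree_verts \<tau>)}"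
  interpret scale ?P "\<lambda>_. {0}" snd E
    by unfold_locales auto
  have "HOrd (verts g) (\<lambda>p y. Qf (fst p) g)"
  proof (rule HOrd_Qf_general[where N = N])
    show "Ord (tree_verts \<tau>) (\<lambda>p y. fst p \<tau>)" if "tree_verts \<tau> \<le> N" for \<tau> :: "'d rtree"
      by (rule Ord_param[of _ 1]) (use that in auto)
    show "set_mset g \<subseteq> {\<tau>. tree_verts \<tau> \<le> N}" using tree_verts_le[of _ g] assms by fastforce
  qed
  from HOrdD[OF this, of h] have "\<exists>C\<ge>0. \<forall>p\<in>?P. \<forall>y\<in>{0}.
      \<bar>Poly_Mapping.lookup (Qf (fst p) g) h\<bar> \<le> C * snd p ^ (verts g - verts h)"
    by (elim Ord_boundE) blast
  then obtain C where C: "C \<ge> 0" "\<forall>p\<in>?P. \<forall>y\<in>{0 :: real}.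
      \<bar>Poly_Mapping.lookup (Qf (fst p) g) h\<bar> \<le> C * snd p ^ (verts g - verts h)" by blast
  show ?thesis
  proof (intro exI[of _ C] conjI allI impI C(1))
    fix \<xi> :: "'d rtree \<Rightarrow> real" and \<epsilon> :: real
    assume "0 \<le> \<epsilon>" "\<epsilon> \<le> E" "\<forall>\<tau>. tree_verts \<tau> \<le> N \<longrightarrow> \<bar>\<xi> \<tau>\<bar> \<le> \<epsilon> ^ tree_verts \<tau>"
    then show "\<bar>Poly_Mapping.lookup (Qf \<xi> g) h\<bar> \<le> C * \<epsilon> ^ (verts g - verts h)"
      using C(2)[rule_format, of "(\<xi>, \<epsilon>)" 0] by simp
  qed
qed

lemma sum_forests_single:
  fixes G :: "'d::finite forest \<Rightarrow> real"
  assumes "N \<ge> 1" "\<And>g. size g \<ge> 2 \<Longrightarrow> verts g < N \<Longrightarrow> G g = 0"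
  shows "(\<Sum>g\<in>forests_upto (int N - 1). G g) = G {#} + (\<Sum>\<tau> | tree_verts \<tau> < N. G {#\<tau>#})"
proof -
  let ?T = "{\<tau> :: 'd rtree. tree_verts \<tau> < N}"
  have fin: "finite ?T" by (rule finite_subset[OF _ finite_trees[of N]]) auto
  let ?S = "insert {#} ((\<lambda>\<tau>. {#\<tau>#}) ` ?T)"
  have "(\<Sum>g\<in>?S. G g) = (\<Sum>g\<in>forests_upto (int N - 1). G g)"
  proof (rule sum.mono_neutral_left)
    show "?S \<subseteq> forests_upto (int N - 1)" using assms(1) by (auto simp: verts_single)
    show "\<forall>g\<in>forests_upto (int N - 1) - ?S. G g = 0"
    proof
      fix g assume g: "g \<in> forests_upto (int N - 1) - ?S"
      have "size g \<noteq> 0" using g by auto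
      moreover have "size g \<noteq> 1"
      proof
        assume "size g = 1"
        then obtain \<tau> where "g = {#\<tau>#}" using size_1_singleton_mset by blast
        then show False using g by (auto simp: verts_single)
      qed
      ultimately have "size g \<ge> 2" by linarith
      then show "G g = 0" using assms(2)[of g] g by auto
    qed
  qed simp
  also have "(\<Sum>g\<in>?S. G g) = G {#} + (\<Sum>g\<in>(\<lambda>\<tau>. {#\<tau>#}) ` ?T. G g)"
    by (rule sum.insert) (use fin in auto)
  also have "(\<Sum>g\<in>(\<lambda>\<tau>. {#\<tau>#}) ` ?T. G g) = (\<Sum>\<tau>\<in>?T. G {#\<tau>#})"
    by (rule sum.reindex_cong[of "\<lambda>\<tau>. {#\<tau>#}"]) (auto simp: inj_on_def)
  finally show ?thesis by simp
qed

lemma lookup_Qt_Node: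
  "Poly_Mapping.lookup (Qt \<xi> (Node b g)) {#Node a h#} = (if b = a then Poly_Mapping.lookup (Qf \<xi> g) h else 0)"
  by (simp add: Qt_Node lookup_add lookup_scaleR' lookup_graft_Node lookup_one)

lemma lookup_Qt_size: "size f \<ge> 2 \<Longrightarrow> Poly_Mapping.lookup (Qt \<xi> \<tau>) f = 0"
  by (cases \<tau>) (auto simp: Qt_Node lookup_add lookup_scaleR' lookup_graft_size lookup_one)

context rough begin

lemma ep_pow:
  assumes "x > 0"
  shows "(Cx * x powr \<gamma>) ^ n = Cx ^ n * x powr (real n * \<gamma>)"
  using assms by (simp add: power_mult_distrib powr_power)

lemma ep_le: "0 \<le> x \<Longrightarrow> x \<le> T \<Longrightarrow> Cx * x powr \<gamma> \<le> Cx * T powr \<gamma>"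
  using Cx0 gam by (intro mult_left_mono powr_mono2) auto

text \<open>
  The path follows the one-step maps with an error of one order less than in \<open>davie\<close>. This is what the
  remainder of a controlled rough path gives directly.
\<close>

definition local_expansion :: "(nat \<Rightarrow> 'd \<Rightarrow> real \<Rightarrow> real) \<Rightarrow> (real \<Rightarrow> real) \<Rightarrow> bool" where
  "local_expansion D y \<longleftrightarrow> (\<exists>C. \<forall>s t. 0 \<le> s \<and> s < t \<and> t \<le> T \<longrightarrow>
     \<bar>y t - step D s t (y s)\<bar> \<le> C * (t - s) powr (real N * \<gamma>))"

lemma davie_local_expansion:
  assumes "davie D y"
  shows "local_expansion D y"
proof -
  obtain C where C: "\<And>s t. 0 \<le> s \<Longrightarrow> s < t \<Longrightarrow> t \<le> T \<Longrightarrow> \<bar>y t - step D s t (y s)\<bar> \<le> C * (t - s) powr \<theta>"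
    using assms unfolding davie_def by blast
  have "\<bar>y t - step D s t (y s)\<bar> \<le> \<bar>C\<bar> * T powr \<gamma> * (t - s) powr (real N * \<gamma>)" if st: "0 \<le> s" "s < t" "t \<le> T" for s t
  proof -
    have "(t - s) powr \<theta> = (t - s) powr \<gamma> * (t - s) powr (real N * \<gamma>)"
      unfolding \<theta>_def powr_add[symmetric] by (simp add: algebra_simps)
    also have "\<dots> \<le> T powr \<gamma> * (t - s) powr (real N * \<gamma>)"
      using st gam by (intro mult_right_mono powr_mono2) auto
    finally have "\<bar>C\<bar> * (t - s) powr \<theta> \<le> \<bar>C\<bar> * (T powr \<gamma> * (t - s) powr (real N * \<gamma>))" by (intro mult_left_mono) auto
    moreover have "C * (t - s) powr \<theta> \<le> \<bar>C\<bar> * (t - s) powr \<theta>" by (intro mult_right_mono) auto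
    ultimately show ?thesis using C[OF st] by (simp add: mult.assoc)
  qed
  then show ?thesis unfolding local_expansion_def by blast
qed

text \<open>
  Consistency with \<open>\<delta> = y t - y s\<close>, which equals the Euler increment up to order \<open>N\<close> by hypothesis.
\<close>

lemma consistency_path:
  fixes h :: "'d forest"
  assumes D: "jets N D" "\<And>a. continuous_on UNIV (D N a)"
    and K: "\<And>t. 0 \<le> t \<Longrightarrow> t \<le> T \<Longrightarrow> \<bar>y t\<bar> \<le> K" and loc: "local_expansion D y" and h: "verts h < N"
  shows "\<exists>C\<ge>0. \<forall>s t. 0 \<le> s \<and> s < t \<and> t \<le> T \<longrightarrow>
    \<bar>(\<Sum>f\<in>forests_upto (int N - 1). cF D (y s) a f * Poly_Mapping.lookup (Qf (\<xi> s t) f) h) - cF D (y t) a h\<bar>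
      \<le> C * (t - s) powr (real (N - verts h) * \<gamma>)"
proof -
  obtain C0 where C0: "\<And>s t. 0 \<le> s \<Longrightarrow> s < t \<Longrightarrow> t \<le> T \<Longrightarrow> \<bar>y t - step D s t (y s)\<bar> \<le> C0 * (t - s) powr (real N * \<gamma>)"
    using loc unfolding local_expansion_def by blast
  obtain B where B: "B \<ge> 0" "\<And>k a x. k \<le> N \<Longrightarrow> \<bar>x\<bar> \<le> 3 * K \<Longrightarrow> \<bar>D k a x\<bar> \<le> B"
    using jets_bounded[OF D, of "3 * K"] by metis
  show ?thesis
  proof (rule consistency_point[where ?'d = 'd and B = B and E = "Cx * T powr \<gamma>" and ?C0.0 = "C0 / Cx ^ N" and a = a, OF N1 h])
    fix C assume C: "C \<ge> 0" and
      cp: "\<And>(D :: nat \<Rightarrow> 'd \<Rightarrow> real \<Rightarrow> real) \<xi> y \<delta> \<epsilon>. \<lbrakk>jets N D;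
        \<And>k a z. k \<le> N \<Longrightarrow> \<bar>z - y\<bar> \<le> \<bar>\<delta>\<bar> \<Longrightarrow> \<bar>D k a z\<bar> \<le> B; 0 \<le> \<epsilon>; \<epsilon> \<le> Cx * T powr \<gamma>;
        \<And>\<tau>. tree_verts \<tau> \<le> N \<Longrightarrow> \<bar>\<xi> \<tau>\<bar> \<le> \<epsilon> ^ tree_verts \<tau>;
        \<bar>\<delta> - evc \<xi> (PP D N y)\<bar> \<le> C0 / Cx ^ N * \<epsilon> ^ N\<rbrakk>
        \<Longrightarrow> \<bar>(\<Sum>f\<in>forests_upto (int N - 1). cF D y a f * Poly_Mapping.lookup (Qf \<xi> f) h) - cF D (y + \<delta>) a h\<bar>
         \<le> C * \<epsilon> ^ (N - verts h)"
    show ?thesis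
    proof (intro exI[of _ "C * Cx ^ (N - verts h)"] conjI allI impI)
      show "C * Cx ^ (N - verts h) \<ge> 0" using C Cx0 by simp
      fix s t assume st: "0 \<le> s \<and> s < t \<and> t \<le> T"
      let ?e = "Cx * (t - s) powr \<gamma>"
      have Ky: "\<bar>y s\<bar> \<le> K" "\<bar>y t\<bar> \<le> K" using K st by auto
      have "\<bar>(\<Sum>f\<in>forests_upto (int N - 1). cF D (y s) a f * Poly_Mapping.lookup (Qf (\<xi> s t) f) h) - cF D (y s + (y t - y s)) a h\<bar>
          \<le> C * ?e ^ (N - verts h)"
      proof (rule cp[OF D(1)])
        show "\<bar>D k a z\<bar> \<le> B" if "k \<le> N" "\<bar>z - y s\<bar> \<le> \<bar>y t - y s\<bar>" for k a z
          by (rule B(2)[OF that(1)]) (use that(2) Ky in linarith)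
        show "0 \<le> ?e" using Cx0 by simp
        show "?e \<le> Cx * T powr \<gamma>" by (rule ep_le) (use st in auto)
        show "\<bar>\<xi> s t \<tau>\<bar> \<le> ?e ^ tree_verts \<tau>" if "tree_verts \<tau> \<le> N" for \<tau>
          by (rule bnd) (use st that in auto)
        have "C0 / Cx ^ N * ?e ^ N = C0 * (t - s) powr (real N * \<gamma>)"
          using st Cx0 ep_pow[of "t - s" N] by simp
        then show "\<bar>y t - y s - evc (\<xi> s t) (PP D N (y s))\<bar> \<le> C0 / Cx ^ N * ?e ^ N"
          using C0[of s t] st unfolding step_def by (simp add: diff_diff_eq)
      qed
      then show "\<bar>(\<Sum>f\<in>forests_upto (int N - 1). cF D (y s) a f * Poly_Mapping.lookup (Qf (\<xi> s t) f) h) - cF D (y t) a h\<bar>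
          \<le> C * Cx ^ (N - verts h) * (t - s) powr (real (N - verts h) * \<gamma>)"
        using st ep_pow[of "t - s" "N - verts h"] by (simp add: mult.assoc)
    qed
  qed
qed

text \<open>
  As for the almost flow, but with the actual value \<open>y u\<close> in place of the Euler step; Chen's relation and consistency along the path give the order \<open>N + 1\<close>.
\<close>

lemma germ_almost_additive:
  assumes D: "jets N D" "\<And>a. continuous_on UNIV (D N a)"
    and K: "\<And>t. 0 \<le> t \<Longrightarrow> t \<le> T \<Longrightarrow> \<bar>y t\<bar> \<le> K" and loc: "local_expansion D y"
  shows "\<exists>C\<ge>0. \<forall>s u t. 0 \<le> s \<and> s < u \<and> u < t \<and> t \<le> T \<longrightarrow>
    \<bar>evc (\<xi> s t) (PP D N (y s)) - evc (\<xi> s u) (PP D N (y s)) - evc (\<xi> u t) (PP D N (y u))\<bar> \<le> C * (t - s) powr \<theta>"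
proof -
  have "\<forall>a h. \<exists>C\<ge>0. verts h < N \<longrightarrow> (\<forall>s t. 0 \<le> s \<and> s < t \<and> t \<le> T \<longrightarrow>
    \<bar>(\<Sum>f\<in>forests_upto (int N - 1). cF D (y s) a f * Poly_Mapping.lookup (Qf (\<xi> s t) f) h) - cF D (y t) a h\<bar>
      \<le> C * (t - s) powr (real (N - verts h) * \<gamma>))"
  proof (intro allI)
    fix a and h :: "'d forest"
    show "\<exists>C\<ge>0. verts h < N \<longrightarrow> (\<forall>s t. 0 \<le> s \<and> s < t \<and> t \<le> T \<longrightarrow>
      \<bar>(\<Sum>f\<in>forests_upto (int N - 1). cF D (y s) a f * Poly_Mapping.lookup (Qf (\<xi> s t) f) h) - cF D (y t) a h\<bar>
        \<le> C * (t - s) powr (real (N - verts h) * \<gamma>))"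
    proof (cases "verts h < N")
      case True
      then show ?thesis using consistency_path[OF D K loc True, of a] by simp
    qed (auto intro: exI[of _ 0])
  qed
  then obtain c where c: "\<And>a h. c a h \<ge> 0" "\<And>a h s t. verts h < N \<Longrightarrow> 0 \<le> s \<Longrightarrow> s < t \<Longrightarrow> t \<le> T \<Longrightarrow>
    \<bar>(\<Sum>f\<in>forests_upto (int N - 1). cF D (y s) a f * Poly_Mapping.lookup (Qf (\<xi> s t) f) h) - cF D (y t) a h\<bar>
      \<le> c a h * (t - s) powr (real (N - verts h) * \<gamma>)"
    unfolding choice_iff by (elim exE) blast
  let ?FN = "forests_upto (int N - 1) :: 'd forest set"
  show ?thesis
  proof (intro exI[of _ "\<Sum>a\<in>UNIV. \<Sum>h\<in>?FN. c a h * Cx ^ Suc (verts h)"] conjI allI impI)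
    show "(\<Sum>a\<in>UNIV. \<Sum>h\<in>?FN. c a h * Cx ^ Suc (verts h)) \<ge> 0"
      using c(1) Cx0 by (auto intro!: sum_nonneg mult_nonneg_nonneg)
    fix s u t assume st: "0 \<le> s \<and> s < u \<and> u < t \<and> t \<le> T"
    let ?d = "\<lambda>a h. (\<Sum>f\<in>?FN. cF D (y s) a f * Poly_Mapping.lookup (Qf (\<xi> s u) f) h) - cF D (y u) a h"
    have "evc (\<xi> s t) (PP D N (y s)) = evc (\<xi> s u) (PP D N (y s)) + (\<Sum>a\<in>UNIV. evc (\<xi> u t) (graft a (Qh (\<xi> s u) (PhiH D N (y s) a))))"
      by (rule evc_PP_convolve, rule chen) (use st in auto)
    also have "(\<Sum>a\<in>UNIV. evc (\<xi> u t) (graft a (Qh (\<xi> s u) (PhiH D N (y s) a))))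
        = (\<Sum>a\<in>UNIV. \<Sum>h\<in>?FN. (\<Sum>f\<in>?FN. cF D (y s) a f * Poly_Mapping.lookup (Qf (\<xi> s u) f) h) * \<xi> u t (Node a h))"
      by (rule sum.cong[OF refl], subst evc_graft_expand[OF lookup_Qh_Phi_0]) (auto simp: lookup_Qh_Phi)
    finally have eq: "evc (\<xi> s t) (PP D N (y s)) - evc (\<xi> s u) (PP D N (y s)) - evc (\<xi> u t) (PP D N (y u))
        = (\<Sum>a\<in>UNIV. \<Sum>h\<in>?FN. ?d a h * \<xi> u t (Node a h))"
      unfolding evc_PP[of "\<xi> u t" D N "y u"] sum_trees by (simp add: sum_subtractf left_diff_distrib)
    have "\<bar>\<Sum>a\<in>UNIV. \<Sum>h\<in>?FN. ?d a h * \<xi> u t (Node a h)\<bar> \<le> (\<Sum>a\<in>UNIV. \<Sum>h\<in>?FN. (c a h * Cx ^ Suc (verts h)) * (t - s) powr \<theta>)"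
    proof (rule order.trans[OF sum_abs], rule sum_mono, rule order.trans[OF sum_abs], rule sum_mono)
      fix a and h :: "'d forest" assume "h \<in> ?FN"
      then have h: "verts h < N" by simp
      have "\<bar>?d a h\<bar> \<le> c a h * (u - s) powr (real (N - verts h) * \<gamma>)"
        by (rule c(2)[OF h]) (use st in auto)
      also have "\<dots> \<le> c a h * (t - s) powr (real (N - verts h) * \<gamma>)"
        using st gam c(1) by (intro mult_left_mono powr_mono2) auto
      finally have 1: "\<bar>?d a h\<bar> \<le> c a h * (t - s) powr (real (N - verts h) * \<gamma>)" .
      have "\<bar>\<xi> u t (Node a h)\<bar> \<le> (Cx * (t - s) powr \<gamma>) ^ tree_verts (Node a h)"
        by (rule bnd_mono) (use st h in auto)
      also have "\<dots> = Cx ^ Suc (verts h) * (t - s) powr (real (Suc (verts h)) * \<gamma>)"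
        using st ep_pow[of "t - s" "Suc (verts h)"] by simp
      finally have 2: "\<bar>\<xi> u t (Node a h)\<bar> \<le> Cx ^ Suc (verts h) * (t - s) powr (real (Suc (verts h)) * \<gamma>)" .
      have "\<bar>?d a h * \<xi> u t (Node a h)\<bar> \<le> (c a h * (t - s) powr (real (N - verts h) * \<gamma>)) * (Cx ^ Suc (verts h) * (t - s) powr (real (Suc (verts h)) * \<gamma>))"
        unfolding abs_mult by (rule mult_mono[OF 1 2]) (use c(1) in auto)
      also have "\<dots> = (c a h * Cx ^ Suc (verts h)) * ((t - s) powr (real (N - verts h) * \<gamma>) * (t - s) powr (real (Suc (verts h)) * \<gamma>))"
        by (simp only: mult_ac)
      also have "(t - s) powr (real (N - verts h) * \<gamma>) * (t - s) powr (real (Suc (verts h)) * \<gamma>) = (t - s) powr \<theta>"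
        unfolding powr_add[symmetric] \<theta>_def using h by (simp add: of_nat_diff algebra_simps)
      finally show "\<bar>?d a h * \<xi> u t (Node a h)\<bar> \<le> (c a h * Cx ^ Suc (verts h)) * (t - s) powr \<theta>" .
    qed
    then show "\<bar>evc (\<xi> s t) (PP D N (y s)) - evc (\<xi> s u) (PP D N (y s)) - evc (\<xi> u t) (PP D N (y u))\<bar>
        \<le> (\<Sum>a\<in>UNIV. \<Sum>h\<in>?FN. c a h * Cx ^ Suc (verts h)) * (t - s) powr \<theta>"
      unfolding eq by (simp only: sum_distrib_right)
  qed
qed

text \<open>
  The Riemann sums of the rough integral over uniform partitions stay within \<open>O((t - s) powr \<theta>)\<close> of one summand.
\<close>

lemma germ_sewing:
  assumes D: "jets N D" "\<And>a. continuous_on UNIV (D N a)"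
    and K: "\<And>t. 0 \<le> t \<Longrightarrow> t \<le> T \<Longrightarrow> \<bar>y t\<bar> \<le> K" and loc: "local_expansion D y"
  shows "\<exists>C\<ge>0. \<forall>s t n. 0 \<le> s \<and> s < t \<and> t \<le> T \<and> n \<ge> (1 :: nat) \<longrightarrow>
    \<bar>(\<Sum>i<n. evc (\<xi> (s + real i * ((t - s) / real n)) (s + real (Suc i) * ((t - s) / real n))) (PP D N (y (s + real i * ((t - s) / real n)))))
      - evc (\<xi> s t) (PP D N (y s))\<bar> \<le> C * (t - s) powr \<theta>"
proof -
  obtain C where C: "C \<ge> 0" "\<And>s u t. 0 \<le> s \<Longrightarrow> s < u \<Longrightarrow> u < t \<Longrightarrow> t \<le> T \<Longrightarrow>
    \<bar>evc (\<xi> s t) (PP D N (y s)) - evc (\<xi> s u) (PP D N (y s)) - evc (\<xi> u t) (PP D N (y u))\<bar> \<le> C * (t - s) powr \<theta>"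
    using germ_almost_additive[OF D K loc] by blast
  have sr: "1 * sew_ratio \<theta> < 1" using sew_ratio_less[OF theta] by simp
  show ?thesis
  proof (intro exI[of _ "C / (1 - 1 * sew_ratio \<theta>)"] conjI allI impI)
    show "C / (1 - 1 * sew_ratio \<theta>) \<ge> 0" using C(1) sr by simp
    fix s t and n :: nat assume h: "0 \<le> s \<and> s < t \<and> t \<le> T \<and> n \<ge> 1"
    define x where "x = (t - s) / real n"
    have x: "x > 0" using h by (simp add: x_def)
    have nx: "real n * x = t - s" using h by (simp add: x_def)
    define p where "p i = s + real i * x" for i
    let ?X = "\<lambda>i k. evc (\<xi> (p i) (p k)) (PP D N (y (p i)))"
    have p_less: "p i < p k" if "i < k" for i k using that x by (simp add: p_def)
    have pk: "p k - p i = real (k - i) * x" if "i < k" for i k using that by (simp add: p_def of_nat_diff algebra_simps)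
    have pT: "0 \<le> p i" "p i \<le> T" if "i \<le> n" for i
    proof -
      have "real i * x \<le> real n * x" using that x by (intro mult_right_mono) auto
      then show "p i \<le> T" using nx h by (simp add: p_def)
      show "0 \<le> p i" using h x by (simp add: p_def)
    qed
    have "\<bar>(\<Sum>j\<in>{0..<n}. ?X j (Suc j)) - ?X 0 n\<bar> \<le> C / (1 - 1 * sew_ratio \<theta>) * (real (n - 0) * x) powr \<theta>"
    proof (rule discrete_sewing[where a = 0 and b = n and r = "\<lambda>i k. \<bar>(\<Sum>j\<in>{i..<k}. ?X j (Suc j)) - ?X i k\<bar>", OF theta _ sr less_imp_le[OF x] C(1)])
      fix i j k :: nat assume ijk: "i < j" "j < k" "k \<le> n"
      have sp: "sum f {i..<k} = sum f {i..<j} + sum f {j..<k}" for f :: "nat \<Rightarrow> real"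
        using sum.atLeastLessThan_concat[of i j k f] ijk by simp
      have ca: "\<bar>?X i k - ?X i j - ?X j k\<bar> \<le> C * (real (k - i) * x) powr \<theta>"
        using C(2)[of "p i" "p j" "p k"] p_less[OF ijk(1)] p_less[OF ijk(2)] pT ijk pk[of i k] by simp
      have tri: "\<bar>a + b - w\<bar> \<le> 1 * (\<bar>a - v\<bar> + \<bar>b - v'\<bar>) + e" if "\<bar>w - v - v'\<bar> \<le> e" for a b v v' w e :: real
        unfolding mult_1_left using that by arith
      show "\<bar>(\<Sum>j\<in>{i..<k}. ?X j (Suc j)) - ?X i k\<bar>
          \<le> 1 * (\<bar>(\<Sum>j\<in>{i..<j}. ?X j (Suc j)) - ?X i j\<bar> + \<bar>(\<Sum>j\<in>{j..<k}. ?X j (Suc j)) - ?X j k\<bar>) + C * (real (k - i) * x) powr \<theta>"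
        unfolding sp by (rule tri[OF ca])
    qed (use h in auto)
    moreover have pe: "p 0 = s" "p n = t" "real (n - 0) * x = t - s" using nx by (simp_all add: p_def)
    ultimately show "\<bar>(\<Sum>i<n. evc (\<xi> (s + real i * ((t - s) / real n)) (s + real (Suc i) * ((t - s) / real n))) (PP D N (y (s + real i * ((t - s) / real n)))))
      - evc (\<xi> s t) (PP D N (y s))\<bar> \<le> C / (1 - 1 * sew_ratio \<theta>) * (t - s) powr \<theta>"
      unfolding x_def[symmetric] p_def[symmetric] by (simp only: pe atLeast0LessThan)
  qed
qed

end

section \<open>Growth of the vector field\<close>

text \<open>
  A decreasing ratio is at most its value \<open>1\<close> at the origin. An increasing ratio that exceeds \<open>2\<close> somewhere
  does so at all larger points, and then \<open>l\<close> outgrows every linear function along the powers of two.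
\<close>

lemma ratio_doubling:
  fixes l :: "real \<Rightarrow> real"
  assumes l1: "\<And>x. x \<ge> 0 \<Longrightarrow> l x \<ge> 1" and mono: "mono_on {0..} l"
    and ratio: "mono_on {0..} (\<lambda>x. l (2 * x) / l x) \<or> antimono_on {0..} (\<lambda>x. l (2 * x) / l x)"
    and lin: "\<forall>x\<ge>0. l x \<le> c * (1 + x)" and x: "x \<ge> 0"
  shows "l (2 * x) \<le> 2 * l x"
proof (rule ccontr)
  assume not: "\<not> ?thesis"
  have pos: "l y > 0" if "y \<ge> 0" for y using l1[OF that] by linarith
  define q where "q = l (2 * x) / l x"
  have q2: "q > 2" using not pos[OF x] by (simp add: q_def field_simps)
  from ratio show False
  proof
    assume "antimono_on {0..} (\<lambda>x. l (2 * x) / l x)"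
    then have "l (2 * x) / l x \<le> l (2 * 0) / l 0" by (rule monotone_onD) (use x in auto)
    also have "\<dots> = 1" using pos[of 0] by simp
    finally show False using q2 by (simp add: q_def)
  next
    assume m: "mono_on {0..} (\<lambda>x. l (2 * x) / l x)"
    have it: "q ^ k \<le> l (2 ^ k * x)" for k
    proof (induction k)
      case 0
      then show ?case using l1[OF x] by simp
    next
      case (Suc k)
      have "x \<le> 2 ^ k * x" using x by (simp add: mult_le_cancel_right1)
      then have "q \<le> l (2 * (2 ^ k * x)) / l (2 ^ k * x)"
        unfolding q_def by (intro mono_onD[OF m]) (use x in auto)
      then have "q * l (2 ^ k * x) \<le> l (2 * (2 ^ k * x))"
        using pos[of "2 ^ k * x"] x by (simp add: pos_le_divide_eq)
      moreover have "q * q ^ k \<le> q * l (2 ^ k * x)" using Suc q2 by (intro mult_left_mono) auto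
      ultimately show ?case by (simp add: mult.assoc)
    qed
    have c0: "c \<ge> 0" using lin[rule_format, of 0] l1[of 0] by simp
    obtain k where k: "c * (1 + x) < (q / 2) ^ k"
      using real_arch_pow[of "q / 2" "c * (1 + x)"] q2 by auto
    have "q ^ k \<le> c * (1 + 2 ^ k * x)" using it[of k] lin x by (meson mult_nonneg_nonneg order_trans zero_le_numeral zero_le_power)
    also have "\<dots> \<le> c * (2 ^ k * (1 + x))" using c0 by (intro mult_left_mono) (auto simp: distrib_left)
    finally have "q ^ k / 2 ^ k \<le> c * (1 + x)" by (simp add: field_simps)
    then show False using k by (simp add: power_divide)
  qed
qed

lemma sublinear_eventually:
  fixes \<beta> c \<alpha> :: real
  assumes "c > 0" "\<beta> > 0" "\<alpha> < 1" "\<alpha> \<ge> 0"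
  shows "eventually (\<lambda>\<rho>. (\<beta> * (ln (8 * (c * (1 + \<rho>))) + 1) + 6) * (c * (1 + \<rho>)) powr \<alpha> \<le> \<rho>) at_top"
  using assms by real_asymp

text \<open>
  The choice \<open>A = 8 * L powr \<alpha>\<close> makes \<open>\<phi>\<close> and its higher derivatives at most \<open>A / M ^ k\<close> already for the larger
  scale \<open>L powr \<alpha>\<close>; for the first derivative \<open>M\<close> has to be smaller by a power of the logarithm. The number \<open>Q\<close> of
  time windows is then proportional to the logarithm of \<open>L\<close>, and \<open>Q * M \<le> \<rho>\<close> for large \<open>\<rho>\<close>
  because \<open>(c * (1 + \<rho>)) powr \<alpha> * ln \<rho>\<close> is sublinear. The factor \<open>8\<close> comes from three doublings, from \<open>\<rho>\<close> to \<open>8 * \<rho>\<close>.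
\<close>

lemma growth_scales:
  fixes D :: "nat \<Rightarrow> 'd \<Rightarrow> real \<Rightarrow> real" and l :: "real \<Rightarrow> real"
  assumes l1: "\<And>x. x \<ge> 0 \<Longrightarrow> l x \<ge> 1" and mono: "mono_on {0..} l"
    and double: "\<And>x. x \<ge> 0 \<Longrightarrow> l (2 * x) \<le> 2 * l x"
    and lin: "\<forall>x\<ge>0. l x \<le> c * (1 + x)" and c: "c > 0"
    and \<alpha>: "\<alpha> \<ge> 0" "\<alpha> < 1" and gam: "\<gamma> > 0" and T: "T > 0" and Cx: "Cx > 0" and \<kappa>: "\<kappa> > 0"
    and D1: "\<And>a x. \<bar>D 1 a x\<bar> \<le> ln (l \<bar>x\<bar>) powr \<gamma>"
    and Dn: "\<And>n a x. n \<in> {0} \<union> {2..N} \<Longrightarrow> \<bar>D n a x\<bar> \<le> l \<bar>x\<bar> powr ((1 - real n) * \<alpha>)"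
  shows "\<exists>\<rho> A M Q. \<rho> \<ge> \<rho>0 \<and> A > 0 \<and> M > 0 \<and> Q \<ge> (1 :: nat) \<and> 4 * M \<le> \<rho> \<and> real Q * M \<le> \<rho> \<and>
      Cx * (2 * T / real Q) powr \<gamma> * (A / M) \<le> \<kappa> \<and>
      (\<forall>k a z. k \<le> N \<longrightarrow> \<rho> \<le> \<bar>z\<bar> \<longrightarrow> \<bar>z\<bar> \<le> 8 * \<rho> \<longrightarrow> \<bar>D k a z\<bar> \<le> A / M ^ k)"
proof -
  \<comment> \<open>With \<open>\<beta> * \<nu>\<close> windows the smallness condition holds with equality, since \<open>A / M = 8 * \<nu> powr \<gamma>\<close>.\<close>
  define \<beta> where "\<beta> = 2 * T * (8 * Cx / \<kappa>) powr (1 / \<gamma>)"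
  have \<beta>: "\<beta> > 0" using T Cx \<kappa> by (simp add: \<beta>_def)
  obtain \<rho> where \<rho>: "\<rho> \<ge> max 1 \<rho>0" "(\<beta> * (ln (8 * (c * (1 + \<rho>))) + 1) + 6) * (c * (1 + \<rho>)) powr \<alpha> \<le> \<rho>"
    using eventually_happens'[OF _ eventually_conj[OF eventually_ge_at_top[of "max 1 \<rho>0"] sublinear_eventually[OF c \<beta> \<alpha>(2,1)]]]
    by auto
  have \<rho>1: "\<rho> \<ge> 1" using \<rho>(1) by simp
  define L where "L = l \<rho>"
  have L1: "L \<ge> 1" using l1 \<rho>1 by (simp add: L_def)
  have Lc: "L \<le> c * (1 + \<rho>)" using lin \<rho>1 by (simp add: L_def)
  define \<nu> where "\<nu> = ln (8 * L) + 1"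
  have ln0: "ln (8 * L) \<ge> 0" using L1 by (intro ln_ge_zero) simp
  have \<nu>1: "\<nu> \<ge> 1" using ln0 by (simp add: \<nu>_def)
  have \<nu>\<gamma>: "\<nu> powr \<gamma> \<ge> 1" using \<nu>1 gam by (simp add: ge_one_powr_ge_zero)
  define A where "A = 8 * L powr \<alpha>"
  define M where "M = L powr \<alpha> / \<nu> powr \<gamma>"
  have L\<alpha>: "L powr \<alpha> > 0" using L1 by simp
  have A: "A > 0" using L\<alpha> by (simp add: A_def)
  have M: "M > 0" using L\<alpha> \<nu>1 by (simp add: M_def)
  have MleL: "M \<le> L powr \<alpha>" using L\<alpha> \<nu>\<gamma> by (simp add: M_def divide_le_eq mult_le_cancel_left1)
  have AM: "A / M = 8 * \<nu> powr \<gamma>" using L\<alpha> \<nu>\<gamma> by (simp add: A_def M_def)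
  have Lp: "L powr \<alpha> \<le> (c * (1 + \<rho>)) powr \<alpha>" using L1 Lc \<alpha> by (intro powr_mono2) auto
  have lam: "\<nu> \<le> ln (8 * (c * (1 + \<rho>))) + 1" using L1 Lc by (simp add: \<nu>_def)
  have bound: "(\<beta> * \<nu> + 6) * L powr \<alpha> \<le> \<rho>"
  proof -
    have "(\<beta> * \<nu> + 6) * L powr \<alpha> \<le> (\<beta> * (ln (8 * (c * (1 + \<rho>))) + 1) + 6) * (c * (1 + \<rho>)) powr \<alpha>"
      using \<beta> lam Lp \<nu>1 by (intro mult_mono add_right_mono mult_left_mono) auto
    then show ?thesis using \<rho>(2) by linarith
  qed
  define Q where "Q = Suc (nat \<lceil>\<beta> * \<nu>\<rceil>)"
  have b\<nu>: "\<beta> * \<nu> > 0" using \<beta> \<nu>1 by simp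
  have Q: "\<beta> * \<nu> \<le> real Q" "real Q \<le> \<beta> * \<nu> + 2" unfolding Q_def using b\<nu> by linarith+
  have 4: "4 * M \<le> \<rho>"
  proof -
    have "4 * M \<le> (\<beta> * \<nu> + 6) * L powr \<alpha>" using MleL M b\<nu> by (intro mult_mono) auto
    then show ?thesis using bound by linarith
  qed
  have QM: "real Q * M \<le> \<rho>"
  proof -
    have "real Q * M \<le> (\<beta> * \<nu> + 6) * L powr \<alpha>" using MleL M Q(2) b\<nu> by (intro mult_mono) auto
    then show ?thesis using bound by linarith
  qed
  have small: "Cx * (2 * T / real Q) powr \<gamma> * (A / M) \<le> \<kappa>"
  proof -
    have "2 * T / real Q \<le> 2 * T / (\<beta> * \<nu>)" using T Q b\<nu> by (intro divide_left_mono) auto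
    then have "(2 * T / real Q) powr \<gamma> \<le> (2 * T / (\<beta> * \<nu>)) powr \<gamma>" using gam T by (intro powr_mono2) auto
    also have "2 * T / (\<beta> * \<nu>) = 1 / ((8 * Cx / \<kappa>) powr (1 / \<gamma>) * \<nu>)" using T by (simp add: \<beta>_def)
    also have "\<dots> powr \<gamma> = 1 / (8 * Cx / \<kappa> * \<nu> powr \<gamma>)"
      using Cx \<kappa> gam by (simp add: powr_divide powr_mult powr_powr)
    finally have *: "(2 * T / real Q) powr \<gamma> \<le> 1 / (8 * Cx / \<kappa> * \<nu> powr \<gamma>)" .
    have "Cx * (2 * T / real Q) powr \<gamma> * (A / M) \<le> Cx * (1 / (8 * Cx / \<kappa> * \<nu> powr \<gamma>)) * (8 * \<nu> powr \<gamma>)"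
      unfolding AM by (intro mult_right_mono mult_left_mono *) (use Cx in auto)
    also have "\<dots> = \<kappa>" using \<nu>1 Cx \<kappa> \<nu>\<gamma> by (simp add: field_simps)
    finally show ?thesis .
  qed
  have bd: "\<bar>D k a z\<bar> \<le> A / M ^ k" if k: "k \<le> N" and z: "\<rho> \<le> \<bar>z\<bar>" "\<bar>z\<bar> \<le> 8 * \<rho>" for k a z
  proof -
    have lz: "L \<le> l \<bar>z\<bar>" unfolding L_def by (rule mono_onD[OF mono]) (use z \<rho>1 in auto)
    have "l \<bar>z\<bar> \<le> l (8 * \<rho>)" by (rule mono_onD[OF mono]) (use z \<rho>1 in auto)
    also have "\<dots> \<le> 8 * L" using double[of "4 * \<rho>"] double[of "2 * \<rho>"] double[of \<rho>] \<rho>1 by (simp add: L_def)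
    finally have lz8: "l \<bar>z\<bar> \<le> 8 * L" .
    have gen: "8 * (L powr \<alpha> / (L powr \<alpha>) ^ k) \<le> A / M ^ k"
    proof -
      have "M ^ k \<le> (L powr \<alpha>) ^ k" using MleL M by (intro power_mono) auto
      then have "A / (L powr \<alpha>) ^ k \<le> A / M ^ k" using A M L\<alpha> by (intro divide_left_mono) auto
      then show ?thesis by (simp add: A_def)
    qed
    consider "k = 0" | "k = 1" | "k \<ge> 2" by linarith
    then show ?thesis
    proof cases
      case 1
      have "\<bar>D k a z\<bar> \<le> l \<bar>z\<bar> powr \<alpha>" using Dn[of 0 a z] 1 by simp
      also have "\<dots> \<le> (8 * L) powr \<alpha>" using lz lz8 L1 \<alpha> by (intro powr_mono2) auto
      also have "\<dots> = 8 powr \<alpha> * L powr \<alpha>" by (rule powr_mult)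
      also have "\<dots> \<le> 8 powr 1 * L powr \<alpha>" using \<alpha> by (intro mult_right_mono powr_mono) auto
      finally show ?thesis using 1 by (simp add: A_def)
    next
      case 2
      have "\<bar>D k a z\<bar> \<le> ln (l \<bar>z\<bar>) powr \<gamma>" using D1[of a z] 2 by simp
      also have "\<dots> \<le> \<nu> powr \<gamma>"
      proof (rule powr_mono2)
        show "0 \<le> ln (l \<bar>z\<bar>)" using lz L1 by (intro ln_ge_zero) simp
        have "ln (l \<bar>z\<bar>) \<le> ln (8 * L)" using lz lz8 L1 by simp
        then show "ln (l \<bar>z\<bar>) \<le> \<nu>" by (simp add: \<nu>_def)
      qed (use gam in simp)
      also have "\<dots> \<le> A / M" unfolding AM using \<nu>\<gamma> by simp
      finally show ?thesis using 2 by simp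
    next
      case 3
      have "\<bar>D k a z\<bar> \<le> l \<bar>z\<bar> powr ((1 - real k) * \<alpha>)" using Dn[of k a z] 3 k by simp
      also have "\<dots> \<le> L powr ((1 - real k) * \<alpha>)"
        using lz L1 \<alpha> 3 by (intro powr_mono2') (auto simp: mult_nonpos_nonneg)
      also have "(1 - real k) * \<alpha> = \<alpha> - real k * \<alpha>" by (simp add: algebra_simps)
      also have "L powr (\<alpha> - real k * \<alpha>) = L powr \<alpha> / (L powr \<alpha>) ^ k"
        using L1 by (simp add: powr_diff powr_power)
      also have "\<dots> \<le> 8 * (L powr \<alpha> / (L powr \<alpha>) ^ k)"
      proof -
        have "0 \<le> L powr \<alpha> / (L powr \<alpha>) ^ k" by simp
        then have "1 * (L powr \<alpha> / (L powr \<alpha>) ^ k) \<le> 8 * (L powr \<alpha> / (L powr \<alpha>) ^ k)"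
          by (intro mult_right_mono) auto
        then show ?thesis by (simp only: mult_1_left)
      qed
      also note gen
      finally show ?thesis .
    qed
  qed
  show ?thesis
    by (rule exI[of _ \<rho>], rule exI[of _ A], rule exI[of _ M], rule exI[of _ Q])
      (use \<rho>(1) A M 4 QM small bd Q_def in auto)
qed

section \<open>Derivatives of the components\<close>

lemma nderiv_0: "nderiv 0 f = f"
  by (simp add: nderiv_def)

lemma nderiv_Suc: "nderiv (Suc k) f x = vector_derivative (nderiv k f) (at x)"
  by (simp add: nderiv_def)

lemma has_vector_derivative_nderiv:
  assumes "cont_differentiable n \<phi>" "k < n"
  shows "(nderiv k \<phi> has_vector_derivative nderiv (Suc k) \<phi> x) (at x)"
  using assms unfolding cont_differentiable_def nderiv_Suc vector_derivative_works[symmetric] by blast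

lemma nderiv_component:
  fixes \<phi> :: "real \<Rightarrow> (real ^ 'd::finite) \<Rightarrow>\<^sub>L real"
  assumes "cont_differentiable n \<phi>" "k \<le> n"
  shows "nderiv k (component \<phi> a) = (\<lambda>x. blinfun_apply (nderiv k \<phi> x) (axis a 1))"
  using assms(2)
proof (induction k)
  case 0
  then show ?case by (simp add: nderiv_0 component_def[abs_def])
next
  case (Suc k)
  have "((\<lambda>x. blinfun_apply (nderiv k \<phi> x) (axis a 1)) has_vector_derivative blinfun_apply (nderiv (Suc k) \<phi> x) (axis a 1)) (at x)" for x
    using bounded_linear.has_vector_derivative[OF blinfun.bounded_linear_left has_vector_derivative_nderiv[OF assms(1)]] Suc by simp
  then show ?case using Suc by (auto simp: nderiv_Suc intro!: vector_derivative_at)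
qed

lemma jets_component:
  fixes \<phi> :: "real \<Rightarrow> (real ^ 'd::finite) \<Rightarrow>\<^sub>L real"
  assumes "cont_differentiable n \<phi>"
  shows "jets n (\<lambda>k a. nderiv k (component \<phi> a))"
  unfolding jets_def
proof (intro allI impI)
  fix k a z assume k: "k < n"
  have "((\<lambda>x. blinfun_apply (nderiv k \<phi> x) (axis a 1)) has_vector_derivative blinfun_apply (nderiv (Suc k) \<phi> z) (axis a 1)) (at z)"
    using bounded_linear.has_vector_derivative[OF blinfun.bounded_linear_left has_vector_derivative_nderiv[OF assms k]] .
  then show "(nderiv k (component \<phi> a) has_real_derivative nderiv (Suc k) (component \<phi> a) z) (at z)"
    using nderiv_component[OF assms, of k a] nderiv_component[OF assms, of "Suc k" a] k
    by (simp add: has_real_derivative_iff_has_vector_derivative)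
qed

lemma continuous_component:
  fixes \<phi> :: "real \<Rightarrow> (real ^ 'd::finite) \<Rightarrow>\<^sub>L real"
  assumes "cont_differentiable n \<phi>"
  shows "continuous_on UNIV (nderiv n (component \<phi> a))"
proof -
  have "continuous_on UNIV (nderiv n \<phi>)" using assms by (simp add: cont_differentiable_def)
  then show ?thesis
    unfolding nderiv_component[OF assms order_refl] by (intro continuous_intros)
qed

lemma nderiv_component_le:
  fixes \<phi> :: "real \<Rightarrow> (real ^ 'd::finite) \<Rightarrow>\<^sub>L real"
  assumes "cont_differentiable n \<phi>" "k \<le> n"
  shows "\<bar>nderiv k (component \<phi> a) x\<bar> \<le> norm (nderiv k \<phi> x)"
  using norm_blinfun[of "nderiv k \<phi> x" "axis a 1"] unfolding nderiv_component[OF assms] by simp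

section \<open>Solutions of the differential equation\<close>

lemma sum_lessThan_add: "(\<Sum>i<m + k. f i) = (\<Sum>i<m. f i) + (\<Sum>i<k. f (m + i))" for f :: "nat \<Rightarrow> real"
  by (induction k) simp_all

lemma bdd_above_pairs:
  assumes "bdd_above {F s t | s t. P s t}"
  shows "\<exists>C :: real. \<forall>s t. P s t \<longrightarrow> F s t \<le> C"
proof -
  obtain C where "\<forall>x\<in>{F s t | s t. P s t}. x \<le> C" using assms by (auto simp only: bdd_above_def)
  then have "P s t \<longrightarrow> F s t \<le> C" for s t by (rule_tac impI, erule_tac bspec) (rule CollectI, rule exI[of _ s], rule exI[of _ t], simp)
  then show ?thesis by (intro exI[of _ C] allI)
qed

text \<open>
  The sum over ordered tuples has equal summands, and their number is contained in the weight \<open>symw\<close>.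
\<close>

lemma compose_derivative_cF:
  assumes "\<And>\<tau>. \<tau> \<in># f \<Longrightarrow> Y {#\<tau>#} t = cT (\<lambda>k a. nderiv k (component \<phi> a)) (Y {#} t) \<tau>"
  shows "compose_derivative (component \<phi> a) Y f t = cF (\<lambda>k a. nderiv k (component \<phi> a)) (Y {#} t) a f"
proof -
  let ?D = "\<lambda>k a. nderiv k (component \<phi> a)"
  have im: "image_mset (\<lambda>\<tau>. Y {#\<tau>#} t) f = image_mset (cT ?D (Y {#} t)) f"
    by (rule image_mset_cong) (rule assms)
  have "compose_derivative (component \<phi> a) Y f t
      = (\<Sum>ts\<in>{ts. mset ts = f}. 1 / fact (size f) * (nderiv (size f) (component \<phi> a) (Y {#} t) * \<Prod>\<^sub># (image_mset (cT ?D (Y {#} t)) f)))"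
    unfolding compose_derivative_def
  proof (rule sum.cong[OF refl])
    fix ts assume "ts \<in> {ts. mset ts = f}"
    then have m: "mset ts = f" by simp
    have "(\<Prod>\<tau>\<leftarrow>ts. Y {#\<tau>#} t) = \<Prod>\<^sub># (mset (map (\<lambda>\<tau>. Y {#\<tau>#} t) ts))" by (rule prod_mset_prod_list[symmetric])
    also have "\<dots> = \<Prod>\<^sub># (image_mset (cT ?D (Y {#} t)) f)" unfolding mset_map m im ..
    finally show "1 / fact (size f) * (nderiv (size f) (component \<phi> a) (Y {#} t) * (\<Prod>\<tau>\<leftarrow>ts. Y {#\<tau>#} t))
      = 1 / fact (size f) * (nderiv (size f) (component \<phi> a) (Y {#} t) * \<Prod>\<^sub># (image_mset (cT ?D (Y {#} t)) f))" by simp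
  qed
  also have "\<dots> = cF ?D (Y {#} t) a f"
    by (simp add: cF_def symw_def)
  finally show ?thesis .
qed

text \<open>
  The candidate for the family of Gubinelli derivatives of a path \<open>y\<close>: elementary differentials on trees and zero on
  products of at least two trees. The definite description extracts the tree of a one-element multiset.
\<close>

definition lift :: "(nat \<Rightarrow> 'd \<Rightarrow> real \<Rightarrow> real) \<Rightarrow> (real \<Rightarrow> real) \<Rightarrow> 'd forest \<Rightarrow> real \<Rightarrow> real" where
  "lift D y f t = (if f = {#} then y t else if size f = 1 then cT D (y t) (THE \<tau>. f = {#\<tau>#}) else 0)"

lemma lift_simps [simp]:
  "lift D y {#} t = y t" "lift D y {#\<tau>#} t = cT D (y t) \<tau>" "size f \<ge> 2 \<Longrightarrow> lift D y f t = 0"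
  by (auto simp: lift_def)

text \<open>
  A rough path given both by its classes and by characters \<open>\<xi>\<close> of its increments, with the vector field
  of the equation.
\<close>

locale rough_equation = rough N \<gamma> T Cx \<xi>
  for N :: nat and \<gamma> T Cx :: real and \<xi> :: "real \<Rightarrow> real \<Rightarrow> 'd::finite rtree \<Rightarrow> real" +
  fixes X :: "real \<Rightarrow> ('d hopf \<Rightarrow> real) set" and \<phi> :: "real \<Rightarrow> (real ^ 'd) \<Rightarrow>\<^sub>L real"
  assumes inc: "\<And>s t f. 0 \<le> s \<Longrightarrow> s \<le> T \<Longrightarrow> 0 \<le> t \<Longrightarrow> t \<le> T \<Longrightarrow> verts f \<le> N \<Longrightarrow>
      increment N X s t (basis f) = evc (\<xi> s t) (basis f)"
    and smooth: "cont_differentiable (Suc N) \<phi>"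
begin

abbreviation D :: "nat \<Rightarrow> 'd \<Rightarrow> real \<Rightarrow> real" where
  "D \<equiv> (\<lambda>k a. nderiv k (component \<phi> a))"

lemma D_jets: "jets (Suc N) D" and D_cont: "continuous_on UNIV (D (Suc N) a)"
  by (rule jets_component[OF smooth], rule continuous_component[OF smooth])

lemma D_jets': "jets N D" and D_cont': "continuous_on UNIV (D N a)"
  using D_jets jets_continuous[OF D_jets, of N] D_cont by (auto simp: jets_def)

lemma remainder_lift:
  assumes st: "0 \<le> s" "s \<le> T" "0 \<le> t" "t \<le> T" and Y: "\<And>g. verts g < N \<Longrightarrow> Y g s = lift D y g s"
  shows "remainder N X Y f s t = Y f t - (Poly_Mapping.lookup 1 f * y s
    + (\<Sum>\<tau> | tree_verts \<tau> < N. Poly_Mapping.lookup (Qt (\<xi> s t) \<tau>) f * cT D (y s) \<tau>))"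
proof -
  have "(\<Sum>g\<in>forests_upto (int N - 1). tensor_functional (increment N X s t) (hinner (basis f)) (coproduct (basis g)) * Y g s)
      = (\<Sum>g\<in>forests_upto (int N - 1). Poly_Mapping.lookup (Qf (\<xi> s t) g) f * lift D y g s)"
  proof (rule sum.cong[OF refl])
    fix g :: "'d forest" assume g: "g \<in> forests_upto (int N - 1)"
    have "tensor_functional (increment N X s t) (hinner (basis f)) (coproduct (basis g)) = Poly_Mapping.lookup (Qf (\<xi> s t) g) f"
      by (rule tensor_functional_Qf[of N]) (use inc[OF st] g in auto)
    then show "tensor_functional (increment N X s t) (hinner (basis f)) (coproduct (basis g)) * Y g s
        = Poly_Mapping.lookup (Qf (\<xi> s t) g) f * lift D y g s" using Y[of g] g by simp
  qed
  also have "\<dots> = Poly_Mapping.lookup (Qf (\<xi> s t) {#}) f * lift D y {#} s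
      + (\<Sum>\<tau> | tree_verts \<tau> < N. Poly_Mapping.lookup (Qf (\<xi> s t) {#\<tau>#}) f * lift D y {#\<tau>#} s)"
    by (rule sum_forests_single[OF N1]) simp
  finally show ?thesis unfolding remainder_def by simp
qed

text \<open>
  The summand of the rough integral is an Euler increment.
\<close>

lemma germ_eq:
  assumes uv: "0 \<le> u" "u \<le> T" "0 \<le> v" "v \<le> T" and Y: "\<And>g. verts g < N \<Longrightarrow> Y g u = lift D y g u"
  shows "(\<Sum>a\<in>UNIV. \<Sum>f\<in>forests_upto (int N - 1). compose_derivative (component \<phi> a) Y f u * increment N X u v (basis {#Node a f#}))
    = evc (\<xi> u v) (PP D N (y u))"
  unfolding evc_PP sum_trees
proof (intro sum.cong refl)
  fix a and f :: "'d forest" assume f: "f \<in> forests_upto (int N - 1)"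
  have Y0: "Y {#} u = y u" using Y[of "{#}"] N1 by simp
  have "compose_derivative (component \<phi> a) Y f u = cF D (Y {#} u) a f"
  proof (rule compose_derivative_cF)
    fix \<tau> assume "\<tau> \<in># f"
    then have "tree_verts \<tau> < N" using tree_verts_le[of \<tau> f] f by simp
    then show "Y {#\<tau>#} u = cT D (Y {#} u) \<tau>" using Y[of "{#\<tau>#}"] Y0 by (simp add: verts_single)
  qed
  moreover have "increment N X u v (basis {#Node a f#}) = \<xi> u v (Node a f)"
    using inc[OF uv, of "{#Node a f#}"] f by (simp add: verts_single evc_basis)
  ultimately show "compose_derivative (component \<phi> a) Y f u * increment N X u v (basis {#Node a f#})
      = cT D (y u) (Node a f) * \<xi> u v (Node a f)" using Y0 by simp
qed

text \<open>
  Induction on trees: the conditions of a solution express each Gubinelli derivative through those of smaller trees.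
\<close>

lemma solution_is_lift:
  assumes "rde_solution N \<gamma> X \<phi> {0..T} Y" "0 \<le> t" "t \<le> T" "verts f < N"
  shows "Y f t = lift D (Y {#}) f t"
proof -
  have tree: "\<And>f a. f \<in> forests_upto (int N - 2) \<Longrightarrow> Y {#Node a f#} t = compose_derivative (component \<phi> a) Y f t"
    and two: "\<And>f. f \<in> forests_upto (int N - 1) \<Longrightarrow> size f \<ge> 2 \<Longrightarrow> Y f t = 0"
    using assms(1-3) unfolding rde_solution_def by auto
  have single: "Y {#\<tau>#} t = cT D (Y {#} t) \<tau>" if "tree_verts \<tau> < N" for \<tau>
    using that
  proof (induction \<tau>)
    case (Node a f)
    have "Y {#Node a f#} t = compose_derivative (component \<phi> a) Y f t"
      by (rule tree) (use Node.prems in \<open>auto simp: forests_upto_def\<close>)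
    also have "\<dots> = cF D (Y {#} t) a f"
    proof (rule compose_derivative_cF)
      fix \<tau> assume \<tau>: "\<tau> \<in># f"
      show "Y {#\<tau>#} t = cT D (Y {#} t) \<tau>" by (rule Node.IH[OF \<tau>]) (use tree_verts_le[OF \<tau>] Node.prems in simp)
    qed
    finally show ?case by simp
  qed
  consider "f = {#}" | \<tau> where "f = {#\<tau>#}" | "size f \<ge> 2"
    by (metis One_nat_def Suc_1 Suc_leI le_neq_implies_less less_one not_less size_1_singleton_mset size_eq_0_iff_empty)
  then show ?thesis
  proof cases
    case 2
    then show ?thesis using single assms(4) by (simp add: verts_single)
  next
    case 3
    then show ?thesis using two assms(4) by simp
  qed simp
qed

text \<open>
  The Euler increment has trees with up to \<open>N\<close> vertices, the remainder of a controlled rough path only those with fewer; the difference is of order \<open>N\<close>.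
\<close>

lemma top_degree_bound:
  assumes K: "\<And>t. 0 \<le> t \<Longrightarrow> t \<le> T \<Longrightarrow> \<bar>y t\<bar> \<le> K"
  shows "\<exists>C. \<forall>s t. 0 \<le> s \<and> s < t \<and> t \<le> T \<longrightarrow>
    \<bar>evc (\<xi> s t) (PP D N (y s)) - (\<Sum>\<tau> | tree_verts \<tau> < N. \<xi> s t \<tau> * cT D (y s) \<tau>)\<bar> \<le> C * (t - s) powr (real N * \<gamma>)"
proof -
  obtain b where b: "\<And>\<tau>. tree_verts \<tau> \<le> N \<Longrightarrow> b \<tau> \<ge> 0"
    "\<And>\<tau> y. tree_verts \<tau> \<le> N \<Longrightarrow> \<bar>y\<bar> \<le> K \<Longrightarrow> \<bar>cT D y \<tau>\<bar> \<le> b \<tau>"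
    using cT_bounded[OF D_jets' D_cont', of K] by metis
  let ?T = "{\<tau> :: 'd rtree. tree_verts \<tau> = N}"
  have fin: "finite ?T" "finite {\<tau> :: 'd rtree. tree_verts \<tau> < N}"
    by (rule finite_subset[OF _ finite_trees[of N]]; auto)+
  show ?thesis
  proof (intro exI[of _ "\<Sum>\<tau>\<in>?T. b \<tau> * Cx ^ N"] allI impI)
    fix s t assume st: "0 \<le> s \<and> s < t \<and> t \<le> T"
    have "evc (\<xi> s t) (PP D N (y s)) = (\<Sum>\<tau>\<in>{\<tau>. tree_verts \<tau> < N} \<union> ?T. \<xi> s t \<tau> * cT D (y s) \<tau>)"
      unfolding evc_PP by (rule sum.cong) (auto simp: mult.commute)
    also have "\<dots> = (\<Sum>\<tau> | tree_verts \<tau> < N. \<xi> s t \<tau> * cT D (y s) \<tau>) + (\<Sum>\<tau>\<in>?T. \<xi> s t \<tau> * cT D (y s) \<tau>)"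
      by (rule sum.union_disjoint) (use fin in auto)
    finally have eq: "evc (\<xi> s t) (PP D N (y s)) - (\<Sum>\<tau> | tree_verts \<tau> < N. \<xi> s t \<tau> * cT D (y s) \<tau>) = (\<Sum>\<tau>\<in>?T. \<xi> s t \<tau> * cT D (y s) \<tau>)"
      by simp
    have "\<bar>\<Sum>\<tau>\<in>?T. \<xi> s t \<tau> * cT D (y s) \<tau>\<bar> \<le> (\<Sum>\<tau>\<in>?T. (b \<tau> * Cx ^ N) * (t - s) powr (real N * \<gamma>))"
    proof (rule order.trans[OF sum_abs], rule sum_mono)
      fix \<tau> assume "\<tau> \<in> ?T"
      then have \<tau>: "tree_verts \<tau> = N" by simp
      have "\<bar>\<xi> s t \<tau>\<bar> \<le> Cx ^ N * (t - s) powr (real N * \<gamma>)"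
        using bnd[of s t \<tau>] st \<tau> ep_pow[of "t - s" N] by simp
      moreover have "\<bar>cT D (y s) \<tau>\<bar> \<le> b \<tau>" using b(2) K st \<tau> by simp
      ultimately have "\<bar>\<xi> s t \<tau>\<bar> * \<bar>cT D (y s) \<tau>\<bar> \<le> (Cx ^ N * (t - s) powr (real N * \<gamma>)) * b \<tau>"
        by (rule mult_mono) (use Cx0 in auto)
      then show "\<bar>\<xi> s t \<tau> * cT D (y s) \<tau>\<bar> \<le> (b \<tau> * Cx ^ N) * (t - s) powr (real N * \<gamma>)"
        unfolding abs_mult by (simp only: mult_ac)
    qed
    then show "\<bar>evc (\<xi> s t) (PP D N (y s)) - (\<Sum>\<tau> | tree_verts \<tau> < N. \<xi> s t \<tau> * cT D (y s) \<tau>)\<bar>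
        \<le> (\<Sum>\<tau>\<in>?T. b \<tau> * Cx ^ N) * (t - s) powr (real N * \<gamma>)"
      unfolding eq by (simp only: sum_distrib_right)
  qed
qed

text \<open>
  The remainder of index \<open>{#}\<close> gives the local expansion, which also bounds the path, as only the value at \<open>0\<close> enters.
  For the Davie estimate the integrals over \<open>[0, s]\<close> and \<open>[0, t]\<close> are approximated along partitions that
  share their points up to \<open>s\<close> and are uniform on \<open>[s, t]\<close>, so that their difference is a
  Riemann sum over \<open>[s, t]\<close> to which the sewing estimate applies.
\<close>

theorem solution_davie:
  assumes sol: "rde_solution N \<gamma> X \<phi> {0..T} Y"
  shows "\<exists>K. \<forall>t. 0 \<le> t \<and> t \<le> T \<longrightarrow> \<bar>Y {#} t\<bar> \<le> K" and "davie D (Y {#})"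
proof -
  let ?y = "Y {#}"
  note lft = solution_is_lift[OF sol]
  have crp: "controlled_rough_path N \<gamma> X {0..T} Y"
    and integral: "\<And>t. 0 \<le> t \<Longrightarrow> t \<le> T \<Longrightarrow> \<exists>I. has_rough_integral N X \<phi> Y 0 t I \<and> ?y t = ?y 0 + I"
    using sol unfolding rde_solution_def by auto
  have e0: "({#} :: 'd forest) \<in> forests_upto (int N - 1)" using N1 by simp
  have "bdd_above {\<bar>remainder N X Y {#} s t\<bar> / \<bar>t - s\<bar> powr ((real N - real (verts ({#} :: 'd forest))) * \<gamma>) | s t. 0 \<le> s \<and> s < t \<and> t \<le> T}"
    by (rule crp[unfolded controlled_rough_path_def, THEN bspec, OF e0, THEN spec, THEN spec, THEN mp, OF order_refl])
  from bdd_above_pairs[OF this] obtain C where C0: "\<forall>s t. 0 \<le> s \<and> s < t \<and> t \<le> T \<longrightarrow> \<bar>remainder N X Y {#} s t\<bar> / \<bar>t - s\<bar> powr ((real N - real (verts ({#} :: 'd forest))) * \<gamma>) \<le> C" ..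
  have C: "\<bar>remainder N X Y {#} s t\<bar> / \<bar>t - s\<bar> powr ((real N - real (verts ({#} :: 'd forest))) * \<gamma>) \<le> C" if "0 \<le> s" "s < t" "t \<le> T" for s t
    by (rule C0[rule_format]) (use that in simp)
  have R: "\<bar>?y t - ?y s - (\<Sum>\<tau> | tree_verts \<tau> < N. \<xi> s t \<tau> * cT D (?y s) \<tau>)\<bar> \<le> C * (t - s) powr (real N * \<gamma>)"
    if st: "0 \<le> s" "s < t" "t \<le> T" for s t
  proof -
    have "remainder N X Y {#} s t = ?y t - ?y s - (\<Sum>\<tau> | tree_verts \<tau> < N. \<xi> s t \<tau> * cT D (?y s) \<tau>)"
    proof -
      have "remainder N X Y {#} s t = Y {#} t - (Poly_Mapping.lookup 1 ({#} :: 'd forest) * ?y s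
          + (\<Sum>\<tau> | tree_verts \<tau> < N. Poly_Mapping.lookup (Qt (\<xi> s t) \<tau>) {#} * cT D (?y s) \<tau>))"
        by (rule remainder_lift) (use st in \<open>auto intro: lft\<close>)
      then show ?thesis by (simp only: lookup_one lookup_Qt_empty) simp
    qed
    moreover have "\<bar>remainder N X Y {#} s t\<bar> \<le> C * \<bar>t - s\<bar> powr ((real N - real (verts ({#} :: 'd forest))) * \<gamma>)"
      using C[OF st] st by (subst (asm) pos_divide_le_eq) auto
    ultimately show ?thesis using st by simp
  qed
  show bounded: "\<exists>K. \<forall>t. 0 \<le> t \<and> t \<le> T \<longrightarrow> \<bar>?y t\<bar> \<le> K"
  proof (intro exI allI impI)
    fix t assume t: "0 \<le> t \<and> t \<le> T"
    let ?S = "\<Sum>\<tau> | tree_verts \<tau> < N. (Cx * T powr \<gamma>) ^ tree_verts \<tau> * \<bar>cT D (?y 0) \<tau>\<bar>"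
    have S0: "?S \<ge> 0" using Cx0 by (auto intro!: sum_nonneg)
    show "\<bar>?y t\<bar> \<le> \<bar>?y 0\<bar> + ?S + \<bar>C\<bar> * T powr (real N * \<gamma>)"
    proof (cases "t = 0")
      case False
      have "\<bar>\<Sum>\<tau> | tree_verts \<tau> < N. \<xi> 0 t \<tau> * cT D (?y 0) \<tau>\<bar> \<le> ?S"
      proof (rule order.trans[OF sum_abs], rule sum_mono)
        fix \<tau> :: "'d rtree" assume "\<tau> \<in> {\<tau>. tree_verts \<tau> < N}"
        then have "\<bar>\<xi> 0 t \<tau>\<bar> \<le> (Cx * T powr \<gamma>) ^ tree_verts \<tau>" using t by (intro bnd_mono) auto
        then show "\<bar>\<xi> 0 t \<tau> * cT D (?y 0) \<tau>\<bar> \<le> (Cx * T powr \<gamma>) ^ tree_verts \<tau> * \<bar>cT D (?y 0) \<tau>\<bar>"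
          unfolding abs_mult by (intro mult_right_mono) auto
      qed
      moreover have "C * (t - 0) powr (real N * \<gamma>) \<le> \<bar>C\<bar> * T powr (real N * \<gamma>)"
        using t gam by (intro mult_mono powr_mono2) auto
      ultimately show ?thesis using R[of 0 t] t False by linarith
    qed (use S0 in simp)
  qed
  then obtain K where K: "\<And>t. 0 \<le> t \<Longrightarrow> t \<le> T \<Longrightarrow> \<bar>?y t\<bar> \<le> K" by blast
  from top_degree_bound[OF K] obtain C1 where C1: "\<forall>s t. 0 \<le> s \<and> s < t \<and> t \<le> T \<longrightarrow>
    \<bar>evc (\<xi> s t) (PP D N (?y s)) - (\<Sum>\<tau> | tree_verts \<tau> < N. \<xi> s t \<tau> * cT D (?y s) \<tau>)\<bar> \<le> C1 * (t - s) powr (real N * \<gamma>)" ..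
  have "\<bar>?y t - step D s t (?y s)\<bar> \<le> (C + C1) * (t - s) powr (real N * \<gamma>)" if "0 \<le> s" "s < t" "t \<le> T" for s t
    using R[OF that] C1[rule_format, of s t] that unfolding step_def distrib_right by linarith
  then have loc: "local_expansion D ?y" unfolding local_expansion_def by blast
  obtain C2 where C2: "\<And>s t n. 0 \<le> s \<Longrightarrow> s < t \<Longrightarrow> t \<le> T \<Longrightarrow> n \<ge> (1 :: nat) \<Longrightarrow>
    \<bar>(\<Sum>i<n. evc (\<xi> (s + real i * ((t - s) / real n)) (s + real (Suc i) * ((t - s) / real n))) (PP D N (?y (s + real i * ((t - s) / real n)))))
      - evc (\<xi> s t) (PP D N (?y s))\<bar> \<le> C2 * (t - s) powr \<theta>"
    using germ_sewing[OF D_jets' D_cont' K loc] by blast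
  have "\<bar>?y t - step D s t (?y s)\<bar> \<le> C2 * (t - s) powr \<theta>" if st: "0 \<le> s" "s < t" "t \<le> T" for s t
  proof (rule field_le_epsilon)
    fix e :: real assume e: "e > 0"
    obtain Is where Is: "has_rough_integral N X \<phi> Y 0 s Is" "?y s = ?y 0 + Is" using integral[of s] st by auto
    obtain It where It: "has_rough_integral N X \<phi> Y 0 t It" "?y t = ?y 0 + It" using integral[of t] st by auto
    let ?G = "\<lambda>u v. \<Sum>a\<in>UNIV. \<Sum>f\<in>forests_upto (int N - 1). compose_derivative (component \<phi> a) Y f u * increment N X u v (basis {#Node a f#})"
    from Is(1)[unfolded has_rough_integral_def, THEN spec, THEN mp, OF half_gt_zero[OF e]]
    obtain d1 where d1: "d1 > 0 \<and> (\<forall>(n :: nat) p. p 0 = 0 \<and> p n = s \<and> (\<forall>i<n. p i < p (Suc i) \<and> p (Suc i) - p i < d1) \<longrightarrow>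
        \<bar>(\<Sum>i<n. ?G (p i) (p (Suc i))) - Is\<bar> < e / 2)" ..
    from It(1)[unfolded has_rough_integral_def, THEN spec, THEN mp, OF half_gt_zero[OF e]]
    obtain d2 where d2: "d2 > 0 \<and> (\<forall>(n :: nat) p. p 0 = 0 \<and> p n = t \<and> (\<forall>i<n. p i < p (Suc i) \<and> p (Suc i) - p i < d2) \<longrightarrow>
        \<bar>(\<Sum>i<n. ?G (p i) (p (Suc i))) - It\<bar> < e / 2)" ..
    define d where "d = min d1 d2"
    have d: "d > 0" using d1 d2 by (simp add: d_def)
    define k where "k = Suc (nat \<lceil>T / d\<rceil>)"
    have "T / d < real k" unfolding k_def by linarith
    moreover have "real k > 0" by (simp add: k_def)
    ultimately have kd: "T / real k < d" using d by (simp only: pos_divide_less_eq mult.commute[of d])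
    \<comment> \<open>Partitions have strictly increasing points, so there is no first part if \<open>s = 0\<close>.\<close>
    define m where "m = (if s = 0 then 0 else k)"
    define p where "p i = (if i \<le> m then real i * (s / real m) else s + real (i - m) * ((t - s) / real k))" for i
    have pm: "p m = s" by (simp add: p_def m_def k_def)
    have p0: "p 0 = 0" by (simp add: p_def)
    have pmk: "p (m + i) = s + real i * ((t - s) / real k)" for i
      using pm by (cases i) (auto simp: p_def)
    have lt1: "p i < p (Suc i) \<and> p (Suc i) - p i < d" if "i < m" for i
    proof -
      have s0: "s > 0" "m = k" using that st by (auto simp: m_def split: if_splits)
      have "p (Suc i) - p i = s / real k"
        using that s0 by (simp add: p_def distrib_right add_divide_distrib)
      moreover have "s / real k > 0" using s0 by (simp add: k_def)
      moreover have "s / real k \<le> T / real k" using st by (intro divide_right_mono) auto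
      ultimately show ?thesis using kd by linarith
    qed
    have lt2: "p (m + i) < p (Suc (m + i)) \<and> p (Suc (m + i)) - p (m + i) < d" for i
    proof -
      have "p (Suc (m + i)) - p (m + i) = (t - s) / real k"
        using pmk[of i] pmk[of "Suc i"] by (simp add: distrib_right add_divide_distrib)
      moreover have "(t - s) / real k > 0" using st by (simp add: k_def)
      moreover have "(t - s) / real k \<le> T / real k" using st by (intro divide_right_mono) auto
      ultimately show ?thesis using kd by linarith
    qed
    have lt: "p i < p (Suc i) \<and> p (Suc i) - p i < d" for i
      using lt1[of i] lt2[of "i - m"] by (cases "i < m") auto
    have "p (m + k) = t" using pmk[of k] by (simp add: k_def)
    then have 2: "\<bar>(\<Sum>i<m + k. ?G (p i) (p (Suc i))) - It\<bar> < e / 2"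
      by (intro d2[THEN conjunct2, rule_format]) (use p0 lt in \<open>auto simp: d_def\<close>)
    have 1: "\<bar>(\<Sum>i<m. ?G (p i) (p (Suc i))) - Is\<bar> < e / 2"
      by (intro d1[THEN conjunct2, rule_format]) (use p0 pm lt in \<open>auto simp: d_def\<close>)
    have split: "(\<Sum>i<m + k. ?G (p i) (p (Suc i))) = (\<Sum>i<m. ?G (p i) (p (Suc i))) + (\<Sum>i<k. ?G (p (m + i)) (p (Suc (m + i))))"
      by (rule sum_lessThan_add)
    have G: "?G (p (m + i)) (p (Suc (m + i))) = evc (\<xi> (s + real i * ((t - s) / real k)) (s + real (Suc i) * ((t - s) / real k))) (PP D N (?y (s + real i * ((t - s) / real k))))"
      if "i < k" for i
    proof -
      let ?x = "(t - s) / real k"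
      have x0: "?x \<ge> 0" using st by simp
      have "real (Suc i) * ?x \<le> real k * ?x" using that x0 by (intro mult_right_mono) auto
      also have "real k * ?x = t - s" by (simp add: k_def)
      finally have le: "s + real (Suc i) * ?x \<le> T" using st by linarith
      have le': "real i * ?x \<le> real (Suc i) * ?x" using x0 by (intro mult_right_mono) auto
      have nn: "0 \<le> real i * ?x" "0 \<le> real (Suc i) * ?x" using x0 by (simp_all only: mult_nonneg_nonneg of_nat_0_le_iff)
      have "?G (s + real i * ?x) (s + real (Suc i) * ?x) = evc (\<xi> (s + real i * ?x) (s + real (Suc i) * ?x)) (PP D N (?y (s + real i * ?x)))"
        by (rule germ_eq) (use lft st le le' nn in linarith | rule lft)+
      then show ?thesis using pmk[of i] pmk[of "Suc i"] by (simp only: add_Suc_right)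
    qed
    have "\<bar>(\<Sum>i<k. ?G (p (m + i)) (p (Suc (m + i)))) - evc (\<xi> s t) (PP D N (?y s))\<bar> \<le> C2 * (t - s) powr \<theta>"
    proof -
      have "(\<Sum>i<k. ?G (p (m + i)) (p (Suc (m + i))))
        = (\<Sum>i<k. evc (\<xi> (s + real i * ((t - s) / real k)) (s + real (Suc i) * ((t - s) / real k))) (PP D N (?y (s + real i * ((t - s) / real k)))))"
        by (rule sum.cong[OF refl], rule G) simp
      then show ?thesis using C2[OF st, of k] by (simp only:) (simp add: k_def)
    qed
    then show "\<bar>?y t - step D s t (?y s)\<bar> \<le> C2 * (t - s) powr \<theta> + e"
      using 1 2 Is(2) It(2) unfolding split step_def by linarith
  qed
  then show "davie D ?y" unfolding davie_def by blast
qed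

text \<open>
  A remainder of index \<open>{#Node a h#}\<close> is the consistency error for \<open>h\<close>, except that its sum stops at forests with
  fewer than \<open>N - 1\<close> vertices; the missing ones are of the admissible order. The Riemann sums converge because each summand differs
  from the increment of the path by \<open>O((v - u) powr \<theta>)\<close> and \<open>\<theta> > 1\<close>.
\<close>

theorem davie_solution:
  assumes dv: "davie D y" and K: "\<And>t. 0 \<le> t \<Longrightarrow> t \<le> T \<Longrightarrow> \<bar>y t\<bar> \<le> K"
  shows "rde_solution N \<gamma> X \<phi> {0..T} (lift D y)"
  unfolding rde_solution_def
proof (intro conjI ballI allI impI)
  let ?Y = "lift D y"
  have loc: "local_expansion D y" by (rule davie_local_expansion[OF dv])
  obtain C where C: "\<And>s t. 0 \<le> s \<Longrightarrow> s < t \<Longrightarrow> t \<le> T \<Longrightarrow> \<bar>y t - step D s t (y s)\<bar> \<le> C * (t - s) powr \<theta>"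
    using dv unfolding davie_def by blast
  show "controlled_rough_path N \<gamma> X {0..T} ?Y"
    unfolding controlled_rough_path_def
  proof (intro ballI allI impI)
    fix f :: "'d forest" and a b :: real
    assume f: "f \<in> forests_upto (int N - 1)" and ab: "{a..b} \<subseteq> {0..T}"
    have fN: "verts f < N" using f by simp
    have "\<exists>B. \<forall>s t. 0 \<le> s \<and> s < t \<and> t \<le> T \<longrightarrow> \<bar>remainder N X ?Y f s t\<bar> \<le> B * (t - s) powr (real (N - verts f) * \<gamma>)"
    proof -
      have rem: "remainder N X ?Y f s t = ?Y f t - (Poly_Mapping.lookup 1 f * y s
          + (\<Sum>\<tau> | tree_verts \<tau> < N. Poly_Mapping.lookup (Qt (\<xi> s t) \<tau>) f * cT D (y s) \<tau>))"
        if "0 \<le> s \<and> s < t \<and> t \<le> T" for s t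
        by (rule remainder_lift) (use that in auto)
      consider "f = {#}" | a h where "f = {#Node a h#}" | "size f \<ge> 2"
        by (metis One_nat_def Suc_1 Suc_leI le_neq_implies_less less_one not_less rtree.exhaust size_1_singleton_mset size_eq_0_iff_empty)
      then show ?thesis
      proof cases
        case 1
        obtain B where B: "\<And>s t. 0 \<le> s \<Longrightarrow> s < t \<Longrightarrow> t \<le> T \<Longrightarrow> \<bar>y t - step D s t (y s)\<bar> \<le> B * (t - s) powr (real N * \<gamma>)"
          using loc unfolding local_expansion_def by blast
        from top_degree_bound[OF K] obtain C1 where C1: "\<forall>s t. 0 \<le> s \<and> s < t \<and> t \<le> T \<longrightarrow>
    \<bar>evc (\<xi> s t) (PP D N (y s)) - (\<Sum>\<tau> | tree_verts \<tau> < N. \<xi> s t \<tau> * cT D (y s) \<tau>)\<bar> \<le> C1 * (t - s) powr (real N * \<gamma>)" ..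
        have "\<bar>remainder N X ?Y f s t\<bar> \<le> (B + C1) * (t - s) powr (real (N - verts f) * \<gamma>)" if st: "0 \<le> s \<and> s < t \<and> t \<le> T" for s t
        proof -
          have "remainder N X ?Y f s t = y t - (y s + (\<Sum>\<tau> | tree_verts \<tau> < N. \<xi> s t \<tau> * cT D (y s) \<tau>))"
            unfolding rem[OF st] by (simp add: 1 lookup_one lookup_Qt_empty)
          then show ?thesis using B[of s t] C1[rule_format, OF st] st unfolding 1 step_def verts_empty diff_zero distrib_right by linarith
        qed
        then show ?thesis by blast
      next
        case (2 a h)
        have hN: "Suc (verts h) < N" using fN 2 by (simp add: verts_single)
        obtain C1 where C1: "C1 \<ge> 0" "\<And>s t. 0 \<le> s \<Longrightarrow> s < t \<Longrightarrow> t \<le> T \<Longrightarrow>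
            \<bar>(\<Sum>f\<in>forests_upto (int N - 1). cF D (y s) a f * Poly_Mapping.lookup (Qf (\<xi> s t) f) h) - cF D (y t) a h\<bar>
            \<le> C1 * (t - s) powr (real (N - verts h) * \<gamma>)"
          using consistency_path[OF D_jets' D_cont' K loc, of h a] hN by (meson Suc_lessD)
        obtain b where b: "\<And>\<tau>. tree_verts \<tau> \<le> N \<Longrightarrow> b \<tau> \<ge> 0"
          "\<And>\<tau> y. tree_verts \<tau> \<le> N \<Longrightarrow> \<bar>y\<bar> \<le> K \<Longrightarrow> \<bar>cT D y \<tau>\<bar> \<le> b \<tau>"
          using cT_bounded[OF D_jets' D_cont', of K] by metis
        have "\<exists>q. \<forall>g. verts g \<le> N \<longrightarrow> q g \<ge> 0 \<and> (\<forall>\<xi> \<epsilon>. 0 \<le> \<epsilon> \<longrightarrow> \<epsilon> \<le> Cx * T powr \<gamma> \<longrightarrow>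
            (\<forall>\<tau>. tree_verts \<tau> \<le> N \<longrightarrow> \<bar>\<xi> \<tau>\<bar> \<le> \<epsilon> ^ tree_verts \<tau>) \<longrightarrow> \<bar>Poly_Mapping.lookup (Qf \<xi> g) h\<bar> \<le> q g * \<epsilon> ^ (verts g - verts h))"
        proof -
          have "\<forall>g. \<exists>C. verts g \<le> N \<longrightarrow> C \<ge> 0 \<and> (\<forall>\<xi> \<epsilon>. 0 \<le> \<epsilon> \<longrightarrow> \<epsilon> \<le> Cx * T powr \<gamma> \<longrightarrow>
            (\<forall>\<tau>. tree_verts \<tau> \<le> N \<longrightarrow> \<bar>\<xi> \<tau>\<bar> \<le> \<epsilon> ^ tree_verts \<tau>) \<longrightarrow> \<bar>Poly_Mapping.lookup (Qf \<xi> g) h\<bar> \<le> C * \<epsilon> ^ (verts g - verts h))"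
          proof
            fix g :: "'d forest"
            show "\<exists>C. verts g \<le> N \<longrightarrow> C \<ge> 0 \<and> (\<forall>\<xi> \<epsilon>. 0 \<le> \<epsilon> \<longrightarrow> \<epsilon> \<le> Cx * T powr \<gamma> \<longrightarrow>
              (\<forall>\<tau>. tree_verts \<tau> \<le> N \<longrightarrow> \<bar>\<xi> \<tau>\<bar> \<le> \<epsilon> ^ tree_verts \<tau>) \<longrightarrow> \<bar>Poly_Mapping.lookup (Qf \<xi> g) h\<bar> \<le> C * \<epsilon> ^ (verts g - verts h))"
              using lookup_Qf_bound[of g N "Cx * T powr \<gamma>" h] by (cases "verts g \<le> N") auto
          qed
          then show ?thesis by (rule choice)
        qed
        then obtain q where q: "\<And>g. verts g \<le> N \<Longrightarrow> q g \<ge> 0" "\<And>g \<xi> \<epsilon>. \<lbrakk>verts g \<le> N; 0 \<le> \<epsilon>; \<epsilon> \<le> Cx * T powr \<gamma>;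
            \<forall>\<tau>. tree_verts \<tau> \<le> N \<longrightarrow> \<bar>\<xi> \<tau>\<bar> \<le> \<epsilon> ^ tree_verts \<tau>\<rbrakk> \<Longrightarrow> \<bar>Poly_Mapping.lookup (Qf \<xi> g) h\<bar> \<le> q g * \<epsilon> ^ (verts g - verts h)"
          by blast
        let ?n = "N - verts f"
        have n: "?n = N - 1 - verts h" using 2 by (simp add: verts_single)
        let ?Top = "{g :: 'd forest. verts g = N - 1}"
        let ?Low = "{g :: 'd forest. verts g < N - 1}"
        have fin: "finite ?Top" "finite ?Low" by (rule finite_subset[OF _ finite_forests_nat[of N]]; auto)+
        let ?B = "C1 * T powr \<gamma> + (\<Sum>g\<in>?Top. b (Node a g) * (q g * Cx ^ ?n))"
        have "\<bar>remainder N X ?Y f s t\<bar> \<le> ?B * (t - s) powr (real ?n * \<gamma>)" if st: "0 \<le> s \<and> s < t \<and> t \<le> T" for s t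
        proof -
          let ?F = "\<lambda>g. cF D (y s) a g * Poly_Mapping.lookup (Qf (\<xi> s t) g) h"
          have sN: "{\<tau> :: 'd rtree. tree_verts \<tau> < N} = {\<tau>. tree_verts \<tau> \<le> N - 1}" using N1 by auto
          have low: "forests_upto (int (N - 1) - 1) = ?Low" by (auto simp: forests_upto_def)
          have "(\<Sum>\<tau> | tree_verts \<tau> < N. Poly_Mapping.lookup (Qt (\<xi> s t) \<tau>) f * cT D (y s) \<tau>)
              = (\<Sum>c\<in>UNIV. \<Sum>g\<in>?Low. Poly_Mapping.lookup (Qt (\<xi> s t) (Node c g)) f * cT D (y s) (Node c g))"
            unfolding sN sum_trees low ..
          also have "\<dots> = (\<Sum>c\<in>UNIV. if c = a then (\<Sum>g\<in>?Low. ?F g) else 0)"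
            by (rule sum.cong[OF refl]) (auto simp: 2 lookup_Qt_Node mult.commute)
          also have "\<dots> = (\<Sum>g\<in>?Low. ?F g)" by simp
          finally have "remainder N X ?Y f s t = cF D (y t) a h - (\<Sum>g\<in>?Low. ?F g)"
            unfolding rem[OF st] by (simp add: 2 lookup_one)
          moreover have "(\<Sum>g\<in>forests_upto (int N - 1). ?F g) = (\<Sum>g\<in>?Low. ?F g) + (\<Sum>g\<in>?Top. ?F g)"
          proof -
            have "forests_upto (int N - 1) = ?Low \<union> ?Top" using N1 by auto
            moreover have "?Low \<inter> ?Top = {}" by auto
            ultimately show ?thesis using sum.union_disjoint[OF fin(2,1)] by simp
          qed
          ultimately have r: "\<bar>remainder N X ?Y f s t\<bar> \<le> C1 * (t - s) powr (real (N - verts h) * \<gamma>) + \<bar>\<Sum>g\<in>?Top. ?F g\<bar>"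
            using C1(2)[of s t] st by linarith
          have "real (N - verts h) = real ?n + 1" using hN n by linarith
          then have "(t - s) powr (real (N - verts h) * \<gamma>) = (t - s) powr \<gamma> * (t - s) powr (real ?n * \<gamma>)"
            unfolding powr_add[symmetric] by (simp add: algebra_simps)
          also have "\<dots> \<le> T powr \<gamma> * (t - s) powr (real ?n * \<gamma>)"
            using st gam by (intro mult_right_mono powr_mono2) auto
          finally have 1: "C1 * (t - s) powr (real (N - verts h) * \<gamma>) \<le> C1 * T powr \<gamma> * (t - s) powr (real ?n * \<gamma>)"
            using C1(1) by (simp add: mult_left_mono mult.assoc)
          have 2: "\<bar>\<Sum>g\<in>?Top. ?F g\<bar> \<le> (\<Sum>g\<in>?Top. b (Node a g) * (q g * Cx ^ ?n) * (t - s) powr (real ?n * \<gamma>))"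
          proof (rule order.trans[OF sum_abs], rule sum_mono)
            fix g assume "g \<in> ?Top"
            then have g: "verts g = N - 1" by simp
            have "\<bar>cT D (y s) (Node a g)\<bar> \<le> b (Node a g)" by (rule b(2)) (use g N1 K st in auto)
            then have c: "\<bar>cF D (y s) a g\<bar> \<le> b (Node a g)" by simp
            have "\<bar>Poly_Mapping.lookup (Qf (\<xi> s t) g) h\<bar> \<le> q g * (Cx * (t - s) powr \<gamma>) ^ (verts g - verts h)"
              by (rule q(2)) (use g st Cx0 bnd in \<open>auto intro!: powr_mono2 less_imp_le[OF gam]\<close>)
            also have "\<dots> = q g * Cx ^ ?n * (t - s) powr (real ?n * \<gamma>)"
              using st ep_pow[of "t - s" ?n] by (simp only: g n mult.assoc) simp
            finally have l: "\<bar>Poly_Mapping.lookup (Qf (\<xi> s t) g) h\<bar> \<le> q g * Cx ^ ?n * (t - s) powr (real ?n * \<gamma>)" .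
            have "\<bar>?F g\<bar> \<le> b (Node a g) * (q g * Cx ^ ?n * (t - s) powr (real ?n * \<gamma>))"
              unfolding abs_mult by (rule mult_mono[OF c l]) (use b(1) g N1 in auto)
            then show "\<bar>?F g\<bar> \<le> b (Node a g) * (q g * Cx ^ ?n) * (t - s) powr (real ?n * \<gamma>)" by (simp only: mult.assoc)
          qed
          show ?thesis using r 1 2 unfolding distrib_right sum_distrib_right by linarith
        qed
        then show ?thesis by blast
      next
        case 3
        have "remainder N X ?Y f s t = 0" if st: "0 \<le> s \<and> s < t \<and> t \<le> T" for s t
        proof -
          have "f \<noteq> {#}" using 3 by auto
          then show ?thesis unfolding rem[OF st] using 3 by (simp add: lookup_one lookup_Qt_size)
        qed
        then show ?thesis by (intro exI[of _ 0]) simp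
      qed
    qed
    then obtain B where B: "\<And>s t. 0 \<le> s \<Longrightarrow> s < t \<Longrightarrow> t \<le> T \<Longrightarrow> \<bar>remainder N X ?Y f s t\<bar> \<le> B * (t - s) powr (real (N - verts f) * \<gamma>)"
      by blast
    have ex: "(real N - real (verts f)) * \<gamma> = real (N - verts f) * \<gamma>" using fN by (simp add: of_nat_diff)
    show "bdd_above {\<bar>remainder N X ?Y f s t\<bar> / \<bar>t - s\<bar> powr ((real N - real (verts f)) * \<gamma>) | s t. a \<le> s \<and> s < t \<and> t \<le> b}"
      unfolding bdd_above_def
    proof (intro exI[of _ B] ballI)
      fix x assume "x \<in> {\<bar>remainder N X ?Y f s t\<bar> / \<bar>t - s\<bar> powr ((real N - real (verts f)) * \<gamma>) | s t. a \<le> s \<and> s < t \<and> t \<le> b}"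
      then obtain s t where x: "x = \<bar>remainder N X ?Y f s t\<bar> / \<bar>t - s\<bar> powr ((real N - real (verts f)) * \<gamma>)"
        and st: "a \<le> s" "s < t" "t \<le> b" by blast
      have "s \<in> {0..T}" "t \<in> {0..T}" using ab st by (auto intro: subsetD[OF ab])
      then show "x \<le> B" using B[of s t] st unfolding x ex by (simp add: pos_divide_le_eq)
    qed
  qed
  show "\<exists>I. has_rough_integral N X \<phi> ?Y 0 t I \<and> ?Y {#} t = ?Y {#} 0 + I" if t: "t \<in> {0..T}" for t
  proof (intro exI conjI)
    show "has_rough_integral N X \<phi> ?Y 0 t (y t - y 0)"
      unfolding has_rough_integral_def
    proof (intro allI impI)
      fix e :: real assume e: "e > 0"
      \<comment> \<open>With this mesh the sum of \<open>\<bar>C\<bar> * (v - u) powr \<theta>\<close> over a partition of \<open>[0, t]\<close> is below \<open>e\<close>.\<close>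
      define d where "d = (e / ((\<bar>C\<bar> + 1) * (T + 1))) powr (1 / (\<theta> - 1))"
      have d: "d > 0" using e T0 by (simp add: d_def)
      have dp: "d powr (\<theta> - 1) = e / ((\<bar>C\<bar> + 1) * (T + 1))" using e T0 theta by (simp add: d_def powr_powr)
      show "\<exists>d>0. \<forall>n p. p 0 = 0 \<and> p n = t \<and> (\<forall>i<n. p i < p (Suc i) \<and> p (Suc i) - p i < d) \<longrightarrow>
        \<bar>(\<Sum>i<n. \<Sum>a\<in>UNIV. \<Sum>f\<in>forests_upto (int N - 1). compose_derivative (component \<phi> a) ?Y f (p i) *
            increment N X (p i) (p (Suc i)) (basis {#Node a f#})) - (y t - y 0)\<bar> < e"
      proof (intro exI[of _ d] conjI allI impI d)
        fix n :: nat and p :: "nat \<Rightarrow> real"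
        assume p: "p 0 = 0 \<and> p n = t \<and> (\<forall>i<n. p i < p (Suc i) \<and> p (Suc i) - p i < d)"
        have mono: "p i \<le> p j" if "i \<le> j" "j \<le> n" for i j
          using that
        proof (induction j)
          case (Suc j)
          show ?case
          proof (cases "i = Suc j")
            case False
            then have "p i \<le> p j" using Suc by simp
            moreover have "p j < p (Suc j)" using p Suc.prems by auto
            ultimately show ?thesis by simp
          qed simp
        qed simp
        have rng: "0 \<le> p i" "p i \<le> T" if "i \<le> n" for i
          using mono[of 0 i] mono[of i n] that p t by auto
        let ?X = "\<lambda>i. evc (\<xi> (p i) (p (Suc i))) (PP D N (y (p i)))"
        have G: "(\<Sum>i<n. \<Sum>a\<in>UNIV. \<Sum>f\<in>forests_upto (int N - 1). compose_derivative (component \<phi> a) ?Y f (p i) *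
            increment N X (p i) (p (Suc i)) (basis {#Node a f#})) = (\<Sum>i<n. ?X i)"
          by (rule sum.cong[OF refl], rule germ_eq) (use rng in auto)
        have tel: "y t - y 0 = (\<Sum>i<n. y (p (Suc i)) - y (p i))"
          using sum_lessThan_telescope[of "\<lambda>i. y (p i)" n] p by simp
        have tel': "t = (\<Sum>i<n. p (Suc i) - p i)"
          using sum_lessThan_telescope[of p n] p by simp
        have "(\<Sum>i<n. ?X i) - (y t - y 0) = (\<Sum>i<n. ?X i - (y (p (Suc i)) - y (p i)))"
          unfolding tel by (simp add: sum_subtractf)
        then have "\<bar>(\<Sum>i<n. ?X i) - (y t - y 0)\<bar> \<le> (\<Sum>i<n. \<bar>?X i - (y (p (Suc i)) - y (p i))\<bar>)"
          by (simp only: sum_abs)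
        also have "\<dots> \<le> (\<Sum>i<n. \<bar>C\<bar> * d powr (\<theta> - 1) * (p (Suc i) - p i))"
        proof (rule sum_mono)
          fix i assume "i \<in> {..<n}"
          then have i: "i < n" by simp
          let ?l = "p (Suc i) - p i"
          have l: "0 < ?l" "?l < d" using p i by auto
          have "\<bar>?X i - (y (p (Suc i)) - y (p i))\<bar> \<le> C * ?l powr \<theta>"
            using C[of "p i" "p (Suc i)"] rng[of i] rng[of "Suc i"] i l unfolding step_def by (simp add: abs_minus_commute algebra_simps)
          also have "\<dots> \<le> \<bar>C\<bar> * ?l powr \<theta>" by (intro mult_right_mono) auto
          also have "?l powr \<theta> = ?l powr (\<theta> - 1) * ?l" using l powr_add[of ?l "\<theta> - 1" 1] by simp
          also have "\<bar>C\<bar> * (?l powr (\<theta> - 1) * ?l) \<le> \<bar>C\<bar> * (d powr (\<theta> - 1) * ?l)"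
            using l theta by (intro mult_left_mono mult_right_mono powr_mono2) auto
          finally show "\<bar>?X i - (y (p (Suc i)) - y (p i))\<bar> \<le> \<bar>C\<bar> * d powr (\<theta> - 1) * ?l" by (simp only: mult.assoc)
        qed
        also have "\<dots> = \<bar>C\<bar> * d powr (\<theta> - 1) * t" unfolding tel' sum_distrib_left ..
        also have "\<dots> \<le> \<bar>C\<bar> * d powr (\<theta> - 1) * T" using t by (intro mult_left_mono) auto
        also have "\<dots> < (\<bar>C\<bar> + 1) * d powr (\<theta> - 1) * (T + 1)"
          using d T0 by (intro mult_strict_mono'[OF mult_strict_right_mono]) auto
        also have "\<dots> = e"
        proof -
          have "a * (e / (a * b)) * b = e" if "a \<noteq> 0" "b \<noteq> 0" for a b :: real using that by simp
          then show ?thesis unfolding dp using T0 by simp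
        qed
        finally show "\<bar>(\<Sum>i<n. \<Sum>a\<in>UNIV. \<Sum>f\<in>forests_upto (int N - 1). compose_derivative (component \<phi> a) ?Y f (p i) *
            increment N X (p i) (p (Suc i)) (basis {#Node a f#})) - (y t - y 0)\<bar> < e" unfolding G .
      qed
    qed
  qed simp
  show "?Y {#Node a f#} t = compose_derivative (component \<phi> a) ?Y f t" for f a t
    by (subst compose_derivative_cF) auto
  show "?Y f t = 0" if "size f \<ge> 2" for f t
    using that by simp
qed

end

theorem theorem4p12:
  fixes N :: nat and T \<gamma> \<alpha> :: real
    and X :: "real \<Rightarrow> ('d::finite hopf \<Rightarrow> real) set"
    and \<phi> :: "real \<Rightarrow> (real ^ 'd) \<Rightarrow>\<^sub>L real"
    and l :: "real \<Rightarrow> real"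
  assumes "N \<ge> 1" and "T > 0"
    and "\<gamma> \<in> {1 / (real N + 1)<..1 / real N}"
    and "branched_rough_path N \<gamma> T X"
    and "cont_differentiable (N + 1) \<phi>"
    and "\<And>x. x \<ge> 0 \<Longrightarrow> l x \<ge> 1" and "mono_on {0..} l"
    and "\<alpha> \<in> {(real N - 1) * \<gamma>..<real N * \<gamma>}"
    and "mono_on {0..} (\<lambda>x. l (2 * x) / l x) \<or> antimono_on {0..} (\<lambda>x. l (2 * x) / l x)"
    and "\<exists>c>0. \<forall>x\<ge>0. l x \<le> c * (1 + x)"
    and "\<And>x. norm (nderiv 1 \<phi> x) \<le> ln (l \<bar>x\<bar>) powr \<gamma>"
    and "\<And>n x. n \<in> {0} \<union> {2..N} \<Longrightarrow> norm (nderiv n \<phi> x) \<le> l \<bar>x\<bar> powr ((1 - real n) * \<alpha>)"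
  shows "\<forall>y0. \<exists>Y. rde_solution N \<gamma> X \<phi> {0..T} Y \<and> Y {#} 0 = y0 \<and>
           (\<forall>Z. rde_solution N \<gamma> X \<phi> {0..T} Z \<and> Z {#} 0 = y0 \<longrightarrow>
              (\<forall>f\<in>forests_upto (int N - 1). \<forall>t\<in>{0..T}. Z f t = Y f t))"
proof
  fix y0
  have gam: "\<gamma> > 0" using assms(3) by (auto intro: less_trans[rotated])
  have gN: "real (Suc N) * \<gamma> > 1" using assms(1,3) by (simp add: field_simps)
  have Ng: "real N * \<gamma> \<le> 1" using assms(1,3) by (simp add: field_simps)
  obtain \<xi> :: "real \<Rightarrow> real \<Rightarrow> 'd rtree \<Rightarrow> real" where
    inc: "\<And>s t f. s \<in> {0..T} \<Longrightarrow> t \<in> {0..T} \<Longrightarrow> verts f \<le> N \<Longrightarrow> increment N X s t (basis f) = evc (\<xi> s t) (basis f)" and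
    chen: "\<And>s u t \<tau>. s \<in> {0..T} \<Longrightarrow> u \<in> {0..T} \<Longrightarrow> t \<in> {0..T} \<Longrightarrow> \<xi> s t \<tau> = evc (\<xi> u t) (Qt (\<xi> s u) \<tau>)" and
    diag: "\<And>s \<tau>. s \<in> {0..T} \<Longrightarrow> \<xi> s s \<tau> = 0"
  proof (rule increment_characters[of "{0..T}" X N])
    show "X t \<in> carrier (trunc_group N)" if "t \<in> {0..T}" for t
      using assms(4) that by (simp add: branched_rough_path_def)
  qed (rule that)
  have "\<forall>\<tau> :: 'd rtree. \<exists>B. tree_verts \<tau> \<le> N \<longrightarrow> (\<forall>s t. 0 \<le> s \<and> s < t \<and> t \<le> T \<longrightarrow> \<bar>\<xi> s t \<tau>\<bar> \<le> B * (t - s) powr (\<gamma> * tree_verts \<tau>))"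
  proof
    fix \<tau> :: "'d rtree"
    show "\<exists>B. tree_verts \<tau> \<le> N \<longrightarrow> (\<forall>s t. 0 \<le> s \<and> s < t \<and> t \<le> T \<longrightarrow> \<bar>\<xi> s t \<tau>\<bar> \<le> B * (t - s) powr (\<gamma> * tree_verts \<tau>))"
    proof (cases "tree_verts \<tau> \<le> N")
      case True
      have "bdd_above {\<bar>increment N X s t (basis {#\<tau>#})\<bar> / \<bar>t - s\<bar> powr (\<gamma> * verts {#\<tau>#}) | s t. 0 \<le> s \<and> s < t \<and> t \<le> T}"
        using assms(4)[unfolded branched_rough_path_def, THEN conjunct2, THEN bspec, of "{#\<tau>#}"]
        True by (simp add: verts_single)
      from bdd_above_pairs[OF this] obtain B where B0: "\<forall>s t. 0 \<le> s \<and> s < t \<and> t \<le> T \<longrightarrow> \<bar>increment N X s t (basis {#\<tau>#})\<bar> / \<bar>t - s\<bar> powr (\<gamma> * verts {#\<tau>#}) \<le> B" ..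
      have B: "\<bar>increment N X s t (basis {#\<tau>#})\<bar> / \<bar>t - s\<bar> powr (\<gamma> * verts {#\<tau>#}) \<le> B" if "0 \<le> s" "s < t" "t \<le> T" for s t
        by (rule B0[rule_format]) (use that in simp)
      have "\<bar>\<xi> s t \<tau>\<bar> \<le> B * (t - s) powr (\<gamma> * tree_verts \<tau>)" if st: "0 \<le> s" "s < t" "t \<le> T" for s t
        using B[OF st] inc[of s t "{#\<tau>#}"] st True by (simp add: verts_single evc_basis pos_divide_le_eq)
      then show ?thesis by blast
    qed auto
  qed
  then obtain B where B: "\<And>\<tau> s t. tree_verts \<tau> \<le> N \<Longrightarrow> 0 \<le> s \<Longrightarrow> s < t \<Longrightarrow> t \<le> T \<Longrightarrow> \<bar>\<xi> s t \<tau>\<bar> \<le> B \<tau> * (t - s) powr (\<gamma> * tree_verts \<tau>)"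
    unfolding choice_iff by blast
  \<comment> \<open>At least \<open>1\<close>, so that the constant may be put inside the power.\<close>
  define Cx where "Cx = 1 + (\<Sum>\<tau> | tree_verts \<tau> \<le> N. \<bar>B (\<tau> :: 'd rtree)\<bar>)"
  have Cx1: "Cx \<ge> 1" by (simp add: Cx_def sum_nonneg)
  have BC: "B \<tau> \<le> Cx" if "tree_verts \<tau> \<le> N" for \<tau> :: "'d rtree"
  proof -
    have "\<bar>B \<tau>\<bar> \<le> (\<Sum>\<tau> | tree_verts \<tau> \<le> N. \<bar>B (\<tau> :: 'd rtree)\<bar>)"
      by (rule member_le_sum) (use that finite_trees in auto)
    then show ?thesis by (simp add: Cx_def)
  qed
  have bnd: "\<bar>\<xi> s t \<tau>\<bar> \<le> (Cx * (t - s) powr \<gamma>) ^ tree_verts \<tau>" if st: "0 \<le> s" "s \<le> t" "t \<le> T" and \<tau>: "tree_verts \<tau> \<le> N" for s t \<tau>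
  proof (cases "s = t")
    case True
    then show ?thesis using diag[of s \<tau>] st Cx1 by simp
  next
    case False
    then have lt: "s < t" using st by simp
    have "\<bar>\<xi> s t \<tau>\<bar> \<le> B \<tau> * (t - s) powr (\<gamma> * tree_verts \<tau>)" by (rule B[OF \<tau> st(1) lt st(3)])
    also have "\<dots> \<le> Cx ^ tree_verts \<tau> * (t - s) powr (\<gamma> * tree_verts \<tau>)"
    proof (rule mult_right_mono)
      have "Cx ^ 1 \<le> Cx ^ tree_verts \<tau>" using Cx1 tree_verts_pos[of \<tau>] by (intro power_increasing) auto
      then show "B \<tau> \<le> Cx ^ tree_verts \<tau>" using BC[OF \<tau>] by simp
    qed simp
    also have "\<dots> = (Cx * (t - s) powr \<gamma>) ^ tree_verts \<tau>"
      using lt by (simp add: power_mult_distrib powr_power mult.commute)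
    finally show ?thesis .
  qed
  interpret rough_equation N \<gamma> T Cx \<xi> X \<phi>
  proof unfold_locales
    show "\<xi> s t \<tau> = evc (\<xi> u t) (Qt (\<xi> s u) \<tau>)" if "0 \<le> s" "s \<le> u" "u \<le> t" "t \<le> T" for s u t \<tau>
      by (rule chen) (use that in auto)
    show "cont_differentiable (Suc N) \<phi>" using assms(5) by simp
  qed (use assms(1,2) gam gN Cx1 diag bnd inc in auto)
  obtain c where c: "c > 0" "\<forall>x\<ge>0. l x \<le> c * (1 + x)" using assms(10) by blast
  have \<alpha>: "\<alpha> \<ge> 0" "\<alpha> < 1"
  proof -
    have "0 \<le> (real N - 1) * \<gamma>" using assms(1) gam by simp
    then show "\<alpha> \<ge> 0" using assms(8) by simp
    show "\<alpha> < 1" using assms(8) Ng by simp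
  qed
  have D1: "\<bar>D 1 a x\<bar> \<le> ln (l \<bar>x\<bar>) powr \<gamma>" for a x
    using nderiv_component_le[OF smooth, of 1 a x] assms(11)[of x] assms(1) by simp
  have Dn: "\<bar>D n a x\<bar> \<le> l \<bar>x\<bar> powr ((1 - real n) * \<alpha>)" if n: "n \<in> {0} \<union> {2..N}" for n a x
    using nderiv_component_le[OF smooth, of n a x] assms(12)[OF n, of x] n by auto
  obtain K n0 where K: "\<And>n i. n \<ge> n0 \<Longrightarrow> i \<le> n \<Longrightarrow> \<bar>scheme D (T / real n) y0 i\<bar> \<le> K"
  proof (rule scheme_bounded[OF D_jets' D_cont', of y0])
    fix \<kappa> \<rho>0 :: real assume \<kappa>: "\<kappa> > 0"
    show "\<exists>\<rho> A M Q. \<rho> \<ge> \<rho>0 \<and> A > 0 \<and> M > 0 \<and> Q \<ge> (1 :: nat) \<and> 4 * M \<le> \<rho> \<and> real Q * M \<le> \<rho> \<and>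
      Cx * (2 * T / real Q) powr \<gamma> * (A / M) \<le> \<kappa> \<and>
      (\<forall>k a z. k \<le> N \<longrightarrow> \<rho> \<le> \<bar>z\<bar> \<longrightarrow> \<bar>z\<bar> \<le> 8 * \<rho> \<longrightarrow> \<bar>D k a z\<bar> \<le> A / M ^ k)"
      by (rule growth_scales[where D = D, OF assms(6,7) ratio_doubling[OF assms(6,7,9) c(2)] c(2,1) \<alpha> gam assms(2) _ \<kappa> D1 Dn])
        (use Cx1 in auto)
  qed (rule that)
  obtain y where y: "davie D y" "y 0 = y0" "\<And>t. \<bar>y t\<bar> \<le> K"
    using davie_exists[OF D_jets' D_cont' K] by metis
  show "\<exists>Y. rde_solution N \<gamma> X \<phi> {0..T} Y \<and> Y {#} 0 = y0 \<and>
           (\<forall>Z. rde_solution N \<gamma> X \<phi> {0..T} Z \<and> Z {#} 0 = y0 \<longrightarrow>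
              (\<forall>f\<in>forests_upto (int N - 1). \<forall>t\<in>{0..T}. Z f t = Y f t))"
  proof (intro exI[of _ "lift D y"] conjI allI impI ballI)
    show "rde_solution N \<gamma> X \<phi> {0..T} (lift D y)" by (rule davie_solution[OF y(1,3)])
    show "lift D y {#} 0 = y0" using y(2) by simp
    fix Z and f :: "'d forest" and t
    assume Z: "rde_solution N \<gamma> X \<phi> {0..T} Z \<and> Z {#} 0 = y0" and f: "f \<in> forests_upto (int N - 1)" and t: "t \<in> {0..T}"
    obtain K' where K': "\<And>t. 0 \<le> t \<Longrightarrow> t \<le> T \<Longrightarrow> \<bar>Z {#} t\<bar> \<le> K'" using solution_davie(1) Z by blast
    have dZ: "davie D (Z {#})" using solution_davie(2) Z by blast
    have "Z {#} t = y t"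
    proof (rule davie_unique[OF D_jets D_cont dZ y(1), of "max K K'"])
      show "\<bar>y r\<bar> \<le> max K K'" for r using y(3)[of r] by simp
      show "\<bar>Z {#} r\<bar> \<le> max K K'" if "0 \<le> r" "r \<le> T" for r using K'[OF that] by simp
    qed (use Z y(2) t in auto)
    then show "Z f t = lift D y f t"
      using solution_is_lift[of Z t f] Z f t by (simp add: lift_def)
  qed
qed

end
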